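(* There is no non-constant harmonic map from a compact Kähler manifold with positive holomorphic sectional curvature to a Riemannian manifold with non-positive complex sectional curvature.
   Context: Manifolds are connected and maps are smooth. A Kähler manifold $(M,h)$ has positive holomorphic sectional curvature if $R(u,\bar u,u,\bar u)=R_{\alpha\bar\beta\gamma\bar\delta}u^\alpha\bar u^\beta u^\gamma\bar u^\delta>0$ for every nonzero $u\in T^{1,0}M$, where $R_{\alpha\bar\beta\gamma\bar\delta}=-\frac{\partial^2 h_{\gamma\bar\delta}}{\partial z^\alpha\partial\bar z^\beta}+h^{\mu\bar\nu}\frac{\partial h_{\gamma\bar\nu}}{\partial z^\alpha}\frac{\partial h_{\mu\bar\delta}}{\partial\bar z^\beta}$ in local holomorphic coordinates. Non-positive complex sectional curvature: for a Riemannian manifold $(N,g)$ with Levi-Civita connection $\nabla$, put $R(X,Y)Z=\nabla_X\nabla_YZ-\nabla_Y\nabla_XZ-\nabla_{[X,Y]}Z$ and $R(X,Y,Z,W)=g(R(X,Y)Z,W)$, extended $\mathbb{C}$-multilinearly to $T_{\mathbb{C}}N=TN\otimes\mathbb{C}$. $(N,g)$ has non-positive complex sectional curvature if $R(Z,\bar W,W,\bar Z)\le 0$ for all $Z,W\in T_{\mathbb{C}}N$ (at the same point). A smooth map $f:(M,h)\to(N,g)$ is harmonic if it satisfies the Euler–Lagrange equation $(\nabla^{\mathscr E})^*df=0$ of the energy $E(f)=\int_M|df|^2\,dv_M$, where $\mathscr E=f^*(TN)$ carries the connection $\nabla^{\mathscr E}$ induced by the Levi-Civita connection of $N$ and $M$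 carries the Riemannian metric underlying $h$. *)

theory Defs
  imports "HOL-Analysis.Analysis"
begin

section \<open>Smooth and holomorphic maps between open subsets of Euclidean spaces\<close>

fun Ck_on :: "nat \<Rightarrow> 'b::real_normed_vector set \<Rightarrow> ('b \<Rightarrow> 'c::real_normed_vector) \<Rightarrow> bool" where
  "Ck_on 0 S f \<longleftrightarrow> continuous_on S f"
| "Ck_on (Suc k) S f \<longleftrightarrow>
     f differentiable_on S \<and> (\<forall>v. Ck_on k S (\<lambda>x. frechet_derivative f (at x) v))"

text \<open>Only meant for open \<open>S\<close>.\<close>
definition smooth_on :: "'b::real_normed_vector set \<Rightarrow> ('b \<Rightarrow> 'c::real_normed_vector) \<Rightarrow> bool" where
  "smooth_on S f \<longleftrightarrow> (\<forall>k. Ck_on k S f)"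

text \<open>Holomorphic maps in several variables: the differential is complex linear.\<close>
definition holomorphic_map_on :: "(complex^'m) set \<Rightarrow> (complex^'m \<Rightarrow> complex^'k) \<Rightarrow> bool" where
  "holomorphic_map_on S f \<longleftrightarrow> smooth_on S f \<and>
     (\<forall>z\<in>S. \<forall>a v. frechet_derivative f (at z) (a *s v) = a *s frechet_derivative f (at z) v)"


section \<open>Manifolds\<close>

text \<open>A chart is an open set with a coordinate map; only the values of the coordinate map on
  the open set are meaningful.\<close>
type_synonym ('a, 'b) chart = "'a set \<times> ('a \<Rightarrow> 'b)"

abbreviation chart_dom :: "('a, 'b) chart \<Rightarrow> 'a set" where
  "chart_dom c \<equiv> fst c"

abbreviation coords :: "('a, 'b) chart \<Rightarrow> 'a \<Rightarrow> 'b" where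
  "coords c \<equiv> snd c"

abbreviation param :: "('a, 'b) chart \<Rightarrow> 'b \<Rightarrow> 'a" where
  "param c \<equiv> inv_into (chart_dom c) (coords c)"

definition transition :: "('a, 'b) chart \<Rightarrow> ('a, 'b) chart \<Rightarrow> 'b \<Rightarrow> 'b" where
  "transition c d = coords d \<circ> param c"

definition overlap :: "('a, 'b) chart \<Rightarrow> ('a, 'b) chart \<Rightarrow> 'b set" where
  "overlap c d = coords c ` (chart_dom c \<inter> chart_dom d)"

text \<open>The atlas is not required to be maximal. Manifolds have no boundary and are connected.\<close>
locale smooth_manifold =
  fixes X :: "'a topology"
    and A :: "('a, 'b::euclidean_space) chart set"
  assumes Hausdorff: "Hausdorff_space X"
    and second_countable: "second_countable X"
    and connected: "connected_space X"
    and chart_dom_open: "c \<in> A \<Longrightarrow> openin X (chart_dom c)"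
    and chart_image_open: "c \<in> A \<Longrightarrow> open (coords c ` chart_dom c)"
    and chart_homeo: "c \<in> A \<Longrightarrow>
      homeomorphic_map (subtopology X (chart_dom c)) (top_of_set (coords c ` chart_dom c)) (coords c)"
    and charts_cover: "topspace X \<subseteq> (\<Union>c\<in>A. chart_dom c)"
    and transition_smooth: "c \<in> A \<Longrightarrow> d \<in> A \<Longrightarrow> smooth_on (overlap c d) (transition c d)"

locale complex_manifold = smooth_manifold X A
  for X :: "'a topology" and A :: "('a, complex^'m) chart set" +
  assumes transition_holomorphic:
    "c \<in> A \<Longrightarrow> d \<in> A \<Longrightarrow> holomorphic_map_on (overlap c d) (transition c d)"

text \<open>The coordinate expression of a map, and the coordinate domain on which it makes sense.\<close>
definition local_rep :: "('a, 'b) chart \<Rightarrow> ('a2, 'c) chart \<Rightarrow> ('a \<Rightarrow> 'a2) \<Rightarrow> 'b \<Rightarrow> 'c" where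
  "local_rep c d f = coords d \<circ> f \<circ> param c"

definition rep_dom :: "('a, 'b) chart \<Rightarrow> ('a2, 'c) chart \<Rightarrow> ('a \<Rightarrow> 'a2) \<Rightarrow> 'b set" where
  "rep_dom c d f = coords c ` (chart_dom c \<inter> f -` chart_dom d)"

definition smooth_map ::
  "'a topology \<Rightarrow> ('a, 'b::euclidean_space) chart set \<Rightarrow>
   'a2 topology \<Rightarrow> ('a2, 'c::euclidean_space) chart set \<Rightarrow> ('a \<Rightarrow> 'a2) \<Rightarrow> bool" where
  "smooth_map X A Y B f \<longleftrightarrow> continuous_map X Y f \<and>
     (\<forall>c\<in>A. \<forall>d\<in>B. smooth_on (rep_dom c d f) (local_rep c d f))"


section \<open>Riemannian geometry in a chart\<close>

text \<open>A local metric assigns to a point \<open>x\<close> of the coordinate domain an inner product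
  \<open>g x u v\<close> of coordinate vectors \<open>u\<close>, \<open>v\<close>.\<close>
type_synonym 'b local_metric = "'b \<Rightarrow> 'b \<Rightarrow> 'b \<Rightarrow> real"

text \<open>The vector dual to the linear form \<open>l\<close> under the inner product \<open>q\<close>.\<close>
definition sharp :: "('b \<Rightarrow> 'b \<Rightarrow> real) \<Rightarrow> ('b \<Rightarrow> real) \<Rightarrow> 'b" where
  "sharp q l = (THE w. \<forall>v. q w v = l v)"

text \<open>The Levi-Civita connection applied to coordinate (constant) fields, by Koszul's formula:
  \<open>christoffel g x u v\<close> has components \<open>\<Gamma>\<^sup>k\<^sub>i\<^sub>j u\<^sup>i v\<^sup>j\<close>.\<close>
definition christoffel :: "'b::euclidean_space local_metric \<Rightarrow> 'b \<Rightarrow> 'b \<Rightarrow> 'b \<Rightarrow> 'b" where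
  "christoffel g x u v = sharp (g x) (\<lambda>w.
     (frechet_derivative (\<lambda>y. g y v w) (at x) u
    + frechet_derivative (\<lambda>y. g y u w) (at x) v
    - frechet_derivative (\<lambda>y. g y u v) (at x) w) / 2)"

definition levi_civita ::
  "'b::euclidean_space local_metric \<Rightarrow> ('b \<Rightarrow> 'b) \<Rightarrow> ('b \<Rightarrow> 'b) \<Rightarrow> 'b \<Rightarrow> 'b" where
  "levi_civita g V W x = frechet_derivative W (at x) (V x) + christoffel g x (V x) (W x)"

definition lie_bracket ::
  "('b::euclidean_space \<Rightarrow> 'b) \<Rightarrow> ('b \<Rightarrow> 'b) \<Rightarrow> 'b \<Rightarrow> 'b" where
  "lie_bracket V W x = frechet_derivative W (at x) (V x) - frechet_derivative V (at x) (W x)"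

definition curvature_op ::
  "'b::euclidean_space local_metric \<Rightarrow> ('b \<Rightarrow> 'b) \<Rightarrow> ('b \<Rightarrow> 'b) \<Rightarrow> ('b \<Rightarrow> 'b) \<Rightarrow> 'b \<Rightarrow> 'b" where
  "curvature_op g V W Z x =
     levi_civita g V (levi_civita g W Z) x
   - levi_civita g W (levi_civita g V Z) x
   - levi_civita g (lie_bracket V W) Z x"

text \<open>The curvature is a tensor, so the vectors may be extended to constant fields.\<close>
definition riemann :: "'b::euclidean_space local_metric \<Rightarrow> 'b \<Rightarrow> 'b \<Rightarrow> 'b \<Rightarrow> 'b \<Rightarrow> 'b \<Rightarrow> real" where
  "riemann g x u v w z = g x (curvature_op g (\<lambda>_. u) (\<lambda>_. v) (\<lambda>_. w) x) z"

text \<open>The complex multilinear extension to \<open>T N \<otimes> \<complex>\<close>, whose elements are complex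
  coordinate vectors.\<close>
definition complex_riemann ::
  "(real^'n) local_metric \<Rightarrow> real^'n \<Rightarrow> complex^'n \<Rightarrow> complex^'n \<Rightarrow> complex^'n \<Rightarrow> complex^'n \<Rightarrow> complex"
  where
  "complex_riemann g x P Q S T =
     (\<Sum>i\<in>UNIV. \<Sum>j\<in>UNIV. \<Sum>k\<in>UNIV. \<Sum>l\<in>UNIV.
        complex_of_real (riemann g x (axis i 1) (axis j 1) (axis k 1) (axis l 1))
        * P $ i * Q $ j * S $ k * T $ l)"

definition vec_cnj :: "complex^'n \<Rightarrow> complex^'n" where
  "vec_cnj Z = (\<chi> i. cnj (Z $ i))"

text \<open>A Riemannian metric is given by its local expressions in the charts of the atlas.\<close>
locale riemannian_manifold = smooth_manifold X A
  for X :: "'a topology" and A :: "('a, 'b::euclidean_space) chart set" +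
  fixes g :: "('a, 'b) chart \<Rightarrow> 'b local_metric"
  assumes metric_bilinear: "c \<in> A \<Longrightarrow> x \<in> coords c ` chart_dom c \<Longrightarrow> bilinear (g c x)"
    and metric_sym: "c \<in> A \<Longrightarrow> x \<in> coords c ` chart_dom c \<Longrightarrow> g c x u v = g c x v u"
    and metric_pos: "c \<in> A \<Longrightarrow> x \<in> coords c ` chart_dom c \<Longrightarrow> u \<noteq> 0 \<Longrightarrow> 0 < g c x u u"
    and metric_smooth: "c \<in> A \<Longrightarrow> smooth_on (coords c ` chart_dom c) (\<lambda>x. g c x u v)"
    and metric_transform: "c \<in> A \<Longrightarrow> d \<in> A \<Longrightarrow> x \<in> overlap c d \<Longrightarrow>
      g c x u v = g d (transition c d x)
        (frechet_derivative (transition c d) (at x) u)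
        (frechet_derivative (transition c d) (at x) v)"

text \<open>By the symmetries of the curvature tensor the complex number below is real.\<close>
definition nonpos_complex_sectional_curvature ::
  "('a, real^'n) chart set \<Rightarrow> (('a, real^'n) chart \<Rightarrow> (real^'n) local_metric) \<Rightarrow> bool" where
  "nonpos_complex_sectional_curvature A g \<longleftrightarrow>
     (\<forall>c\<in>A. \<forall>x\<in>coords c ` chart_dom c. \<forall>Z W.
        Re (complex_riemann (g c) x Z (vec_cnj W) W (vec_cnj Z)) \<le> 0)"


section \<open>Harmonic maps\<close>

text \<open>Below \<open>F\<close> is the coordinate expression of a map from a domain with metric \<open>g\<close> to a target
  with metric \<open>k\<close>. A section of \<open>F\<^sup>* T N\<close> is a function \<open>s\<close> with \<open>s x\<close> tangent at \<open>F x\<close>, and an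
  \<open>F\<^sup>* T N\<close>-valued one-form is a function \<open>\<theta>\<close> with \<open>\<theta> x\<close> linear.\<close>

definition pullback_connection ::
  "'c::euclidean_space local_metric \<Rightarrow> ('b::euclidean_space \<Rightarrow> 'c) \<Rightarrow> 'b \<Rightarrow> ('b \<Rightarrow> 'c) \<Rightarrow> 'b \<Rightarrow> 'c" where
  "pullback_connection k F u s x =
     frechet_derivative s (at x) u
   + christoffel k (F x) (frechet_derivative F (at x) u) (s x)"

text \<open>\<open>(\<nabla>\<^sub>u \<theta>)(v)\<close>, for constant \<open>u\<close> and \<open>v\<close>.\<close>
definition cov_deriv_form ::
  "'b::euclidean_space local_metric \<Rightarrow> 'c::euclidean_space local_metric \<Rightarrow> ('b \<Rightarrow> 'c) \<Rightarrow>
   ('b \<Rightarrow> 'b \<Rightarrow> 'c) \<Rightarrow> 'b \<Rightarrow> 'b \<Rightarrow> 'b \<Rightarrow> 'c" where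
  "cov_deriv_form g k F \<theta> x u v =
     pullback_connection k F u (\<lambda>y. \<theta> y v) x - \<theta> x (christoffel g x u v)"

text \<open>The formal \<open>L\<^sup>2\<close>-adjoint \<open>(\<nabla>\<^sup>E)\<^sup>*\<close> of the pullback connection, acting on one-forms by
  \<open>- tr\<^sub>g (\<nabla> \<theta>) = - g\<^sup>i\<^sup>j (\<nabla>\<^sub>i \<theta>)\<^sub>j\<close>. The vector dual to the coordinate form \<open>dx\<^sup>j\<close> is
  \<open>g\<^sup>i\<^sup>j \<partial>\<^sub>i\<close>.\<close>
definition connection_adjoint ::
  "'b::euclidean_space local_metric \<Rightarrow> 'c::euclidean_space local_metric \<Rightarrow> ('b \<Rightarrow> 'c) \<Rightarrow>
   ('b \<Rightarrow> 'b \<Rightarrow> 'c) \<Rightarrow> 'b \<Rightarrow> 'c" where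
  "connection_adjoint g k F \<theta> x =
     - (\<Sum>b\<in>Basis. cov_deriv_form g k F \<theta> x (sharp (g x) (\<lambda>v. v \<bullet> b)) b)"

definition harmonic_map ::
  "'a topology \<Rightarrow> ('a, 'b::euclidean_space) chart set \<Rightarrow> (('a, 'b) chart \<Rightarrow> 'b local_metric) \<Rightarrow>
   'a2 topology \<Rightarrow> ('a2, 'c::euclidean_space) chart set \<Rightarrow> (('a2, 'c) chart \<Rightarrow> 'c local_metric) \<Rightarrow>
   ('a \<Rightarrow> 'a2) \<Rightarrow> bool" where
  "harmonic_map X A g Y B k f \<longleftrightarrow> smooth_map X A Y B f \<and>
     (\<forall>c\<in>A. \<forall>d\<in>B. \<forall>x\<in>rep_dom c d f.
        connection_adjoint (g c) (k d) (local_rep c d f)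
          (\<lambda>y. frechet_derivative (local_rep c d f) (at y)) x = 0)"


section \<open>Kaehler manifolds\<close>

text \<open>The entry \<open>H $ \<alpha> $ \<beta>\<close> of a matrix representing a Hermitian metric is
  \<open>h\<^sub>\<alpha>\<^sub>\<beta>\<close> with \<open>\<beta>\<close> barred.\<close>
definition herm_form :: "complex^'m^'m \<Rightarrow> complex^'m \<Rightarrow> complex^'m \<Rightarrow> complex" where
  "herm_form H u v = (\<Sum>\<alpha>\<in>UNIV. \<Sum>\<beta>\<in>UNIV. H $ \<alpha> $ \<beta> * u $ \<alpha> * cnj (v $ \<beta>))"

text \<open>The underlying Riemannian metric is normalised as \<open>Re h\<close>; a constant factor affects neither
  the Levi-Civita connection nor harmonicity. A real tangent vector at a point of a complex
  manifold is identified with its complex coordinate vector.\<close>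
definition real_metric ::
  "('p \<Rightarrow> complex^'m \<Rightarrow> complex^'m^'m) \<Rightarrow> 'p \<Rightarrow> (complex^'m) local_metric" where
  "real_metric h c z u v = Re (herm_form (h c z) u v)"

text \<open>The fundamental form \<open>\<omega>(u, v) = g(J u, v)\<close>, where \<open>J\<close> is multiplication by \<open>\<i>\<close>.\<close>
definition fundamental_form ::
  "('p \<Rightarrow> complex^'m \<Rightarrow> complex^'m^'m) \<Rightarrow> 'p \<Rightarrow> complex^'m \<Rightarrow> complex^'m \<Rightarrow> complex^'m \<Rightarrow> real" where
  "fundamental_form h c z u v = real_metric h c z (\<i> *s u) v"

text \<open>The exterior derivative of a two-form, evaluated on constant fields.\<close>
definition ext_deriv2 ::
  "('b::euclidean_space \<Rightarrow> 'b \<Rightarrow> 'b \<Rightarrow> real) \<Rightarrow> 'b \<Rightarrow> 'b \<Rightarrow> 'b \<Rightarrow> 'b \<Rightarrow> real" where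
  "ext_deriv2 \<omega> x u v w =
     frechet_derivative (\<lambda>y. \<omega> y v w) (at x) u
   - frechet_derivative (\<lambda>y. \<omega> y u w) (at x) v
   + frechet_derivative (\<lambda>y. \<omega> y u v) (at x) w"

locale kaehler_manifold = complex_manifold X A
  for X :: "'a topology" and A :: "('a, complex^'m) chart set" +
  fixes h :: "('a, complex^'m) chart \<Rightarrow> complex^'m \<Rightarrow> complex^'m^'m"
  assumes herm_cnj: "c \<in> A \<Longrightarrow> z \<in> coords c ` chart_dom c \<Longrightarrow>
      h c z $ \<beta> $ \<alpha> = cnj (h c z $ \<alpha> $ \<beta>)"
    and herm_pos: "c \<in> A \<Longrightarrow> z \<in> coords c ` chart_dom c \<Longrightarrow> u \<noteq> 0 \<Longrightarrow>
      0 < Re (herm_form (h c z) u u)"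
    and herm_smooth: "c \<in> A \<Longrightarrow> smooth_on (coords c ` chart_dom c) (h c)"
    and herm_transform: "c \<in> A \<Longrightarrow> d \<in> A \<Longrightarrow> z \<in> overlap c d \<Longrightarrow>
      herm_form (h c z) u v = herm_form (h d (transition c d z))
        (frechet_derivative (transition c d) (at z) u)
        (frechet_derivative (transition c d) (at z) v)"
    and kaehler_closed: "c \<in> A \<Longrightarrow> z \<in> coords c ` chart_dom c \<Longrightarrow>
      ext_deriv2 (fundamental_form h c) z u v w = 0"

text \<open>The Wirtinger derivatives with respect to \<open>z\<^sup>\<alpha>\<close> and to its conjugate.\<close>
definition d_z :: "'m \<Rightarrow> (complex^'m \<Rightarrow> complex) \<Rightarrow> complex^'m \<Rightarrow> complex" where
  "d_z \<alpha> F z = (frechet_derivative F (at z) (axis \<alpha> 1)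
                 - \<i> * frechet_derivative F (at z) (axis \<alpha> \<i>)) / 2"

definition d_zbar :: "'m \<Rightarrow> (complex^'m \<Rightarrow> complex) \<Rightarrow> complex^'m \<Rightarrow> complex" where
  "d_zbar \<alpha> F z = (frechet_derivative F (at z) (axis \<alpha> 1)
                 + \<i> * frechet_derivative F (at z) (axis \<alpha> \<i>)) / 2"

text \<open>The components \<open>R\<^sub>\<alpha>\<^sub>\<beta>\<^sub>\<gamma>\<^sub>\<delta>\<close> with \<open>\<beta>\<close> and \<open>\<delta>\<close> barred. With upper indices,
  \<open>h\<^sup>\<mu>\<^sup>\<nu>\<close> is determined by \<open>\<Sum>\<nu>. h\<^sub>\<gamma>\<^sub>\<nu> h\<^sup>\<mu>\<^sup>\<nu> = \<delta>\<^sub>\<gamma>\<^sub>\<mu>\<close>, hence it is the transposed inverse.\<close>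
definition kaehler_curvature ::
  "(complex^'m \<Rightarrow> complex^'m^'m) \<Rightarrow> complex^'m \<Rightarrow> 'm \<Rightarrow> 'm \<Rightarrow> 'm \<Rightarrow> 'm \<Rightarrow> complex" where
  "kaehler_curvature H z \<alpha> \<beta> \<gamma> \<delta> =
     - d_z \<alpha> (d_zbar \<beta> (\<lambda>w. H w $ \<gamma> $ \<delta>)) z
     + (\<Sum>\<mu>\<in>UNIV. \<Sum>\<nu>\<in>UNIV. matrix_inv (H z) $ \<nu> $ \<mu>
          * d_z \<alpha> (\<lambda>w. H w $ \<gamma> $ \<nu>) z * d_zbar \<beta> (\<lambda>w. H w $ \<mu> $ \<delta>) z)"

text \<open>By the symmetries of the Kaehler curvature tensor the sum below is real.\<close>
definition positive_holomorphic_sectional_curvature ::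
  "('a, complex^'m) chart set \<Rightarrow> (('a, complex^'m) chart \<Rightarrow> complex^'m \<Rightarrow> complex^'m^'m) \<Rightarrow> bool"
  where
  "positive_holomorphic_sectional_curvature A h \<longleftrightarrow>
     (\<forall>c\<in>A. \<forall>z\<in>coords c ` chart_dom c. \<forall>u. u \<noteq> 0 \<longrightarrow>
        0 < Re (\<Sum>\<alpha>\<in>UNIV. \<Sum>\<beta>\<in>UNIV. \<Sum>\<gamma>\<in>UNIV. \<Sum>\<delta>\<in>UNIV.
          kaehler_curvature (h c) z \<alpha> \<beta> \<gamma> \<delta> * u $ \<alpha> * cnj (u $ \<beta>) * u $ \<gamma> * cnj (u $ \<delta>)))"

end

theory Submission
  imports Defs
begin

text \<open>
  Write \<open>\<psi>\<close> for the (1,1)-part of the metric pulled back by a harmonic map \<open>f\<close>. The divergence of the vector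
  field \<open>V\<^sup>l = h\<^sup>l\<^sup>j h\<^sup>i\<^sup>k (\<partial>\<^sub>j \<psi>\<^sub>i\<^sub>k - \<partial>\<^sub>k \<psi>\<^sub>i\<^sub>j)\<close> (indices \<open>j\<close>, \<open>k\<close> barred) equals, by the Kaehler condition and
  harmonicity, twice the real part of \<open>|\<nabla>'' \<partial> f|\<^sup>2\<close> minus a complex sectional curvature term of the target; hence it is
  non-negative (Siu, Sampson). Its integral over the compact manifold vanishes, so \<open>f\<close> is pluriharmonic.

  Suppose \<open>\<psi>(u, u) / h(u, u)\<close> has a positive maximum \<open>l\<close>, attained at a vector \<open>u\<close> over \<open>z\<close>. Extend \<open>u\<close> along its own
  direction to a holomorphic field \<open>U\<close> with vanishing covariant derivative at \<open>z\<close>. Pluriharmonicity and the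
  curvature of the target make the complex Hessian of \<open>\<psi>(U, U)\<close> in the direction \<open>u\<close> non-negative, while that of
  \<open>h(U, U)\<close> is minus the holomorphic sectional curvature, hence negative. So \<open>\<psi>(U, U) - l h(U, U)\<close> cannot have
  a local maximum at \<open>z\<close>. Therefore \<open>\<psi> = 0\<close>, that is, \<open>df = 0\<close>.
\<close>


section \<open>Calculus of smooth functions\<close>

text \<open>The Bochner step uses the target curvature for all pairs Z, W, the maximum step only for
  Z = W. What passes from the first to the second is that \<open>FX (dirz u)\<close> is annihilated
  by the (0,1)-part of the pullback connection, so it behaves like a holomorphic section whose
  squared norm is subharmonic along u.

  Unitary frames are available at single points and are never differentiated. Whatever is
  differentiated is written in coordinates with the inverse matrix \<open>K\<close>; a frame of
  constant vectors, unitary only at the given point, serves to read off signs and chart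
  independence. The symmetry of the first derivatives of h does the work of normal coordinates.

  The field V contains first derivatives of psi, so its transformation law could involve second
  derivatives of the transition maps; the antisymmetrisation in the barred indices removes them.
  Multiplied by \<open>rho\<close>, V becomes a vector density, for which the divergence theorem
  needs only Jacobian determinants and a partition of unity of class C^1.\<close>

abbreviation D :: "('b::real_normed_vector \<Rightarrow> 'c::real_normed_vector) \<Rightarrow> 'b \<Rightarrow> 'b \<Rightarrow> 'c" where
  "D f x \<equiv> frechet_derivative f (at x)"

lemma D_eqI: "(f has_derivative f') (at x) \<Longrightarrow> D f x = f'"
  by (rule frechet_derivative_at[symmetric])

lemma has_derivative_D: "f differentiable at x \<Longrightarrow> (f has_derivative D f x) (at x)"
  using frechet_derivative_works by blast

lemma Ck_on_SucD:
  assumes "Ck_on (Suc k) S f" "open S"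
  shows "x \<in> S \<Longrightarrow> f differentiable at x" "Ck_on k S (\<lambda>x. D f x v)"
  using assms by (auto simp: differentiable_on_eq_differentiable_at)

lemma Ck_on_SucI:
  assumes "open S" "\<And>x. x \<in> S \<Longrightarrow> f differentiable at x" "\<And>v. Ck_on k S (\<lambda>x. D f x v)"
  shows "Ck_on (Suc k) S f"
  using assms by (auto simp: differentiable_on_eq_differentiable_at)

lemma Ck_on_cong:
  assumes "open S" "\<And>x. x \<in> S \<Longrightarrow> f x = g x" "Ck_on k S f"
  shows "Ck_on k S g"
  using assms
proof (induction k arbitrary: f g)
  case 0
  then show ?case by (metis Ck_on.simps(1) continuous_on_cong)
next
  case (Suc k)
  have d: "(g has_derivative D f x) (at x)" if "x \<in> S" for x
    by (rule has_derivative_transform_within_open[OF has_derivative_D Suc.prems(1) that])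
      (use Ck_on_SucD(1)[OF Suc.prems(3,1) that] Suc.prems(2) in auto)
  show ?case
  proof (rule Ck_on_SucI[OF Suc.prems(1)])
    show "g differentiable at x" if "x \<in> S" for x using d[OF that] differentiableI by blast
    show "Ck_on k S (\<lambda>x. D g x v)" for v
      by (rule Suc.IH[OF Suc.prems(1) _ Ck_on_SucD(2)[OF Suc.prems(3,1)], of v])
        (simp add: D_eqI[OF d])
  qed
qed

text \<open>Introduction rule behind the closure lemmas: one supplies an explicit formula for the
  derivative, valid on \<open>S\<close> only, instead of arguing about \<open>D f\<close>.\<close>

lemma Ck_on_Suc_deriv:
  assumes "open S" "\<And>x. x \<in> S \<Longrightarrow> (f has_derivative f' x) (at x)"
    "\<And>v. Ck_on k S (\<lambda>x. f' x v)"
  shows "Ck_on (Suc k) S f"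
proof (rule Ck_on_SucI[OF assms(1)])
  show "f differentiable at x" if "x \<in> S" for x using assms(2)[OF that] differentiableI by blast
  show "Ck_on k S (\<lambda>x. D f x v)" for v
    by (rule Ck_on_cong[OF assms(1) _ assms(3)]) (simp add: D_eqI[OF assms(2)])
qed

lemma Ck_on_continuous: "Ck_on k S f \<Longrightarrow> continuous_on S f"
  by (cases k) (auto intro: differentiable_imp_continuous_on)

lemma Ck_on_decSuc: "open S \<Longrightarrow> Ck_on (Suc k) S f \<Longrightarrow> Ck_on k S f"
proof (induction k arbitrary: f)
  case 0
  then show ?case using Ck_on_continuous Ck_on.simps(1) by blast
next
  case (Suc k)
  show ?case
    by (rule Ck_on_SucI) (use Suc Ck_on_SucD[OF Suc.prems(2,1)] in auto)
qed

lemma Ck_on_subset: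
  assumes "open S" "open T" "T \<subseteq> S" "Ck_on k S f"
  shows "Ck_on k T f"
  using assms
proof (induction k arbitrary: f)
  case 0
  then show ?case by (auto intro: continuous_on_subset)
next
  case (Suc k)
  show ?case
    by (rule Ck_on_SucI) (use Suc Ck_on_SucD[OF Suc.prems(4,1)] in auto)
qed

lemma Ck_on_const: "open S \<Longrightarrow> Ck_on k S (\<lambda>x. c)"
proof (induction k arbitrary: c)
  case (Suc k)
  show ?case by (rule Ck_on_Suc_deriv[where f' = "\<lambda>x v. 0"]) (use Suc in auto)
qed auto

lemma Ck_on_linear:
  assumes "bounded_linear L" "open S"
  shows "Ck_on k S L"
proof (cases k)
  case (Suc j)
  show ?thesis unfolding Suc
    by (rule Ck_on_Suc_deriv[where f' = "\<lambda>x. L"])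
      (use assms Ck_on_const bounded_linear_imp_has_derivative in auto)
qed (use assms linear_continuous_on in auto)

lemma Ck_on_add:
  assumes "open S" "Ck_on k S f" "Ck_on k S g"
  shows "Ck_on k S (\<lambda>x. f x + g x)"
  using assms
proof (induction k arbitrary: f g)
  case 0 then show ?case by (auto intro: continuous_intros)
next
  case (Suc k)
  note f = Ck_on_SucD[OF Suc.prems(2,1)] and g = Ck_on_SucD[OF Suc.prems(3,1)]
  show ?case
    by (rule Ck_on_Suc_deriv[where f' = "\<lambda>x v. D f x v + D g x v"])
      (use Suc f g in \<open>auto intro!: has_derivative_add has_derivative_D\<close>)
qed

lemma Ck_on_bilinear:
  assumes b: "bounded_bilinear b" and "open S" "Ck_on k S f" "Ck_on k S g"
  shows "Ck_on k S (\<lambda>x. b (f x) (g x))"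
  using assms(2-)
proof (induction k arbitrary: f g)
  case 0 then show ?case using bounded_bilinear.continuous_on[OF b] by auto
next
  case (Suc k)
  note f = Ck_on_SucD[OF Suc.prems(2,1)] and g = Ck_on_SucD[OF Suc.prems(3,1)]
  note f' = Ck_on_decSuc[OF Suc.prems(1,2)] and g' = Ck_on_decSuc[OF Suc.prems(1,3)]
  show ?case
    by (rule Ck_on_Suc_deriv[where f' = "\<lambda>x v. b (f x) (D g x v) + b (D f x v) (g x)"])
      (use Suc f g f' g' in \<open>auto intro!: bounded_bilinear.FDERIV[OF b] has_derivative_D Ck_on_add\<close>)
qed

lemma Ck_on_sum:
  assumes "open S" "\<And>i. i \<in> I \<Longrightarrow> Ck_on k S (f i)"
  shows "Ck_on k S (\<lambda>x. \<Sum>i\<in>I. f i x)"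
  using assms(2) by (induction I rule: infinite_finite_induct) (auto intro!: Ck_on_const Ck_on_add assms(1))

lemma Ck_on_linear_comp:
  assumes L: "bounded_linear L" and "open S" "Ck_on k S f"
  shows "Ck_on k S (\<lambda>x. L (f x))"
  using assms(2-)
proof (induction k arbitrary: f)
  case 0 then show ?case using bounded_linear.continuous_on[OF L] by auto
next
  case (Suc k)
  note f = Ck_on_SucD[OF Suc.prems(2,1)]
  show ?case
    by (rule Ck_on_Suc_deriv[where f' = "\<lambda>x v. L (D f x v)"])
      (use Suc f in \<open>auto intro!: bounded_linear.has_derivative[OF L] has_derivative_D\<close>)
qed

lemma linear_euclidean_sum:
  fixes f :: "'b::euclidean_space \<Rightarrow> 'c::real_vector"
  assumes "linear f" shows "f v = (\<Sum>b\<in>Basis. (v \<bullet> b) *\<^sub>R f b)"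
proof -
  interpret linear f by fact
  have "f v = f (\<Sum>b\<in>Basis. (v \<bullet> b) *\<^sub>R b)" by (simp add: euclidean_representation)
  then show ?thesis by (simp add: sum scale)
qed

lemma Ck_on_comp:
  fixes f :: "'b::euclidean_space \<Rightarrow> 'c::real_normed_vector"
  assumes "open S" "open T" "\<And>x. x \<in> S \<Longrightarrow> g x \<in> T" "Ck_on k T f" "Ck_on k S g"
  shows "Ck_on k S (\<lambda>x. f (g x))"
  using assms
proof (induction k arbitrary: f)
  case 0 then show ?case by (auto intro: continuous_on_compose2)
next
  case (Suc k)
  note f = Ck_on_SucD[OF Suc.prems(4,2)] and g = Ck_on_SucD[OF Suc.prems(5,1)]
  note g' = Ck_on_decSuc[OF Suc.prems(1,5)]
  have lin: "linear (D f (g x))" if "x \<in> S" for x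
    using f(1) Suc.prems(3)[OF that] linear_frechet_derivative by blast
  show ?case
  proof (rule Ck_on_Suc_deriv[where f' = "\<lambda>x v. D f (g x) (D g x v)"])
    show "((\<lambda>x. f (g x)) has_derivative (\<lambda>v. D f (g x) (D g x v))) (at x)" if "x \<in> S" for x
      by (rule has_derivative_compose) (use that f g Suc.prems(3) in \<open>auto intro: has_derivative_D\<close>)
    fix v
    \<comment> \<open>In \<open>D f (g x) (D g x v)\<close> both the point and the direction depend
      on x, whereas the hypothesis on f concerns constant directions. Expanding the direction in a
      basis separates the two.\<close>
    have "Ck_on k S (\<lambda>x. \<Sum>b\<in>Basis. (D g x v \<bullet> b) *\<^sub>R D f (g x) b)"
      by (intro Ck_on_sum Ck_on_bilinear[OF bounded_bilinear_scaleR]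
          Ck_on_linear_comp[OF bounded_linear_inner_left] Suc.IH f g g' Suc.prems)
    then show "Ck_on k S (\<lambda>x. D f (g x) (D g x v))"
      by (rule Ck_on_cong[OF \<open>open S\<close>, rotated]) (use linear_euclidean_sum[OF lin] in auto)
  qed (use Suc in auto)
qed

lemma Ck_on_inverse:
  fixes f :: "'b::real_normed_vector \<Rightarrow> 'c::real_normed_field"
  assumes "open S" "\<And>x. x \<in> S \<Longrightarrow> f x \<noteq> 0" "Ck_on k S f"
  shows "Ck_on k S (\<lambda>x. inverse (f x))"
  using assms
proof (induction k)
  case 0 then show ?case by (auto intro: continuous_intros)
next
  case (Suc k)
  note f = Ck_on_SucD[OF Suc.prems(3,1)] and f' = Ck_on_decSuc[OF Suc.prems(1,3)]
  show ?case
    by (rule Ck_on_Suc_deriv[where f' = "\<lambda>x v. - 1 * (inverse (f x) * D f x v * inverse (f x))"])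
      (use Suc.IH Suc.prems f f' in \<open>auto intro!: derivative_eq_intros has_derivative_D
        Ck_on_bilinear[OF bounded_bilinear_mult] Ck_on_linear_comp[OF bounded_linear_minus[OF bounded_linear_ident]]\<close>)
qed

lemma Ck_on_powr:
  fixes f :: "'b::real_normed_vector \<Rightarrow> real"
  assumes "open S" "\<And>x. x \<in> S \<Longrightarrow> f x > 0" "Ck_on k S f"
  shows "Ck_on k S (\<lambda>x. f x powr r)"
  using assms
proof (induction k arbitrary: r)
  case 0 then show ?case by (fastforce intro!: continuous_intros)
next
  case (Suc k)
  note f = Ck_on_SucD[OF Suc.prems(3,1)] and f' = Ck_on_decSuc[OF Suc.prems(1,3)]
  show ?case
  proof (rule Ck_on_Suc_deriv[where f' = "\<lambda>x v. r * (f x powr (r - 1) * D f x v)"])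
    show "((\<lambda>x. f x powr r) has_derivative (\<lambda>v. r * (f x powr (r - 1) * D f x v))) (at x)"
      if "x \<in> S" for x
    proof -
      have "((\<lambda>t. t powr r) has_derivative (\<lambda>v. r * (f x powr (r - 1)) * v)) (at (f x))"
        using has_real_derivative_powr[of "f x" r] Suc.prems(2)[OF that]
        by (simp add: has_field_derivative_def)
      from has_derivative_compose[OF has_derivative_D[OF f(1)[OF that]] this]
      show ?thesis by (simp add: mult_ac)
    qed
  qed (use Suc.IH Suc.prems f f' in \<open>auto intro!:
        Ck_on_bilinear[OF bounded_bilinear_mult] Ck_on_const\<close>)
qed

lemma Ck_on_prod:
  fixes f :: "'i \<Rightarrow> 'b::real_normed_vector \<Rightarrow> 'c::real_normed_field"
  assumes "open S" "\<And>i. i \<in> I \<Longrightarrow> Ck_on k S (f i)"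
  shows "Ck_on k S (\<lambda>x. \<Prod>i\<in>I. f i x)"
  using assms(2) by (induction I rule: infinite_finite_induct)
    (auto intro!: Ck_on_const Ck_on_bilinear[OF bounded_bilinear_mult] assms(1))

text \<open>Needed for functions extended by zero, whose regularity is seen on two different open
  sets.\<close>

lemma Ck_on_local:
  assumes "\<And>x. x \<in> S \<Longrightarrow> \<exists>T. open T \<and> x \<in> T \<and> T \<subseteq> S \<and> Ck_on k T f" "open S"
  shows "Ck_on k S f"
  using assms(1)
proof (induction k arbitrary: f)
  case 0
  then show ?case
    by (metis Ck_on.simps(1) continuous_on_eq_continuous_at assms(2))
next
  case (Suc k)
  show ?case
  proof (rule Ck_on_SucI[OF assms(2)])
    show "f differentiable at x" if "x \<in> S" for x
      using Suc.prems[OF that] Ck_on_SucD(1) by blast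
    show "Ck_on k S (\<lambda>x. D f x v)" for v
    proof (rule Suc.IH)
      fix x assume "x \<in> S"
      from Suc.prems[OF this] obtain T where T: "open T" "x \<in> T" "T \<subseteq> S" "Ck_on (Suc k) T f" by blast
      then show "\<exists>T. open T \<and> x \<in> T \<and> T \<subseteq> S \<and> Ck_on k T (\<lambda>x. D f x v)"
        using Ck_on_SucD(2)[OF T(4,1)] by blast
    qed
  qed
qed

lemma smooth_onD:
  assumes "smooth_on S f" "open S"
  shows "x \<in> S \<Longrightarrow> f differentiable at x" "smooth_on S (\<lambda>x. D f x v)" "continuous_on S f" "Ck_on k S f"
  using assms Ck_on_SucD Ck_on_continuous unfolding smooth_on_def by blast+

lemma smooth_on_cong: "open S \<Longrightarrow> (\<And>x. x \<in> S \<Longrightarrow> f x = g x) \<Longrightarrow> smooth_on S f \<Longrightarrow> smooth_on S g"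
  unfolding smooth_on_def using Ck_on_cong by blast

lemma smooth_on_subset: "smooth_on S f \<Longrightarrow> open S \<Longrightarrow> open T \<Longrightarrow> T \<subseteq> S \<Longrightarrow> smooth_on T f"
  unfolding smooth_on_def using Ck_on_subset by blast

lemma smooth_on_comp:
  fixes f :: "'b::euclidean_space \<Rightarrow> 'c::real_normed_vector"
  shows "smooth_on T f \<Longrightarrow> smooth_on S g \<Longrightarrow> open S \<Longrightarrow> open T \<Longrightarrow> (\<And>x. x \<in> S \<Longrightarrow> g x \<in> T) \<Longrightarrow>
    smooth_on S (\<lambda>x. f (g x))"
  unfolding smooth_on_def using Ck_on_comp by blast

lemma smooth_on_const: "open S \<Longrightarrow> smooth_on S (\<lambda>x. c)"
  unfolding smooth_on_def using Ck_on_const by blast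

lemma smooth_on_linear: "bounded_linear L \<Longrightarrow> open S \<Longrightarrow> smooth_on S L"
  unfolding smooth_on_def using Ck_on_linear by blast

lemma smooth_on_linear_comp:
  "bounded_linear L \<Longrightarrow> open S \<Longrightarrow> smooth_on S f \<Longrightarrow> smooth_on S (\<lambda>x. L (f x))"
  unfolding smooth_on_def using Ck_on_linear_comp by blast

lemma smooth_on_bilinear:
  "bounded_bilinear b \<Longrightarrow> open S \<Longrightarrow> smooth_on S f \<Longrightarrow> smooth_on S g \<Longrightarrow>
    smooth_on S (\<lambda>x. b (f x) (g x))"
  unfolding smooth_on_def using Ck_on_bilinear by blast

lemma smooth_on_add:
  "open S \<Longrightarrow> smooth_on S f \<Longrightarrow> smooth_on S g \<Longrightarrow> smooth_on S (\<lambda>x. f x + g x)"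
  unfolding smooth_on_def using Ck_on_add by blast

lemma smooth_on_minus: "open S \<Longrightarrow> smooth_on S f \<Longrightarrow> smooth_on S (\<lambda>x. - f x)"
  by (rule smooth_on_linear_comp[OF bounded_linear_minus[OF bounded_linear_ident]])

lemma smooth_on_diff:
  "open S \<Longrightarrow> smooth_on S f \<Longrightarrow> smooth_on S g \<Longrightarrow> smooth_on S (\<lambda>x. f x - g x)"
  using smooth_on_add[OF _ _ smooth_on_minus] by fastforce

lemma smooth_on_sum:
  "open S \<Longrightarrow> (\<And>i. i \<in> I \<Longrightarrow> smooth_on S (f i)) \<Longrightarrow> smooth_on S (\<lambda>x. \<Sum>i\<in>I. f i x)"
  unfolding smooth_on_def using Ck_on_sum[of S I] by blast

lemma smooth_on_prod:
  fixes f :: "'i \<Rightarrow> 'b::real_normed_vector \<Rightarrow> 'c::real_normed_field"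
  shows "open S \<Longrightarrow> (\<And>i. i \<in> I \<Longrightarrow> smooth_on S (f i)) \<Longrightarrow> smooth_on S (\<lambda>x. \<Prod>i\<in>I. f i x)"
  unfolding smooth_on_def using Ck_on_prod[of S I] by blast

lemma smooth_on_inverse:
  fixes f :: "'b::real_normed_vector \<Rightarrow> 'c::real_normed_field"
  shows "open S \<Longrightarrow> (\<And>x. x \<in> S \<Longrightarrow> f x \<noteq> 0) \<Longrightarrow> smooth_on S f \<Longrightarrow> smooth_on S (\<lambda>x. inverse (f x))"
  unfolding smooth_on_def using Ck_on_inverse by blast

lemma smooth_on_powr:
  fixes f :: "'b::real_normed_vector \<Rightarrow> real"
  shows "open S \<Longrightarrow> (\<And>x. x \<in> S \<Longrightarrow> f x > 0) \<Longrightarrow> smooth_on S f \<Longrightarrow> smooth_on S (\<lambda>x. f x powr r)"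
  unfolding smooth_on_def using Ck_on_powr by blast

lemmas smooth_on_mult = smooth_on_bilinear[OF bounded_bilinear_mult]
lemmas smooth_on_scaleR = smooth_on_bilinear[OF bounded_bilinear_scaleR]

lemma smooth_on_nth: "open S \<Longrightarrow> smooth_on S f \<Longrightarrow> smooth_on S (\<lambda>x. f x $ i)"
  by (rule smooth_on_linear_comp[OF bounded_linear_vec_nth])

lemma smooth_on_vec:
  fixes f :: "'b::real_normed_vector \<Rightarrow> 'c::real_normed_vector ^ 'n"
  assumes "open S" "\<And>i. smooth_on S (\<lambda>x. f x $ i)"
  shows "smooth_on S f"
proof -
  have bl: "bounded_linear (\<lambda>y::'c. axis i y :: 'c^'n)" for i
    by (rule bounded_linear_intro[where K=1])
      (auto simp: vec_eq_iff axis_def norm_vec_def L2_set_def if_distrib[of norm] if_distrib[of "\<lambda>x. x^2"] cong: if_cong)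
  have "smooth_on S (\<lambda>x. \<Sum>i\<in>UNIV. (axis i (f x $ i) :: 'c^'n))"
    by (intro smooth_on_sum smooth_on_linear_comp[OF bl] assms)
  then show ?thesis
    by (rule smooth_on_cong[OF assms(1), rotated])
      (simp add: vec_eq_iff axis_def if_distrib cong: if_cong)
qed

section \<open>Smoothness of determinants and of inverse matrices\<close>

lemma smooth_on_det:
  fixes f :: "'b::real_normed_vector \<Rightarrow> 'c::real_normed_field ^ 'n ^ 'n"
  assumes "open S" "\<And>i j. smooth_on S (\<lambda>x. f x $ i $ j)"
  shows "smooth_on S (\<lambda>x. det (f x))"
  unfolding det_def
  by (intro smooth_on_sum smooth_on_mult smooth_on_prod smooth_on_const assms)

lemma matrix_inv_works:
  fixes A :: "'c::semiring_1^'n^'m"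
  assumes "invertible A"
  shows matrix_inv_right: "A ** matrix_inv A = mat 1" and matrix_inv_left: "matrix_inv A ** A = mat 1"
proof -
  have "\<exists>A'. A ** A' = mat 1 \<and> A' ** A = mat 1" using assms by (simp add: invertible_def)
  then have "A ** matrix_inv A = mat 1 \<and> matrix_inv A ** A = mat 1"
    unfolding matrix_inv_def by (rule someI_ex)
  then show "A ** matrix_inv A = mat 1" "matrix_inv A ** A = mat 1" by auto
qed

text \<open>Makes the entries of the inverse rational functions of the entries of \<open>A\<close>,
  so that smoothness carries over.\<close>

lemma matrix_inv_cramer:
  fixes A :: "'c::field^'n^'n"
  assumes "det A \<noteq> 0"
  shows "matrix_inv A $ k $ l = det (\<chi> i j. if j = k then axis l 1 $ i else A $ i $ j) * inverse (det A)"
proof -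
  have inv: "invertible A" using assms invertible_det_nz by blast
  have "A *v (matrix_inv A *v axis l 1) = axis l 1"
    by (simp add: matrix_vector_mul_assoc matrix_inv_right[OF inv])
  then have "matrix_inv A *v axis l 1 = (\<chi> k. det (\<chi> i j. if j = k then axis l 1 $ i else A $ i $ j) / det A)"
    using cramer[OF assms] by blast
  moreover have "(matrix_inv A *v axis l 1) $ k = matrix_inv A $ k $ l"
    by (simp add: matrix_vector_mult_def axis_def if_distrib cong: if_cong)
  ultimately show ?thesis by (simp add: divide_inverse)
qed

lemma smooth_on_matrix_inv:
  fixes f :: "'b::real_normed_vector \<Rightarrow> 'c::real_normed_field ^ 'n ^ 'n"
  assumes "open S" "\<And>i j. smooth_on S (\<lambda>x. f x $ i $ j)" "\<And>x. x \<in> S \<Longrightarrow> det (f x) \<noteq> 0"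
  shows "smooth_on S (\<lambda>x. matrix_inv (f x) $ k $ l)"
proof -
  have "smooth_on S (\<lambda>x. det (\<chi> i j. if j = k then axis l 1 $ i else f x $ i $ j) * inverse (det (f x)))"
  proof (intro smooth_on_mult smooth_on_inverse smooth_on_det assms)
    show "smooth_on S (\<lambda>x. (\<chi> i j. if j = k then axis l 1 $ i else f x $ i $ j) $ i $ j)" for i j
      by (cases "j = k") (use assms smooth_on_const in auto)
  qed
  then show ?thesis
    by (rule smooth_on_cong[OF assms(1), rotated]) (simp add: matrix_inv_cramer assms(3))
qed

lemma linear_D:
  assumes "f differentiable at x"
  shows "linear (D f x)" "bounded_linear (D f x)"
  using assms linear_frechet_derivative has_derivative_D has_derivative_bounded_linear by blast+

lemma has_real_derivative_line:
  fixes g :: "'b::real_normed_vector \<Rightarrow> real"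
  assumes "g differentiable at (c + t *\<^sub>R v)"
  shows "((\<lambda>t. g (c + t *\<^sub>R v)) has_real_derivative D g (c + t *\<^sub>R v) v) (at t)"
proof -
  have "((\<lambda>t. c + t *\<^sub>R v) has_derivative (\<lambda>h. h *\<^sub>R v)) (at t)"
    by (auto intro!: derivative_eq_intros)
  from has_derivative_compose[OF this has_derivative_D[OF assms]]
  show ?thesis using linear_D(1)[OF assms]
    by (simp add: has_field_derivative_def linear_cmul mult.commute[of _ "D g (c + t *\<^sub>R v) v"])
qed

subsection \<open>Symmetry of second derivatives\<close>

text \<open>The mean value theorem is applied to the difference in direction b as a function along
  a, and then once more along b. The point is that the left-hand side is symmetric in a and
  b.\<close>

lemma second_difference:
  fixes f :: "'b::real_normed_vector \<Rightarrow> real"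
  assumes sm: "smooth_on S f" and S: "open S" and s: "s > 0"
    and sub: "\<And>p q. 0 \<le> p \<Longrightarrow> p \<le> s \<Longrightarrow> 0 \<le> q \<Longrightarrow> q \<le> s \<Longrightarrow> x + p *\<^sub>R a + q *\<^sub>R b \<in> S"
  shows "\<exists>p q. 0 \<le> p \<and> p \<le> s \<and> 0 \<le> q \<and> q \<le> s \<and>
    f (x + s *\<^sub>R a + s *\<^sub>R b) - f (x + s *\<^sub>R a) - f (x + s *\<^sub>R b) + f x
      = s * s * D (\<lambda>y. D f y a) (x + p *\<^sub>R a + q *\<^sub>R b) b"
proof -
  note dline = has_real_derivative_line
  define \<phi> where "\<phi> = (\<lambda>t. f ((x + s *\<^sub>R b) + t *\<^sub>R a) - f (x + t *\<^sub>R a))"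
  have "\<exists>z::real. z > 0 \<and> z < s \<and> \<phi> s - \<phi> 0 = (s - 0) * (D f ((x + s *\<^sub>R b) + z *\<^sub>R a) a - D f (x + z *\<^sub>R a) a)"
  proof (rule MVT2[OF s])
    fix t assume t: "0 \<le> t" "t \<le> s"
    show "(\<phi> has_real_derivative (D f ((x + s *\<^sub>R b) + t *\<^sub>R a) a - D f (x + t *\<^sub>R a) a)) (at t)"
      unfolding \<phi>_def
      by (intro DERIV_diff dline smooth_onD(1)[OF sm S])
        (use sub[of t s] sub[of t 0] t s in \<open>auto simp: algebra_simps\<close>)
  qed
  then obtain p where p: "0 < p" "p < s"
    "\<phi> s - \<phi> 0 = s * (D f ((x + p *\<^sub>R a) + s *\<^sub>R b) a - D f ((x + p *\<^sub>R a) + 0 *\<^sub>R b) a)"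
    by (auto simp: algebra_simps)
  have "\<exists>z::real. z > 0 \<and> z < s \<and> D f ((x + p *\<^sub>R a) + s *\<^sub>R b) a - D f ((x + p *\<^sub>R a) + 0 *\<^sub>R b) a
      = (s - 0) * D (\<lambda>y. D f y a) ((x + p *\<^sub>R a) + z *\<^sub>R b) b"
    by (rule MVT2[OF s]) (intro dline smooth_onD(1)[OF smooth_onD(2)[OF sm S] S] sub, use p in auto)
  then obtain q where q: "0 < q" "q < s"
    "D f ((x + p *\<^sub>R a) + s *\<^sub>R b) a - D f ((x + p *\<^sub>R a) + 0 *\<^sub>R b) a
      = s * D (\<lambda>y. D f y a) ((x + p *\<^sub>R a) + q *\<^sub>R b) b" by auto
  have "\<phi> s - \<phi> 0 = f (x + s *\<^sub>R a + s *\<^sub>R b) - f (x + s *\<^sub>R a) - f (x + s *\<^sub>R b) + f x"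
    by (simp add: \<phi>_def algebra_simps)
  with p q show ?thesis by (intro exI[of _ p] exI[of _ q]) (auto simp: algebra_simps)
qed

text \<open>By \<open>second_difference\<close> in both orders, the two mixed derivatives take a
  common value at points arbitrarily close to x; continuity of both at x then forbids a gap between
  \<open>L\<close> and \<open>M\<close>.\<close>

lemma D_D_commute_real:
  fixes f :: "'b::real_normed_vector \<Rightarrow> real"
  assumes sm: "smooth_on S f" and S: "open S" and x: "x \<in> S"
  shows "D (\<lambda>y. D f y a) x b = D (\<lambda>y. D f y b) x a"
proof (rule ccontr)
  define L where "L = D (\<lambda>y. D f y a) x b"
  define M where "M = D (\<lambda>y. D f y b) x a"
  assume "\<not> ?thesis"
  then have e: "\<bar>L - M\<bar> > 0" by (simp add: L_def M_def)
  define e where "e = \<bar>L - M\<bar> / 2"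
  have e0: "e > 0" using e by (simp add: e_def)
  have c1: "isCont (\<lambda>y. D (\<lambda>y. D f y a) y b) x" "isCont (\<lambda>y. D (\<lambda>y. D f y b) y a) x"
    using smooth_onD(3)[OF smooth_onD(2)[OF smooth_onD(2)[OF sm S] S] S] S x
    by (simp_all add: continuous_on_eq_continuous_at)
  obtain d1 where d1: "d1 > 0" "\<And>y. dist y x < d1 \<Longrightarrow> dist (D (\<lambda>y. D f y a) y b) L < e"
    using c1(1) e0 unfolding continuous_at_eps_delta L_def by blast
  obtain d2 where d2: "d2 > 0" "\<And>y. dist y x < d2 \<Longrightarrow> dist (D (\<lambda>y. D f y b) y a) M < e"
    using c1(2) e0 unfolding continuous_at_eps_delta M_def by blast
  obtain d3 where d3: "d3 > 0" "\<And>y. dist y x < d3 \<Longrightarrow> y \<in> S"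
    using S x unfolding open_dist by blast
  define d where "d = min d1 (min d2 d3)"
  \<comment> \<open>This makes \<open>s * (norm a + norm b) < d\<close>; the summand 1 keeps the
    denominator positive when both directions vanish.\<close>
  define s where "s = d / (2 * (norm a + norm b + 1))"
  have d0: "d > 0" using d1 d2 d3 by (simp add: d_def)
  have s0: "s > 0" using d0 by (simp add: s_def add_nonneg_pos)
  have "s * (norm a + norm b + 1) = d / 2"
    unfolding s_def using norm_ge_zero[of a] norm_ge_zero[of b]
    by (simp add: add_nonneg_eq_0_iff add_nonneg_pos field_simps)
  then have sd: "s * (norm a + norm b) < d" using s0 d0 by (simp add: algebra_simps)
  have near: "dist (x + p *\<^sub>R u + q *\<^sub>R v) x < d"
    if "0 \<le> p" "p \<le> s" "0 \<le> q" "q \<le> s" "norm u + norm v = norm a + norm b" for p q and u v :: 'b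
  proof -
    have "dist (x + p *\<^sub>R u + q *\<^sub>R v) x \<le> p * norm u + q * norm v"
      using that norm_triangle_ineq[of "p *\<^sub>R u" "q *\<^sub>R v"] by (simp add: dist_norm add.assoc)
    also have "\<dots> \<le> s * norm u + s * norm v"
      using that by (intro add_mono mult_right_mono) auto
    also have "\<dots> = s * (norm a + norm b)" by (simp add: that(5)[symmetric] algebra_simps)
    finally show ?thesis using sd by simp
  qed
  obtain p q where pq: "0 \<le> p" "p \<le> s" "0 \<le> q" "q \<le> s"
    "f (x + s *\<^sub>R a + s *\<^sub>R b) - f (x + s *\<^sub>R a) - f (x + s *\<^sub>R b) + f x
      = s * s * D (\<lambda>y. D f y a) (x + p *\<^sub>R a + q *\<^sub>R b) b"
    using second_difference[OF sm S s0, of x a b] near[of _ _ a b] d3(2) by (auto simp: d_def)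
  obtain p' q' where pq': "0 \<le> p'" "p' \<le> s" "0 \<le> q'" "q' \<le> s"
    "f (x + s *\<^sub>R b + s *\<^sub>R a) - f (x + s *\<^sub>R b) - f (x + s *\<^sub>R a) + f x
      = s * s * D (\<lambda>y. D f y b) (x + p' *\<^sub>R b + q' *\<^sub>R a) a"
    using second_difference[OF sm S s0, of x b a] near[of _ _ b a] d3(2) by (auto simp: d_def)
  have "x + s *\<^sub>R b + s *\<^sub>R a = x + s *\<^sub>R a + s *\<^sub>R b" by simp
  then have "s * s * D (\<lambda>y. D f y a) (x + p *\<^sub>R a + q *\<^sub>R b) b = s * s * D (\<lambda>y. D f y b) (x + p' *\<^sub>R b + q' *\<^sub>R a) a"
    using pq(5) pq'(5) by (metis add.commute diff_diff_eq)
  then have eq: "D (\<lambda>y. D f y a) (x + p *\<^sub>R a + q *\<^sub>R b) b = D (\<lambda>y. D f y b) (x + p' *\<^sub>R b + q' *\<^sub>R a) a"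
    using s0 by simp
  have "dist (D (\<lambda>y. D f y a) (x + p *\<^sub>R a + q *\<^sub>R b) b) L < e"
    using d1(2) near[OF pq(1-4), of a b] by (simp add: d_def)
  moreover have "dist (D (\<lambda>y. D f y b) (x + p' *\<^sub>R b + q' *\<^sub>R a) a) M < e"
    using d2(2) near[OF pq'(1-4), of b a] by (simp add: d_def)
  ultimately have "\<bar>L - M\<bar> < 2 * e" unfolding eq dist_real_def by linarith
  then show False by (simp add: e_def)
qed

lemma D_linear_comp:
  assumes "bounded_linear L" "f differentiable at x"
  shows "D (\<lambda>y. L (f y)) x v = L (D f x v)"
  using D_eqI[OF bounded_linear.has_derivative[OF assms(1) has_derivative_D[OF assms(2)]]] by simp

lemma D_cong:
  assumes "open S" "x \<in> S" "\<And>y. y \<in> S \<Longrightarrow> f y = g y"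
  shows "D f x = D g x"
proof -
  have "(f has_derivative F) (at x) \<longleftrightarrow> (g has_derivative F) (at x)" for F
    using has_derivative_transform_within_open[OF _ assms(1,2)] assms(3) by metis
  then show ?thesis unfolding frechet_derivative_def by simp
qed

lemma D_D_commute:
  fixes f :: "'b::real_normed_vector \<Rightarrow> 'c::euclidean_space"
  assumes sm: "smooth_on S f" and S: "open S" and x: "x \<in> S"
  shows "D (\<lambda>y. D f y a) x b = D (\<lambda>y. D f y b) x a"
proof (rule euclidean_eqI)
  fix i :: 'c assume "i \<in> Basis"
  have *: "D (\<lambda>y. D f y u) x v \<bullet> i = D (\<lambda>y. D (\<lambda>z. f z \<bullet> i) y u) x v" for u v
  proof -
    have "D (\<lambda>y. D f y u) x v \<bullet> i = D (\<lambda>y. D f y u \<bullet> i) x v"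
      by (rule D_linear_comp[OF bounded_linear_inner_left, symmetric])
        (use smooth_onD(1)[OF smooth_onD(2)[OF sm S] S x] in auto)
    also have "D (\<lambda>y. D f y u \<bullet> i) x = D (\<lambda>y. D (\<lambda>z. f z \<bullet> i) y u) x"
      by (rule D_cong[OF S x]) (rule D_linear_comp[OF bounded_linear_inner_left, symmetric],
         use smooth_onD(1)[OF sm S] in auto)
    finally show ?thesis .
  qed
  show "D (\<lambda>y. D f y a) x b \<bullet> i = D (\<lambda>y. D f y b) x a \<bullet> i"
    unfolding * by (rule D_D_commute_real[OF _ S x])
      (rule smooth_on_linear_comp[OF bounded_linear_inner_left S sm])
qed


section \<open>Complexified Levi-Civita connection of the target\<close>

text \<open>Riesz representation for q: positivity makes the Gram map \<open>T\<close> injective,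
  and finite dimension makes it surjective.\<close>

lemma ex1_dual_vector:
  fixes q :: "'b::euclidean_space \<Rightarrow> 'b \<Rightarrow> real"
  assumes q: "bilinear q" and pos: "\<And>u. u \<noteq> 0 \<Longrightarrow> 0 < q u u" and l: "linear l"
  shows "\<exists>!w. \<forall>v. q w v = l v"
proof -
  define T where "T = (\<lambda>w. \<Sum>b\<in>Basis. q w b *\<^sub>R b)"
  have ql: "linear (\<lambda>w. q w v)" "linear (q w)" for v w using q by (simp_all add: bilinear_def)
  have linT: "linear T" unfolding T_def
    by (intro linear_compose_sum ballI linear_compose[OF ql(1), unfolded o_def, of "\<lambda>t. t *\<^sub>R _"])
       (simp add: linear_iff algebra_simps)
  have T: "T w \<bullet> b = q w b" if "b \<in> Basis" for w b
    using that by (simp add: T_def)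
  have qT: "q w v = T w \<bullet> v" for w v
  proof -
    have "q w v = (\<Sum>b\<in>Basis. (v \<bullet> b) *\<^sub>R q w b)" by (rule linear_euclidean_sum[OF ql(2)])
    also have "\<dots> = (\<Sum>b\<in>Basis. (T w \<bullet> b) * (v \<bullet> b))" by (simp add: T mult.commute)
    also have "\<dots> = T w \<bullet> v" by (rule euclidean_inner[symmetric])
    finally show ?thesis .
  qed
  have "T w = 0 \<Longrightarrow> w = 0" for w using qT[of w w] pos[of w] by force
  then have inj: "inj T" by (rule linear_injective_0[OF linT, THEN iffD2, rule_format]) 
  then have "surj T" using linear_injective_imp_surjective[OF linT] by blast
  then obtain w where w: "T w = (\<Sum>b\<in>Basis. l b *\<^sub>R b)" by (metis surjD)
  have lw: "q w v = l v" for v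
    unfolding qT w linear_euclidean_sum[OF l, of v]
    by (simp add: inner_sum_left inner_sum_right inner_commute mult.commute)
  show ?thesis
  proof (rule ex1I[of _ w])
    show "\<forall>v. q w v = l v" using lw by blast
    fix w' assume "\<forall>v. q w' v = l v"
    then have "T w' \<bullet> v = T w \<bullet> v" for v using lw qT by metis
    then have "T w' = T w" by (metis inner_commute vector_eq_ldot)
    then show "w' = w" using inj by (simp add: inj_eq)
  qed
qed

lemma sharp_works:
  fixes q :: "'b::euclidean_space \<Rightarrow> 'b \<Rightarrow> real"
  assumes "bilinear q" "\<And>u. u \<noteq> 0 \<Longrightarrow> 0 < q u u" "linear l"
  shows "q (sharp q l) v = l v"
  using theI'[OF ex1_dual_vector[OF assms]] unfolding sharp_def by blast

lemma sharp_eqI: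
  fixes q :: "'b::euclidean_space \<Rightarrow> 'b \<Rightarrow> real"
  assumes "bilinear q" "\<And>u. u \<noteq> 0 \<Longrightarrow> 0 < q u u" "\<And>v. q w v = l v"
  shows "sharp q l = w"
proof -
  have "l = q w" using assms(3) by auto
  then have "linear l" using assms(1) by (simp add: bilinear_def)
  from ex1_dual_vector[OF assms(1,2) this] show ?thesis
    unfolding sharp_def using assms(3) by (intro the1_equality) auto
qed

lemma pos_bilinear_cancel:
  fixes q :: "'b::euclidean_space \<Rightarrow> 'b \<Rightarrow> real"
  assumes "bilinear q" "\<And>u. u \<noteq> 0 \<Longrightarrow> 0 < q u u" "\<And>v. q w v = q w' v"
  shows "w = w'"
proof -
  have "q (w - w') (w - w') = 0" using assms(3)[of "w - w'"] by (simp add: bilinear_lsub[OF assms(1)])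
  then show ?thesis using assms(2)[of "w - w'"] by (cases "w - w' = 0") auto
qed

text \<open>A Riemannian metric on a coordinate domain, detached from any manifold. It is used for
  charts of the target and for the real part of the Hermitian metric of the source.\<close>

locale metric_domain =
  fixes Y :: "'b::euclidean_space set" and k :: "'b local_metric"
  assumes open_Y: "open Y"
    and k_bilinear: "y \<in> Y \<Longrightarrow> bilinear (k y)"
    and k_sym: "y \<in> Y \<Longrightarrow> k y u v = k y v u"
    and k_pos: "y \<in> Y \<Longrightarrow> u \<noteq> 0 \<Longrightarrow> 0 < k y u u"
    and k_smooth: "smooth_on Y (\<lambda>y. k y u v)"
begin

abbreviation \<Gamma> where "\<Gamma> \<equiv> christoffel k"

definition koszul :: "'b \<Rightarrow> 'b \<Rightarrow> 'b \<Rightarrow> 'b \<Rightarrow> real" where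
  "koszul y u v w = (D (\<lambda>y. k y v w) y u + D (\<lambda>y. k y u w) y v - D (\<lambda>y. k y u v) y w) / 2"

lemma k_diff: "y \<in> Y \<Longrightarrow> (\<lambda>y. k y u v) differentiable at y"
  using smooth_onD(1)[OF k_smooth open_Y] .

lemma k_lin: "y \<in> Y \<Longrightarrow> linear (\<lambda>u. k y u v)" "y \<in> Y \<Longrightarrow> linear (k y u)"
  using k_bilinear by (simp_all add: bilinear_def)

lemma Dk_add: "y \<in> Y \<Longrightarrow> D (\<lambda>y. k y (u + u') v) y w = D (\<lambda>y. k y u v) y w + D (\<lambda>y. k y u' v) y w"
proof -
  assume y: "y \<in> Y"
  have "D (\<lambda>y. k y (u + u') v) y = D (\<lambda>y. k y u v + k y u' v) y"
    by (rule D_cong[OF open_Y y]) (simp add: k_lin linear_add[OF k_lin(1)])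
  also have "\<dots> = (\<lambda>w. D (\<lambda>y. k y u v) y w + D (\<lambda>y. k y u' v) y w)"
    by (intro D_eqI has_derivative_add has_derivative_D k_diff y)
  finally show ?thesis by simp
qed

lemma Dk_scale: "y \<in> Y \<Longrightarrow> D (\<lambda>y. k y (c *\<^sub>R u) v) y w = c * D (\<lambda>y. k y u v) y w"
proof -
  assume y: "y \<in> Y"
  have "D (\<lambda>y. k y (c *\<^sub>R u) v) y = D (\<lambda>y. c * k y u v) y"
    by (rule D_cong[OF open_Y y]) (simp add: k_lin linear_cmul[OF k_lin(1)])
  also have "\<dots> = (\<lambda>w. c * D (\<lambda>y. k y u v) y w)"
    by (intro D_eqI bounded_linear.has_derivative[OF bounded_linear_mult_right] has_derivative_D k_diff y)
  finally show ?thesis by simp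
qed

lemma Dk_sym: "y \<in> Y \<Longrightarrow> D (\<lambda>y. k y u v) y = D (\<lambda>y. k y v u) y"
  by (rule D_cong[OF open_Y]) (auto simp: k_sym)

lemma Dk_linear:
  assumes "y \<in> Y"
  shows "linear (D (\<lambda>y. k y u v) y)" "linear (\<lambda>u. D (\<lambda>y. k y u v) y w)" "linear (\<lambda>v. D (\<lambda>y. k y u v) y w)"
proof -
  show "linear (D (\<lambda>y. k y u v) y)" using linear_D(1)[OF k_diff[OF assms]] .
  show l: "linear (\<lambda>u. D (\<lambda>y. k y u v) y w)" for v
    by (rule linearI) (simp_all add: Dk_add Dk_scale assms)
  show "linear (\<lambda>v. D (\<lambda>y. k y u v) y w)"
    using l[of u] by (simp add: Dk_sym[OF assms, of u])
qed

lemma koszul_linear: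
  assumes "y \<in> Y"
  shows "linear (\<lambda>u. koszul y u v w)" "linear (\<lambda>v. koszul y u v w)" "linear (\<lambda>w. koszul y u v w)"
  using Dk_linear[OF assms] unfolding koszul_def linear_iff by (auto simp: algebra_simps divide_simps)

lemma k_\<Gamma>: "y \<in> Y \<Longrightarrow> k y (\<Gamma> y u v) w = koszul y u v w"
  unfolding christoffel_def koszul_def[symmetric]
  by (rule sharp_works[OF k_bilinear k_pos koszul_linear(3)])

lemma \<Gamma>_eqI: "y \<in> Y \<Longrightarrow> (\<And>w. k y x w = koszul y u v w) \<Longrightarrow> \<Gamma> y u v = x"
  by (rule pos_bilinear_cancel[OF k_bilinear k_pos]) (auto simp: k_\<Gamma>)

lemma \<Gamma>_sym: "y \<in> Y \<Longrightarrow> \<Gamma> y u v = \<Gamma> y v u"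
  by (rule \<Gamma>_eqI) (simp_all add: k_\<Gamma> koszul_def Dk_sym[of y u v])

lemma \<Gamma>_bilinear: assumes "y \<in> Y" shows "bilinear (\<Gamma> y)"
proof -
  have "linear (\<lambda>u. \<Gamma> y u v)" for v
  proof (rule linearI)
    show "\<Gamma> y (a + b) v = \<Gamma> y a v + \<Gamma> y b v" for a b
      by (rule \<Gamma>_eqI[OF assms])
        (simp add: k_\<Gamma> assms linear_add[OF k_lin(1)] linear_add[OF koszul_linear(1)])
    show "\<Gamma> y (c *\<^sub>R a) v = c *\<^sub>R \<Gamma> y a v" for a c
      by (rule \<Gamma>_eqI[OF assms])
        (simp add: k_\<Gamma> assms linear_cmul[OF k_lin(1)] linear_cmul[OF koszul_linear(1)])
  qed
  then show ?thesis using \<Gamma>_sym[OF assms] by (simp add: bilinear_def)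
qed

lemma metric_compatible: "y \<in> Y \<Longrightarrow> D (\<lambda>y. k y v w) y u = k y (\<Gamma> y u v) w + k y v (\<Gamma> y u w)"
  by (subst k_sym[of y v]) (simp_all add: k_\<Gamma> koszul_def Dk_sym[of y w v] Dk_sym[of y v u] Dk_sym[of y w u] field_simps)

end

text \<open>A vector given by \<open>sharp\<close> says nothing about its dependence on the point;
  here it is the solution of a linear system with the Gram matrix \<open>G\<close>, and Cramer's
  rule gives smoothness.\<close>

lemma smooth_christoffel:
  fixes k :: "(real^'n) local_metric"
  assumes "metric_domain Y k"
  shows "smooth_on Y (\<lambda>y. christoffel k y u v $ c)"
proof -
  interpret metric_domain Y k by fact
  define G :: "real^'n \<Rightarrow> real^'n^'n" where "G = (\<lambda>y. \<chi> i j. k y (axis j 1) (axis i 1))"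
  have Gv: "(G y *v w) $ i = k y w (axis i 1)" if "y \<in> Y" for y w i
  proof -
    have "k y w (axis i 1) = (\<Sum>b\<in>Basis. (w \<bullet> b) *\<^sub>R k y b (axis i 1))"
      by (rule linear_euclidean_sum[OF k_lin(1)[OF that]])
    also have "\<dots> = (\<Sum>j\<in>UNIV. w $ j * k y (axis j 1) (axis i 1))"
      unfolding Basis_vec_def by (subst sum.UNION_disjoint; simp add: axis_eq_axis inner_axis)
    finally show ?thesis by (simp add: G_def matrix_vector_mult_def mult.commute)
  qed
  have det: "det (G y) \<noteq> 0" if "y \<in> Y" for y
  proof -
    have "w = 0" if w: "G y *v w = 0" for w
    proof (rule ccontr)
      assume "w \<noteq> 0"
      have "k y w w = (\<Sum>b\<in>Basis. (w \<bullet> b) *\<^sub>R k y w b)"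
        by (rule linear_euclidean_sum[OF k_lin(2)[OF \<open>y \<in> Y\<close>]])
      also have "\<dots> = 0"
        using w Gv[OF \<open>y \<in> Y\<close>, of w] by (intro sum.neutral) (auto simp: Basis_vec_def vec_eq_iff)
      finally show False using k_pos[OF \<open>y \<in> Y\<close> \<open>w \<noteq> 0\<close>] by simp
    qed
    then show ?thesis
      by (metis invertible_det_nz invertible_left_inverse matrix_left_invertible_ker)
  qed
  have inv: "invertible (G y)" if "y \<in> Y" for y using det[OF that] invertible_det_nz by blast
  have eq: "\<Gamma> y u v = matrix_inv (G y) *v (\<chi> i. koszul y u v (axis i 1))" if "y \<in> Y" for y
  proof -
    have "G y *v \<Gamma> y u v = (\<chi> i. koszul y u v (axis i 1))"
      by (simp add: vec_eq_iff Gv that k_\<Gamma>)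
    then have "matrix_inv (G y) *v (\<chi> i. koszul y u v (axis i 1)) = (matrix_inv (G y) ** G y) *v \<Gamma> y u v"
      by (metis matrix_vector_mul_assoc)
    then show ?thesis by (simp add: matrix_inv_left[OF inv[OF that]])
  qed
  have "smooth_on Y (\<lambda>y. koszul y u v w)" for w
    unfolding koszul_def divide_inverse
    by (intro smooth_on_mult smooth_on_add smooth_on_diff smooth_on_const smooth_onD(2) k_smooth open_Y)
  then have "smooth_on Y (\<lambda>y. \<Sum>j\<in>UNIV. matrix_inv (G y) $ c $ j * koszul y u v (axis j 1))"
    using det by (intro smooth_on_sum smooth_on_mult smooth_on_matrix_inv open_Y)
      (auto simp: G_def k_smooth)
  then show ?thesis
    by (rule smooth_on_cong[OF open_Y, rotated]) (simp add: eq matrix_vector_mult_def)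
qed


subsection \<open>Complex directional derivatives\<close>

text \<open>A pair \<open>(a, b)\<close> of real vectors stands for the complex direction \<open>a + \<i> b\<close>.\<close>
definition Dc :: "'e \<times> 'e \<Rightarrow> ('e::real_normed_vector \<Rightarrow> complex) \<Rightarrow> 'e \<Rightarrow> complex" where
  "Dc \<xi> \<phi> x = D \<phi> x (fst \<xi>) + \<i> * D \<phi> x (snd \<xi>)"

text \<open>Complex conjugation on the complexified tangent space, in the encoding by pairs.\<close>

definition cdir :: "'e::real_normed_vector \<times> 'e \<Rightarrow> 'e \<times> 'e" where
  "cdir \<xi> = (fst \<xi>, - snd \<xi>)"

lemma cdir_cdir [simp]: "cdir (cdir \<xi>) = \<xi>" by (simp add: cdir_def)

lemma Dc_cong:
  assumes "open S" "x \<in> S" "\<And>y. y \<in> S \<Longrightarrow> f y = g y"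
  shows "Dc \<xi> f x = Dc \<xi> g x"
  using D_cong[OF assms(1,2), of f g] assms(3) by (simp add: Dc_def)

lemma Dc_const [simp]: "Dc \<xi> (\<lambda>x. c) x = 0"
  by (simp add: Dc_def)

lemma D_add:
  assumes "f differentiable at x" "g differentiable at x"
  shows "D (\<lambda>y. f y + g y) x v = D f x v + D g x v"
  using D_eqI[OF has_derivative_add[OF assms[THEN has_derivative_D]]] by simp

lemma D_diff:
  assumes "f differentiable at x" "g differentiable at x"
  shows "D (\<lambda>y. f y - g y) x v = D f x v - D g x v"
  using D_eqI[OF has_derivative_diff[OF assms[THEN has_derivative_D]]] by simp

lemma D_mult:
  fixes f g :: "'e::real_normed_vector \<Rightarrow> 'a::real_normed_algebra"
  assumes "f differentiable at x" "g differentiable at x"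
  shows "D (\<lambda>y. f y * g y) x v = f x * D g x v + D f x v * g x"
  using D_eqI[OF has_derivative_mult[OF assms[THEN has_derivative_D]]] by simp

lemma D_sum:
  assumes "\<And>i. i \<in> I \<Longrightarrow> f i differentiable at x"
  shows "D (\<lambda>y. \<Sum>i\<in>I. f i y) x v = (\<Sum>i\<in>I. D (f i) x v)"
  using D_eqI[OF has_derivative_sum[of I f, OF has_derivative_D[OF assms]]] by simp

lemma Dc_add:
  assumes "f differentiable at x" "g differentiable at x"
  shows "Dc \<xi> (\<lambda>y. f y + g y) x = Dc \<xi> f x + Dc \<xi> g x"
  using assms by (simp add: Dc_def D_add algebra_simps)

lemma Dc_diff:
  assumes "f differentiable at x" "g differentiable at x"
  shows "Dc \<xi> (\<lambda>y. f y - g y) x = Dc \<xi> f x - Dc \<xi> g x"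
  using assms by (simp add: Dc_def D_diff algebra_simps)

lemma Dc_mult:
  assumes "f differentiable at x" "g differentiable at x"
  shows "Dc \<xi> (\<lambda>y. f y * g y) x = f x * Dc \<xi> g x + Dc \<xi> f x * g x"
  using assms by (simp add: Dc_def D_mult algebra_simps)

lemma Dc_sum:
  assumes "\<And>i. i \<in> I \<Longrightarrow> f i differentiable at x"
  shows "Dc \<xi> (\<lambda>y. \<Sum>i\<in>I. f i y) x = (\<Sum>i\<in>I. Dc \<xi> (f i) x)"
  using assms by (simp add: Dc_def D_sum sum.distrib sum_distrib_left)

lemma Dc_cnj:
  assumes "f differentiable at x"
  shows "Dc \<xi> (\<lambda>y. cnj (f y)) x = cnj (Dc (cdir \<xi>) f x)"
  using linear_neg[OF linear_D(1)[OF assms]]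
  by (simp add: Dc_def D_linear_comp[OF bounded_linear_cnj assms] cdir_def)

lemma Dc_Dc_commute:
  assumes f: "smooth_on S f" and S: "open S" and x: "x \<in> S"
  shows "Dc \<xi> (Dc \<eta> f) x = Dc \<eta> (Dc \<xi> f) x"
proof -
  have d: "(\<lambda>y. D f y v) differentiable at x" for v
    using smooth_onD(1)[OF smooth_onD(2)[OF f S] S x] .
  have "D (\<lambda>y. D f y (fst \<eta>) + \<i> * D f y (snd \<eta>)) x u = D (\<lambda>y. D f y (fst \<eta>)) x u + \<i> * D (\<lambda>y. D f y (snd \<eta>)) x u" for u \<eta>
    by (subst D_add) (auto simp: D_linear_comp[OF bounded_linear_mult_right] d intro!: differentiable_mult)
  then show ?thesis unfolding Dc_def[abs_def]
    using D_D_commute[OF f S x] by (simp add: algebra_simps)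
qed

lemma smooth_on_Dc:
  assumes "smooth_on S f" "open S"
  shows "smooth_on S (Dc \<xi> f)"
  unfolding Dc_def[abs_def]
  by (intro smooth_on_add smooth_on_mult smooth_on_const smooth_onD(2) assms)

lemma Dc_chain:
  fixes F :: "'e::real_normed_vector \<Rightarrow> real^'n" and \<phi> :: "real^'n \<Rightarrow> real"
  assumes F: "F differentiable at x" and \<phi>: "\<phi> differentiable at (F x)"
  shows "Dc \<xi> (\<lambda>x. complex_of_real (\<phi> (F x))) x =
    (\<Sum>e\<in>UNIV. complex_of_real (D \<phi> (F x) (axis e 1)) * Dc \<xi> (\<lambda>x. complex_of_real (F x $ e)) x)"
proof -
  have F': "D (\<lambda>x. complex_of_real (F x $ e)) x v = complex_of_real (D F x v $ e)" for e v
    using D_linear_comp[OF bounded_linear_compose[OF bounded_linear_of_real bounded_linear_vec_nth[of e]] F] .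
  have "D (\<lambda>x. complex_of_real (\<phi> (F x))) x v = complex_of_real (D \<phi> (F x) (D F x v))" for v
    by (rule D_eqI[THEN fun_cong])
      (rule bounded_linear.has_derivative[OF bounded_linear_of_real has_derivative_compose[OF has_derivative_D[OF F] has_derivative_D[OF \<phi>]]])
  moreover have "D \<phi> (F x) (D F x v) = (\<Sum>e\<in>UNIV. D F x v $ e * D \<phi> (F x) (axis e 1))" for v
    unfolding linear_euclidean_sum[OF linear_D(1)[OF \<phi>], of "D F x v"] Basis_vec_def
    by (subst sum.UNION_disjoint; simp add: axis_eq_axis inner_axis)
  ultimately show ?thesis
    by (simp add: Dc_def F' sum.distrib algebra_simps sum_distrib_left)
qed

subsection \<open>Complex multilinear extension\<close>

definition clin :: "(complex^'n \<Rightarrow> complex) \<Rightarrow> bool" where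
  "clin f \<longleftrightarrow> (\<forall>P Q. f (P + Q) = f P + f Q) \<and> (\<forall>c P. f (c *s P) = c * f P)"

lemma clin_sum: assumes "clin f" shows "f (\<Sum>i\<in>I. P i) = (\<Sum>i\<in>I. f (P i))"
proof -
  have "f 0 = 0" using assms unfolding clin_def by (metis mult_zero_left vector_smult_lzero)
  then show ?thesis using assms unfolding clin_def
    by (induction I rule: infinite_finite_induct) auto
qed

lemma clin_expand: assumes "clin f" shows "f P = (\<Sum>i\<in>UNIV. P $ i * f (axis i 1))"
proof -
  have "P = (\<Sum>i\<in>UNIV. P $ i *s axis i 1)" by (simp add: basis_expansion)
  then have "f P = f (\<Sum>i\<in>UNIV. P $ i *s axis i 1)" by simp
  also have "\<dots> = (\<Sum>i\<in>UNIV. P $ i * f (axis i 1))"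
    using assms by (simp add: clin_sum[OF assms] clin_def)
  finally show ?thesis .
qed

lemma clin_eqI: "clin f \<Longrightarrow> clin g \<Longrightarrow> (\<And>i. f (axis i 1) = g (axis i 1)) \<Longrightarrow> f P = g P"
  using clin_expand[of f P] clin_expand[of g P] by simp

definition cvec :: "real^'n \<Rightarrow> complex^'n" where
  "cvec v = (\<chi> i. complex_of_real (v $ i))"

lemma cvec_nth [simp]: "cvec v $ i = complex_of_real (v $ i)" by (simp add: cvec_def)

lemma cvec_axis: "cvec (axis i 1) = axis i 1" by (simp add: vec_eq_iff axis_def)

lemma vec_cnj_nth [simp]: "vec_cnj P $ i = cnj (P $ i)" by (simp add: vec_cnj_def)

lemma vec_cnj_vec_cnj [simp]: "vec_cnj (vec_cnj P) = P" by (simp add: vec_eq_iff)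

lemma linear_axis_expand:
  fixes f :: "real^'n \<Rightarrow> real"
  assumes "linear f" shows "f v = (\<Sum>i\<in>UNIV. v $ i * f (axis i 1))"
  unfolding linear_euclidean_sum[OF assms, of v] Basis_vec_def
    by (subst sum.UNION_disjoint; simp add: axis_eq_axis inner_axis)

lemma bilinear_axis_expand:
  fixes q :: "real^'n \<Rightarrow> real^'n \<Rightarrow> real"
  assumes "bilinear q" shows "q u v = (\<Sum>a\<in>UNIV. \<Sum>b\<in>UNIV. q (axis a 1) (axis b 1) * u $ a * v $ b)"
proof -
  have "q u v = (\<Sum>a\<in>UNIV. u $ a * q (axis a 1) v)"
    using assms by (intro linear_axis_expand) (simp add: bilinear_def)
  also have "\<dots> = (\<Sum>a\<in>UNIV. u $ a * (\<Sum>b\<in>UNIV. v $ b * q (axis a 1) (axis b 1)))"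
    using assms linear_axis_expand[of "q (axis _ 1)" v] by (simp add: bilinear_def)
  finally show ?thesis by (simp add: sum_distrib_left mult_ac)
qed

definition cform :: "(real^'n \<Rightarrow> real^'n \<Rightarrow> real) \<Rightarrow> complex^'n \<Rightarrow> complex^'n \<Rightarrow> complex" where
  "cform q P Q = (\<Sum>a\<in>UNIV. \<Sum>b\<in>UNIV. complex_of_real (q (axis a 1) (axis b 1)) * P $ a * Q $ b)"

lemma cform_clin: "clin (\<lambda>P. cform q P Q)" "clin (cform q P)"
  by (auto simp: clin_def cform_def algebra_simps sum.distrib sum_distrib_left)

lemma cform_linear:
  "cform q (P + P') Q = cform q P Q + cform q P' Q" "cform q P (Q + Q') = cform q P Q + cform q P Q'"
  "cform q (P - P') Q = cform q P Q - cform q P' Q" "cform q P (Q - Q') = cform q P Q - cform q P Q'"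
  "cform q (c *s P) Q = c * cform q P Q" "cform q P (c *s Q) = c * cform q P Q"
  by (auto simp: cform_def algebra_simps sum.distrib sum_distrib_left sum_subtractf)

lemma cform_cvec: "bilinear q \<Longrightarrow> cform q (cvec u) (cvec v) = complex_of_real (q u v)"
  by (subst bilinear_axis_expand[of q u v]) (auto simp: cform_def)

lemma cform_sum: "cform q (\<Sum>i\<in>I. P i) Q = (\<Sum>i\<in>I. cform q (P i) Q)"
  "cform q Q (\<Sum>i\<in>I. P i) = (\<Sum>i\<in>I. cform q Q (P i))"
  by (rule clin_sum[OF cform_clin(1)], rule clin_sum[OF cform_clin(2)])

lemma cform_sym: "(\<And>u v. q u v = q v u) \<Longrightarrow> cform q P Q = cform q Q P"
  unfolding cform_def by (subst sum.swap) (simp add: mult_ac)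

lemma cform_cnj: "cnj (cform q P Q) = cform q (vec_cnj P) (vec_cnj Q)"
  by (simp add: cform_def)

text \<open>Write \<open>P = u + \<i> v\<close>: the cross terms cancel by symmetry. This is the
  source of all positivity statements for the complexified metric.\<close>

lemma cform_norm:
  assumes q: "bilinear q" and sym: "\<And>u v. q u v = q v u"
  shows "cform q P (vec_cnj P) = complex_of_real (q (\<chi> i. Re (P $ i)) (\<chi> i. Re (P $ i))
    + q (\<chi> i. Im (P $ i)) (\<chi> i. Im (P $ i)))"
proof -
  let ?u = "\<chi> i. Re (P $ i)" and ?v = "\<chi> i. Im (P $ i)"
  have "P = cvec ?u + \<i> *s cvec ?v" "vec_cnj P = cvec ?u - \<i> *s cvec ?v"
    by (simp_all add: vec_eq_iff complex_eq_iff)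
  then have "cform q P (vec_cnj P) = cform q (cvec ?u + \<i> *s cvec ?v) (cvec ?u - \<i> *s cvec ?v)" by metis
  then show ?thesis
    by (simp add: cform_linear cform_cvec q sym[of ?v ?u] algebra_simps)
qed

section \<open>Complex multilinear extension of metric, connection and curvature of the
  target\<close>

locale metric_domain_n = metric_domain Y k for Y :: "(real^'n) set" and k
begin

definition kC :: "real^'n \<Rightarrow> complex^'n \<Rightarrow> complex^'n \<Rightarrow> complex" where
  "kC y = cform (k y)"

lemmas kC_linear = cform_linear[where q="k _", folded kC_def]
lemmas kC_sum = cform_sum[where q="k _", folded kC_def]

lemma kC_sym: "y \<in> Y \<Longrightarrow> kC y P Q = kC y Q P"
  unfolding kC_def by (rule cform_sym) (rule k_sym)

lemma kC_cvec: "y \<in> Y \<Longrightarrow> kC y (cvec u) (cvec v) = complex_of_real (k y u v)"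
  unfolding kC_def by (rule cform_cvec[OF k_bilinear])

lemma kC_norm_pos:
  assumes "y \<in> Y"
  shows "Im (kC y P (vec_cnj P)) = 0" "0 \<le> Re (kC y P (vec_cnj P))" "P \<noteq> 0 \<Longrightarrow> 0 < Re (kC y P (vec_cnj P))"
proof -
  note * = cform_norm[OF k_bilinear[OF assms] k_sym[OF assms], folded kC_def, of P]
  have nn: "0 \<le> k y u u" for u using k_pos[OF assms, of u] linear_0[OF k_lin(2)[OF assms, of u]]
    by (cases "u = 0") auto
  show "Im (kC y P (vec_cnj P)) = 0" "0 \<le> Re (kC y P (vec_cnj P))"
    using * nn by (auto intro: add_nonneg_nonneg)
  assume "P \<noteq> 0"
  then have "(\<chi> i. Re (P $ i)) \<noteq> (0::real^'n) \<or> (\<chi> i. Im (P $ i)) \<noteq> (0::real^'n)"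
    by (auto simp: vec_eq_iff complex_eq_iff)
  then show "0 < Re (kC y P (vec_cnj P))"
    using * nn k_pos[OF assms] by (auto intro: add_pos_nonneg add_nonneg_pos)
qed

definition GC :: "real^'n \<Rightarrow> complex^'n \<Rightarrow> complex^'n \<Rightarrow> complex^'n" where
  "GC y P Q = (\<chi> c. cform (\<lambda>u v. \<Gamma> y u v $ c) P Q)"

lemma GC_nth: "GC y P Q $ c = cform (\<lambda>u v. \<Gamma> y u v $ c) P Q" by (simp add: GC_def)

lemma GC_linear:
  "GC y (P + P') Q = GC y P Q + GC y P' Q" "GC y P (Q + Q') = GC y P Q + GC y P Q'"
  "GC y (P - P') Q = GC y P Q - GC y P' Q" "GC y P (Q - Q') = GC y P Q - GC y P Q'"
  "GC y (c *s P) Q = c *s GC y P Q" "GC y P (c *s Q) = c *s GC y P Q"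
  by (simp_all add: vec_eq_iff GC_nth cform_linear)

lemma GC_sym: "y \<in> Y \<Longrightarrow> GC y P Q = GC y Q P"
  unfolding vec_eq_iff GC_nth by (intro allI cform_sym) (simp add: \<Gamma>_sym)

lemma GC_cvec: "y \<in> Y \<Longrightarrow> GC y (cvec u) (cvec v) = cvec (\<Gamma> y u v)"
proof -
  assume "y \<in> Y"
  note b = \<Gamma>_bilinear[OF this]
  have "bilinear (\<lambda>u v. \<Gamma> y u v $ c)" for c
    unfolding bilinear_def
    by (auto intro!: linearI simp: bilinear_ladd[OF b] bilinear_radd[OF b] bilinear_lmul[OF b] bilinear_rmul[OF b])
  then show ?thesis by (simp add: vec_eq_iff GC_nth cform_cvec)
qed

lemma GC_cnj: "vec_cnj (GC y P Q) = GC y (vec_cnj P) (vec_cnj Q)"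
  by (simp add: vec_eq_iff GC_nth cform_cnj)

definition dkC :: "real^'n \<Rightarrow> complex^'n \<Rightarrow> complex^'n \<Rightarrow> complex^'n \<Rightarrow> complex" where
  "dkC y X P Q = (\<Sum>e\<in>UNIV. X $ e * cform (\<lambda>u v. D (\<lambda>y. k y u v) y (axis e 1)) P Q)"

text \<open>Metric compatibility of the Levi-Civita connection, complexified: both sides are complex
  linear in each of X, P, Q, so comparison on real basis vectors suffices.\<close>

lemma dkC_eq:
  assumes "y \<in> Y"
  shows "dkC y X P Q = kC y (GC y X P) Q + kC y P (GC y X Q)"
proof -
  have 1: "clin (\<lambda>X. dkC y X P Q)" "clin (\<lambda>P. dkC y X P Q)" "clin (\<lambda>Q. dkC y X P Q)" for X P Q
    by (auto simp: clin_def dkC_def cform_linear algebra_simps sum.distrib sum_distrib_left)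
  have 2: "clin (\<lambda>X. kC y (GC y X P) Q + kC y P (GC y X Q))"
    "clin (\<lambda>P. kC y (GC y X P) Q + kC y P (GC y X Q))"
    "clin (\<lambda>Q. kC y (GC y X P) Q + kC y P (GC y X Q))" for X P Q
    by (auto simp: clin_def kC_linear GC_linear algebra_simps)
  have 3: "dkC y (axis e 1) (axis a 1) (axis b 1) = 
     kC y (GC y (axis e 1) (axis a 1)) (axis b 1) + kC y (axis a 1) (GC y (axis e 1) (axis b 1))" for e a b
  proof -
    have "dkC y (axis e 1) (axis a 1) (axis b 1) = cform (\<lambda>u v. D (\<lambda>y. k y u v) y (axis e 1)) (cvec (axis a 1)) (cvec (axis b 1))"
      by (simp add: dkC_def cvec_axis) (simp add: axis_def if_distrib[of "\<lambda>x. x * _"] cong: if_cong)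
    also have "\<dots> = complex_of_real (D (\<lambda>y. k y (axis a 1) (axis b 1)) y (axis e 1))"
      by (rule cform_cvec) (use Dk_linear[OF assms] in \<open>simp add: bilinear_def\<close>)
    also have "\<dots> = kC y (cvec (\<Gamma> y (axis e 1) (axis a 1))) (cvec (axis b 1)) + kC y (cvec (axis a 1)) (cvec (\<Gamma> y (axis e 1) (axis b 1)))"
      by (simp add: metric_compatible assms kC_cvec)
    finally show ?thesis using assms by (simp add: GC_cvec[symmetric] cvec_axis)
  qed
  show ?thesis
    by (rule clin_eqI[OF 1(1) 2(1)], rule clin_eqI[OF 1(2) 2(2)], rule clin_eqI[OF 1(3) 2(3)], rule 3)
qed

definition dGC :: "real^'n \<Rightarrow> complex^'n \<Rightarrow> complex^'n \<Rightarrow> complex^'n \<Rightarrow> complex^'n" where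
  "dGC y X P Q = (\<chi> c. \<Sum>e\<in>UNIV. X $ e * cform (\<lambda>u v. D (\<lambda>y. \<Gamma> y u v $ c) y (axis e 1)) P Q)"

text \<open>The coordinate formula of the curvature operator, two derivatives of Christoffel symbols
  plus two quadratic terms, extended complex trilinearly. It is the form in which commutators of
  \<open>nab\<close> produce it.\<close>

definition RC :: "real^'n \<Rightarrow> complex^'n \<Rightarrow> complex^'n \<Rightarrow> complex^'n \<Rightarrow> complex^'n" where
  "RC y P Q S = dGC y P Q S - dGC y Q P S + GC y P (GC y Q S) - GC y Q (GC y P S)"

lemma \<Gamma>_smooth: "smooth_on Y (\<lambda>y. \<Gamma> y u v $ c)"
  by (rule smooth_christoffel) (rule metric_domain_axioms)

lemma \<Gamma>_diff: "y \<in> Y \<Longrightarrow> (\<lambda>y. \<Gamma> y u v $ c) differentiable at y"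
  using smooth_onD(1)[OF \<Gamma>_smooth open_Y] .

lemma cform_axis: "cform q (axis a 1) (axis b 1) = complex_of_real (q (axis a 1) (axis b 1))"
  by (simp add: cform_def axis_def if_distrib[of "\<lambda>x. _ * x"] if_distrib[of "\<lambda>x. x * _"] cong: if_cong)

lemma D_\<Gamma>_nth:
  assumes "y \<in> Y" shows "D (\<lambda>y. \<Gamma> y u v) y w $ c = D (\<lambda>y. \<Gamma> y u v $ c) y w"
proof -
  have "(\<lambda>y. \<Gamma> y u v) differentiable at y"
    by (rule smooth_onD(1)[OF smooth_on_vec[OF open_Y \<Gamma>_smooth] open_Y assms])
  then show ?thesis using D_linear_comp[OF bounded_linear_vec_nth] by metis
qed

lemma dGC_axis:
  assumes "y \<in> Y"
  shows "dGC y (axis i 1) (axis j 1) (axis l 1) = cvec (D (\<lambda>y. \<Gamma> y (axis j 1) (axis l 1)) y (axis i 1))"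
  by (simp add: vec_eq_iff dGC_def cform_axis D_\<Gamma>_nth[OF assms])
    (simp add: axis_def if_distrib[of "\<lambda>x. x * _"] cong: if_cong)

lemma curvature_op_const:
  assumes y: "y \<in> Y"
  shows "curvature_op k (\<lambda>_. u) (\<lambda>_. v) (\<lambda>_. w) y = D (\<lambda>y. \<Gamma> y v w) y u - D (\<lambda>y. \<Gamma> y u w) y v
     + \<Gamma> y u (\<Gamma> y v w) - \<Gamma> y v (\<Gamma> y u w)"
proof -
  have "lie_bracket (\<lambda>_. u) (\<lambda>_. v) = (\<lambda>_. 0)" by (simp add: lie_bracket_def fun_eq_iff)
  moreover have "\<Gamma> y 0 w = 0" using \<Gamma>_bilinear[OF y] linear_0 unfolding bilinear_def by blast
  ultimately show ?thesis
    by (simp add: curvature_op_def levi_civita_def[abs_def] algebra_simps)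
qed

text \<open>Both sides are complex linear in P, Q, S and T; on real basis vectors the constant
  fields commute and \<open>RC\<close> is the curvature operator itself.\<close>

lemma kC_RC:
  assumes y: "y \<in> Y"
  shows "kC y (RC y P Q S) T = complex_riemann k y P Q S T"
proof -
  have dl: "dGC y (P + P') Q S = dGC y P Q S + dGC y P' Q S" "dGC y (c *s P) Q S = c *s dGC y P Q S"
      "dGC y P (Q + Q') S = dGC y P Q S + dGC y P Q' S" "dGC y P (c *s Q) S = c *s dGC y P Q S"
      "dGC y P Q (S + S') = dGC y P Q S + dGC y P Q S'" "dGC y P Q (c *s S) = c *s dGC y P Q S" for P Q S P' Q' S' c
    by (auto simp: vec_eq_iff dGC_def cform_linear algebra_simps sum.distrib sum_distrib_left)
  have 1: "clin (\<lambda>P. kC y (RC y P Q S) T)" "clin (\<lambda>Q. kC y (RC y P Q S) T)" "clin (\<lambda>S. kC y (RC y P Q S) T)"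
    "clin (kC y (RC y P Q S))" for P Q S T
    by (auto simp: clin_def RC_def kC_linear GC_linear dl algebra_simps)
  have ax: "kC y (RC y (axis i 1) (axis j 1) (axis l 1)) (axis m 1) = complex_of_real (riemann k y (axis i 1) (axis j 1) (axis l 1) (axis m 1))" for i j l m
  proof -
    have "RC y (axis i 1) (axis j 1) (axis l 1) = cvec (curvature_op k (\<lambda>_. axis i 1) (\<lambda>_. axis j 1) (\<lambda>_. axis l 1) y)"
      unfolding RC_def curvature_op_const[OF y] dGC_axis[OF y]
      by (simp add: cvec_axis[symmetric] GC_cvec[OF y]) (simp add: vec_eq_iff)
    then show ?thesis unfolding riemann_def by (metis kC_cvec[OF y] cvec_axis)
  qed
  have "kC y (RC y P Q S) T = (\<Sum>i\<in>UNIV. P $ i * kC y (RC y (axis i 1) Q S) T)"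
    using clin_expand[OF 1(1)] .
  also have "\<dots> = (\<Sum>i\<in>UNIV. P $ i * (\<Sum>j\<in>UNIV. Q $ j * kC y (RC y (axis i 1) (axis j 1) S) T))"
    by (subst clin_expand[OF 1(2)]) simp
  also have "\<dots> = (\<Sum>i\<in>UNIV. P $ i * (\<Sum>j\<in>UNIV. Q $ j * (\<Sum>l\<in>UNIV. S $ l * kC y (RC y (axis i 1) (axis j 1) (axis l 1)) T)))"
    by (subst clin_expand[OF 1(3)]) simp
  also have "\<dots> = (\<Sum>i\<in>UNIV. P $ i * (\<Sum>j\<in>UNIV. Q $ j * (\<Sum>l\<in>UNIV. S $ l * (\<Sum>m\<in>UNIV. T $ m * 
     complex_of_real (riemann k y (axis i 1) (axis j 1) (axis l 1) (axis m 1))))))"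
    by (subst clin_expand[OF 1(4)]) (simp add: ax)
  also have "\<dots> = complex_riemann k y P Q S T"
    by (simp add: complex_riemann_def sum_distrib_left mult_ac)
  finally show ?thesis .
qed

lemma RC_antisym: "RC y P Q S = - RC y Q P S"
  by (simp add: RC_def)

end


subsection \<open>Sections along a map and the Bochner formula\<close>

lemma smooth_on_of_real:
  fixes f :: "'e::real_normed_vector \<Rightarrow> real"
  assumes "open S" "smooth_on S f" shows "smooth_on S (\<lambda>x. complex_of_real (f x))"
  by (rule smooth_on_linear_comp[OF bounded_linear_of_real assms])

locale target_map = metric_domain_n Y k for Y :: "(real^'n) set" and k +
  fixes S :: "'e::euclidean_space set" and F :: "'e \<Rightarrow> real^'n"
  assumes open_S: "open S" and F_smooth: "smooth_on S F" and F_in: "x \<in> S \<Longrightarrow> F x \<in> Y"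
begin

text \<open>The complexified differential of \<open>F\<close>, evaluated on the constant complex
  direction \<xi>.\<close>

definition FX :: "'e \<times> 'e \<Rightarrow> 'e \<Rightarrow> complex^'n" where
  "FX \<xi> x = (\<chi> e. Dc \<xi> (\<lambda>x. complex_of_real (F x $ e)) x)"

text \<open>The complexified pullback connection of \<open>F\<^sup>* T N\<close>.\<close>
definition nab :: "'e \<times> 'e \<Rightarrow> ('e \<Rightarrow> complex^'n) \<Rightarrow> 'e \<Rightarrow> complex^'n" where
  "nab \<xi> s x = (\<chi> c. Dc \<xi> (\<lambda>y. s y $ c) x) + GC (F x) (FX \<xi> x) (s x)"

lemma FX_nth: "FX \<xi> x $ e = Dc \<xi> (\<lambda>x. complex_of_real (F x $ e)) x" by (simp add: FX_def)

lemma nab_nth: "nab \<xi> s x $ c = Dc \<xi> (\<lambda>y. s y $ c) x + GC (F x) (FX \<xi> x) (s x) $ c"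
  by (simp add: nab_def)

lemma smooth_on_comp_F: "smooth_on Y \<phi> \<Longrightarrow> smooth_on S (\<lambda>x. complex_of_real (\<phi> (F x)))"
  by (intro smooth_on_of_real open_S smooth_on_comp[OF _ F_smooth open_S open_Y]) (auto simp: F_in)

lemma smooth_on_F_nth: "smooth_on S (\<lambda>x. complex_of_real (F x $ e))"
  by (intro smooth_on_of_real smooth_on_nth F_smooth open_S)

lemma smooth_FX: "smooth_on S (FX \<xi>)"
  by (rule smooth_on_vec[OF open_S])
    (simp add: FX_nth smooth_on_Dc[OF smooth_on_F_nth open_S])

lemma smooth_on_cform:
  assumes "\<And>u v. smooth_on Y (\<lambda>y. q y u v)" "smooth_on S s" "smooth_on S t"
  shows "smooth_on S (\<lambda>x. cform (q (F x)) (s x) (t x))"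
  unfolding cform_def
  by (intro smooth_on_sum smooth_on_mult smooth_on_comp_F smooth_on_nth open_S assms)

lemma smooth_kC: "smooth_on S s \<Longrightarrow> smooth_on S t \<Longrightarrow> smooth_on S (\<lambda>x. kC (F x) (s x) (t x))"
  unfolding kC_def by (rule smooth_on_cform[of k, OF k_smooth])

lemma smooth_GC_nth:
  "smooth_on S s \<Longrightarrow> smooth_on S t \<Longrightarrow> smooth_on S (\<lambda>x. GC (F x) (s x) (t x) $ c)"
  unfolding GC_nth by (rule smooth_on_cform[of "\<lambda>y u v. \<Gamma> y u v $ c", OF \<Gamma>_smooth])

lemma smooth_nab: "smooth_on S s \<Longrightarrow> smooth_on S (nab \<xi> s)"
  by (rule smooth_on_vec[OF open_S])
    (simp add: nab_nth smooth_on_add smooth_on_Dc smooth_on_nth smooth_GC_nth smooth_FX open_S)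

lemma smooth_vec_cnj: "smooth_on S s \<Longrightarrow> smooth_on S (\<lambda>x. vec_cnj (s x))"
  by (rule smooth_on_vec[OF open_S])
    (simp add: smooth_on_linear_comp[OF bounded_linear_cnj] smooth_on_nth open_S)

lemma nab_cong:
  assumes "x \<in> S" "\<And>y. y \<in> S \<Longrightarrow> s y = t y"
  shows "nab \<xi> s x = nab \<xi> t x"
proof -
  have "Dc \<xi> (\<lambda>y. s y $ c) x = Dc \<xi> (\<lambda>y. t y $ c) x" for c
    by (rule Dc_cong[OF open_S assms(1)]) (simp add: assms(2))
  then show ?thesis by (simp add: vec_eq_iff nab_nth assms)
qed

lemma Dc_cform:
  assumes q: "\<And>u v. smooth_on Y (\<lambda>y. q y u v)" and s: "smooth_on S s" and t: "smooth_on S t" and x: "x \<in> S"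
  shows "Dc \<xi> (\<lambda>x. cform (q (F x)) (s x) (t x)) x =
    (\<Sum>e\<in>UNIV. FX \<xi> x $ e * cform (\<lambda>u v. D (\<lambda>y. q y u v) (F x) (axis e 1)) (s x) (t x))
    + cform (q (F x)) (\<chi> c. Dc \<xi> (\<lambda>y. s y $ c) x) (t x)
    + cform (q (F x)) (s x) (\<chi> c. Dc \<xi> (\<lambda>y. t y $ c) x)"
proof -
  have d: "(\<lambda>x. complex_of_real (q (F x) u v)) differentiable at x" "(\<lambda>x. s x $ c) differentiable at x"
    "(\<lambda>x. t x $ c) differentiable at x" for u v c
    using smooth_onD(1)[OF smooth_on_comp_F[OF q] open_S x] smooth_onD(1)[OF smooth_on_nth[OF open_S s] open_S x]
      smooth_onD(1)[OF smooth_on_nth[OF open_S t] open_S x] by auto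
  have ch: "Dc \<xi> (\<lambda>x. complex_of_real (q (F x) u v)) x = (\<Sum>e\<in>UNIV. complex_of_real (D (\<lambda>y. q y u v) (F x) (axis e 1)) * FX \<xi> x $ e)" for u v
    unfolding FX_nth by (rule Dc_chain[where \<phi>="\<lambda>y. q y u v"])
      (use smooth_onD(1)[OF F_smooth open_S x] smooth_onD(1)[OF q open_Y F_in[OF x]] in auto)
  have "Dc \<xi> (\<lambda>x. cform (q (F x)) (s x) (t x)) x =
   (\<Sum>a\<in>UNIV. \<Sum>b\<in>UNIV. (\<Sum>e\<in>UNIV. complex_of_real (D (\<lambda>y. q y (axis a 1) (axis b 1)) (F x) (axis e 1)) * FX \<xi> x $ e) * s x $ a * t x $ b
      + complex_of_real (q (F x) (axis a 1) (axis b 1)) * Dc \<xi> (\<lambda>y. s y $ a) x * t x $ b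
      + complex_of_real (q (F x) (axis a 1) (axis b 1)) * s x $ a * Dc \<xi> (\<lambda>y. t y $ b) x)"
    unfolding cform_def
    by (simp add: Dc_sum Dc_mult d differentiable_sum differentiable_mult ch algebra_simps)
  also have "\<dots> = (\<Sum>a\<in>UNIV. \<Sum>b\<in>UNIV. \<Sum>e\<in>UNIV. FX \<xi> x $ e * (complex_of_real (D (\<lambda>y. q y (axis a 1) (axis b 1)) (F x) (axis e 1)) * s x $ a * t x $ b))
    + cform (q (F x)) (\<chi> c. Dc \<xi> (\<lambda>y. s y $ c) x) (t x)
    + cform (q (F x)) (s x) (\<chi> c. Dc \<xi> (\<lambda>y. t y $ c) x)"
    by (simp add: cform_def sum.distrib sum_distrib_left mult_ac)
  also have "(\<Sum>a\<in>UNIV. \<Sum>b\<in>UNIV. \<Sum>e\<in>UNIV. FX \<xi> x $ e * (complex_of_real (D (\<lambda>y. q y (axis a 1) (axis b 1)) (F x) (axis e 1)) * s x $ a * t x $ b))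
     = (\<Sum>e\<in>UNIV. FX \<xi> x $ e * cform (\<lambda>u v. D (\<lambda>y. q y u v) (F x) (axis e 1)) (s x) (t x))"
    unfolding cform_def sum_distrib_left
    by (rule trans[OF sum.cong[OF refl sum.swap] sum.swap])
  finally show ?thesis .
qed

text \<open>The pullback connection inherits metric compatibility: the chain rule through
  \<open>F\<close> produces exactly \<open>dkC\<close> in the direction
  \<open>FX \<xi> x\<close>.\<close>

lemma Dc_kC:
  assumes s: "smooth_on S s" and t: "smooth_on S t" and x: "x \<in> S"
  shows "Dc \<xi> (\<lambda>x. kC (F x) (s x) (t x)) x = kC (F x) (nab \<xi> s x) (t x) + kC (F x) (s x) (nab \<xi> t x)"
  using Dc_cform[of k, OF k_smooth s t x, of \<xi>] dkC_eq[OF F_in[OF x], of "FX \<xi> x" "s x" "t x"]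
  unfolding nab_def kC_linear by (simp add: kC_def dkC_def)

text \<open>Constant directions commute, so this is symmetry of second derivatives together with
  symmetry of the Christoffel symbols.\<close>

lemma nab_torsion_free:
  assumes x: "x \<in> S"
  shows "nab \<xi> (FX \<eta>) x = nab \<eta> (FX \<xi>) x"
  using Dc_Dc_commute[OF smooth_on_F_nth open_S x] GC_sym[OF F_in[OF x]]
  by (simp add: vec_eq_iff nab_nth FX_nth[abs_def])

text \<open>After expansion the second derivatives of s and of \<open>F\<close> are symmetric in
  \<xi> and \<eta>, and the two mixed first order terms are exchanged; what survives is the target
  curvature.\<close>

lemma nab_commutator:
  assumes s: "smooth_on S s" and x: "x \<in> S"
  shows "nab \<xi> (nab \<eta> s) x - nab \<eta> (nab \<xi> s) x = RC (F x) (FX \<xi> x) (FX \<eta> x) (s x)"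
proof -
  have dd: "nab \<xi> (nab \<eta> s) x = (\<chi> c. Dc \<xi> (Dc \<eta> (\<lambda>y. s y $ c)) x) + dGC (F x) (FX \<xi> x) (FX \<eta> x) (s x)
     + GC (F x) (\<chi> c. Dc \<xi> (\<lambda>y. FX \<eta> y $ c) x) (s x) + GC (F x) (FX \<eta> x) (\<chi> c. Dc \<xi> (\<lambda>y. s y $ c) x)
     + GC (F x) (FX \<xi> x) (\<chi> c. Dc \<eta> (\<lambda>y. s y $ c) x) + GC (F x) (FX \<xi> x) (GC (F x) (FX \<eta> x) (s x))" for \<xi> \<eta>
  proof -
    have "Dc \<xi> (\<lambda>y. nab \<eta> s y $ c) x = Dc \<xi> (Dc \<eta> (\<lambda>y. s y $ c)) x + Dc \<xi> (\<lambda>y. GC (F y) (FX \<eta> y) (s y) $ c) x" for c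
      unfolding nab_nth
      by (intro Dc_add smooth_onD(1)[OF _ open_S x] smooth_on_Dc smooth_on_nth smooth_GC_nth smooth_FX s open_S)
    moreover have "Dc \<xi> (\<lambda>y. GC (F y) (FX \<eta> y) (s y) $ c) x = (dGC (F x) (FX \<xi> x) (FX \<eta> x) (s x)
     + GC (F x) (\<chi> c. Dc \<xi> (\<lambda>y. FX \<eta> y $ c) x) (s x) + GC (F x) (FX \<eta> x) (\<chi> c. Dc \<xi> (\<lambda>y. s y $ c) x)) $ c" for c
      unfolding GC_nth using Dc_cform[of "\<lambda>y u v. \<Gamma> y u v $ c", OF \<Gamma>_smooth smooth_FX s x]
      by (simp add: dGC_def GC_nth)
    ultimately have "nab \<xi> (nab \<eta> s) x = (\<chi> c. Dc \<xi> (Dc \<eta> (\<lambda>y. s y $ c)) x) + (dGC (F x) (FX \<xi> x) (FX \<eta> x) (s x)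
     + GC (F x) (\<chi> c. Dc \<xi> (\<lambda>y. FX \<eta> y $ c) x) (s x) + GC (F x) (FX \<eta> x) (\<chi> c. Dc \<xi> (\<lambda>y. s y $ c) x))
     + GC (F x) (FX \<xi> x) (nab \<eta> s x)"
      by (simp add: vec_eq_iff nab_nth[of \<xi> "nab \<eta> s"])
    then show ?thesis by (simp add: nab_def[of \<eta> s x] GC_linear)
  qed
  have "Dc \<xi> (\<lambda>y. FX \<eta> y $ c) x = Dc \<eta> (\<lambda>y. FX \<xi> y $ c) x" for c
    using Dc_Dc_commute[OF smooth_on_F_nth open_S x] by (simp add: FX_nth[abs_def])
  moreover have "Dc \<xi> (Dc \<eta> (\<lambda>y. s y $ c)) x = Dc \<eta> (Dc \<xi> (\<lambda>y. s y $ c)) x" for c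
    by (rule Dc_Dc_commute[OF smooth_on_nth[OF open_S s] open_S x])
  ultimately show ?thesis unfolding dd[of \<xi> \<eta>] dd[of \<eta> \<xi>] RC_def by simp
qed

lemma FX_cnj: "x \<in> S \<Longrightarrow> vec_cnj (FX \<xi> x) = FX (cdir \<xi>) x"
proof -
  assume x: "x \<in> S"
  have "Dc (cdir \<xi>) (\<lambda>x. cnj (complex_of_real (F x $ e))) x = cnj (Dc (cdir (cdir \<xi>)) (\<lambda>x. complex_of_real (F x $ e)) x)" for e
    by (rule Dc_cnj[OF smooth_onD(1)[OF smooth_on_F_nth open_S x]])
  then show ?thesis by (simp add: vec_eq_iff FX_nth)
qed

lemma nab_cnj:
  assumes "smooth_on S s" "x \<in> S"
  shows "vec_cnj (nab \<xi> s x) = nab (cdir \<xi>) (\<lambda>y. vec_cnj (s y)) x"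
proof -
  have "Dc (cdir \<xi>) (\<lambda>y. cnj (s y $ c)) x = cnj (Dc (cdir (cdir \<xi>)) (\<lambda>y. s y $ c) x)" for c
    by (rule Dc_cnj[OF smooth_onD(1)[OF smooth_on_nth[OF open_S assms(1)] open_S assms(2)]])
  moreover have "cnj (GC (F x) (FX \<xi> x) (s x) $ c) = GC (F x) (FX (cdir \<xi>) x) (vec_cnj (s x)) $ c" for c
    using GC_cnj[of "F x" "FX \<xi> x" "s x"] FX_cnj[OF assms(2), of \<xi>] by (metis vec_cnj_nth)
  ultimately show ?thesis by (simp add: vec_eq_iff nab_nth)
qed

section \<open>The Bochner formula for the pulled back metric\<close>

definition psi :: "'e \<times> 'e \<Rightarrow> 'e \<times> 'e \<Rightarrow> 'e \<Rightarrow> complex" where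
  "psi \<xi> \<eta> x = kC (F x) (FX \<xi> x) (vec_cnj (FX \<eta> x))"

lemma smooth_psi: "smooth_on S (psi \<xi> \<eta>)"
  unfolding psi_def[abs_def] by (intro smooth_kC smooth_FX smooth_vec_cnj)

text \<open>The terms in which the derivative falls on the conjugated factor involve
  \<open>nab p (FX r)\<close>, symmetric in p and r, and cancel in the difference. Only derivatives
  of type (1,1) of the map remain.\<close>

lemma dbar_psi:
  assumes x: "x \<in> S"
  shows "Dc (cdir p) (psi q r) x - Dc (cdir r) (psi q p) x =
    kC (F x) (nab (cdir p) (FX q) x) (vec_cnj (FX r x)) - kC (F x) (nab (cdir r) (FX q) x) (vec_cnj (FX p x))"
proof -
  have a: "Dc (cdir p) (psi q r) x = kC (F x) (nab (cdir p) (FX q) x) (vec_cnj (FX r x)) + kC (F x) (FX q x) (vec_cnj (nab p (FX r) x))" for p r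
    unfolding psi_def[abs_def] Dc_kC[OF smooth_FX smooth_vec_cnj[OF smooth_FX] x] nab_cnj[OF smooth_FX x] ..
  show ?thesis unfolding a nab_torsion_free[OF x, of r p] by simp
qed

lemma Dc_dbar_psi:
  assumes x: "x \<in> S"
  shows "Dc m (\<lambda>x. Dc (cdir p) (psi q r) x - Dc (cdir r) (psi q p) x) x =
    kC (F x) (nab m (nab (cdir p) (FX q)) x) (FX (cdir r) x) + kC (F x) (nab (cdir p) (FX q) x) (nab m (FX (cdir r)) x)
   - kC (F x) (nab m (nab (cdir r) (FX q)) x) (FX (cdir p) x) - kC (F x) (nab (cdir r) (FX q) x) (nab m (FX (cdir p)) x)"
proof -
  have "Dc m (\<lambda>x. Dc (cdir p) (psi q r) x - Dc (cdir r) (psi q p) x) x =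
    Dc m (\<lambda>x. kC (F x) (nab (cdir p) (FX q) x) (FX (cdir r) x) - kC (F x) (nab (cdir r) (FX q) x) (FX (cdir p) x)) x"
    by (rule Dc_cong[OF open_S x]) (simp add: dbar_psi FX_cnj)
  also have "\<dots> = Dc m (\<lambda>x. kC (F x) (nab (cdir p) (FX q) x) (FX (cdir r) x)) x - Dc m (\<lambda>x. kC (F x) (nab (cdir r) (FX q) x) (FX (cdir p) x)) x"
    by (intro Dc_diff smooth_onD(1)[OF smooth_kC open_S x] smooth_nab smooth_FX)
  also have "\<dots> = kC (F x) (nab m (nab (cdir p) (FX q)) x) (FX (cdir r) x) + kC (F x) (nab (cdir p) (FX q) x) (nab m (FX (cdir r)) x)
   - (kC (F x) (nab m (nab (cdir r) (FX q)) x) (FX (cdir p) x) + kC (F x) (nab (cdir r) (FX q) x) (nab m (FX (cdir p)) x))"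
    by (simp only: Dc_kC[OF smooth_nab smooth_FX x, OF smooth_FX])
  finally show ?thesis by simp
qed

lemma nab_nab_swap:
  assumes x: "x \<in> S"
  shows "nab m (nab \<xi> (FX \<eta>)) x = nab m (nab \<eta> (FX \<xi>)) x"
  by (rule nab_cong[OF x]) (rule nab_torsion_free)

text \<open>The terms with second covariant derivatives cancel after exchanging \<open>p\<close> and \<open>q\<close>
  in one of the two sums, up to the curvature.\<close>
lemma bochner:
  fixes E :: "'i \<Rightarrow> 'e \<times> 'e"
  assumes x: "x \<in> S" and harm: "(\<Sum>q\<in>I. nab (cdir (E q)) (FX (E q)) x) = 0"
  shows "(\<Sum>p\<in>I. \<Sum>q\<in>I. Dc (E p) (\<lambda>x. Dc (cdir (E p)) (psi (E q) (E q)) x - Dc (cdir (E q)) (psi (E q) (E p)) x) x) =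
    (\<Sum>p\<in>I. \<Sum>q\<in>I. kC (F x) (nab (cdir (E p)) (FX (E q)) x) (vec_cnj (nab (cdir (E p)) (FX (E q)) x)))
    - (\<Sum>p\<in>I. \<Sum>q\<in>I. complex_riemann k (F x) (FX (E p) x) (FX (E q) x) (FX (cdir (E q)) x) (FX (cdir (E p)) x))"
proof -
  note y = F_in[OF x]
  \<comment> \<open>The only use of harmonicity in the formula: the sum over q alone is the tension
    field up to a factor.\<close>
  have zero: "(\<Sum>p\<in>I. \<Sum>q\<in>I. kC (F x) (nab (cdir (E q)) (FX (E q)) x) (nab (E p) (FX (cdir (E p))) x)) = 0"
    by (simp add: kC_sum[symmetric] harm) (simp add: kC_def cform_def)
  have sw: "(\<Sum>p\<in>I. \<Sum>q\<in>I. kC (F x) (nab (E p) (nab (cdir (E q)) (FX (E q))) x) (FX (cdir (E p)) x))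
     = (\<Sum>p\<in>I. \<Sum>q\<in>I. kC (F x) (nab (E q) (nab (E p) (FX (cdir (E p)))) x) (FX (cdir (E q)) x))"
    by (subst sum.swap) (simp add: nab_nab_swap[OF x, of _ "cdir _" "_"])
  \<comment> \<open>Torsion-freeness first moves the inner derivative from \<open>E q\<close> to the
    conjugate of \<open>E p\<close>; then the two outer derivatives are in directions
    \<open>E p\<close> and \<open>E q\<close> and their commutator is the curvature.\<close>
  have R: "kC (F x) (nab (E p) (nab (cdir (E p)) (FX (E q))) x) (FX (cdir (E q)) x)
      - kC (F x) (nab (E q) (nab (E p) (FX (cdir (E p)))) x) (FX (cdir (E q)) x)
      = complex_riemann k (F x) (FX (E p) x) (FX (E q) x) (FX (cdir (E p)) x) (FX (cdir (E q)) x)" for p q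
    unfolding nab_nab_swap[OF x, of "E p" "cdir (E p)" "E q"] kC_RC[OF y, symmetric]
      nab_commutator[OF smooth_FX x, symmetric] kC_linear ..
  \<comment> \<open>Renaming the indices and using antisymmetry in the first pair brings the term
    into the shape of a complex sectional curvature, with Z equal to \<open>FX (E p)\<close> and W
    equal to \<open>FX (cdir (E q))\<close>.\<close>
  have "(\<Sum>p\<in>I. \<Sum>q\<in>I. complex_riemann k (F x) (FX (E p) x) (FX (E q) x) (FX (cdir (E p)) x) (FX (cdir (E q)) x))
     = (\<Sum>p\<in>I. \<Sum>q\<in>I. complex_riemann k (F x) (FX (E q) x) (FX (E p) x) (FX (cdir (E q)) x) (FX (cdir (E p)) x))"
    by (rule sum.swap)
  also have "\<dots> = (\<Sum>p\<in>I. \<Sum>q\<in>I. - complex_riemann k (F x) (FX (E p) x) (FX (E q) x) (FX (cdir (E q)) x) (FX (cdir (E p)) x))"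
    unfolding kC_RC[OF y, symmetric]
    by (subst RC_antisym) (simp add: kC_def cform_def sum_negf)
  finally have R2: "(\<Sum>p\<in>I. \<Sum>q\<in>I. complex_riemann k (F x) (FX (E p) x) (FX (E q) x) (FX (cdir (E p)) x) (FX (cdir (E q)) x))
     = - (\<Sum>p\<in>I. \<Sum>q\<in>I. complex_riemann k (F x) (FX (E p) x) (FX (E q) x) (FX (cdir (E q)) x) (FX (cdir (E p)) x))"
    by (simp add: sum_negf)
  have nn: "nab (E p) (FX (cdir (E q))) x = vec_cnj (nab (cdir (E p)) (FX (E q)) x)" for p q
  proof -
    have "nab (E p) (FX (cdir (E q))) x = nab (E p) (\<lambda>y. vec_cnj (FX (E q) y)) x"
      by (rule nab_cong[OF x]) (simp add: FX_cnj)
    then show ?thesis by (simp add: nab_cnj[OF smooth_FX x])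
  qed
  have "(\<Sum>p\<in>I. \<Sum>q\<in>I. Dc (E p) (\<lambda>x. Dc (cdir (E p)) (psi (E q) (E q)) x - Dc (cdir (E q)) (psi (E q) (E p)) x) x) =
    (\<Sum>p\<in>I. \<Sum>q\<in>I. kC (F x) (nab (E p) (nab (cdir (E p)) (FX (E q))) x) (FX (cdir (E q)) x))
  + (\<Sum>p\<in>I. \<Sum>q\<in>I. kC (F x) (nab (cdir (E p)) (FX (E q)) x) (nab (E p) (FX (cdir (E q))) x))
  - (\<Sum>p\<in>I. \<Sum>q\<in>I. kC (F x) (nab (E p) (nab (cdir (E q)) (FX (E q))) x) (FX (cdir (E p)) x))
  - (\<Sum>p\<in>I. \<Sum>q\<in>I. kC (F x) (nab (cdir (E q)) (FX (E q)) x) (nab (E p) (FX (cdir (E p))) x))"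
    unfolding Dc_dbar_psi[OF x] by (simp add: sum.distrib sum_subtractf)
  also have "\<dots> = (\<Sum>p\<in>I. \<Sum>q\<in>I. kC (F x) (nab (cdir (E p)) (FX (E q)) x) (nab (E p) (FX (cdir (E q))) x))
    + (\<Sum>p\<in>I. \<Sum>q\<in>I. complex_riemann k (F x) (FX (E p) x) (FX (E q) x) (FX (cdir (E p)) x) (FX (cdir (E q)) x))"
    unfolding sw zero R[symmetric] by (simp add: sum.distrib sum_subtractf)
  finally show ?thesis unfolding R2 nn by simp
qed

end


section \<open>Local Kaehler geometry\<close>

subsection \<open>Wirtinger derivatives\<close>

text \<open>The complex direction \<open>(v - \<i> J v) / 2\<close>, the component of type (1,0) of the real vector \<open>v\<close>.\<close>
definition dirz :: "complex^'m \<Rightarrow> (complex^'m) \<times> (complex^'m)" where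
  "dirz v = ((1/2) *\<^sub>R v, - (1/2) *\<^sub>R (\<i> *s v))"

abbreviation dirzb :: "complex^'m \<Rightarrow> (complex^'m) \<times> (complex^'m)" where
  "dirzb v \<equiv> cdir (dirz v)"

lemma Dc_dirz:
  assumes "f differentiable at z"
  shows "Dc (dirz v) f z = (D f z v - \<i> * D f z (\<i> *s v)) / 2"
    "Dc (dirzb v) f z = (D f z v + \<i> * D f z (\<i> *s v)) / 2"
proof -
  interpret linear "D f z" using linear_D(1)[OF assms] .
  have "D f z (- (1 / 2) *\<^sub>R (\<i> *s v)) = - (1/2) *\<^sub>R D f z (\<i> *s v)"
    "D f z ((1 / 2) *\<^sub>R (\<i> *s v)) = (1/2) *\<^sub>R D f z (\<i> *s v)"
    "D f z ((1 / 2) *\<^sub>R v) = (1/2) *\<^sub>R D f z v" by (rule scale)+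
  then show "Dc (dirz v) f z = (D f z v - \<i> * D f z (\<i> *s v)) / 2"
    "Dc (dirzb v) f z = (D f z v + \<i> * D f z (\<i> *s v)) / 2"
    by (simp_all add: Dc_def dirz_def cdir_def complex_eq_iff)
qed

lemma i_axis: "\<i> *s axis \<alpha> 1 = (axis \<alpha> \<i> :: complex^'m)"
  by (simp add: vec_eq_iff axis_def)

lemma d_z_eq: "f differentiable at z \<Longrightarrow> d_z \<alpha> f z = Dc (dirz (axis \<alpha> 1)) f z"
  and d_zbar_eq: "f differentiable at z \<Longrightarrow> d_zbar \<alpha> f z = Dc (dirzb (axis \<alpha> 1)) f z"
  by (simp_all add: d_z_def d_zbar_def Dc_dirz i_axis)

lemma D_dirz: "f differentiable at z \<Longrightarrow> D f z v = Dc (dirz v) f z + Dc (dirzb v) f z"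
  by (simp add: Dc_dirz field_simps)

lemma D_complex_scale:
  assumes "f differentiable at (z::complex^'m)"
  shows "D f z (c *s v) = Re c *\<^sub>R D f z v + Im c *\<^sub>R D f z (\<i> *s v)"
proof -
  interpret linear "D f z" using linear_D(1)[OF assms] .
  have "c *s v = Re c *\<^sub>R v + Im c *\<^sub>R (\<i> *s v)"
    by (simp add: vec_eq_iff complex_eq_iff)
  then show ?thesis by (simp add: add scale)
qed

lemma Dc_dirz_linear:
  assumes "f differentiable at z"
  shows "Dc (dirz (v + w)) f z = Dc (dirz v) f z + Dc (dirz w) f z"
    "Dc (dirz (c *s v)) f z = c * Dc (dirz v) f z"
    "Dc (dirzb (v + w)) f z = Dc (dirzb v) f z + Dc (dirzb w) f z"
    "Dc (dirzb (c *s v)) f z = cnj c * Dc (dirzb v) f z"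
proof -
  interpret linear "D f z" using linear_D(1)[OF assms] .
  have 1: "\<i> *s (v + w) = \<i> *s v + \<i> *s w" by (simp add: vec_eq_iff algebra_simps)
  have 2: "\<i> *s (c *s v) = (\<i> * c) *s v" by (simp add: vec_eq_iff)
  show "Dc (dirz (v + w)) f z = Dc (dirz v) f z + Dc (dirz w) f z"
    "Dc (dirzb (v + w)) f z = Dc (dirzb v) f z + Dc (dirzb w) f z"
    by (simp_all add: Dc_dirz assms 1 add field_simps)
  show "Dc (dirz (c *s v)) f z = c * Dc (dirz v) f z"
    "Dc (dirzb (c *s v)) f z = cnj c * Dc (dirzb v) f z"
    unfolding Dc_dirz[OF assms] 2 D_complex_scale[OF assms, of c] D_complex_scale[OF assms, of "\<i> * c"]
    by (simp_all add: complex_eq_iff algebra_simps)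
qed

lemma clin_Dc_dirz:
  assumes "f differentiable at (z :: complex^'m)"
  shows "clin (\<lambda>v. Dc (dirz v) f z)" "clin (\<lambda>v. Dc (dirzb (vec_cnj v)) f z)"
proof -
  have "vec_cnj (v + w) = vec_cnj v + vec_cnj w" "vec_cnj (c *s v) = cnj c *s vec_cnj v" for v w :: "complex^'m" and c
    by (simp_all add: vec_eq_iff)
  then show "clin (\<lambda>v. Dc (dirz v) f z)" "clin (\<lambda>v. Dc (dirzb (vec_cnj v)) f z)"
    by (simp_all add: clin_def Dc_dirz_linear assms)
qed

lemma Dc_dirz_expand:
  assumes "f differentiable at (z :: complex^'m)"
  shows "Dc (dirz v) f z = (\<Sum>l\<in>UNIV. v $ l * Dc (dirz (axis l 1)) f z)"
    "Dc (dirzb v) f z = (\<Sum>l\<in>UNIV. cnj (v $ l) * Dc (dirzb (axis l 1)) f z)"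
proof -
  show "Dc (dirz v) f z = (\<Sum>l\<in>UNIV. v $ l * Dc (dirz (axis l 1)) f z)"
    by (rule clin_expand[OF clin_Dc_dirz(1)[OF assms]])
  have "vec_cnj (axis l 1) = (axis l 1 :: complex^'m)" for l by (simp add: vec_eq_iff axis_def)
  then show "Dc (dirzb v) f z = (\<Sum>l\<in>UNIV. cnj (v $ l) * Dc (dirzb (axis l 1)) f z)"
    using clin_expand[OF clin_Dc_dirz(2)[OF assms], of "vec_cnj v"] by simp
qed

subsection \<open>Hermitian forms\<close>

lemma scaleR_eq_smult: "r *\<^sub>R u = complex_of_real r *s u"
  unfolding vec_eq_iff by (simp add: scaleR_conv_of_real[where 'a=complex])

lemma herm_form_linear:
  "herm_form H (u + u') v = herm_form H u v + herm_form H u' v"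
  "herm_form H u (v + v') = herm_form H u v + herm_form H u v'"
  "herm_form H (u - u') v = herm_form H u v - herm_form H u' v"
  "herm_form H u (v - v') = herm_form H u v - herm_form H u v'"
  "herm_form H (- u) v = - herm_form H u v"
  "herm_form H u (- v) = - herm_form H u v"
  "herm_form H (c *s u) v = c * herm_form H u v"
  "herm_form H u (c *s v) = cnj c * herm_form H u v"
  "herm_form H (r *\<^sub>R u) v = r *\<^sub>R herm_form H u v"
  "herm_form H u (r *\<^sub>R v) = r *\<^sub>R herm_form H u v"
  by (simp_all add: herm_form_def algebra_simps sum.distrib sum_distrib_left sum_subtractf sum_negf scaleR_eq_smult scaleR_conv_of_real[where 'a=complex])

lemma herm_form_sum:
  "herm_form H (\<Sum>i\<in>I. u i) v = (\<Sum>i\<in>I. herm_form H (u i) v)"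
  "herm_form H v (\<Sum>i\<in>I. u i) = (\<Sum>i\<in>I. herm_form H v (u i))"
proof -
  have "herm_form H 0 v = 0" "herm_form H v 0 = 0" by (simp_all add: herm_form_def)
  then show "herm_form H (\<Sum>i\<in>I. u i) v = (\<Sum>i\<in>I. herm_form H (u i) v)"
    "herm_form H v (\<Sum>i\<in>I. u i) = (\<Sum>i\<in>I. herm_form H v (u i))"
    by (induction I rule: infinite_finite_induct) (auto simp: herm_form_linear)
qed

lemma herm_form_axis: "herm_form H (axis a 1) (axis b 1) = H $ a $ b"
  by (simp add: herm_form_def axis_def if_distrib[of cnj] if_distrib[of "\<lambda>x. _ * x"] if_distrib[of "\<lambda>x. x * _"] cong: if_cong)

lemma herm_form_cnj:
  assumes "\<And>a b. H $ b $ a = cnj (H $ a $ b)"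
  shows "cnj (herm_form H u v) = herm_form H v u"
  unfolding herm_form_def by (subst sum.swap) (simp add: assms[symmetric] mult_ac)

text \<open>Complete the square in the variable \<open>p\<close> and recurse on the Schur complement.\<close>
lemma positive_hermitian_decomposition:
  fixes M :: "'m \<Rightarrow> 'm \<Rightarrow> complex"
  assumes "finite I"
    and "\<And>i j. i \<in> I \<Longrightarrow> j \<in> I \<Longrightarrow> M j i = cnj (M i j)"
    and "\<And>v. (\<exists>i\<in>I. v i \<noteq> 0) \<Longrightarrow> 0 < Re (\<Sum>i\<in>I. \<Sum>j\<in>I. M i j * v i * cnj (v j))"
  shows "\<exists>G. \<forall>i\<in>I. \<forall>j\<in>I. M i j = (\<Sum>a\<in>I. cnj (G a i) * G a j)"
  using assms
proof (induction I arbitrary: M rule: finite_induct)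
  case (insert p I)
  define c where "c = Re (M p p)"
  have cnj_pp: "M p p = complex_of_real c" using insert.prems(1)[of p p] by (simp add: c_def complex_eq_iff)
  have c0: "c > 0"
  proof -
    have "(\<Sum>i\<in>insert p I. \<Sum>j\<in>insert p I. M i j * (if i = p then 1 else 0) * cnj (if j = p then 1 else 0))
      = (\<Sum>i\<in>insert p I. if i = p then M p p else 0)"
      using insert.hyps by (intro sum.cong refl) (auto simp: if_distrib[of cnj] if_distrib[of "\<lambda>x. _ * x"] sum.delta cong: if_cong)
    also have "\<dots> = M p p" using insert.hyps by simp
    finally show ?thesis using insert.prems(2)[of "\<lambda>i. if i = p then 1 else 0"] by (auto simp: c_def)
  qed
  define N where "N = (\<lambda>i j. M i j - M i p * M p j / c)"
  have herm: "N j i = cnj (N i j)" if "i \<in> I" "j \<in> I" for i j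
    using insert.prems(1)[of i j] insert.prems(1)[of p i] insert.prems(1)[of p j] that
    by (simp add: N_def)
  have pos: "0 < Re (\<Sum>i\<in>I. \<Sum>j\<in>I. N i j * v i * cnj (v j))" if v: "\<exists>i\<in>I. v i \<noteq> 0" for v
  proof -
    define A where "A = (\<Sum>i\<in>I. M i p * v i)"
    have A': "cnj A = (\<Sum>j\<in>I. M p j * cnj (v j))"
      unfolding A_def using insert.prems(1) by (simp add: insert.prems(1)[symmetric])
    \<comment> \<open>The value at p minimises the form for given v on I; at this value the form is
      that of the Schur complement \<open>N\<close>.\<close>
    define w where "w = (\<lambda>i. if i = p then - A / c else v i)"
    have wI: "w i = v i" if "i \<in> I" for i using that insert.hyps by (auto simp: w_def)
    have wp: "w p = - A / c" by (simp add: w_def)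
    have "(\<Sum>i\<in>insert p I. \<Sum>j\<in>insert p I. M i j * w i * cnj (w j)) =
       M p p * w p * cnj (w p) + w p * (\<Sum>j\<in>I. M p j * cnj (v j)) + cnj (w p) * (\<Sum>i\<in>I. M i p * v i)
       + (\<Sum>i\<in>I. \<Sum>j\<in>I. M i j * v i * cnj (v j))"
      using insert.hyps by (simp add: wI sum.distrib sum_distrib_left mult_ac)
    also have "\<dots> = (\<Sum>i\<in>I. \<Sum>j\<in>I. M i j * v i * cnj (v j)) - A * cnj A / c"
      unfolding A'[symmetric] A_def[symmetric] cnj_pp wp using c0 by (simp add: field_simps)
    also have "A * cnj A / c = (\<Sum>i\<in>I. \<Sum>j\<in>I. M i p * M p j / c * v i * cnj (v j))"
      unfolding A' unfolding A_def by (simp add: sum_product sum_divide_distrib mult_ac)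
    also have "(\<Sum>i\<in>I. \<Sum>j\<in>I. M i j * v i * cnj (v j)) - \<dots> = (\<Sum>i\<in>I. \<Sum>j\<in>I. N i j * v i * cnj (v j))"
      by (simp add: N_def sum_subtractf algebra_simps)
    finally show ?thesis using insert.prems(2)[of w] v wI by (metis insertCI)
  qed
  obtain G where G: "\<And>i j. i \<in> I \<Longrightarrow> j \<in> I \<Longrightarrow> N i j = (\<Sum>a\<in>I. cnj (G a i) * G a j)"
    using insert.IH[of N] herm pos by blast
  \<comment> \<open>Row p reproduces row and column p of M, and column p of the other rows is zero,
    so that on I these rows only have to account for the Schur complement.\<close>
  define G' where "G' = (\<lambda>a j. if a = p then M p j / sqrt c else if j = p then 0 else G a j)"
  have I: "(\<Sum>a\<in>I. cnj (G' a i) * G' a j) = (if i = p \<or> j = p then 0 else (\<Sum>a\<in>I. cnj (G a i) * G a j))" for i j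
    using insert.hyps by (auto simp: G'_def intro!: sum.neutral sum.cong)
  have sq: "complex_of_real (sqrt c) * complex_of_real (sqrt c) = c" using c0 by (simp flip: of_real_mult)
  have P: "cnj (G' p i) * G' p j = M i p * M p j / c" if "i \<in> insert p I" for i j
    using insert.prems(1)[of p i] that sq by (simp add: G'_def field_simps)
  have "M i j = (\<Sum>a\<in>insert p I. cnj (G' a i) * G' a j)" if "i \<in> insert p I" "j \<in> insert p I" for i j
    using insert.hyps that c0 G[of i j] by (auto simp: I P N_def cnj_pp diff_eq_eq add.commute)
  then show ?case by blast
qed auto

text \<open>A resolution of the identity: \<open>E\<close> is a unitary frame. In this form the notion is visibly
  preserved by isometric isomorphisms.\<close>
definition frame_at :: "complex^'m^'m \<Rightarrow> ('m \<Rightarrow> complex^'m) \<Rightarrow> bool" where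
  "frame_at H E \<longleftrightarrow> (\<forall>u. (\<Sum>a\<in>UNIV. herm_form H u (E a) *s E a) = u)"

text \<open>A vector in the kernel of the transpose has \<open>herm_form H u u = 0\<close>.\<close>

lemma det_positive_hermitian:
  fixes H :: "complex^'m^'m"
  assumes pos: "\<And>u. u \<noteq> 0 \<Longrightarrow> 0 < Re (herm_form H u u)"
  shows "det H \<noteq> 0"
proof -
  have hf: "herm_form H u v = (\<Sum>b\<in>UNIV. (transpose H *v u) $ b * cnj (v $ b))" for u v
    unfolding herm_form_def by (subst sum.swap) (simp add: matrix_vector_mult_def transpose_def sum_distrib_right)
  have "u = 0" if "transpose H *v u = 0" for u
    using hf[of u u] that pos[of u] by (cases "u = 0") auto
  then have "invertible (transpose H)"
    using matrix_left_invertible_ker invertible_left_inverse by blast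
  then show ?thesis by (simp add: invertible_det_nz)
qed

text \<open>If H is the product of the conjugate transpose of G with G, the conjugated columns of
  the inverse of G form the frame: pairing u with the a-th of them gives the a-th conjugated linear
  form of G.\<close>

lemma frame_exists:
  fixes H :: "complex^'m^'m"
  assumes herm: "\<And>a b. H $ b $ a = cnj (H $ a $ b)" and pos: "\<And>u. u \<noteq> 0 \<Longrightarrow> 0 < Re (herm_form H u u)"
  shows "\<exists>E. frame_at H E"
proof -
  have "\<exists>G :: 'm \<Rightarrow> 'm \<Rightarrow> complex. \<forall>i\<in>UNIV. \<forall>j\<in>UNIV. H $ i $ j = (\<Sum>a\<in>UNIV. cnj (G a i) * G a j)"
  proof (rule positive_hermitian_decomposition[where M = "\<lambda>i j. H $ i $ j"])
    fix v :: "'m \<Rightarrow> complex" assume "\<exists>i\<in>UNIV. v i \<noteq> 0"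
    then have "(\<chi> i. v i) \<noteq> 0" by (auto simp: vec_eq_iff)
    from pos[OF this] show "0 < Re (\<Sum>i\<in>UNIV. \<Sum>j\<in>UNIV. H $ i $ j * v i * cnj (v j))"
      by (simp add: herm_form_def)
  qed (simp, rule herm)
  then obtain g :: "'m \<Rightarrow> 'm \<Rightarrow> complex" where g: "\<And>i j. H $ i $ j = (\<Sum>a\<in>UNIV. cnj (g a i) * g a j)" by auto
  define G where "G = (\<chi> a i. g a i)"
  define Gs where "Gs = (\<chi> i a. cnj (g a i))"
  have "H = Gs ** G" by (simp add: vec_eq_iff g Gs_def G_def matrix_matrix_mult_def)
  then have "det G \<noteq> 0" using det_positive_hermitian[OF pos] by (metis det_mul mult_zero_right)
  then have inv: "invertible G" by (simp add: invertible_det_nz)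
  define R where "R = matrix_inv G"
  have RG: "(\<Sum>a\<in>UNIV. R $ l $ a * g a i) = (if l = i then 1 else 0)" for l i
    using arg_cong[OF matrix_inv_left[OF inv], of "\<lambda>M. M $ l $ i"]
    unfolding R_def[symmetric] by (simp add: matrix_matrix_mult_def G_def mat_def)
  have GR: "(\<Sum>i\<in>UNIV. g b i * R $ i $ a) = (if b = a then 1 else 0)" for a b
    using arg_cong[OF matrix_inv_right[OF inv], of "\<lambda>M. M $ b $ a"]
    unfolding R_def[symmetric] by (simp add: matrix_matrix_mult_def G_def mat_def)
  define E where "E = (\<lambda>a. \<chi> l. cnj (R $ l $ a))"
  have hE: "herm_form H u (E a) = (\<Sum>i\<in>UNIV. u $ i * cnj (g a i))" for u a
  proof -
    have "herm_form H u (E a) = (\<Sum>i\<in>UNIV. \<Sum>j\<in>UNIV. \<Sum>b\<in>UNIV. u $ i * cnj (g b i) * (g b j * R $ j $ a))"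
      by (simp add: herm_form_def E_def g sum_distrib_left sum_distrib_right mult_ac)
    also have "\<dots> = (\<Sum>i\<in>UNIV. \<Sum>b\<in>UNIV. u $ i * cnj (g b i) * (\<Sum>j\<in>UNIV. g b j * R $ j $ a))"
      unfolding sum_distrib_left by (rule sum.cong[OF refl], rule sum.swap)
    also have "\<dots> = (\<Sum>i\<in>UNIV. u $ i * cnj (g a i))"
      by (simp add: GR if_distrib[of "\<lambda>x. _ * x"] cong: if_cong)
    finally show ?thesis .
  qed
  have "(\<Sum>a\<in>UNIV. herm_form H u (E a) *s E a) = u" for u
  proof -
    have "(\<Sum>a\<in>UNIV. herm_form H u (E a) * E a $ l) = u $ l" for l
    proof -
      have "(\<Sum>a\<in>UNIV. herm_form H u (E a) * E a $ l) = (\<Sum>i\<in>UNIV. u $ i * cnj (\<Sum>a\<in>UNIV. R $ l $ a * g a i))"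
        unfolding hE sum_distrib_right cnj_sum sum_distrib_left
        by (subst sum.swap) (simp add: E_def mult_ac)
      then show ?thesis by (simp add: RG if_distrib[of cnj] if_distrib[of "\<lambda>x. _ * x"] cong: if_cong)
    qed
    then show ?thesis by (simp add: vec_eq_iff)
  qed
  then show ?thesis unfolding frame_at_def by blast
qed

text \<open>Applied to basis vectors, the resolution of the identity reads
  \<open>H ** Q = mat 1\<close>. With this, contractions with the inverse metric can be traded for
  sums over a unitary frame.\<close>

lemma frame_matrix_inv:
  fixes H :: "complex^'m^'m"
  assumes pos: "\<And>u. u \<noteq> 0 \<Longrightarrow> 0 < Re (herm_form H u u)" and E: "frame_at H E"
  shows "matrix_inv H $ j $ l = (\<Sum>a\<in>UNIV. E a $ l * cnj (E a $ j))"
proof -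
  define Q where "Q = (\<chi> j l. \<Sum>a\<in>UNIV. E a $ l * cnj (E a $ j))"
  have "(H ** Q) $ i $ l = mat 1 $ i $ l" for i l
  proof -
    have "(H ** Q) $ i $ l = (\<Sum>a\<in>UNIV. herm_form H (axis i 1) (E a) * E a $ l)"
    proof -
      have "herm_form H (axis i 1) (E a) = (\<Sum>j\<in>UNIV. H $ i $ j * cnj (E a $ j))" for a
      proof -
        have "herm_form H (axis i 1) (E a) = (\<Sum>\<alpha>\<in>UNIV. if \<alpha> = i then \<Sum>j\<in>UNIV. H $ i $ j * cnj (E a $ j) else 0)"
          unfolding herm_form_def by (intro sum.cong refl) (auto simp: axis_def)
        then show ?thesis by simp
      qed
      then show ?thesis
        unfolding matrix_matrix_mult_def Q_def
        by (simp add: sum_distrib_left sum_distrib_right) (subst sum.swap, simp add: mult_ac)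
    qed
    also have "\<dots> = (\<Sum>a\<in>UNIV. herm_form H (axis i 1) (E a) *s E a) $ l" by simp
    also have "\<dots> = mat 1 $ i $ l" using E by (simp add: frame_at_def mat_def axis_def)
    finally show ?thesis .
  qed
  then have HQ: "H ** Q = mat 1" by (simp add: vec_eq_iff)
  have inv: "invertible H" using det_positive_hermitian[OF pos] invertible_det_nz by blast
  have "matrix_inv H = matrix_inv H ** (H ** Q)" by (simp add: HQ)
  also have "\<dots> = Q" by (simp add: matrix_mul_assoc matrix_inv_left[OF inv])
  finally show ?thesis by (simp add: Q_def)
qed


subsection \<open>Kaehler metrics\<close>

locale kaehler_domain =
  fixes S :: "(complex^'m) set" and H :: "complex^'m \<Rightarrow> complex^'m^'m"
  assumes open_dom: "open S"
    and H_cnj: "z \<in> S \<Longrightarrow> H z $ b $ a = cnj (H z $ a $ b)"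
    and H_pos: "z \<in> S \<Longrightarrow> u \<noteq> 0 \<Longrightarrow> 0 < Re (herm_form (H z) u u)"
    and H_smooth: "smooth_on S H"
    and H_closed: "z \<in> S \<Longrightarrow> ext_deriv2 (\<lambda>z u v. Re (herm_form (H z) (\<i> *s u) v)) z u v w = 0"
begin

abbreviation gM :: "(complex^'m) local_metric" where
  "gM \<equiv> \<lambda>z u v. Re (herm_form (H z) u v)"

lemma H_nth_smooth: "smooth_on S (\<lambda>z. H z $ a $ b)"
  by (intro smooth_on_nth open_dom H_smooth)

lemma h_smooth: "smooth_on S (\<lambda>z. herm_form (H z) u v)"
  unfolding herm_form_def by (intro smooth_on_sum smooth_on_mult smooth_on_const open_dom H_nth_smooth)

lemma h_diff: "z \<in> S \<Longrightarrow> (\<lambda>z. herm_form (H z) u v) differentiable at z"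
  by (rule smooth_onD(1)[OF h_smooth open_dom])

lemma h_cnj: "z \<in> S \<Longrightarrow> cnj (herm_form (H z) u v) = herm_form (H z) v u"
  by (rule herm_form_cnj) (rule H_cnj)

lemma metric_domain_gM: "metric_domain S gM"
proof
  show "open S" by (rule open_dom)
  show "bilinear (gM y)" if "y \<in> S" for y
    unfolding bilinear_def by (auto intro!: linearI simp: herm_form_linear)
  show "gM y u v = gM y v u" if "y \<in> S" for y u v
    using arg_cong[OF h_cnj[OF that, of u v], of Re] by simp
  show "smooth_on S (\<lambda>y. gM y u v)" for u v
    by (rule smooth_on_linear_comp[OF bounded_linear_Re open_dom h_smooth])
qed (rule H_pos)

lemma D_h_scale:
  assumes "z \<in> S"
  shows "D (\<lambda>z. herm_form (H z) (c *s v) w) z u = c * D (\<lambda>z. herm_form (H z) v w) z u"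
    "D (\<lambda>z. herm_form (H z) v (c *s w)) z u = cnj c * D (\<lambda>z. herm_form (H z) v w) z u"
  by (simp_all add: herm_form_linear D_linear_comp[OF bounded_linear_mult_right h_diff[OF assms]])

lemma Re_D_h: "z \<in> S \<Longrightarrow> D (\<lambda>z. Re (herm_form (H z) v w)) z u = Re (D (\<lambda>z. herm_form (H z) v w) z u)"
  by (rule D_linear_comp[OF bounded_linear_Re h_diff])

text \<open>The fundamental form is minus the imaginary part of h, because \<open>\<i>\<close> is
  pulled out of the first argument.\<close>

lemma closed_Im:
  assumes "z \<in> S"
  shows "Im (D (\<lambda>z. herm_form (H z) v w) z u - D (\<lambda>z. herm_form (H z) u w) z v + D (\<lambda>z. herm_form (H z) u v) z w) = 0"
  using H_closed[OF assms, of u v w] unfolding ext_deriv2_def Re_D_h[OF assms] D_h_scale[OF assms] by simp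

text \<open>The part of closedness of type (2,1). The difference \<open>Z w\<close> of the two sides
  (up to the factor 2) is conjugate linear in w, so once its imaginary part vanishes for all w, so
  does its real part.\<close>

lemma kaehler_symmetry:
  assumes z: "z \<in> S"
  shows "Dc (dirz u) (\<lambda>z. herm_form (H z) v w) z = Dc (dirz v) (\<lambda>z. herm_form (H z) u w) z"
proof -
  define A where "A u v w = D (\<lambda>z. herm_form (H z) v w) z u" for u v w
  define Z where "Z w = A u v w - A v u w - \<i> * A (\<i> *s u) v w + \<i> * A (\<i> *s v) u w" for w
  have sc: "A u (\<i> *s v) w = \<i> * A u v w" "A u v (\<i> *s w) = - \<i> * A u v w" for u v w
    by (simp_all add: A_def D_h_scale z)
  have im: "Im (A u v w - A v u w + A w u v) = 0" for u v w
    unfolding A_def by (rule closed_Im[OF z])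
  \<comment> \<open>Closedness for u, v, w minus closedness for \<open>\<i> *s u\<close>,
    \<open>\<i> *s v\<close>, w; the last terms cancel since h is invariant under multiplying both
    arguments by \<open>\<i>\<close>.\<close>
  have "Z w = (A u v w - A v u w + A w u v) - (A (\<i> *s u) (\<i> *s v) w - A (\<i> *s v) (\<i> *s u) w + A w (\<i> *s u) (\<i> *s v))" for w
    unfolding Z_def sc by (simp add: algebra_simps)
  then have Im: "Im (Z w) = 0" for w using im[of u v w] im[of "\<i> *s u" "\<i> *s v" w] by simp
  have "Z (\<i> *s w) = - \<i> * Z w" unfolding Z_def sc by (simp add: algebra_simps)
  then have "Z w = 0" using Im[of w] Im[of "\<i> *s w"] by (simp add: complex_eq_iff)
  then have "A u v w - \<i> * A (\<i> *s u) v w = A v u w - \<i> * A (\<i> *s v) u w"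
    unfolding Z_def by (simp add: algebra_simps)
  then show ?thesis unfolding Dc_dirz(1)[OF h_diff[OF z]] A_def by simp
qed

text \<open>Closedness evaluated on u, \<open>\<i> *s u\<close>, w is the sum of two Koszul
  formulas. Consequently the harmonic map equation, traced over pairs u, \<open>\<i> *s u\<close>,
  contains no Christoffel symbols of the source.\<close>

lemma christoffel_J_trace:
  assumes z: "z \<in> S"
  shows "christoffel gM z u u + christoffel gM z (\<i> *s u) (\<i> *s u) = 0"
proof -
  interpret g: metric_domain S gM by (rule metric_domain_gM)
  show ?thesis
  proof (rule pos_bilinear_cancel[of "gM z"])
    show "bilinear (gM z)" by (rule g.k_bilinear[OF z])
    show "0 < gM z u u" if "u \<noteq> 0" for u by (rule H_pos[OF z that])
    fix w
    have nn: "\<i> *s (\<i> *s u) = - u" by (simp add: vec_eq_iff)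
    have eq: "herm_form (H y) (\<i> *s u) (\<i> *s v) = herm_form (H y) u v" for y u v
      by (simp add: herm_form_linear)
    have neg: "D (\<lambda>y. Re (herm_form (H y) (- u) w)) z v = - D (\<lambda>y. Re (herm_form (H y) u w)) z v" for v w u
      using D_linear_comp[OF bounded_linear_minus[OF bounded_linear_ident] g.k_diff[OF z]] by (simp add: herm_form_linear)
    have "- D (\<lambda>y. gM y u w) z u - D (\<lambda>y. gM y (\<i> *s u) w) z (\<i> *s u) + D (\<lambda>y. gM y u u) z w = 0"
      using H_closed[OF z, of u "\<i> *s u" w] unfolding ext_deriv2_def nn neg eq by simp
    then have "g.koszul z u u w + g.koszul z (\<i> *s u) (\<i> *s u) w = 0"
      unfolding g.koszul_def eq by (simp add: field_simps)
    then have "gM z (christoffel gM z u u) w + gM z (christoffel gM z (\<i> *s u) (\<i> *s u)) w = 0"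
      by (simp add: g.k_\<Gamma>[OF z])
    moreover have "herm_form (H z) 0 w = 0" by (simp add: herm_form_def)
    ultimately show "gM z (christoffel gM z u u + christoffel gM z (\<i> *s u) (\<i> *s u)) w = gM z 0 w"
      by (simp add: herm_form_linear)
  qed
qed

abbreviation K :: "complex^'m \<Rightarrow> complex^'m^'m" where "K z \<equiv> matrix_inv (H z)"

lemma det_H: "z \<in> S \<Longrightarrow> det (H z) \<noteq> 0"
  by (rule det_positive_hermitian) (rule H_pos)

lemma K_smooth: "smooth_on S (\<lambda>z. K z $ i $ j)"
  by (rule smooth_on_matrix_inv) (auto simp: open_dom H_nth_smooth det_H)

lemma K_diff: "z \<in> S \<Longrightarrow> (\<lambda>z. K z $ i $ j) differentiable at z"
  by (rule smooth_onD(1)[OF K_smooth open_dom])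

lemma H_diff: "z \<in> S \<Longrightarrow> (\<lambda>z. H z $ i $ j) differentiable at z"
  by (rule smooth_onD(1)[OF H_nth_smooth open_dom])

lemma frame_ex: "z \<in> S \<Longrightarrow> \<exists>E. frame_at (H z) E"
  by (rule frame_exists) (rule H_cnj, assumption, rule H_pos)

lemma frame_K: "z \<in> S \<Longrightarrow> frame_at (H z) E \<Longrightarrow> K z $ j $ l = (\<Sum>a\<in>UNIV. E a $ l * cnj (E a $ j))"
  by (rule frame_matrix_inv) (rule H_pos)

lemma KH: assumes "z \<in> S"
  shows "(\<Sum>m\<in>UNIV. K z $ j $ m * H z $ m $ n) = (if j = n then 1 else 0)"
    "(\<Sum>m\<in>UNIV. H z $ j $ m * K z $ m $ n) = (if j = n then 1 else 0)"
proof -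
  have inv: "invertible (H z)" using det_H[OF assms] by (simp add: invertible_det_nz)
  show "(\<Sum>m\<in>UNIV. K z $ j $ m * H z $ m $ n) = (if j = n then 1 else 0)"
    using arg_cong[OF matrix_inv_left[OF inv], of "\<lambda>M. M $ j $ n"] by (simp add: matrix_matrix_mult_def mat_def)
  show "(\<Sum>m\<in>UNIV. H z $ j $ m * K z $ m $ n) = (if j = n then 1 else 0)"
    using arg_cong[OF matrix_inv_right[OF inv], of "\<lambda>M. M $ j $ n"] by (simp add: matrix_matrix_mult_def mat_def)
qed

text \<open>Differentiate \<open>K H = 1\<close> and multiply by \<open>K\<close> from the
  right.\<close>

lemma Dc_K:
  assumes z: "z \<in> S"
  shows "Dc \<xi> (\<lambda>z. K z $ j $ l) z = - (\<Sum>m\<in>UNIV. \<Sum>n\<in>UNIV. K z $ j $ m * Dc \<xi> (\<lambda>z. H z $ m $ n) z * K z $ n $ l)"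
proof -
  have 1: "(\<Sum>m\<in>UNIV. Dc \<xi> (\<lambda>z. K z $ j $ m) z * H z $ m $ n) = - (\<Sum>m\<in>UNIV. K z $ j $ m * Dc \<xi> (\<lambda>z. H z $ m $ n) z)" for n
  proof -
    have "Dc \<xi> (\<lambda>z. \<Sum>m\<in>UNIV. K z $ j $ m * H z $ m $ n) z = Dc \<xi> (\<lambda>z. if j = n then 1 else 0) z"
      by (rule Dc_cong[OF open_dom z]) (rule KH)
    also have "\<dots> = 0" by (rule Dc_const)
    finally show ?thesis
      by (simp add: Dc_sum Dc_mult K_diff H_diff z differentiable_mult sum.distrib eq_neg_iff_add_eq_0 add.commute)
  qed
  have "Dc \<xi> (\<lambda>z. K z $ j $ l) z = (\<Sum>m\<in>UNIV. Dc \<xi> (\<lambda>z. K z $ j $ m) z * (\<Sum>n\<in>UNIV. H z $ m $ n * K z $ n $ l))"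
    by (simp add: KH[OF z] if_distrib[of "\<lambda>x. _ * x"] cong: if_cong)
  also have "\<dots> = (\<Sum>n\<in>UNIV. (\<Sum>m\<in>UNIV. Dc \<xi> (\<lambda>z. K z $ j $ m) z * H z $ m $ n) * K z $ n $ l)"
    unfolding sum_distrib_left sum_distrib_right by (subst sum.swap) (simp add: mult_ac)
  also have "\<dots> = - (\<Sum>m\<in>UNIV. \<Sum>n\<in>UNIV. K z $ j $ m * Dc \<xi> (\<lambda>z. H z $ m $ n) z * K z $ n $ l)"
    unfolding 1 by (subst sum.swap) (simp add: sum_distrib_right sum_negf)
  finally show ?thesis .
qed

lemma dH_sym: "z \<in> S \<Longrightarrow> Dc (dirz (axis l 1)) (\<lambda>z. H z $ m $ n) z = Dc (dirz (axis m 1)) (\<lambda>z. H z $ l $ n) z"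
  using kaehler_symmetry[of z "axis l 1" "axis m 1" "axis n 1"] by (simp add: herm_form_axis)

end

text \<open>With \<xi> = a + \<open>\<i>\<close> b, the imaginary part B(a, b) - B(b, a) vanishes by
  symmetry of second derivatives and Christoffel symbols. Here B is the Hessian of \<open>F\<close>
  without the source connection.\<close>

lemma (in target_map) nab_cdir_FX:
  assumes x: "x \<in> S"
  defines "B \<equiv> \<lambda>u v. D (\<lambda>y. D F y v) x u + \<Gamma> (F x) (D F x u) (D F x v)"
  shows "nab (cdir \<xi>) (FX \<xi>) x = cvec (B (fst \<xi>) (fst \<xi>) + B (snd \<xi>) (snd \<xi>))"
proof -
  have F: "D (\<lambda>x. complex_of_real (F x $ e)) y v = complex_of_real (D F y v $ e)" if "y \<in> S" for e v y
    using D_linear_comp[OF bounded_linear_compose[OF bounded_linear_of_real bounded_linear_vec_nth[of e]] smooth_onD(1)[OF F_smooth open_S that]] .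
  have FXe: "FX \<xi> y = cvec (D F y (fst \<xi>)) + \<i> *s cvec (D F y (snd \<xi>))" if "y \<in> S" for y \<xi>
    by (simp add: vec_eq_iff FX_nth Dc_def F[OF that])
  have dd: "(\<lambda>y. D F y v) differentiable at x" for v
    by (rule smooth_onD(1)[OF smooth_onD(2)[OF F_smooth open_S] open_S x])
  have F2: "D (\<lambda>y. complex_of_real (D F y v $ c)) x u = complex_of_real (D (\<lambda>y. D F y v) x u $ c)" for u v c
    using D_linear_comp[OF bounded_linear_compose[OF bounded_linear_of_real bounded_linear_vec_nth[of c]] dd] .
  have dc: "(\<lambda>y. complex_of_real (D F y v $ c)) differentiable at x" for v c
    by (rule smooth_onD(1)[OF smooth_on_of_real open_S x, OF open_S])
      (intro smooth_on_nth smooth_onD(2) F_smooth open_S)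
  have D2: "D (\<lambda>y. FX \<xi> y $ c) x u = complex_of_real (D (\<lambda>y. D F y (fst \<xi>)) x u $ c) + \<i> * complex_of_real (D (\<lambda>y. D F y (snd \<xi>)) x u $ c)" for u c
  proof -
    have "D (\<lambda>y. FX \<xi> y $ c) x = D (\<lambda>y. complex_of_real (D F y (fst \<xi>) $ c) + \<i> * complex_of_real (D F y (snd \<xi>) $ c)) x"
      by (rule D_cong[OF open_S x]) (simp add: FXe)
    then show ?thesis
      by (simp add: D_add dc differentiable_mult D_linear_comp[OF bounded_linear_mult_right] F2)
  qed
  have sym: "D (\<lambda>y. D F y u) x v = D (\<lambda>y. D F y v) x u" for u v
    by (rule D_D_commute[OF F_smooth open_S x])
  note y = F_in[OF x]
  have "GC (F x) (FX (cdir \<xi>) x) (FX \<xi> x) = cvec (\<Gamma> (F x) (D F x (fst \<xi>)) (D F x (fst \<xi>)) + \<Gamma> (F x) (D F x (snd \<xi>)) (D F x (snd \<xi>)))"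
  proof -
    have n: "D F x (- v) = - D F x v" for v
      using linear_neg[OF linear_D(1)[OF smooth_onD(1)[OF F_smooth open_S x]]] .
    have "FX (cdir \<xi>) x = cvec (D F x (fst \<xi>)) - \<i> *s cvec (D F x (snd \<xi>))"
      by (simp add: FXe[OF x] cdir_def n) (simp add: vec_eq_iff)
    then show ?thesis
      unfolding FXe[OF x, of \<xi>]
      by (simp add: GC_linear GC_cvec[OF y] \<Gamma>_sym[OF y, of "D F x (snd \<xi>)" "D F x (fst \<xi>)"]) (simp add: vec_eq_iff algebra_simps)
  qed
  moreover have "Dc (cdir \<xi>) (\<lambda>y. FX \<xi> y $ c) x = complex_of_real (D (\<lambda>y. D F y (fst \<xi>)) x (fst \<xi>) $ c + D (\<lambda>y. D F y (snd \<xi>)) x (snd \<xi>) $ c)" for c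
  proof -
    have n: "D (\<lambda>y. D F y u) x (- v) = - D (\<lambda>y. D F y u) x v" for u v
      using linear_neg[OF linear_D(1)[OF dd]] .
    show ?thesis unfolding Dc_def cdir_def D2 by (simp add: n sym[of "snd \<xi>" "fst \<xi>"] algebra_simps)
  qed
  ultimately show ?thesis
    by (simp add: vec_eq_iff nab_nth B_def)
qed

section \<open>The harmonic map equation in a unitary frame\<close>

locale kaehler_map = target_map Y k S F + kaehler_domain S H
  for Y :: "(real^'n) set" and k and S :: "(complex^'m) set" and F H
begin

text \<open>The real trace defining the tension field is rewritten over the vectors
  \<open>E a\<close> and \<open>\<i> *s E a\<close>; by \<open>christoffel_J_trace\<close> the
  source connection drops out, and each remaining pair is a mixed derivative of type (1,1).\<close>

lemma harmonic_frame:
  assumes z: "z \<in> S" and E: "frame_at (H z) E"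
    and harm: "connection_adjoint gM k F (\<lambda>y. D F y) z = 0"
  shows "(\<Sum>a\<in>UNIV. nab (dirzb (E a)) (FX (dirz (E a))) z) = 0"
proof -
  interpret g: metric_domain S gM by (rule metric_domain_gM)
  define B where "B u v = D (\<lambda>y. D F y v) z u + \<Gamma> (F z) (D F z u) (D F z v)" for u v
  define Q where "Q u v = B u v - D F z (christoffel gM z u v)" for u v
  have dF: "F differentiable at z" "(\<lambda>y. D F y v) differentiable at z" for v
    using smooth_onD(1)[OF F_smooth open_S z] smooth_onD(1)[OF smooth_onD(2)[OF F_smooth open_S] open_S z] by auto
  note lF = linear_D(1)[OF dF(1)]
  note bt = \<Gamma>_bilinear[OF F_in[OF z]] and bg = g.\<Gamma>_bilinear[OF z]
  have lB: "linear (\<lambda>u. B u v)" for v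
    unfolding B_def
    by (intro linearI) (simp_all add: linear_add[OF linear_D(1)[OF dF(2)]] linear_cmul[OF linear_D(1)[OF dF(2)]]
        linear_add[OF lF] linear_cmul[OF lF] bilinear_ladd[OF bt] bilinear_lmul[OF bt] algebra_simps)
  have Bsym: "B u v = B v u" for u v
    unfolding B_def using D_D_commute[OF F_smooth open_S z, of u v] \<Gamma>_sym[OF F_in[OF z]] by metis
  have lQ: "linear (\<lambda>u. Q u v)" for v
    unfolding Q_def
    by (intro linearI) (simp_all add: linear_add[OF lB] linear_cmul[OF lB]
        linear_add[OF lF] linear_cmul[OF lF] bilinear_ladd[OF bg] bilinear_lmul[OF bg] algebra_simps)
  have Qsym: "Q u v = Q v u" for u v unfolding Q_def Bsym[of u v] g.\<Gamma>_sym[OF z, of u v] ..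
  have "Q u = (\<lambda>v. Q v u)" for u using Qsym by auto
  then have lQ2: "linear (Q u)" for u using lQ by metis
  \<comment> \<open>The vectors \<open>E a\<close> and \<open>\<i> *s E a\<close> together form an
    orthonormal frame of the real metric, in which the vector dual to a coordinate form has its
    coordinates as coefficients.\<close>
  have sh: "sharp (gM z) (\<lambda>v. v \<bullet> b) = (\<Sum>a\<in>UNIV. (E a \<bullet> b) *\<^sub>R E a + ((\<i> *s E a) \<bullet> b) *\<^sub>R (\<i> *s E a))" for b
  proof (rule sharp_eqI[OF g.k_bilinear[OF z] g.k_pos[OF z]])
    fix v
    have "gM z (\<Sum>a\<in>UNIV. (E a \<bullet> b) *\<^sub>R E a + ((\<i> *s E a) \<bullet> b) *\<^sub>R (\<i> *s E a)) v
       = gM z v (\<Sum>a\<in>UNIV. (E a \<bullet> b) *\<^sub>R E a + ((\<i> *s E a) \<bullet> b) *\<^sub>R (\<i> *s E a))"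
      by (rule g.k_sym[OF z])
    also have "\<dots> = (\<Sum>a\<in>UNIV. (E a \<bullet> b) * Re (herm_form (H z) v (E a)) + ((\<i> *s E a) \<bullet> b) * Im (herm_form (H z) v (E a)))"
      by (simp add: herm_form_sum herm_form_linear)
    also have "\<dots> = (\<Sum>a\<in>UNIV. herm_form (H z) v (E a) *s E a) \<bullet> b"
    proof -
      have "herm_form (H z) v (E a) *s E a = Re (herm_form (H z) v (E a)) *\<^sub>R E a + Im (herm_form (H z) v (E a)) *\<^sub>R (\<i> *s E a)" for a
        by (simp add: vec_eq_iff complex_eq_iff)
      then show ?thesis by (simp add: inner_sum_left inner_add_left mult.commute)
    qed
    also have "\<dots> = v \<bullet> b" using E by (simp add: frame_at_def)
    finally show "gM z (\<Sum>a\<in>UNIV. (E a \<bullet> b) *\<^sub>R E a + ((\<i> *s E a) \<bullet> b) *\<^sub>R (\<i> *s E a)) v = v \<bullet> b" .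
  qed
  have "0 = (\<Sum>b\<in>Basis. Q (sharp (gM z) (\<lambda>v. v \<bullet> b)) b)"
    using harm by (simp add: connection_adjoint_def cov_deriv_form_def pullback_connection_def Q_def B_def)
  also have "\<dots> = (\<Sum>b\<in>Basis. \<Sum>a\<in>UNIV. (E a \<bullet> b) *\<^sub>R Q (E a) b + ((\<i> *s E a) \<bullet> b) *\<^sub>R Q (\<i> *s E a) b)"
    unfolding sh by (simp add: linear_sum[OF lQ] linear_add[OF lQ] linear_cmul[OF lQ])
  also have "\<dots> = (\<Sum>a\<in>UNIV. (\<Sum>b\<in>Basis. (E a \<bullet> b) *\<^sub>R Q (E a) b) + (\<Sum>b\<in>Basis. ((\<i> *s E a) \<bullet> b) *\<^sub>R Q (\<i> *s E a) b))"
    by (subst sum.swap) (simp add: sum.distrib)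
  also have "\<dots> = (\<Sum>a\<in>UNIV. Q (E a) (E a) + Q (\<i> *s E a) (\<i> *s E a))"
    by (simp add: linear_euclidean_sum[OF lQ2, symmetric])
  also have "\<dots> = (\<Sum>a\<in>UNIV. B (E a) (E a) + B (\<i> *s E a) (\<i> *s E a))"
  proof (rule sum.cong[OF refl])
    fix a
    have "D F z (christoffel gM z (E a) (E a)) + D F z (christoffel gM z (\<i> *s E a) (\<i> *s E a)) = 0"
      using linear_add[OF lF] christoffel_J_trace[OF z, of "E a"] linear_0[OF lF] by metis
    then show "Q (E a) (E a) + Q (\<i> *s E a) (\<i> *s E a) = B (E a) (E a) + B (\<i> *s E a) (\<i> *s E a)"
      by (simp add: Q_def algebra_simps eq_neg_iff_add_eq_0)
  qed
  finally have BB: "(\<Sum>a\<in>UNIV. B (E a) (E a) + B (\<i> *s E a) (\<i> *s E a)) = 0" by simp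
  have "B u = (\<lambda>v. B v u)" for u using Bsym by auto
  then have lB2: "linear (B u)" for u using lB by metis
  \<comment> \<open>Both components of \<open>dirz\<close> carry a factor 1/2, and B is bilinear and
    even.\<close>
  have "nab (dirzb (E a)) (FX (dirz (E a))) z = cvec ((1/4) *\<^sub>R (B (E a) (E a) + B (\<i> *s E a) (\<i> *s E a)))" for a
  proof -
    have "nab (dirzb (E a)) (FX (dirz (E a))) z = cvec (B (fst (dirz (E a))) (fst (dirz (E a))) + B (snd (dirz (E a))) (snd (dirz (E a))))"
      unfolding nab_cdir_FX[OF z] B_def ..
    also have "\<dots> = cvec ((1/4) *\<^sub>R (B (E a) (E a) + B (\<i> *s E a) (\<i> *s E a)))"
      unfolding dirz_def fst_conv snd_conv linear_cmul[OF lB] linear_cmul[OF lB2]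
      by (simp add: algebra_simps)
    finally show ?thesis .
  qed
  moreover have "(\<Sum>a\<in>UNIV. cvec (c a)) = cvec (\<Sum>a\<in>UNIV. c a)" for c :: "'m \<Rightarrow> real^'n"
    by (simp add: vec_eq_iff)
  ultimately have "(\<Sum>a\<in>UNIV. nab (dirzb (E a)) (FX (dirz (E a))) z) = cvec ((1/4) *\<^sub>R (\<Sum>a\<in>UNIV. B (E a) (E a) + B (\<i> *s E a) (\<i> *s E a)))"
    by (simp add: scaleR_sum_right)
  then show ?thesis unfolding BB by (simp add: vec_eq_iff)
qed

end


subsection \<open>The divergence of the Bochner vector field\<close>

context kaehler_map
begin

text \<open>Up to normalisation the exterior derivative in the barred variables of psi, regarded as
  a form of type (1,1); it is antisymmetric in v and w.\<close>

definition Wf :: "complex^'m \<Rightarrow> complex^'m \<Rightarrow> complex^'m \<Rightarrow> complex^'m \<Rightarrow> complex" where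
  "Wf v u w z = Dc (dirzb v) (psi (dirz u) (dirz w)) z - Dc (dirzb w) (psi (dirz u) (dirz v)) z"

abbreviation W :: "'m \<Rightarrow> 'm \<Rightarrow> 'm \<Rightarrow> complex^'m \<Rightarrow> complex" where
  "W j i m \<equiv> Wf (axis j 1) (axis i 1) (axis m 1)"

text \<open>In index notation \<open>V\<^sup>l = h\<^sup>l\<^sup>j h\<^sup>i\<^sup>k (\<partial>\<^sub>j \<psi>\<^sub>i\<^sub>k - \<partial>\<^sub>k \<psi>\<^sub>i\<^sub>j)\<close> with \<open>j\<close> and \<open>k\<close> barred, where
  \<open>\<psi>\<close> is the (1,1)-part of the pulled back metric; \<open>h\<^sup>l\<^sup>j\<close> is \<open>K $ j $ l\<close>.\<close>
definition V :: "complex^'m \<Rightarrow> complex^'m" where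
  "V z = (\<chi> l. \<Sum>j\<in>UNIV. \<Sum>i\<in>UNIV. \<Sum>k\<in>UNIV. K z $ j $ l * K z $ k $ i * W j i k z)"

lemma psi_diff: "z \<in> S \<Longrightarrow> psi \<xi> \<eta> differentiable at z"
  by (rule smooth_onD(1)[OF smooth_psi open_S])

lemma Wf_smooth: "smooth_on S (Wf v u w)"
  unfolding Wf_def[abs_def] by (intro smooth_on_diff smooth_on_Dc smooth_psi open_S)

lemma V_smooth: "smooth_on S V"
proof (rule smooth_on_vec[OF open_S])
  show "smooth_on S (\<lambda>z. V z $ l)" for l
    unfolding V_def vec_lambda_beta by (intro smooth_on_sum smooth_on_mult K_smooth Wf_smooth open_S)
qed

lemma FX_dirz_expand: "z \<in> S \<Longrightarrow> FX (dirz u) z = (\<Sum>i\<in>UNIV. u $ i *s FX (dirz (axis i 1)) z)"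
  unfolding vec_eq_iff sum_component vector_smult_component FX_nth
  using Dc_dirz_expand(1)[OF smooth_onD(1)[OF smooth_on_F_nth open_S]] by blast

lemma vec_cnj_sum: "vec_cnj (\<Sum>i\<in>I. f i) = (\<Sum>i\<in>I. vec_cnj (f i))"
  by (simp add: vec_eq_iff)

lemma vec_cnj_smult: "vec_cnj (c *s v) = cnj c *s vec_cnj v"
  by (simp add: vec_eq_iff)

lemma psi_expand: "z \<in> S \<Longrightarrow> psi (dirz u) (dirz w) z =
    (\<Sum>i\<in>UNIV. \<Sum>k\<in>UNIV. (u $ i * cnj (w $ k)) * psi (dirz (axis i 1)) (dirz (axis k 1)) z)"
  unfolding psi_def by (subst FX_dirz_expand, assumption, subst (2) FX_dirz_expand, assumption)
    (simp add: vec_cnj_sum vec_cnj_smult kC_sum kC_linear sum_distrib_left mult_ac, rule sum.swap)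

lemma KK_frame: "z \<in> S \<Longrightarrow> frame_at (H z) E \<Longrightarrow> K z $ j $ l * K z $ m $ i * c =
    (\<Sum>a\<in>UNIV. \<Sum>b\<in>UNIV. cnj (E a $ j) * E b $ i * cnj (E b $ m) * c * E a $ l)"
  unfolding frame_K sum_product sum_distrib_right by (simp add: sum_distrib_left mult_ac)

lemma Dc_psi_expand:
  assumes z: "z \<in> S"
  shows "Dc (dirzb v) (psi (dirz u) (dirz w)) z = (\<Sum>j\<in>UNIV. \<Sum>i\<in>UNIV. \<Sum>k\<in>UNIV. cnj (v $ j) * u $ i * cnj (w $ k) * 
     Dc (dirzb (axis j 1)) (psi (dirz (axis i 1)) (dirz (axis k 1))) z)"
proof -
  have "Dc (dirzb v') (psi (dirz u) (dirz w)) z = (\<Sum>i\<in>UNIV. \<Sum>k\<in>UNIV. (u $ i * cnj (w $ k)) * 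
     Dc (dirzb v') (psi (dirz (axis i 1)) (dirz (axis k 1))) z)" for v'
  proof -
    have "Dc (dirzb v') (psi (dirz u) (dirz w)) z = Dc (dirzb v') (\<lambda>z. \<Sum>i\<in>UNIV. \<Sum>k\<in>UNIV. (u $ i * cnj (w $ k)) * psi (dirz (axis i 1)) (dirz (axis k 1)) z) z"
      by (rule Dc_cong[OF open_S z]) (rule psi_expand)
    then show ?thesis by (simp add: Dc_sum Dc_mult psi_diff[OF z] differentiable_mult differentiable_sum)
  qed
  then show ?thesis
    by (subst Dc_dirz_expand(2)[OF psi_diff[OF z]]) (simp add: sum_distrib_left mult_ac)
qed

lemma Wf_expand:
  assumes z: "z \<in> S"
  shows "Wf v u w z = (\<Sum>j\<in>UNIV. \<Sum>i\<in>UNIV. \<Sum>k\<in>UNIV. cnj (v $ j) * u $ i * cnj (w $ k) * W j i k z)"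
proof -
  define P where "P j i m = Dc (dirzb (axis j 1)) (psi (dirz (axis i 1)) (dirz (axis m 1))) z" for j i m
  have P: "Dc (dirzb v) (psi (dirz u) (dirz w)) z = (\<Sum>j\<in>UNIV. \<Sum>i\<in>UNIV. \<Sum>k\<in>UNIV. cnj (v $ j) * u $ i * cnj (w $ k) * P j i k)" for u v w
    unfolding P_def by (rule Dc_psi_expand[OF z])
  have WP: "W j i m z = P j i m - P m i j" for j i m by (simp add: Wf_def P_def)
  have "(\<Sum>j\<in>UNIV. \<Sum>i\<in>UNIV. \<Sum>k\<in>UNIV. cnj (w $ j) * u $ i * cnj (v $ k) * P j i k)
   = (\<Sum>k\<in>UNIV. \<Sum>i\<in>UNIV. \<Sum>j\<in>UNIV. cnj (w $ j) * u $ i * cnj (v $ k) * P j i k)"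
    by (rule trans[OF sum.cong[OF refl sum.swap]], subst sum.swap, rule sum.cong[OF refl], rule sum.swap)
  then show ?thesis
    unfolding WP unfolding Wf_def P by (simp add: algebra_simps sum_subtractf)
qed

lemma W_antisym: "W j i m z = - W m i j z"
  by (simp add: Wf_def)

text \<open>The coordinate definition shows that \<open>V\<close> is smooth; this form shows that it
  does not depend on the chart, once \<open>Wf\<close> and frames are known to transform
  correctly.\<close>

lemma V_frame:
  assumes z: "z \<in> S" and E: "frame_at (H z) E"
  shows "V z = (\<Sum>a\<in>UNIV. \<Sum>b\<in>UNIV. Wf (E a) (E b) (E b) z *s E a)"
proof -
  have "V z $ l = (\<Sum>a\<in>UNIV. \<Sum>b\<in>UNIV. Wf (E a) (E b) (E b) z * E a $ l)" for l
  proof -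
    have "V z $ l = (\<Sum>j\<in>UNIV. \<Sum>i\<in>UNIV. \<Sum>k\<in>UNIV. \<Sum>a\<in>UNIV. \<Sum>b\<in>UNIV. (cnj (E a $ j) * E b $ i * cnj (E b $ k) * W j i k z) * E a $ l)"
      by (simp add: V_def KK_frame[OF z E])
    also have "\<dots> = (\<Sum>j\<in>UNIV. \<Sum>i\<in>UNIV. \<Sum>a\<in>UNIV. \<Sum>b\<in>UNIV. \<Sum>k\<in>UNIV. (cnj (E a $ j) * E b $ i * cnj (E b $ k) * W j i k z) * E a $ l)"
      by (intro sum.cong[OF refl] trans[OF sum.swap sum.cong[OF refl sum.swap]])
    also have "\<dots> = (\<Sum>j\<in>UNIV. \<Sum>a\<in>UNIV. \<Sum>b\<in>UNIV. \<Sum>i\<in>UNIV. \<Sum>k\<in>UNIV. (cnj (E a $ j) * E b $ i * cnj (E b $ k) * W j i k z) * E a $ l)"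
      by (intro sum.cong[OF refl] trans[OF sum.swap sum.cong[OF refl sum.swap]])
    also have "\<dots> = (\<Sum>a\<in>UNIV. \<Sum>b\<in>UNIV. \<Sum>j\<in>UNIV. \<Sum>i\<in>UNIV. \<Sum>k\<in>UNIV. (cnj (E a $ j) * E b $ i * cnj (E b $ k) * W j i k z) * E a $ l)"
      by (intro trans[OF sum.swap sum.cong[OF refl sum.swap]])
    finally show ?thesis unfolding Wf_expand[OF z, of "E _" "E _" "E _"] by (simp add: sum_distrib_right)
  qed
  then show ?thesis by (simp add: vec_eq_iff)
qed

text \<open>The vectors \<open>E a\<close> are constant, unitary at z only, so on the right the
  derivatives fall on \<open>W\<close> alone, as they do on the left.\<close>

lemma sum_KK_dW:
  assumes z: "z \<in> S" and E: "frame_at (H z) E"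
  shows "(\<Sum>l\<in>UNIV. \<Sum>j\<in>UNIV. \<Sum>i\<in>UNIV. \<Sum>k\<in>UNIV. K z $ j $ l * K z $ k $ i * Dc (dirz (axis l 1)) (W j i k) z)
    = (\<Sum>a\<in>UNIV. \<Sum>b\<in>UNIV. Dc (dirz (E a)) (Wf (E a) (E b) (E b)) z)"
proof -
  have dW: "Wf v u w differentiable at z" for v u w
    by (rule smooth_onD(1)[OF Wf_smooth open_S z])
  have "Dc (dirz (E a)) (Wf (E a) (E b) (E b)) z = (\<Sum>l\<in>UNIV. \<Sum>j\<in>UNIV. \<Sum>i\<in>UNIV. \<Sum>k\<in>UNIV.
      E a $ l * (cnj (E a $ j) * E b $ i * cnj (E b $ k)) * Dc (dirz (axis l 1)) (W j i k) z)" for a b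
  proof -
    have "Dc \<xi> (Wf (E a) (E b) (E b)) z = (\<Sum>j\<in>UNIV. \<Sum>i\<in>UNIV. \<Sum>k\<in>UNIV. (cnj (E a $ j) * E b $ i * cnj (E b $ k)) * Dc \<xi> (W j i k) z)" for \<xi>
    proof -
      have "Dc \<xi> (Wf (E a) (E b) (E b)) z = Dc \<xi> (\<lambda>z. \<Sum>j\<in>UNIV. \<Sum>i\<in>UNIV. \<Sum>k\<in>UNIV. (cnj (E a $ j) * E b $ i * cnj (E b $ k)) * W j i k z) z"
        by (rule Dc_cong[OF open_S z]) (rule Wf_expand)
      then show ?thesis by (simp add: Dc_sum Dc_mult dW differentiable_mult differentiable_sum)
    qed
    then show ?thesis by (subst Dc_dirz_expand(1)[OF dW]) (simp add: sum_distrib_left mult_ac)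
  qed
  moreover have "(\<Sum>l\<in>UNIV. \<Sum>j\<in>UNIV. \<Sum>i\<in>UNIV. \<Sum>k\<in>UNIV. K z $ j $ l * K z $ k $ i * Dc (dirz (axis l 1)) (W j i k) z)
    = (\<Sum>a\<in>UNIV. \<Sum>b\<in>UNIV. \<Sum>l\<in>UNIV. \<Sum>j\<in>UNIV. \<Sum>i\<in>UNIV. \<Sum>k\<in>UNIV. E a $ l * (cnj (E a $ j) * E b $ i * cnj (E b $ k)) * Dc (dirz (axis l 1)) (W j i k) z)"
    (is "?L = ?R")
  proof -
    let ?f = "\<lambda>a b l j i k. E a $ l * (cnj (E a $ j) * E b $ i * cnj (E b $ k)) * Dc (dirz (axis l 1)) (W j i k) z"
    have "?L = (\<Sum>l\<in>UNIV. \<Sum>j\<in>UNIV. \<Sum>i\<in>UNIV. \<Sum>k\<in>UNIV. \<Sum>a\<in>UNIV. \<Sum>b\<in>UNIV. ?f a b l j i k)"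
      unfolding KK_frame[OF z E] by (simp add: mult_ac)
    also have "\<dots> = (\<Sum>l\<in>UNIV. \<Sum>j\<in>UNIV. \<Sum>i\<in>UNIV. \<Sum>a\<in>UNIV. \<Sum>b\<in>UNIV. \<Sum>k\<in>UNIV. ?f a b l j i k)"
      by (intro sum.cong[OF refl] trans[OF sum.swap sum.cong[OF refl sum.swap]])
    also have "\<dots> = (\<Sum>l\<in>UNIV. \<Sum>j\<in>UNIV. \<Sum>a\<in>UNIV. \<Sum>b\<in>UNIV. \<Sum>i\<in>UNIV. \<Sum>k\<in>UNIV. ?f a b l j i k)"
      by (intro sum.cong[OF refl] trans[OF sum.swap sum.cong[OF refl sum.swap]])
    also have "\<dots> = (\<Sum>l\<in>UNIV. \<Sum>a\<in>UNIV. \<Sum>b\<in>UNIV. \<Sum>j\<in>UNIV. \<Sum>i\<in>UNIV. \<Sum>k\<in>UNIV. ?f a b l j i k)"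
      by (intro sum.cong[OF refl] trans[OF sum.swap sum.cong[OF refl sum.swap]])
    also have "\<dots> = ?R"
      by (intro trans[OF sum.swap sum.cong[OF refl sum.swap]])
    finally show ?thesis .
  qed
  ultimately show ?thesis by simp
qed

text \<open>Closedness makes \<open>\<partial>\<^sub>l h\<^sub>m\<^sub>n\<close> symmetric in \<open>l\<close> and \<open>m\<close>. Hence the derivatives of the first factor
  \<open>K\<close> of \<open>V\<close> cancel against the derivative of the volume density, and those of the second factor are
  contracted with the antisymmetric \<open>W\<close>.\<close>
lemma complex_divergence_V:
  assumes z: "z \<in> S" and E: "frame_at (H z) E"
  shows "(\<Sum>l\<in>UNIV. Dc (dirz (axis l 1)) (\<lambda>z. V z $ l) z
      + V z $ l * (\<Sum>m\<in>UNIV. \<Sum>n\<in>UNIV. K z $ n $ m * Dc (dirz (axis l 1)) (\<lambda>z. H z $ m $ n) z))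
    = (\<Sum>a\<in>UNIV. \<Sum>b\<in>UNIV. Dc (dirz (E a)) (Wf (E a) (E b) (E b)) z)"
proof -
  define dh where "dh l m n = Dc (dirz (axis l 1)) (\<lambda>z. H z $ m $ n) z" for l m n
  define dk where "dk l j i = Dc (dirz (axis l 1)) (\<lambda>z. K z $ j $ i) z" for l j i
  define dw where "dw l j i k = Dc (dirz (axis l 1)) (W j i k) z" for l j i k
  have dh_sym: "dh l m n = dh m l n" for l m n unfolding dh_def by (rule dH_sym[OF z])
  have dk: "dk l j i = - (\<Sum>m\<in>UNIV. \<Sum>n\<in>UNIV. K z $ j $ m * dh l m n * K z $ n $ i)" for l j i
    unfolding dk_def dh_def by (rule Dc_K[OF z])
  have dW: "Wf v u w differentiable at z" for v u w
    by (rule smooth_onD(1)[OF Wf_smooth open_S z])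
  \<comment> \<open>The inner double sum is the logarithmic derivative of \<open>det H\<close>, so
    the identity says that \<open>det H\<close> times row j of \<open>K\<close> has zero
    divergence.\<close>
  have first: "(\<Sum>l\<in>UNIV. dk l j l + K z $ j $ l * (\<Sum>m\<in>UNIV. \<Sum>n\<in>UNIV. K z $ n $ m * dh l m n)) = 0" for j
  proof -
    have "(\<Sum>l\<in>UNIV. K z $ j $ l * (\<Sum>m\<in>UNIV. \<Sum>n\<in>UNIV. K z $ n $ m * dh l m n))
        = (\<Sum>l\<in>UNIV. \<Sum>m\<in>UNIV. \<Sum>n\<in>UNIV. K z $ j $ l * dh m l n * K z $ n $ m)"
      by (simp add: sum_distrib_left mult_ac dh_sym)
    also have "\<dots> = (\<Sum>m\<in>UNIV. \<Sum>l\<in>UNIV. \<Sum>n\<in>UNIV. K z $ j $ l * dh m l n * K z $ n $ m)"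
      by (rule sum.swap)
    also have "\<dots> = - (\<Sum>l\<in>UNIV. dk l j l)" by (simp add: dk sum_negf)
    finally show ?thesis by (simp add: sum.distrib)
  qed
  have second: "(\<Sum>l\<in>UNIV. \<Sum>j\<in>UNIV. \<Sum>k\<in>UNIV. K z $ j $ l * dk l k i * W j i k z) = 0" for i
  proof -
    define C where "C j k = (\<Sum>l\<in>UNIV. K z $ j $ l * dk l k i)" for j k
    have Cs: "C j k = C k j" for j k
    proof -
      have C: "C j k = - (\<Sum>l\<in>UNIV. \<Sum>m\<in>UNIV. \<Sum>n\<in>UNIV. K z $ j $ l * K z $ k $ m * dh l m n * K z $ n $ i)" for j k
        by (simp add: C_def dk sum_distrib_left sum_negf mult_ac)
      have "(\<Sum>l\<in>UNIV. \<Sum>m\<in>UNIV. \<Sum>n\<in>UNIV. K z $ j $ l * K z $ k $ m * dh l m n * K z $ n $ i)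
         = (\<Sum>l\<in>UNIV. \<Sum>m\<in>UNIV. \<Sum>n\<in>UNIV. K z $ j $ l * K z $ k $ m * dh m l n * K z $ n $ i)"
        by (simp only: dh_sym)
      also have "\<dots> = (\<Sum>m\<in>UNIV. \<Sum>l\<in>UNIV. \<Sum>n\<in>UNIV. K z $ j $ l * K z $ k $ m * dh m l n * K z $ n $ i)"
        by (rule sum.swap)
      finally show ?thesis unfolding C by (simp add: mult_ac)
    qed
    have "(\<Sum>j\<in>UNIV. \<Sum>k\<in>UNIV. C j k * W j i k z) = (\<Sum>k\<in>UNIV. \<Sum>j\<in>UNIV. C j k * W j i k z)"
      by (rule sum.swap)
    also have "\<dots> = (\<Sum>k\<in>UNIV. \<Sum>j\<in>UNIV. - (C k j * W k i j z))"
      by (intro sum.cong refl) (subst W_antisym, subst Cs, simp)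
    finally have "(\<Sum>j\<in>UNIV. \<Sum>k\<in>UNIV. C j k * W j i k z) = 0" by (simp add: sum_negf)
    moreover have "(\<Sum>l\<in>UNIV. \<Sum>j\<in>UNIV. \<Sum>k\<in>UNIV. K z $ j $ l * dk l k i * W j i k z) = (\<Sum>j\<in>UNIV. \<Sum>k\<in>UNIV. C j k * W j i k z)"
      unfolding C_def sum_distrib_right
      by (rule trans[OF sum.swap sum.cong[OF refl sum.swap]])
    ultimately show ?thesis by simp
  qed
  have dV: "Dc (dirz (axis l 1)) (\<lambda>z. V z $ l) z = (\<Sum>j\<in>UNIV. \<Sum>i\<in>UNIV. \<Sum>k\<in>UNIV. 
      dk l j l * (K z $ k $ i * W j i k z) + K z $ j $ l * dk l k i * W j i k z + K z $ j $ l * K z $ k $ i * dw l j i k)" for l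
    unfolding V_def vec_lambda_beta dk_def dw_def
    by (simp add: Dc_sum Dc_mult dW K_diff[OF z] differentiable_mult differentiable_sum algebra_simps)
  define R where "R j = (\<Sum>i\<in>UNIV. \<Sum>k\<in>UNIV. K z $ k $ i * W j i k z)" for j
  have "(\<Sum>l\<in>UNIV. Dc (dirz (axis l 1)) (\<lambda>z. V z $ l) z
      + V z $ l * (\<Sum>m\<in>UNIV. \<Sum>n\<in>UNIV. K z $ n $ m * dh l m n))
    = (\<Sum>l\<in>UNIV. \<Sum>j\<in>UNIV. dk l j l * R j + K z $ j $ l * (\<Sum>m\<in>UNIV. \<Sum>n\<in>UNIV. K z $ n $ m * dh l m n) * R j)
     + (\<Sum>l\<in>UNIV. \<Sum>j\<in>UNIV. \<Sum>i\<in>UNIV. \<Sum>k\<in>UNIV. K z $ j $ l * dk l k i * W j i k z)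
     + (\<Sum>l\<in>UNIV. \<Sum>j\<in>UNIV. \<Sum>i\<in>UNIV. \<Sum>k\<in>UNIV. K z $ j $ l * K z $ k $ i * dw l j i k)"
  proof -
    have "V z $ l = (\<Sum>j\<in>UNIV. K z $ j $ l * R j)" for l
      by (simp add: V_def R_def sum_distrib_left mult_ac)
    then have "V z $ l * c = (\<Sum>j\<in>UNIV. K z $ j $ l * c * R j)" for l c
      by (simp add: sum_distrib_left sum_distrib_right mult_ac)
    moreover have "dk l j l * R j = (\<Sum>i\<in>UNIV. \<Sum>k\<in>UNIV. dk l j l * (K z $ k $ i * W j i k z))" for l j
      by (simp add: R_def sum_distrib_left)
    ultimately show ?thesis unfolding dV by (simp add: sum.distrib)
  qed
  also have "(\<Sum>l\<in>UNIV. \<Sum>j\<in>UNIV. dk l j l * R j + K z $ j $ l * (\<Sum>m\<in>UNIV. \<Sum>n\<in>UNIV. K z $ n $ m * dh l m n) * R j) = 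
    (\<Sum>j\<in>UNIV. (\<Sum>l\<in>UNIV. dk l j l + K z $ j $ l * (\<Sum>m\<in>UNIV. \<Sum>n\<in>UNIV. K z $ n $ m * dh l m n)) * R j)"
    by (subst sum.swap) (simp add: sum_distrib_right distrib_right)
  also have "\<dots> = 0" by (simp add: first)
  also have "(\<Sum>l\<in>UNIV. \<Sum>j\<in>UNIV. \<Sum>i\<in>UNIV. \<Sum>k\<in>UNIV. K z $ j $ l * dk l k i * W j i k z)
     = (\<Sum>i\<in>UNIV. \<Sum>l\<in>UNIV. \<Sum>j\<in>UNIV. \<Sum>k\<in>UNIV. K z $ j $ l * dk l k i * W j i k z)"
    by (rule trans[OF sum.cong[OF refl sum.swap] sum.swap])
  also have "\<dots> = 0" by (simp add: second)
  finally show ?thesis unfolding dh_def[symmetric] by (simp add: dw_def sum_KK_dW[OF z E])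
qed

lemma pos_sum_iff_zero:
  fixes f :: "'i \<Rightarrow> 'j \<Rightarrow> real"
  assumes "finite I" "finite J" "\<And>i j. i \<in> I \<Longrightarrow> j \<in> J \<Longrightarrow> 0 \<le> f i j" "(\<Sum>i\<in>I. \<Sum>j\<in>J. f i j) \<le> 0" "i \<in> I" "j \<in> J"
  shows "f i j = 0"
proof -
  have "(\<Sum>i\<in>I. \<Sum>j\<in>J. f i j) = 0" using assms(3,4) by (intro antisym) (auto intro!: sum_nonneg)
  then have "(\<Sum>j\<in>J. f i j) = 0" using assms(1,3,5) by (subst (asm) sum_nonneg_eq_0_iff) (auto intro!: sum_nonneg)
  then show ?thesis using assms(2,3,5,6) by (subst (asm) sum_nonneg_eq_0_iff) auto
qed

text \<open>The Bochner sum is a sum of squared norms plus non-negative curvature terms. If it is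
  not positive, the mixed derivatives vanish for all pairs of frame vectors, and linearity extends
  this to all u and v.\<close>

lemma bochner_nonneg:
  assumes z: "z \<in> S" and E: "frame_at (H z) E"
    and harm: "connection_adjoint gM k F (\<lambda>y. D F y) z = 0"
    and curv: "\<And>P Q. Re (complex_riemann k (F z) P (vec_cnj Q) Q (vec_cnj P)) \<le> 0"
  shows "0 \<le> Re (\<Sum>a\<in>UNIV. \<Sum>b\<in>UNIV. Dc (dirz (E a)) (Wf (E a) (E b) (E b)) z)"
    and "Re (\<Sum>a\<in>UNIV. \<Sum>b\<in>UNIV. Dc (dirz (E a)) (Wf (E a) (E b) (E b)) z) \<le> 0 \<Longrightarrow> nab (dirzb v) (FX (dirz u)) z = 0"
proof -
  let ?N = "\<lambda>p q. nab (dirzb (E p)) (FX (dirz (E q))) z"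
  let ?n = "\<lambda>p q. Re (kC (F z) (?N p q) (vec_cnj (?N p q)))"
  have eq: "(\<Sum>a\<in>UNIV. \<Sum>b\<in>UNIV. Dc (dirz (E a)) (Wf (E a) (E b) (E b)) z) =
    (\<Sum>p\<in>UNIV. \<Sum>q\<in>UNIV. kC (F z) (?N p q) (vec_cnj (?N p q)))
    - (\<Sum>p\<in>UNIV. \<Sum>q\<in>UNIV. complex_riemann k (F z) (FX (dirz (E p)) z) (FX (dirz (E q)) z) (FX (dirzb (E q)) z) (FX (dirzb (E p)) z))"
    unfolding Wf_def[abs_def] by (rule bochner[OF z, of "\<lambda>a. dirz (E a)" UNIV]) (rule harmonic_frame[OF z E harm])
  \<comment> \<open>The second vector of the curvature condition is taken to be
    \<open>FX (dirzb (E q)) z\<close>, whose conjugate is the (1,0)-derivative.\<close>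
  have c: "Re (complex_riemann k (F z) (FX (dirz (E p)) z) (FX (dirz (E q)) z) (FX (dirzb (E q)) z) (FX (dirzb (E p)) z)) \<le> 0" for p q
    using curv[of "FX (dirz (E p)) z" "FX (dirzb (E q)) z"] by (simp add: FX_cnj[OF z])
  have ge: "(\<Sum>p\<in>UNIV. \<Sum>q\<in>UNIV. ?n p q) \<le> Re (\<Sum>a\<in>UNIV. \<Sum>b\<in>UNIV. Dc (dirz (E a)) (Wf (E a) (E b) (E b)) z)"
    unfolding eq using c by (simp add: sum_nonpos)
  have nn: "0 \<le> ?n p q" for p q by (rule kC_norm_pos(2)[OF F_in[OF z]])
  then have "0 \<le> (\<Sum>p\<in>UNIV. \<Sum>q\<in>UNIV. ?n p q)" by (intro sum_nonneg)
  then show "0 \<le> Re (\<Sum>a\<in>UNIV. \<Sum>b\<in>UNIV. Dc (dirz (E a)) (Wf (E a) (E b) (E b)) z)" using ge by linarith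
  assume "Re (\<Sum>a\<in>UNIV. \<Sum>b\<in>UNIV. Dc (dirz (E a)) (Wf (E a) (E b) (E b)) z) \<le> 0"
  then have le: "(\<Sum>p\<in>UNIV. \<Sum>q\<in>UNIV. ?n p q) \<le> 0" using ge by linarith
  have "?n p q = 0" for p q
    by (rule pos_sum_iff_zero[OF _ _ nn le]) auto
  then have N0: "?N p q = 0" for p q
    using kC_norm_pos(3)[OF F_in[OF z], of "?N p q"] by (metis less_irrefl)
  have ex: "v = (\<Sum>a\<in>UNIV. herm_form (H z) v (E a) *s E a)" for v using E by (simp add: frame_at_def)
  define c where "c v a = herm_form (H z) v (E a)" for v a
  have cv: "v $ i = (\<Sum>a\<in>UNIV. c v a * E a $ i)" for v i
    using arg_cong[OF ex[of v], of "\<lambda>v. v $ i"] by (simp add: c_def)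
  have nabD: "nab (dirzb v) s z = (\<Sum>a\<in>UNIV. cnj (c v a) *s nab (dirzb (E a)) s z)" if s: "smooth_on S s" for s v
  proof -
    have dd: "Dc (dirzb v) f z = (\<Sum>a\<in>UNIV. cnj (c v a) * Dc (dirzb (E a)) f z)" if "f differentiable at z" for f
    proof -
      have "Dc (dirzb v) f z = (\<Sum>i\<in>UNIV. \<Sum>a\<in>UNIV. cnj (c v a) * (cnj (E a $ i) * Dc (dirzb (axis i 1)) f z))"
        unfolding Dc_dirz_expand(2)[OF that, of v] cv[of v] by (simp add: sum_distrib_left sum_distrib_right mult_ac)
      also have "\<dots> = (\<Sum>a\<in>UNIV. cnj (c v a) * Dc (dirzb (E a)) f z)"
        by (subst sum.swap) (simp add: Dc_dirz_expand(2)[OF that, of "E _"] sum_distrib_left)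
      finally show ?thesis .
    qed
    have "FX (dirzb v) z = (\<Sum>a\<in>UNIV. cnj (c v a) *s FX (dirzb (E a)) z)"
      by (simp add: vec_eq_iff FX_nth dd smooth_onD(1)[OF smooth_on_F_nth open_S z])
    then have "GC (F z) (FX (dirzb v) z) (s z) $ i = (\<Sum>a\<in>UNIV. cnj (c v a) * GC (F z) (FX (dirzb (E a)) z) (s z) $ i)" for i
      by (simp add: GC_nth cform_sum cform_linear)
    then show ?thesis
      by (simp add: vec_eq_iff nab_nth dd smooth_onD(1)[OF smooth_on_nth[OF open_S s] open_S z] sum.distrib distrib_left)
  qed
  \<comment> \<open>Here u sits under the derivative. Torsion-freeness and conjugation exchange it
    with the direction, so linearity in the direction, \<open>nabD\<close>, covers this argument
    too.\<close>
  have nab_E: "nab (dirzb (E a)) (FX (dirz u)) z = 0" for a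
  proof -
    have "nab (dirzb (E a)) (FX (dirz u)) z = vec_cnj (nab (dirzb u) (FX (dirz (E a))) z)"
    proof -
      have "nab (dirzb (E a)) (FX (dirz u)) z = nab (dirz u) (FX (dirzb (E a))) z"
        by (rule nab_torsion_free[OF z])
      also have "\<dots> = nab (dirz u) (\<lambda>y. vec_cnj (FX (dirz (E a)) y)) z"
        by (rule nab_cong[OF z]) (simp add: FX_cnj)
      also have "\<dots> = vec_cnj (nab (dirzb u) (FX (dirz (E a))) z)"
        using nab_cnj[OF smooth_FX z, of "dirzb u"] by simp
      finally show ?thesis .
    qed
    also have "nab (dirzb u) (FX (dirz (E a))) z = 0"
      by (subst nabD[OF smooth_FX]) (simp add: N0)
    finally show ?thesis by (simp add: vec_eq_iff)
  qed
  show "nab (dirzb v) (FX (dirz u)) z = 0"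
    by (subst nabD[OF smooth_FX]) (simp add: nab_E)
qed

end


subsection \<open>Real determinants of endomorphisms and the volume density\<close>

text \<open>An isometry of \<open>\<complex>\<^sup>m\<close> with a space \<open>\<real>\<^sup>2\<^sup>m\<close> on which determinants and the change of variables
  formula of the library are available.\<close>
definition iso_pair :: "(complex^'m \<Rightarrow> real^('m bit0)) \<times> (real^('m bit0) \<Rightarrow> complex^'m)" where
  "iso_pair = (SOME p. linear (fst p) \<and> linear (snd p) \<and> (\<forall>x. norm (fst p x) = norm x) \<and> (\<forall>y. norm (snd p y) = norm y)
     \<and> (\<forall>x. snd p (fst p x) = x) \<and> (\<forall>y. fst p (snd p y) = y))"

definition iota :: "complex^'m \<Rightarrow> real^('m bit0)" where "iota = fst iso_pair"
definition jota :: "real^('m bit0) \<Rightarrow> complex^'m" where "jota = snd iso_pair"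

lemma iota_works:
  "linear (iota :: complex^'m \<Rightarrow> _)" "linear (jota :: _ \<Rightarrow> complex^'m)"
  "norm (iota (x :: complex^'m)) = norm x" "norm (jota y :: complex^'m) = norm y"
  "jota (iota x) = x" "iota (jota y :: complex^'m) = y"
proof -
  have d: "DIM(complex^'m) = DIM(real^('m bit0))" by simp
  obtain f :: "complex^'m \<Rightarrow> real^('m bit0)" and g where "linear f" "linear g"
    "\<And>x. norm (f x) = norm x" "\<And>y. norm (g y) = norm y" "\<And>x. g (f x) = x" "\<And>y. f (g y) = y"
    using isomorphisms_UNIV_UNIV[OF d] by blast
  then have "\<exists>p :: (complex^'m \<Rightarrow> real^('m bit0)) \<times> _. linear (fst p) \<and> linear (snd p) \<and> (\<forall>x. norm (fst p x) = norm x) \<and> (\<forall>y. norm (snd p y) = norm y)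
     \<and> (\<forall>x. snd p (fst p x) = x) \<and> (\<forall>y. fst p (snd p y) = y)"
    by (intro exI[of _ "(f, g)"]) auto
  from someI_ex[OF this, folded iso_pair_def]
  show "linear (iota :: complex^'m \<Rightarrow> _)" "linear (jota :: _ \<Rightarrow> complex^'m)"
    "norm (iota (x :: complex^'m)) = norm x" "norm (jota y :: complex^'m) = norm y"
    "jota (iota x) = x" "iota (jota y :: complex^'m) = y"
    unfolding iota_def jota_def by auto
qed

lemma iota_inner: "iota x \<bullet> iota y = x \<bullet> y"
proof -
  have "iota x + iota y = iota (x + y)" by (rule linear_add[OF iota_works(1), symmetric])
  then show ?thesis by (simp add: dot_norm iota_works)
qed

lemma iota_jota_inner: "iota x \<bullet> y = x \<bullet> jota y"
  using iota_inner[of x "jota y"] by (simp add: iota_works)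

lemma iota_bounded_linear: "bounded_linear iota" "bounded_linear jota"
  using iota_works linear_conv_bounded_linear by blast+

definition matR :: "(complex^'m \<Rightarrow> complex^'m) \<Rightarrow> real^('m bit0)^('m bit0)" where
  "matR L = matrix (iota \<circ> L \<circ> jota)"

lemma matR_nth: "matR L $ i $ j = iota (L (jota (axis j 1))) $ i"
  by (simp add: matR_def matrix_def)

lemma matR_compose: "linear L \<Longrightarrow> linear L' \<Longrightarrow> matR (L \<circ> L') = matR L ** matR L'"
proof -
  assume l: "linear L" "linear L'"
  have "iota \<circ> (L \<circ> L') \<circ> jota = (iota \<circ> L \<circ> jota) \<circ> (iota \<circ> L' \<circ> jota)"
    by (simp add: fun_eq_iff iota_works)
  then show ?thesis unfolding matR_def
    by (simp add: matrix_compose linear_compose l iota_works)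
qed

lemma matR_id: "matR (\<lambda>x. x) = mat 1"
  by (simp add: vec_eq_iff matR_nth iota_works mat_def axis_def)

lemma linear_cmat: "linear ((*v) (M :: complex^'m^'m))"
  by simp

lemma matR_adjoint: "(\<And>x y. L x \<bullet> y = x \<bullet> L' y) \<Longrightarrow> matR L' = transpose (matR L)"
proof -
  assume a: "\<And>x y. L x \<bullet> y = x \<bullet> L' y"
  have "iota (L' (jota (axis j 1))) $ i = iota (L (jota (axis i 1))) $ j" for i j
  proof -
    have "iota (L' (jota (axis j 1))) $ i = iota (L' (jota (axis j 1))) \<bullet> axis i 1" by (simp add: inner_axis)
    also have "\<dots> = jota (axis i 1) \<bullet> L' (jota (axis j 1))" by (metis iota_jota_inner inner_commute)
    also have "\<dots> = iota (L (jota (axis i 1))) \<bullet> axis j 1" by (simp add: a[symmetric] iota_jota_inner)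
    finally show ?thesis by (simp add: inner_axis)
  qed
  then show ?thesis by (simp add: vec_eq_iff matR_nth transpose_def)
qed

lemma sum_Basis_cvec:
  fixes f :: "complex^'m \<Rightarrow> 'b::comm_monoid_add"
  shows "(\<Sum>b\<in>Basis. f b) = (\<Sum>l\<in>UNIV. f (axis l 1) + f (axis l \<i>))"
proof -
  have "(\<Sum>b\<in>Basis. f b) = (\<Sum>l\<in>UNIV. \<Sum>b\<in>(\<Union>u\<in>Basis. {axis l u}). f b)"
    unfolding Basis_vec_def
    by (rule sum.UNION_disjoint) (auto simp: axis_eq_axis Basis_complex_def)
  also have "\<dots> = (\<Sum>l\<in>UNIV. f (axis l 1) + f (axis l \<i>))"
    by (intro sum.cong refl) (auto simp: Basis_complex_def axis_eq_axis add.commute)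
  finally show ?thesis .
qed

lemma trace_matR:
  assumes L: "linear (L :: complex^'m \<Rightarrow> complex^'m)"
  shows "(\<Sum>i\<in>UNIV. matR L $ i $ i) = (\<Sum>b\<in>Basis. L b \<bullet> b)"
proof -
  have "(\<Sum>i\<in>UNIV. matR L $ i $ i) = (\<Sum>i\<in>UNIV. L (jota (axis i 1)) \<bullet> jota (axis i 1))"
    by (simp add: matR_nth iota_jota_inner[symmetric] inner_axis)
  also have "\<dots> = (\<Sum>i\<in>UNIV. \<Sum>b\<in>Basis. (jota (axis i 1) \<bullet> b) * (L b \<bullet> jota (axis i 1)))"
    by (subst linear_euclidean_sum[OF L]) (simp add: inner_sum_left)
  also have "\<dots> = (\<Sum>b\<in>Basis. \<Sum>i\<in>UNIV. iota b $ i * iota (L b) $ i)"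
    by (subst sum.swap) (simp add: iota_jota_inner[symmetric] inner_axis inner_commute[of "jota _"])
  also have "\<dots> = (\<Sum>b\<in>Basis. iota (L b) \<bullet> iota b)"
    by (simp add: inner_vec_def mult.commute)
  finally show ?thesis by (simp add: iota_inner)
qed

text \<open>Each complex line contributes the two real basis vectors \<open>axis l 1\<close> and
  \<open>axis l \<i>\<close>. The resulting factor 2 is what the square root in the volume density
  cancels.\<close>

lemma trace_cmat: "(\<Sum>b\<in>Basis. (M *v b) \<bullet> b) = 2 * Re (\<Sum>i\<in>UNIV. (M :: complex^'m^'m) $ i $ i)"
proof -
  have "(M *v axis l c) $ l = M $ l $ l * c" for l c
    by (simp add: matrix_vector_mult_def axis_def if_distrib[of "\<lambda>x. _ * x"] cong: if_cong)
  then have "(M *v axis l c) \<bullet> axis l c = Re (M $ l $ l * c * cnj c)" for l c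
    by (simp add: inner_axis inner_complex_def algebra_simps)
  then show ?thesis by (simp add: sum_Basis_cvec sum_distrib_left)
qed

section \<open>Jacobi's formula for the derivative of a determinant\<close>

lemma sum_diag_perm:
  fixes f :: "'k::finite \<Rightarrow> real"
  assumes p: "p permutes (UNIV :: 'k set)" and "p \<noteq> id"
  shows "(\<Prod>j\<in>UNIV - {i}. mat 1 $ j $ p j) = (0 :: real)"
proof -
  obtain a where a: "p a \<noteq> a" using assms(2) by (auto simp: fun_eq_iff)
  \<comment> \<open>A permutation other than the identity moves at least two points, so a moved one
    remains after deleting i.\<close>
  have "\<exists>j. j \<noteq> i \<and> p j \<noteq> j"
  proof (cases "a = i")
    case True
    have "p (p a) \<noteq> p a" using a permutes_inj[OF p] by (metis injD)
    then show ?thesis using a True by metis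
  qed (use a in auto)
  then obtain j where "j \<noteq> i" "p j \<noteq> j" by blast
  then show ?thesis by (intro prod_zero bexI[of _ j]) (auto simp: mat_def)
qed

text \<open>In the Leibniz expansion at the identity matrix, every other permutation keeps a zero
  off-diagonal factor after one factor has been differentiated.\<close>

lemma has_derivative_det_at_1:
  fixes A :: "'b::real_normed_vector \<Rightarrow> real^'k^'k"
  assumes d: "\<And>i j. ((\<lambda>y. A y $ i $ j) has_derivative A' i j) (at z)" and A1: "A z = mat 1"
  shows "((\<lambda>y. det (A y)) has_derivative (\<lambda>v. \<Sum>i\<in>UNIV. A' i i v)) (at z)"
proof -
  have "((\<lambda>y. det (A y)) has_derivative (\<lambda>v. \<Sum>p\<in>{p. p permutes (UNIV :: 'k set)}. of_int (sign p) *
     (\<Sum>i\<in>UNIV. A' i (p i) v * (\<Prod>j\<in>UNIV - {i}. A z $ j $ p j)))) (at z)"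
    unfolding det_def
    by (intro has_derivative_sum has_derivative_mult_right has_derivative_prod d)
  also have "(\<lambda>v. \<Sum>p\<in>{p. p permutes (UNIV :: 'k set)}. of_int (sign p) *
     (\<Sum>i\<in>UNIV. A' i (p i) v * (\<Prod>j\<in>UNIV - {i}. A z $ j $ p j))) = (\<lambda>v. \<Sum>i\<in>UNIV. A' i i v)"
  proof
    fix v
    have "(\<Sum>p\<in>{p. p permutes (UNIV :: 'k set)}. of_int (sign p) *
     (\<Sum>i\<in>UNIV. A' i (p i) v * (\<Prod>j\<in>UNIV - {i}. A z $ j $ p j)))
     = (\<Sum>p\<in>{id}. of_int (sign p) * (\<Sum>i\<in>UNIV. A' i (p i) v * (\<Prod>j\<in>UNIV - {i}. A z $ j $ p j)))"
      by (rule sum.mono_neutral_right) (auto simp: A1 sum_diag_perm permutes_id finite_permutations)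
    also have "\<dots> = (\<Sum>i\<in>UNIV. A' i i v)"
      by (simp add: A1 mat_def sign_id)
    finally show "(\<Sum>p\<in>{p. p permutes (UNIV :: 'k set)}. of_int (sign p) *
     (\<Sum>i\<in>UNIV. A' i (p i) v * (\<Prod>j\<in>UNIV - {i}. A z $ j $ p j))) = (\<Sum>i\<in>UNIV. A' i i v)" .
  qed
  finally show ?thesis .
qed

text \<open>Left multiplication by the inverse of \<open>A z\<close> reduces to the identity
  matrix.\<close>

lemma has_derivative_det:
  fixes A :: "'b::real_normed_vector \<Rightarrow> real^'k^'k"
  assumes d: "\<And>i j. ((\<lambda>y. A y $ i $ j) has_derivative (\<lambda>v. A' v $ i $ j)) (at z)" and inv: "B ** A z = mat 1"
  shows "((\<lambda>y. det (A y)) has_derivative (\<lambda>v. det (A z) * (\<Sum>i\<in>UNIV. (B ** A' v) $ i $ i))) (at z)"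
proof -
  have "((\<lambda>y. det (B ** A y)) has_derivative (\<lambda>v. \<Sum>i\<in>UNIV. (B ** A' v) $ i $ i)) (at z)"
  proof (rule has_derivative_det_at_1[where A' = "\<lambda>i j v. (B ** A' v) $ i $ j"])
    show "((\<lambda>y. (B ** A y) $ i $ j) has_derivative (\<lambda>v. (B ** A' v) $ i $ j)) (at z)" for i j
      unfolding matrix_matrix_mult_def vec_lambda_beta
      by (intro has_derivative_sum has_derivative_mult_right d)
  qed (rule inv)
  from has_derivative_mult_right[OF this, of "det (A z)"]
  have "((\<lambda>y. det (A z) * det (B ** A y)) has_derivative (\<lambda>v. det (A z) * (\<Sum>i\<in>UNIV. (B ** A' v) $ i $ i))) (at z)" .
  moreover have "det (A z) * det (B ** A y) = det (A y)" for y
  proof -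
    have "det (A z) * det B = 1" using arg_cong[OF inv, of det] by (simp add: det_mul mult.commute)
    then show ?thesis by (simp add: det_mul mult.assoc[symmetric])
  qed
  ultimately show ?thesis by simp
qed

section \<open>The volume density of a Kaehler metric\<close>

context kaehler_domain
begin

text \<open>Under the Euclidean inner product the transpose of \<open>H z\<close>, not
  \<open>H z\<close> itself, is the real endomorphism representing the metric Re h; hence this is
  its Gram determinant.\<close>

definition detH :: "complex^'m \<Rightarrow> real" where
  "detH z = det (matR ((*v) (transpose (H z))))"

text \<open>The square root of the determinant of the real metric, without having to know that this
  determinant is positive.\<close>
definition rho :: "complex^'m \<Rightarrow> real" where
  "rho z = ((detH z)\<^sup>2) powr (1/4)"

lemma smooth_matR_entry:
  "smooth_on S (\<lambda>z. matR ((*v) (transpose (H z))) $ i $ j)"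
  unfolding matR_nth
proof (rule smooth_on_nth[OF open_dom], rule smooth_on_linear_comp[OF iota_bounded_linear(1) open_dom],
    rule smooth_on_vec[OF open_dom])
  show "smooth_on S (\<lambda>z. (transpose (H z) *v w) $ l)" for w l
    unfolding matrix_vector_mult_def transpose_def vec_lambda_beta
    by (intro smooth_on_sum smooth_on_mult smooth_on_const H_nth_smooth open_dom)
qed

lemma detH_nz: assumes "z \<in> S" shows "detH z \<noteq> 0"
proof -
  have inv: "invertible (H z)" using det_H[OF assms] by (simp add: invertible_det_nz)
  have "transpose (H z) ** transpose (K z) = mat 1"
    by (metis matrix_inv_left[OF inv] matrix_transpose_mul transpose_mat)
  then have "(*v) (transpose (H z)) \<circ> (*v) (transpose (K z)) = (\<lambda>x. x)"
    by (simp add: fun_eq_iff matrix_vector_mul_assoc del: transpose_matrix_vector)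
  then have "matR ((*v) (transpose (H z))) ** matR ((*v) (transpose (K z))) = mat 1"
    by (metis matR_compose linear_cmat matR_id)
  then have "det (matR ((*v) (transpose (H z)))) * det (matR ((*v) (transpose (K z)))) = 1"
    by (metis det_mul det_I)
  then show ?thesis unfolding detH_def by auto
qed

lemma rho_pos: "z \<in> S \<Longrightarrow> 0 < rho z"
  using detH_nz by (simp add: rho_def)

lemma smooth_rho: "smooth_on S rho"
  unfolding rho_def[abs_def] power2_eq_square
proof (intro smooth_on_powr smooth_on_mult open_dom)
  show "smooth_on S detH" "smooth_on S detH"
    unfolding detH_def[abs_def] by (intro smooth_on_det open_dom smooth_matR_entry)+
  show "0 < detH z * detH z" if "z \<in> S" for z using detH_nz[OF that]
    by (metis zero_less_power2 power2_eq_square)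
qed

text \<open>The logarithmic derivative of the root of a determinant is half a real trace, and the
  real trace of a complex matrix is twice the real part of the complex one: the factors
  cancel.\<close>

lemma D_rho:
  assumes z: "z \<in> S"
  shows "D rho z v = rho z * Re (\<Sum>m\<in>UNIV. \<Sum>n\<in>UNIV. K z $ n $ m * D (\<lambda>z. H z $ m $ n) z v)"
proof -
  define H' where "H' v = (\<chi> m n. D (\<lambda>z. H z $ m $ n) z v)" for v
  have inv: "invertible (H z)" using det_H[OF z] by (simp add: invertible_det_nz)
  have KHt: "transpose (K z) ** transpose (H z) = mat 1"
    by (metis matrix_inv_right[OF inv] matrix_transpose_mul transpose_mat)
  then have BA: "matR ((*v) (transpose (K z))) ** matR ((*v) (transpose (H z))) = mat 1"
  proof -
    have "(*v) (transpose (K z)) \<circ> (*v) (transpose (H z)) = (\<lambda>x. x)"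
      by (simp add: fun_eq_iff matrix_vector_mul_assoc KHt del: transpose_matrix_vector)
    then show ?thesis by (metis matR_compose linear_cmat matR_id)
  qed
  have "((\<lambda>y. matR ((*v) (transpose (H y))) $ i $ j) has_derivative (\<lambda>v. matR ((*v) (transpose (H' v))) $ i $ j)) (at z)" for i j
    unfolding matR_nth
  proof (intro bounded_linear.has_derivative[OF bounded_linear_vec_nth] bounded_linear.has_derivative[OF iota_bounded_linear(1)])
    define w :: "complex^'m" where "w = jota (axis j 1)"
    have "((\<lambda>y. \<Sum>m\<in>UNIV. \<Sum>l\<in>UNIV. axis l (H y $ m $ l * w $ m)) has_derivative (\<lambda>v. \<Sum>m\<in>UNIV. \<Sum>l\<in>UNIV. axis l (H' v $ m $ l * w $ m))) (at z)"
    proof (intro has_derivative_sum)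
      fix m l :: 'm
      have bl: "bounded_linear (\<lambda>c. axis l (c * w $ m) :: complex^'m)"
        by (rule linear_conv_bounded_linear[THEN iffD1]) (auto intro!: linearI simp: vec_eq_iff axis_def algebra_simps)
      show "((\<lambda>y. axis l (H y $ m $ l * w $ m) :: complex^'m) has_derivative (\<lambda>v. axis l (H' v $ m $ l * w $ m))) (at z)"
        by (rule bounded_linear.has_derivative[OF bl]) (simp add: H'_def has_derivative_D[OF H_diff[OF z]])
    qed
    moreover have "(\<Sum>m\<in>UNIV. \<Sum>l\<in>UNIV. axis l (M $ m $ l * w $ m)) = transpose M *v w" for M :: "complex^'m^'m"
      by (simp add: vec_eq_iff matrix_vector_mult_def transpose_def axis_def if_distrib cong: if_cong)
    ultimately show "((\<lambda>x. transpose (H x) *v jota (axis j 1)) has_derivative (\<lambda>x. transpose (H' x) *v jota (axis j 1))) (at z)"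
      by (simp add: w_def)
  qed
  from has_derivative_det[OF this BA]
  have dd: "(detH has_derivative (\<lambda>v. detH z * (\<Sum>i\<in>UNIV. (matR ((*v) (transpose (K z))) ** matR ((*v) (transpose (H' v)))) $ i $ i))) (at z)"
    unfolding detH_def[abs_def] .
  have tr: "(\<Sum>i\<in>UNIV. (matR ((*v) (transpose (K z))) ** matR ((*v) (transpose (H' v)))) $ i $ i)
     = 2 * Re (\<Sum>m\<in>UNIV. \<Sum>n\<in>UNIV. K z $ n $ m * D (\<lambda>z. H z $ m $ n) z v)" for v
  proof -
    have "matR ((*v) (transpose (K z))) ** matR ((*v) (transpose (H' v))) = matR ((*v) (transpose (K z) ** transpose (H' v)))"
      by (subst matR_compose[symmetric]) (auto simp: fun_eq_iff matrix_vector_mul_assoc simp del: transpose_matrix_vector intro!: arg_cong[where f=matR])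
    then have "(\<Sum>i\<in>UNIV. (matR ((*v) (transpose (K z))) ** matR ((*v) (transpose (H' v)))) $ i $ i) =
      2 * Re (\<Sum>i\<in>UNIV. (transpose (K z) ** transpose (H' v)) $ i $ i)"
      by (simp only: trace_matR[OF linear_cmat] trace_cmat)
    also have "(\<Sum>i\<in>UNIV. (transpose (K z) ** transpose (H' v)) $ i $ i) = (\<Sum>m\<in>UNIV. \<Sum>n\<in>UNIV. K z $ n $ m * D (\<lambda>z. H z $ m $ n) z v)"
      by (simp add: matrix_matrix_mult_def transpose_def H'_def)
    finally show ?thesis .
  qed
  define T where "T = Re (\<Sum>m\<in>UNIV. \<Sum>n\<in>UNIV. K z $ n $ m * D (\<lambda>z. H z $ m $ n) z v)"
  have dv: "D detH z v = detH z * (2 * T)" and df: "detH differentiable at z"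
    using D_eqI[OF dd] dd by (auto simp: tr T_def intro: differentiableI)
  have nz: "detH z \<noteq> 0" by (rule detH_nz[OF z])
  have pw: "((\<lambda>t. t powr (1/4)) has_real_derivative (1/4) * ((detH z)\<^sup>2) powr (1/4 - 1)) (at ((detH z)\<^sup>2))"
    by (rule has_real_derivative_powr) (simp add: nz)
  have sq: "((\<lambda>z. (detH z)\<^sup>2) has_derivative (\<lambda>v. 2 * detH z * D detH z v)) (at z)"
    using has_derivative_power[OF has_derivative_D[OF df], of 2] by (simp add: mult_ac)
  have "(rho has_derivative (\<lambda>v. (1/4) * ((detH z)\<^sup>2) powr (1/4 - 1) * (2 * detH z * D detH z v))) (at z)"
    unfolding rho_def[abs_def]
    by (rule has_derivative_compose[OF sq pw[unfolded has_field_derivative_def]])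
  then have "D rho z v = (1/4) * ((detH z)\<^sup>2) powr (1/4 - 1) * (2 * detH z * D detH z v)"
    by (simp add: D_eqI)
  \<comment> \<open>The constants 1/4 and 2, and the 2 contained in \<open>dv\<close>, multiply to
    1.\<close>
  also have "\<dots> = ((detH z)\<^sup>2) powr (1/4 - 1) * (detH z)\<^sup>2 * T"
    by (simp add: dv power2_eq_square)
  also have "((detH z)\<^sup>2) powr (1/4 - 1) * (detH z)\<^sup>2 = rho z"
  proof -
    have "((detH z)\<^sup>2) powr (1/4 - 1) * ((detH z)\<^sup>2) powr 1 = ((detH z)\<^sup>2) powr (1/4 - 1 + 1)"
      by (rule powr_add[symmetric])
    then show ?thesis using nz by (simp add: rho_def)
  qed
  finally show ?thesis by (simp add: T_def)
qed

lemma K_cnj: "z \<in> S \<Longrightarrow> cnj (K z $ i $ j) = K z $ j $ i"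
  using frame_ex[of z] frame_K[of z] by (auto simp: mult.commute)

text \<open>Splitting the real derivative into its two Wirtinger halves, the barred half is the
  conjugate of the other after exchanging the summation indices, because \<open>H\<close> and
  \<open>K\<close> are Hermitian.\<close>

lemma D_rho_dz:
  assumes z: "z \<in> S"
  shows "D rho z v = rho z * (2 * Re (\<Sum>m\<in>UNIV. \<Sum>n\<in>UNIV. K z $ n $ m * Dc (dirz v) (\<lambda>z. H z $ m $ n) z))"
proof -
  have "cnj (\<Sum>m\<in>UNIV. \<Sum>n\<in>UNIV. K z $ n $ m * Dc (dirzb v) (\<lambda>z. H z $ m $ n) z)
     = (\<Sum>m\<in>UNIV. \<Sum>n\<in>UNIV. K z $ m $ n * Dc (dirz v) (\<lambda>z. H z $ n $ m) z)"
  proof -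
    have "cnj (Dc (dirzb v) (\<lambda>z. H z $ m $ n) z) = Dc (dirz v) (\<lambda>z. H z $ n $ m) z" for m n
    proof -
      have "Dc (dirz v) (\<lambda>z. H z $ n $ m) z = Dc (dirz v) (\<lambda>z. cnj (H z $ m $ n)) z"
        by (rule Dc_cong[OF open_dom z]) (rule H_cnj)
      then show ?thesis by (simp add: Dc_cnj[OF H_diff[OF z]])
    qed
    then show ?thesis by (simp add: K_cnj[OF z])
  qed
  also have "\<dots> = (\<Sum>m\<in>UNIV. \<Sum>n\<in>UNIV. K z $ n $ m * Dc (dirz v) (\<lambda>z. H z $ m $ n) z)"
    by (rule sum.swap)
  finally have eq: "cnj (\<Sum>m\<in>UNIV. \<Sum>n\<in>UNIV. K z $ n $ m * Dc (dirzb v) (\<lambda>z. H z $ m $ n) z) = (\<Sum>m\<in>UNIV. \<Sum>n\<in>UNIV. K z $ n $ m * Dc (dirz v) (\<lambda>z. H z $ m $ n) z)" .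
  have "Re (\<Sum>m\<in>UNIV. \<Sum>n\<in>UNIV. K z $ n $ m * Dc (dirzb v) (\<lambda>z. H z $ m $ n) z) = Re (cnj (\<Sum>m\<in>UNIV. \<Sum>n\<in>UNIV. K z $ n $ m * Dc (dirzb v) (\<lambda>z. H z $ m $ n) z))"
    by (rule cnj.sel(1)[symmetric])
  also have "\<dots> = Re (\<Sum>m\<in>UNIV. \<Sum>n\<in>UNIV. K z $ n $ m * Dc (dirz v) (\<lambda>z. H z $ m $ n) z)"
    by (simp only: eq)
  finally have "Re (\<Sum>m\<in>UNIV. \<Sum>n\<in>UNIV. K z $ n $ m * Dc (dirzb v) (\<lambda>z. H z $ m $ n) z) = Re (\<Sum>m\<in>UNIV. \<Sum>n\<in>UNIV. K z $ n $ m * Dc (dirz v) (\<lambda>z. H z $ m $ n) z)" .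
  then show ?thesis
    unfolding D_rho[OF z] D_dirz[OF H_diff[OF z]] by (simp add: distrib_left sum.distrib)
qed

end

section \<open>Coordinate divergence of the vector density \<open>rho\<close> times
  \<open>V\<close>\<close>

definition divergence :: "('b::euclidean_space \<Rightarrow> 'b) \<Rightarrow> 'b \<Rightarrow> real" where
  "divergence X z = (\<Sum>b\<in>Basis. D X z b \<bullet> b)"

lemma divergence_scaleR:
  assumes "r differentiable at z" "X differentiable at z"
  shows "divergence (\<lambda>z. r z *\<^sub>R X z) z = r z * divergence X z + D r z (X z)"
proof -
  have "D (\<lambda>z. r z *\<^sub>R X z) z = (\<lambda>v. r z *\<^sub>R D X z v + D r z v *\<^sub>R X z)"
    by (intro D_eqI has_derivative_scaleR has_derivative_D assms)
  then show ?thesis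
    using linear_euclidean_sum[OF linear_D(1)[OF assms(1)], of "X z"]
    by (simp add: divergence_def inner_add_left sum.distrib sum_distrib_left mult.commute)
qed

lemma divergence_complex:
  assumes "X differentiable at (z :: complex^'m)"
  shows "divergence X z = 2 * Re (\<Sum>l\<in>UNIV. Dc (dirz (axis l 1)) (\<lambda>z. X z $ l) z)"
proof -
  have d: "(\<lambda>z. X z $ l) differentiable at z" and n: "D X z v $ l = D (\<lambda>z. X z $ l) z v" for l v
    using bounded_linear.has_derivative[OF bounded_linear_vec_nth has_derivative_D[OF assms]]
      D_linear_comp[OF bounded_linear_vec_nth assms] by (auto intro: differentiableI)
  show ?thesis
    by (simp add: divergence_def sum_Basis_cvec inner_axis n Dc_dirz d i_axis inner_complex_def sum_distrib_left add_divide_distrib)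
qed

text \<open>The derivative of \<open>rho\<close> along \<open>V\<close> supplies exactly the trace
  term in \<open>complex_divergence_V\<close>; together they are \<open>rho\<close> times the
  Riemannian divergence.\<close>

lemma (in kaehler_map) divergence_rho_V:
  assumes z: "z \<in> S" and E: "frame_at (H z) E"
  shows "divergence (\<lambda>z. rho z *\<^sub>R V z) z
    = 2 * rho z * Re (\<Sum>a\<in>UNIV. \<Sum>b\<in>UNIV. Dc (dirz (E a)) (Wf (E a) (E b) (E b)) z)"
proof -
  have dr: "rho differentiable at z" and dV: "V differentiable at z"
    using smooth_onD(1)[OF smooth_rho open_S z] smooth_onD(1)[OF V_smooth open_S z] by auto
  have "(\<Sum>m\<in>UNIV. \<Sum>n\<in>UNIV. K z $ n $ m * Dc (dirz (V z)) (\<lambda>z. H z $ m $ n) z)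
     = (\<Sum>m\<in>UNIV. \<Sum>n\<in>UNIV. \<Sum>l\<in>UNIV. V z $ l * (K z $ n $ m * Dc (dirz (axis l 1)) (\<lambda>z. H z $ m $ n) z))"
    by (subst Dc_dirz_expand(1)[OF H_diff[OF z]]) (simp add: sum_distrib_left mult_ac)
  also have "\<dots> = (\<Sum>l\<in>UNIV. \<Sum>m\<in>UNIV. \<Sum>n\<in>UNIV. V z $ l * (K z $ n $ m * Dc (dirz (axis l 1)) (\<lambda>z. H z $ m $ n) z))"
    by (rule trans[OF sum.cong[OF refl sum.swap] sum.swap])
  finally have "D rho z (V z) = rho z * (2 * Re (\<Sum>l\<in>UNIV. V z $ l * (\<Sum>m\<in>UNIV. \<Sum>n\<in>UNIV. K z $ n $ m * Dc (dirz (axis l 1)) (\<lambda>z. H z $ m $ n) z)))"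
    unfolding D_rho_dz[OF z] by (simp add: sum_distrib_left)
  then show ?thesis
    unfolding divergence_scaleR[OF dr dV] divergence_complex[OF dV] complex_divergence_V[OF z E, symmetric]
    by (simp add: sum.distrib algebra_simps)
qed


section \<open>The divergence theorem on a compact manifold\<close>

subsection \<open>Integration of compactly supported functions\<close>

definition cc :: "('b::euclidean_space \<Rightarrow> real) \<Rightarrow> bool" where
  "cc f \<longleftrightarrow> continuous_on UNIV f \<and> (\<exists>C. compact C \<and> (\<forall>y. y \<notin> C \<longrightarrow> f y = 0))"

lemma ccI: "continuous_on UNIV f \<Longrightarrow> compact C \<Longrightarrow> (\<And>y. y \<notin> C \<Longrightarrow> f y = 0) \<Longrightarrow> cc f"
  unfolding cc_def by blast

lemma cc_integrable: assumes "cc f" shows "integrable lborel f"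
proof -
  obtain C where C: "compact C" "\<And>y. y \<notin> C \<Longrightarrow> f y = 0" and f: "continuous_on UNIV f"
    using assms unfolding cc_def by blast
  have "integrable lborel (\<lambda>x. indicat_real C x *\<^sub>R f x)"
    by (rule borel_integrable_compact[OF C(1)]) (use f continuous_on_subset in blast)
  moreover have "(\<lambda>x. indicat_real C x *\<^sub>R f x) = f"
    using C(2) by (auto simp: fun_eq_iff indicator_def)
  ultimately show ?thesis by simp
qed

text \<open>Continuity is checked on the two open sets \<open>S\<close> and the complement of
  \<open>C\<close>, which cover the space.\<close>

lemma cc_extend:
  assumes O: "open S" and f: "continuous_on S f" and C: "compact C" "C \<subseteq> S"
    and 0: "\<And>y. y \<in> S \<Longrightarrow> y \<notin> C \<Longrightarrow> f y = 0"
  shows "cc (\<lambda>y. if y \<in> S then f y else 0)"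
proof (rule ccI[OF _ C(1)])
  have SC: "S \<union> - C = UNIV" using C(2) by blast
  have "continuous_on (S \<union> - C) (\<lambda>y. if y \<in> S then f y else 0)"
  proof (rule continuous_on_open_Un)
    show "continuous_on S (\<lambda>y. if y \<in> S then f y else 0)"
      by (rule continuous_on_eq[OF f]) simp
    show "continuous_on (- C) (\<lambda>y. if y \<in> S then f y else 0)"
      by (rule continuous_on_eq[OF continuous_on_const[of _ 0]]) (simp add: 0)
  qed (use O C compact_imp_closed in auto)
  then show "continuous_on UNIV (\<lambda>y. if y \<in> S then f y else 0)"
    by (simp only: SC)
qed (use C 0 in auto)

lemma cc_translate: "cc f \<Longrightarrow> cc (\<lambda>y. f (c + y))"
proof -
  assume "cc f"
  then obtain C where C: "compact C" "\<And>y. y \<notin> C \<Longrightarrow> f y = 0" and f: "continuous_on UNIV f"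
    unfolding cc_def by blast
  show ?thesis
  proof (rule ccI)
    show "continuous_on UNIV (\<lambda>y. f (c + y))"
      by (rule continuous_on_compose2[OF f]) (auto intro: continuous_intros)
    show "compact ((+) (- c) ` C)" by (rule compact_translation[OF C(1)])
    show "f (c + y) = 0" if "y \<notin> (+) (- c) ` C" for y
    proof (rule C(2))
      show "c + y \<notin> C" using that by (metis add.commute add_minus_cancel imageI minus_add_cancel)
    qed
  qed
qed

lemma integral_translate: "cc f \<Longrightarrow> (LINT y|lborel. f (c + y)) = (LINT y|lborel. f y)"
proof -
  assume "cc f"
  then have "f \<in> borel_measurable borel"
    using borel_measurable_continuous_onI unfolding cc_def by blast
  then have "(LINT y|distr lborel borel ((+) c). f y) = (LINT y|lborel. f (c + y))"
    by (intro integral_distr) auto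
  then show ?thesis by (simp add: lborel_distr_plus)
qed

lemma C1_derivative_cc:
  fixes g :: "'b::euclidean_space \<Rightarrow> real"
  assumes g: "Ck_on (Suc 0) UNIV g" and C: "compact C" "\<And>y. y \<notin> C \<Longrightarrow> g y = 0"
  shows "cc (\<lambda>y. D g y v)"
proof (rule ccI[OF _ C(1)])
  show "continuous_on UNIV (\<lambda>y. D g y v)" using g by simp
  show "D g y v = 0" if "y \<notin> C" for y
  proof -
    have "D g y = D (\<lambda>y. 0) y"
      by (rule D_cong[of "- C"]) (use C that compact_imp_closed in auto)
    then show ?thesis by simp
  qed
qed

text \<open>The difference quotients of g have integral zero by translation invariance; dominated
  convergence passes to the derivative.\<close>

lemma integral_derivative_zero:
  fixes g :: "'b::euclidean_space \<Rightarrow> real"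
  assumes g: "Ck_on (Suc 0) UNIV g" and C: "compact C" "\<And>y. y \<notin> C \<Longrightarrow> g y = 0"
  shows "(LINT y|lborel. D g y v) = 0"
proof -
  have gd: "g differentiable at y" for y using Ck_on_SucD(1)[OF g] by simp
  have gcc: "cc g" by (rule ccI[OF Ck_on_continuous[OF g] C])
  note dcc = C1_derivative_cc[OF assms, of v]
  obtain C1 where C1: "compact C1" "\<And>y. y \<notin> C1 \<Longrightarrow> D g y v = 0" "continuous_on UNIV (\<lambda>y. D g y v)"
    using dcc unfolding cc_def by blast
  have "bounded ((\<lambda>y. D g y v) ` C1)"
    by (rule compact_imp_bounded, rule compact_continuous_image[OF continuous_on_subset[OF C1(3)] C1(1)]) simp
  then obtain M0 where M0: "\<And>y. y \<in> C1 \<Longrightarrow> \<bar>D g y v\<bar> \<le> M0"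
    unfolding bounded_iff by auto
  \<comment> \<open>Off \<open>C1\<close> the derivative is zero, so the bound has to be
    non-negative.\<close>
  define M where "M = max 0 M0"
  have M: "\<bar>D g y v\<bar> \<le> M" for y using M0[of y] C1(2)[of y] by (cases "y \<in> C1") (auto simp: M_def)
  obtain R where R: "\<And>y. y \<in> C \<Longrightarrow> norm y \<le> R"
    using compact_imp_bounded[OF C(1)] unfolding bounded_iff by metis
  define h where "h n = inverse (real (Suc n))" for n
  have h: "0 < h n" "h n \<le> 1" for n by (auto simp: h_def field_simps)
  have dline: "((\<lambda>t. g (y + t *\<^sub>R v)) has_real_derivative D g (y + t *\<^sub>R v) v) (at t)" for y t
    by (rule has_real_derivative_line[OF gd])
  define s where "s n y = (g (h n *\<^sub>R v + y) - g y) / h n" for n y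
  have s_cc: "cc (\<lambda>y. g (h n *\<^sub>R v + y))" for n by (rule cc_translate[OF gcc])
  have s0: "(LINT y|lborel. s n y) = 0" for n
    unfolding s_def using cc_integrable[OF s_cc] cc_integrable[OF gcc] integral_translate[OF gcc] by simp
  have sM: "\<bar>s n y\<bar> \<le> M" for n y
  proof -
    have "\<exists>z::real. z > 0 \<and> z < h n \<and> g (y + h n *\<^sub>R v) - g (y + 0 *\<^sub>R v) = (h n - 0) * D g (y + z *\<^sub>R v) v"
      by (rule MVT2[OF h(1)]) (rule dline)
    then obtain z where z: "g (y + h n *\<^sub>R v) - g (y + 0 *\<^sub>R v) = (h n - 0) * D g (y + z *\<^sub>R v) v"
      by blast
    then have "s n y = D g (y + z *\<^sub>R v) v"
      using h(1)[of n] by (simp add: s_def add.commute)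
    then show ?thesis using M by simp
  qed
  \<comment> \<open>Since \<open>h n \<le> 1\<close>, every translate involved is by at most
    \<open>norm v\<close>, so one ball contains the supports of all quotients.\<close>
  define C' where "C' = cball (0::'b) (R + norm v)"
  have sC: "s n y = 0" if "y \<notin> C'" for n y
  proof -
    have "norm (h n *\<^sub>R v) \<le> norm v" using h[of n] by (simp add: mult_left_le_one_le)
    then have "norm y > R + norm (h n *\<^sub>R v)" using that by (simp add: C'_def)
    then have "norm (h n *\<^sub>R v + y) > R" using norm_triangle_ineq4[of "h n *\<^sub>R v + y" "h n *\<^sub>R v"] by simp
    then have "h n *\<^sub>R v + y \<notin> C" "y \<notin> C" using R[of y] R[of "h n *\<^sub>R v + y"] \<open>norm y > _\<close> norm_ge_zero[of "h n *\<^sub>R v"] by linarith+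
    then show ?thesis by (simp add: s_def C(2))
  qed
  have "(\<lambda>n. LINT y|lborel. s n y) \<longlonglongrightarrow> (LINT y|lborel. D g y v)"
  proof (rule integral_dominated_convergence[where w = "\<lambda>y. indicat_real C' y * M"])
    show "(\<lambda>y. D g y v) \<in> borel_measurable lborel" using cc_integrable[OF dcc] by auto
    show "s n \<in> borel_measurable lborel" for n
      unfolding s_def[abs_def] using cc_integrable[OF s_cc, of n] cc_integrable[OF gcc] by auto
    have "integrable lborel (\<lambda>x. indicat_real C' x *\<^sub>R M)"
      by (rule borel_integrable_compact) (auto simp: C'_def)
    then show "integrable lborel (\<lambda>y. indicat_real C' y * M)" by simp
    show "AE y in lborel. norm (s n y) \<le> indicat_real C' y * M" for n
      using sM sC by (auto simp: indicator_def)
    have "(\<lambda>n. s n y) \<longlonglongrightarrow> D g y v" for y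
    proof -
      have "((\<lambda>k. (g (y + (0 + k) *\<^sub>R v) - g (y + 0 *\<^sub>R v)) / k) \<longlongrightarrow> D g (y + 0 *\<^sub>R v) v) (at 0)"
        using dline[of y 0] unfolding DERIV_def by simp
      moreover have "filterlim h (at 0) sequentially"
        unfolding filterlim_at h_def using LIMSEQ_inverse_real_of_nat by auto
      ultimately have "(\<lambda>n. (g (y + (0 + h n) *\<^sub>R v) - g (y + 0 *\<^sub>R v)) / h n) \<longlonglongrightarrow> D g (y + 0 *\<^sub>R v) v"
        by (rule filterlim_compose)
      then show ?thesis by (simp add: s_def add.commute)
    qed
    then show "AE y in lborel. (\<lambda>n. s n y) \<longlonglongrightarrow> D g y v" by auto
  qed
  then show ?thesis unfolding s0 by (simp add: LIMSEQ_const_iff)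
qed

definition integr :: "(complex^'m \<Rightarrow> real) \<Rightarrow> real" where
  "integr f = (LINT y|lborel. f (jota y))"

lemma cc_jota: "cc f \<Longrightarrow> cc (\<lambda>y. f (jota y :: complex^'m))"
proof -
  assume "cc f"
  then obtain C where C: "compact C" "\<And>y. y \<notin> C \<Longrightarrow> f y = 0" and f: "continuous_on UNIV f"
    unfolding cc_def by blast
  show ?thesis
  proof (rule ccI)
    show "continuous_on UNIV (\<lambda>y. f (jota y))"
      by (rule continuous_on_compose2[OF f]) (use linear_continuous_on[OF iota_bounded_linear(2)] in auto)
    show "compact (iota ` C)"
      by (rule compact_continuous_image[OF _ C(1)]) (rule linear_continuous_on[OF iota_bounded_linear(1)])
    show "f (jota y) = 0" if "y \<notin> iota ` C" for y
    proof (rule C(2))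
      show "jota y \<notin> C" using that by (metis imageI iota_works(6))
    qed
  qed
qed

lemma integr_integrable: "cc f \<Longrightarrow> integrable lborel (\<lambda>y. f (jota y))"
  by (rule cc_integrable[OF cc_jota])

lemma integr_sum: "(\<And>i. i \<in> I \<Longrightarrow> cc (f i)) \<Longrightarrow> integr (\<lambda>y. \<Sum>i\<in>I. f i y) = (\<Sum>i\<in>I. integr (f i))"
  unfolding integr_def by (rule Bochner_Integration.integral_sum) (rule integr_integrable)

lemma integr_add: "cc f \<Longrightarrow> cc g \<Longrightarrow> integr (\<lambda>y. f y + g y) = integr f + integr g"
  unfolding integr_def by (rule Bochner_Integration.integral_add) (rule integr_integrable, assumption)+

lemma integr_nonneg: "(\<And>y. 0 \<le> f y) \<Longrightarrow> 0 \<le> integr f"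
  unfolding integr_def by (rule Bochner_Integration.integral_nonneg)

text \<open>The function vanishes almost everywhere, and by continuity its non-zero set is open; a
  non-empty open set is not negligible.\<close>

lemma integr_eq_0:
  assumes f: "cc f" and nn: "\<And>y. 0 \<le> f y" and 0: "integr f = 0"
  shows "f y = 0"
proof -
  have "AE y in lborel. f (jota y) = 0"
    using integral_nonneg_eq_0_iff_AE[OF integr_integrable[OF f]] nn 0 by (simp add: integr_def)
  then obtain N where N: "{y. f (jota y) \<noteq> 0} \<subseteq> N" "N \<in> null_sets lborel"
    by (elim AE_E) (auto simp: null_sets_def)
  then have "N \<in> null_sets lebesgue" by (intro null_sets_completionI)
  then have "negligible {y. f (jota y) \<noteq> 0}"
    using N(1) negligible_subset negligible_iff_null_sets by blast
  moreover have "open {y. f (jota y) \<noteq> 0}"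
    using cc_jota[OF f] by (intro open_Collect_neq) (auto simp: cc_def)
  ultimately have "{y. f (jota y) \<noteq> 0} = {}" using open_not_negligible by blast
  then have "f (jota (iota y)) = 0" by blast
  then show ?thesis by (simp add: iota_works)
qed

lemma integr_divergence:
  fixes Z :: "complex^'m \<Rightarrow> complex^'m"
  assumes Z: "Ck_on (Suc 0) UNIV Z" and C: "compact C" "\<And>y. y \<notin> C \<Longrightarrow> Z y = 0"
  shows "integr (divergence Z) = 0"
proof -
  define g where "g b y = Z (jota y) \<bullet> b" for b y
  have Zd: "Z differentiable at y" for y using Ck_on_SucD(1)[OF Z] by simp
  have gC: "Ck_on (Suc 0) UNIV (g b)" for b
    unfolding g_def
    by (rule Ck_on_linear_comp[OF bounded_linear_inner_left], simp)
      (rule Ck_on_comp[OF _ _ _ Z Ck_on_linear[OF iota_bounded_linear(2)]], auto)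
  have Dg: "D (g b) y w = D Z (jota y) (jota w) \<bullet> b" for b y w
  proof -
    have "(g b has_derivative (\<lambda>w. D Z (jota y) (jota w) \<bullet> b)) (at y)"
      unfolding g_def
      by (rule bounded_linear.has_derivative[OF bounded_linear_inner_left])
        (rule has_derivative_compose[OF bounded_linear_imp_has_derivative[OF iota_bounded_linear(2)] has_derivative_D[OF Zd]])
    then show ?thesis by (simp add: D_eqI)
  qed
  have gz: "g b y = 0" if "y \<notin> iota ` C" for b y
  proof -
    have "jota y \<notin> C" using that by (metis imageI iota_works(6))
    then show ?thesis by (simp add: g_def C(2))
  qed
  have cC: "compact (iota ` C)"
    by (rule compact_continuous_image[OF _ C(1)]) (rule linear_continuous_on[OF iota_bounded_linear(1)])
  have "integr (divergence Z) = (LINT y|lborel. (\<Sum>b\<in>Basis. D (g b) y (iota b)))"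
    by (simp add: integr_def divergence_def Dg iota_works)
  also have "\<dots> = (\<Sum>b\<in>Basis. (LINT y|lborel. D (g b) y (iota b)))"
    by (rule Bochner_Integration.integral_sum) (rule cc_integrable[OF C1_derivative_cc[OF gC cC gz]])
  also have "\<dots> = 0"
    using integral_derivative_zero[OF gC cC gz] by simp
  finally show ?thesis .
qed

text \<open>The function h is the pulled back integrand extended by zero. Assuming \<open>cc\<close>
  for it as well as for f gives integrability on both sides beforehand.\<close>

lemma integr_change_of_variables:
  fixes T :: "complex^'m \<Rightarrow> complex^'m"
  assumes A: "open A" and d: "\<And>y. y \<in> A \<Longrightarrow> T differentiable at y" and inj: "inj_on T A"
    and f: "cc f" "\<And>y. y \<notin> T ` A \<Longrightarrow> f y = 0"
    and h: "cc h" "\<And>y. h y = (if y \<in> A then \<bar>det (matR (D T y))\<bar> * f (T y) else 0)"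
  shows "integr f = integr h"
proof -
  define A' where "A' = jota -` A"
  define G where "G = iota \<circ> T \<circ> jota"
  define G' where "G' y = iota \<circ> D T (jota y) \<circ> jota" for y
  \<comment> \<open>The change of variables formula is applied to vector valued functions, hence the
    values in \<open>real^1\<close>.\<close>
  define F where "F y = (vec (f (jota y)) :: real^1)" for y
  have A': "open A'" unfolding A'_def
    by (rule open_vimage[OF A]) (rule linear_continuous_on[OF iota_bounded_linear(2)])
  have GA: "y \<in> G ` A' \<longleftrightarrow> jota y \<in> T ` A" for y
  proof
    assume "y \<in> G ` A'"
    then show "jota y \<in> T ` A" by (auto simp: G_def A'_def iota_works)
  next
    assume "jota y \<in> T ` A"
    then obtain x where x: "x \<in> A" "jota y = T x" by blast
    then have "y = G (iota x)" "iota x \<in> A'" by (auto simp: G_def A'_def iota_works x(2)[symmetric])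
    then show "y \<in> G ` A'" by blast
  qed
  have dG: "(G has_derivative G' y) (at y within A')" if "y \<in> A'" for y
  proof -
    have "(G has_derivative G' y) (at y)"
      unfolding G_def G'_def comp_assoc
      by (intro diff_chain_at bounded_linear_imp_has_derivative iota_bounded_linear)
        (use that d in \<open>simp add: A'_def has_derivative_D\<close>)
    then show ?thesis by (rule has_derivative_at_withinI)
  qed
  have injG: "inj_on G A'"
    unfolding inj_on_def G_def A'_def comp_def
    by (metis inj inj_onD iota_works(5,6) vimageD)
  have mat: "matrix (G' y) = matR (D T (jota y))" for y
    by (simp add: G'_def matR_def)
  have ai: "(\<lambda>y. f (jota y)) absolutely_integrable_on UNIV" "(\<lambda>y. h (jota y)) absolutely_integrable_on UNIV"
    using integr_integrable[OF f(1)] integr_integrable[OF h(1)]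
    by (auto simp: set_integrable_def integrable_completion)
  have fr: "(\<lambda>y. if y \<in> G ` A' then f (jota y) else 0) = (\<lambda>y. f (jota y))"
    using f(2) GA by auto
  have hr: "(\<lambda>y. if y \<in> A' then \<bar>det (matrix (G' y))\<bar> * f (jota (G y)) else 0) = (\<lambda>y. h (jota y))"
    by (auto simp: h(2) A'_def mat G_def iota_works)
  have "(\<lambda>y. f (jota y)) absolutely_integrable_on G ` A'"
    using ai(1) absolutely_integrable_restrict_UNIV[of "G ` A'" "\<lambda>y. f (jota y)"] by (simp only: fr)
  then have "F absolutely_integrable_on G ` A'"
    by (subst absolutely_integrable_on_1_iff) (simp add: F_def)
  then have "integral (G ` A') F = integral A' (\<lambda>x. \<bar>det (matrix (G' x))\<bar> *\<^sub>R F (G x))"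
    by (intro integral_change_of_variables[OF _ dG injG]) (use A' in \<open>auto simp: lmeasurable_iff_has_integral\<close>)
  then have "integral (G ` A') (\<lambda>y. f (jota y)) = integral A' (\<lambda>y. \<bar>det (matrix (G' y))\<bar> * f (jota (G y)))"
    unfolding integral_on_1_eq by (simp add: F_def vec_eq_iff)
  then have "integral UNIV (\<lambda>y. f (jota y)) = integral UNIV (\<lambda>y. h (jota y))"
    using integral_restrict_UNIV[of "G ` A'" "\<lambda>y. f (jota y)"]
      integral_restrict_UNIV[of A' "\<lambda>y. \<bar>det (matrix (G' y))\<bar> * f (jota (G y))"] by (simp only: fr hr)
  then show ?thesis
    unfolding integr_def integral_lborel[OF integr_integrable[OF f(1)]] integral_lborel[OF integr_integrable[OF h(1)]] .
qed

subsection \<open>Bump functions\<close>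

text \<open>Squaring smooths the corner at 0: the difference quotient there is at most the modulus
  of the increment.\<close>

lemma C1_pos_part_square: "Ck_on (Suc 0) UNIV (\<lambda>t::real. (max 0 t)\<^sup>2)"
proof (rule Ck_on_Suc_deriv[where f' = "\<lambda>t v. 2 * max 0 t * v"])
  fix t :: real
  have "((\<lambda>t::real. (max 0 t)\<^sup>2) has_real_derivative 2 * max 0 t) (at t)"
  proof (cases "t = 0")
    case True
    have "((\<lambda>h::real. max 0 h * (max 0 h / h)) \<longlongrightarrow> 0) (at 0)"
    proof (rule Lim_null_comparison)
      show "\<forall>\<^sub>F h in at 0. norm (max 0 h * (max 0 h / h)) \<le> \<bar>h\<bar>"
        by (auto simp: eventually_at max_def intro!: exI[of _ 1])
      show "((\<lambda>h::real. \<bar>h\<bar>) \<longlongrightarrow> 0) (at 0)" by (auto intro!: tendsto_eq_intros)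
    qed
    then show ?thesis unfolding DERIV_def True by (simp add: power2_eq_square)
  next
    case False
    show ?thesis
    proof (cases "t > 0")
      case True
      have "((\<lambda>t::real. t\<^sup>2) has_real_derivative 2 * t) (at t)" by (auto intro!: derivative_eq_intros)
      then show ?thesis using True
        by (auto simp: max_def intro: DERIV_cong_ev[THEN iffD1, rotated -1, OF _ refl _ refl]
          has_field_derivative_transform_within_open[of "\<lambda>t. t\<^sup>2" _ _ "{0<..}"])
    next
      case False
      then have "t < 0" using \<open>t \<noteq> 0\<close> by simp
      then show ?thesis
        by (auto simp: max_def intro: has_field_derivative_transform_within_open[of "\<lambda>t. 0" _ _ "{..<0}"])
    qed
  qed
  then show "((\<lambda>t::real. (max 0 t)\<^sup>2) has_derivative (\<lambda>v. 2 * max 0 t * v)) (at t)"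
    by (simp add: has_field_derivative_def)
qed (auto intro!: continuous_intros)

text \<open>Polynomial inside the ball and only of class C^1 across the sphere, which is as much as
  one integration by parts requires.\<close>

definition bump :: "'b::euclidean_space \<Rightarrow> real \<Rightarrow> 'b \<Rightarrow> real" where
  "bump c r y = (max 0 (r\<^sup>2 - (norm (y - c))\<^sup>2))\<^sup>2"

lemma C1_bump: "Ck_on (Suc 0) UNIV (bump c r)"
proof -
  have "Ck_on (Suc 0) UNIV (\<lambda>y. r\<^sup>2 + - 1 * ((y + - c) \<bullet> (y + - c)))"
    by (intro Ck_on_add Ck_on_bilinear[OF bounded_bilinear_mult] Ck_on_bilinear[OF bounded_bilinear_inner]
        Ck_on_const Ck_on_linear[OF bounded_linear_ident]) auto
  then have "Ck_on (Suc 0) UNIV (\<lambda>y. r\<^sup>2 - (norm (y - c))\<^sup>2)"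
    by (simp only: power2_norm_eq_inner) simp
  from Ck_on_comp[OF open_UNIV open_UNIV _ C1_pos_part_square this]
  show ?thesis by (simp add: bump_def[abs_def])
qed

lemma bump_nonneg: "0 \<le> bump c r y" by (simp add: bump_def)

lemma bump_pos: "y \<in> ball c r \<Longrightarrow> 0 < bump c r y"
proof -
  assume "y \<in> ball c r"
  then have "norm (y - c) < r" by (simp add: dist_norm norm_minus_commute)
  then have "(norm (y - c))\<^sup>2 < r\<^sup>2" by (intro power_strict_mono) auto
  then show ?thesis by (simp add: bump_def)
qed

lemma bump_zero: "0 < r \<Longrightarrow> y \<notin> cball c r \<Longrightarrow> bump c r y = 0"
  by (auto simp: bump_def dist_norm norm_minus_commute max_def intro!: power_mono)


subsection \<open>Compact manifolds covered by charts\<close>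

text \<open>Charts are an indexed family, so that the index may carry more than the chart itself;
  later it is a pair consisting of a chart of the source and one of the target.\<close>

locale chart_family =
  fixes X :: "'a topology" and I :: "'i set" and U :: "'i \<Rightarrow> 'a set" and x :: "'i \<Rightarrow> 'a \<Rightarrow> complex^'m"
  assumes Haus: "Hausdorff_space X" and comp: "compact_space X"
    and U_open: "i \<in> I \<Longrightarrow> openin X (U i)"
    and img_open: "i \<in> I \<Longrightarrow> open (x i ` U i)"
    and homeo: "i \<in> I \<Longrightarrow> homeomorphic_map (subtopology X (U i)) (top_of_set (x i ` U i)) (x i)"
    and cover: "topspace X \<subseteq> (\<Union>i\<in>I. U i)"
    and trans: "i \<in> I \<Longrightarrow> j \<in> I \<Longrightarrow> smooth_on (x i ` (U i \<inter> U j)) (x j \<circ> inv_into (U i) (x i))"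
begin

definition p :: "'i \<Rightarrow> complex^'m \<Rightarrow> 'a" where "p i = inv_into (U i) (x i)"

definition dom :: "'i \<Rightarrow> (complex^'m) set" where "dom i = x i ` U i"

definition T :: "'i \<Rightarrow> 'i \<Rightarrow> complex^'m \<Rightarrow> complex^'m" where "T i j = x j \<circ> p i"

definition ov :: "'i \<Rightarrow> 'i \<Rightarrow> (complex^'m) set" where "ov i j = x i ` (U i \<inter> U j)"

lemma U_sub: "i \<in> I \<Longrightarrow> U i \<subseteq> topspace X"
  using U_open openin_subset by blast

lemma x_inj: "i \<in> I \<Longrightarrow> inj_on (x i) (U i)"
  using homeomorphic_imp_injective_map[OF homeo] U_sub by (simp add: topspace_subtopology Int_absorb1)

lemma p_x: "i \<in> I \<Longrightarrow> q \<in> U i \<Longrightarrow> p i (x i q) = q"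
  unfolding p_def by (rule inv_into_f_f[OF x_inj])

lemma x_p: "y \<in> dom i \<Longrightarrow> x i (p i y) = y"
  unfolding p_def dom_def by (rule f_inv_into_f)

lemma p_in: "y \<in> dom i \<Longrightarrow> p i y \<in> U i"
  unfolding p_def dom_def by (rule inv_into_into)

lemma x_in: "q \<in> U i \<Longrightarrow> x i q \<in> dom i"
  unfolding dom_def by blast

lemma open_domi: "i \<in> I \<Longrightarrow> open (dom i)"
  unfolding dom_def by (rule img_open)

lemma openin_preimage:
  assumes "i \<in> I" "open W" shows "openin X {q \<in> U i. x i q \<in> W}"
proof -
  have "continuous_map (subtopology X (U i)) (top_of_set (x i ` U i)) (x i)"
    by (rule homeomorphic_imp_continuous_map[OF homeo[OF assms(1)]])
  moreover have "openin (top_of_set (x i ` U i)) (x i ` U i \<inter> W)"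
    using assms(2) by (simp add: openin_open_Int)
  ultimately have "openin (subtopology X (U i)) {q \<in> topspace (subtopology X (U i)). x i q \<in> x i ` U i \<inter> W}"
    by (rule openin_continuous_map_preimage)
  then have "openin X {q \<in> topspace (subtopology X (U i)). x i q \<in> x i ` U i \<inter> W}"
    by (rule openin_trans_full[OF _ U_open[OF assms(1)]])
  moreover have "{q \<in> topspace (subtopology X (U i)). x i q \<in> x i ` U i \<inter> W} = {q \<in> U i. x i q \<in> W}"
    using U_sub[OF assms(1)] by auto
  ultimately show ?thesis by simp
qed

lemma open_image:
  assumes "i \<in> I" "openin X V" shows "open (x i ` (U i \<inter> V))"
proof -
  have "open_map (subtopology X (U i)) (top_of_set (x i ` U i)) (x i)"
    by (rule homeomorphic_imp_open_map[OF homeo[OF assms(1)]])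
  moreover have "openin (subtopology X (U i)) (U i \<inter> V)"
    by (rule openin_subtopology_Int2[OF assms(2)])
  ultimately have "openin (top_of_set (x i ` U i)) (x i ` (U i \<inter> V))"
    unfolding open_map_def by blast
  then show ?thesis using img_open[OF assms(1)] openin_open_eq by blast
qed

lemma open_ov: "i \<in> I \<Longrightarrow> j \<in> I \<Longrightarrow> open (ov i j)"
  unfolding ov_def by (rule open_image[OF _ U_open])

lemma ov_sub: "ov i j \<subseteq> dom i"
  unfolding ov_def dom_def by blast

lemma ov_iff: "i \<in> I \<Longrightarrow> y \<in> ov i j \<longleftrightarrow> y \<in> dom i \<and> p i y \<in> U j"
  unfolding ov_def dom_def using p_x by (auto simp: image_iff)

lemma T_smooth: "i \<in> I \<Longrightarrow> j \<in> I \<Longrightarrow> smooth_on (ov i j) (T i j)"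
  unfolding ov_def T_def p_def by (rule trans)

lemma T_in: "i \<in> I \<Longrightarrow> y \<in> ov i j \<Longrightarrow> T i j y \<in> ov j i"
  unfolding T_def by (simp add: ov_iff) (auto simp: ov_def intro: p_in[of y i])

lemma p_T: "i \<in> I \<Longrightarrow> j \<in> I \<Longrightarrow> y \<in> ov i j \<Longrightarrow> p j (T i j y) = p i y"
  by (simp add: T_def p_x ov_iff)

lemma T_T: "i \<in> I \<Longrightarrow> j \<in> I \<Longrightarrow> y \<in> ov i j \<Longrightarrow> T j i (T i j y) = y"
  using p_T[of i j y] x_p[of y i] by (simp add: T_def[of j i] ov_iff)

lemma compactin_p:
  assumes "i \<in> I" "compact C" "C \<subseteq> dom i"
  shows "compactin X (p i ` C)"
proof -
  obtain g where g: "homeomorphic_maps (subtopology X (U i)) (top_of_set (x i ` U i)) (x i) g"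
    using homeo[OF assms(1)] homeomorphic_map_maps by blast
  then have cg: "continuous_map (top_of_set (dom i)) (subtopology X (U i)) g"
    and gx: "\<And>q. q \<in> U i \<Longrightarrow> g (x i q) = q"
    using U_sub[OF assms(1)] unfolding homeomorphic_maps_def dom_def by auto
  have "compactin (top_of_set (dom i)) C"
    using assms by (simp add: compactin_subtopology)
  then have "compactin (subtopology X (U i)) (g ` C)"
    by (rule image_compactin[OF _ cg])
  then have "compactin X (g ` C)" by (simp add: compactin_subtopology)
  moreover have "g ` C = p i ` C"
    using assms(3) gx x_p p_in by (intro image_cong refl) (metis subsetD)
  ultimately show ?thesis by simp
qed

definition good :: "'i \<times> (complex^'m) \<times> real \<Rightarrow> bool" where
  "good s \<longleftrightarrow> (case s of (i, c, r) \<Rightarrow> i \<in> I \<and> 0 < r \<and> cball c r \<subseteq> dom i)"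

text \<open>The open balls cover while the closed balls stay inside their charts: the first gives
  positivity of bump functions, the second gives compact supports and compact sets on which to
  attain a maximum.\<close>

lemma finite_ball_cover:
  "\<exists>S. finite S \<and> (\<forall>s\<in>S. good s) \<and> topspace X \<subseteq> (\<Union>(i, c, r)\<in>S. {q \<in> U i. x i q \<in> ball c r})"
proof -
  define B where "B = (\<lambda>(i, c, r). {q \<in> U i. x i q \<in> ball c r})"
  have op: "openin X (B s)" if "good s" for s
    using that openin_preimage[of "fst s" "ball (fst (snd s)) (snd (snd s))"]
    by (auto simp: good_def B_def split: prod.splits)
  have cov: "topspace X \<subseteq> \<Union> (B ` Collect good)"
  proof
    fix q assume "q \<in> topspace X"
    then obtain i where i: "i \<in> I" "q \<in> U i" using cover by blast
    obtain r where r: "r > 0" "cball (x i q) r \<subseteq> dom i"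
      using open_domi[OF i(1)] x_in[OF i(2)] open_contains_cball by blast
    then have "good (i, x i q, r)" "q \<in> B (i, x i q, r)" using i by (auto simp: good_def B_def)
    then show "q \<in> \<Union> (B ` Collect good)" by blast
  qed
  have "\<exists>\<F>. finite \<F> \<and> \<F> \<subseteq> B ` Collect good \<and> topspace X \<subseteq> \<Union>\<F>"
    using comp op cov unfolding compact_space_def compactin_def by auto
  then obtain \<F> where F: "finite \<F>" "\<F> \<subseteq> B ` Collect good" "topspace X \<subseteq> \<Union>\<F>" by blast
  from finite_subset_image[OF F(1,2)] obtain S where S: "finite S" "S \<subseteq> Collect good" "\<F> = B ` S" by blast
  show ?thesis using S F(3) unfolding B_def by blast
qed

end

section \<open>Partition of unity and integration by parts\<close>

locale chart_cover = chart_family X I U x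
  for X :: "'a topology" and I :: "'i set" and U and x :: "'i \<Rightarrow> 'a \<Rightarrow> complex^'m" +
  fixes S :: "('i \<times> (complex^'m) \<times> real) set"
  assumes fin: "finite S" and S_good: "s \<in> S \<Longrightarrow> good s"
    and S_cover: "topspace X \<subseteq> (\<Union>(i, c, r)\<in>S. {q \<in> U i. x i q \<in> ball c r})"
begin

abbreviation ch :: "'i \<times> (complex^'m) \<times> real \<Rightarrow> 'i" where "ch s \<equiv> fst s"
abbreviation bl :: "'i \<times> (complex^'m) \<times> real \<Rightarrow> (complex^'m) set" where "bl s \<equiv> cball (fst (snd s)) (snd (snd s))"

lemma S_facts: assumes "s \<in> S" shows "ch s \<in> I" "0 < snd (snd s)" "bl s \<subseteq> dom (ch s)"
  using S_good[OF assms] by (auto simp: good_def split: prod.splits)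

definition beta :: "'i \<times> (complex^'m) \<times> real \<Rightarrow> 'a \<Rightarrow> real" where
  "beta s q = (if q \<in> U (ch s) then bump (fst (snd s)) (snd (snd s)) (x (ch s) q) else 0)"

definition supp :: "'i \<times> (complex^'m) \<times> real \<Rightarrow> 'a set" where
  "supp s = p (ch s) ` bl s"

lemma supp_iff: "s \<in> S \<Longrightarrow> q \<in> supp s \<longleftrightarrow> q \<in> U (ch s) \<and> x (ch s) q \<in> bl s"
proof
  assume s: "s \<in> S"
  note sf = S_facts[OF s]
  show "q \<in> U (ch s) \<and> x (ch s) q \<in> bl s" if h: "q \<in> supp s"
  proof -
    obtain y where y: "q = p (ch s) y" "y \<in> bl s" using h unfolding supp_def by blast
    then have "y \<in> dom (ch s)" using sf(3) by blast
    then show ?thesis using y by (simp add: x_p p_in)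
  qed
  show "q \<in> supp s" if "q \<in> U (ch s) \<and> x (ch s) q \<in> bl s"
    unfolding supp_def using that p_x[OF sf(1)] by (intro image_eqI[of _ _ "x (ch s) q"]) auto
qed

text \<open>Compact sets are closed in a Hausdorff space; this is where Hausdorffness enters the
  extension by zero.\<close>

lemma closedin_supp: "s \<in> S \<Longrightarrow> closedin X (supp s)"
  unfolding supp_def
proof -
  assume "s \<in> S"
  from S_facts[OF this] show "closedin X (p (ch s) ` bl s)"
    by (intro compactin_imp_closedin[OF Haus] compactin_p) simp_all
qed

lemma beta_supp: "s \<in> S \<Longrightarrow> q \<notin> supp s \<Longrightarrow> beta s q = 0"
  using S_facts[of s] by (auto simp: beta_def supp_iff intro: bump_zero)

lemma beta_nonneg: "0 \<le> beta s q"
  by (simp add: beta_def bump_nonneg)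

definition sigma :: "'a \<Rightarrow> real" where "sigma q = (\<Sum>s\<in>S. beta s q)"

lemma ex_beta_pos: assumes "q \<in> topspace X" shows "\<exists>s\<in>S. 0 < beta s q"
proof -
  obtain s where s: "s \<in> S" "q \<in> U (ch s)" "x (ch s) q \<in> ball (fst (snd s)) (snd (snd s))"
    using S_cover assms by fastforce
  then have "0 < beta s q" by (simp add: beta_def bump_pos)
  then show ?thesis using s by blast
qed

lemma sigma_pos: "q \<in> topspace X \<Longrightarrow> 0 < sigma q"
  unfolding sigma_def using ex_beta_pos fin beta_nonneg by (meson sum_pos2)

definition phi :: "'i \<times> (complex^'m) \<times> real \<Rightarrow> 'a \<Rightarrow> real" where "phi s q = beta s q / sigma q"

lemma phi_nonneg: "q \<in> topspace X \<Longrightarrow> 0 \<le> phi s q"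
  unfolding phi_def using beta_nonneg sigma_pos by (simp add: less_imp_le)

lemma phi_supp: "s \<in> S \<Longrightarrow> q \<notin> supp s \<Longrightarrow> phi s q = 0"
  by (simp add: phi_def beta_supp)

lemma sum_phi: "q \<in> topspace X \<Longrightarrow> (\<Sum>s\<in>S. phi s q) = 1"
  using sigma_pos[of q] by (simp add: phi_def sum_divide_distrib[symmetric] sigma_def[symmetric])

text \<open>The open set, in the coordinates of j, on which the partition function of s vanishes
  identically.\<close>

definition far :: "'i \<times> (complex^'m) \<times> real \<Rightarrow> 'i \<Rightarrow> (complex^'m) set" where
  "far s j = x j ` (U j \<inter> (topspace X - supp s))"

lemma open_far: "s \<in> S \<Longrightarrow> j \<in> I \<Longrightarrow> open (far s j)"
  unfolding far_def by (rule open_image) (auto intro: closedin_supp)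

lemma far_iff: "j \<in> I \<Longrightarrow> y \<in> far s j \<longleftrightarrow> y \<in> dom j \<and> p j y \<notin> supp s"
  using U_sub[of j] p_in[of y j] x_p[of y j] unfolding far_def
  by (auto simp: p_x x_in intro!: image_eqI[of y "x j" "p j y"])

lemma p_top: "j \<in> I \<Longrightarrow> y \<in> dom j \<Longrightarrow> p j y \<in> topspace X"
  using U_sub p_in by blast

text \<open>A point of chart j lies either in the chart of s, where a transition map expresses the
  function as a bump, or off the closed support, where it vanishes nearby.\<close>

lemma C1_beta:
  assumes s: "s \<in> S" and j: "j \<in> I"
  shows "Ck_on (Suc 0) (dom j) (\<lambda>y. beta s (p j y))"
proof (rule Ck_on_local[OF _ open_domi[OF j]])
  fix y assume y: "y \<in> dom j"
  note i = S_facts(1)[OF s]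
  show "\<exists>W. open W \<and> y \<in> W \<and> W \<subseteq> dom j \<and> Ck_on (Suc 0) W (\<lambda>y. beta s (p j y))"
  proof (cases "p j y \<in> U (ch s)")
    case True
    have "Ck_on (Suc 0) (ov j (ch s)) (\<lambda>y. bump (fst (snd s)) (snd (snd s)) (T j (ch s) y))"
      by (rule Ck_on_comp[OF open_ov[OF j i] open_UNIV _ C1_bump])
        (use smooth_onD(4)[OF T_smooth[OF j i] open_ov[OF j i]] in auto)
    then have "Ck_on (Suc 0) (ov j (ch s)) (\<lambda>y. beta s (p j y))"
      by (rule Ck_on_cong[OF open_ov[OF j i], rotated]) (simp add: beta_def T_def ov_iff[OF j])
    then show ?thesis using open_ov[OF j i] ov_sub[of j "ch s"] y True ov_iff[OF j] by blast
  next
    case False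
    have "Ck_on (Suc 0) (far s j) (\<lambda>y. beta s (p j y))"
      by (rule Ck_on_cong[OF open_far[OF s j] _ Ck_on_const[OF open_far[OF s j], of _ 0]])
        (simp add: far_iff[OF j] beta_supp[OF s])
    moreover have "y \<in> far s j" "far s j \<subseteq> dom j"
      using False y by (auto simp: far_iff[OF j] supp_iff[OF s])
    ultimately show ?thesis using open_far[OF s j] by blast
  qed
qed

lemma C1_phi:
  assumes s: "s \<in> S" and j: "j \<in> I"
  shows "Ck_on (Suc 0) (dom j) (\<lambda>y. phi s (p j y))"
  unfolding phi_def divide_inverse
proof (intro Ck_on_bilinear[OF bounded_bilinear_mult] open_domi j C1_beta s Ck_on_inverse)
  show "Ck_on (Suc 0) (dom j) (\<lambda>y. sigma (p j y))"
    unfolding sigma_def by (intro Ck_on_sum open_domi j C1_beta)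
  show "sigma (p j y) \<noteq> 0" if "y \<in> dom j" for y
    using sigma_pos[OF p_top[OF j that]] by simp
qed

lemma D_phi_far:
  assumes s: "s \<in> S" and j: "j \<in> I" and y: "y \<in> dom j" "p j y \<notin> supp s"
  shows "D (\<lambda>y. phi s (p j y)) y v = 0"
proof -
  have "D (\<lambda>y. phi s (p j y)) y = D (\<lambda>y. 0) y"
    by (rule D_cong[OF open_far[OF s j]]) (use y in \<open>auto simp: far_iff[OF j] phi_supp[OF s]\<close>)
  then show ?thesis by simp
qed

lemma D_phi_sum:
  assumes j: "j \<in> I" and y: "y \<in> dom j"
  shows "(\<Sum>s\<in>S. D (\<lambda>y. phi s (p j y)) y v) = 0"
proof -
  have "(\<Sum>s\<in>S. D (\<lambda>y. phi s (p j y)) y v) = D (\<lambda>y. \<Sum>s\<in>S. phi s (p j y)) y v"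
    by (rule D_sum[symmetric]) (use Ck_on_SucD(1)[OF C1_phi open_domi] j y in blast)
  also have "D (\<lambda>y. \<Sum>s\<in>S. phi s (p j y)) y = D (\<lambda>y. 1) y"
    by (rule D_cong[OF open_domi[OF j] y]) (simp add: sum_phi p_top[OF j])
  finally show ?thesis by simp
qed

lemma D_phi_transform:
  assumes s: "s \<in> S" and i: "i \<in> I" and j: "j \<in> I" and y: "y \<in> ov i j"
  shows "D (\<lambda>y. phi s (p i y)) y v = D (\<lambda>y. phi s (p j y)) (T i j y) (D (T i j) y v)"
proof -
  have Ty: "T i j y \<in> dom j" using T_in[OF i y] ov_sub by blast
  have "D (\<lambda>y. phi s (p i y)) y = D (\<lambda>y. phi s (p j (T i j y))) y"
    by (rule D_cong[OF open_ov[OF i j] y]) (simp add: p_T[OF i j])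
  also have "\<dots> = (\<lambda>v. D (\<lambda>y. phi s (p j y)) (T i j y) (D (T i j) y v))"
    by (rule D_eqI, rule has_derivative_compose[of "T i j"])
      (intro has_derivative_D smooth_onD(1)[OF T_smooth[OF i j] open_ov[OF i j] y] Ck_on_SucD(1)[OF C1_phi[OF s j] open_domi[OF j] Ty])+
  finally show ?thesis by simp
qed

text \<open>The fields \<open>Z i\<close> are the local expressions of a vector density.\<close>
theorem divergence_theorem:
  assumes Z: "\<And>i. i \<in> I \<Longrightarrow> Ck_on (Suc 0) (dom i) (Z i)"
    and tr: "\<And>i j y. i \<in> I \<Longrightarrow> j \<in> I \<Longrightarrow> y \<in> ov i j \<Longrightarrow>
      \<bar>det (matR (D (T i j) y))\<bar> *\<^sub>R Z j (T i j y) = D (T i j) y (Z i y)"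
    and nonneg: "\<And>i y. i \<in> I \<Longrightarrow> y \<in> dom i \<Longrightarrow> 0 \<le> divergence (Z i) y"
    and q: "q \<in> topspace X"
  shows "\<exists>i\<in>I. q \<in> U i \<and> (\<exists>W. open W \<and> x i q \<in> W \<and> W \<subseteq> dom i \<and> (\<forall>y\<in>W. divergence (Z i) y = 0))"
proof -
  define f where "f s j y = phi s (p j y)" for s j y
  have f1: "Ck_on (Suc 0) (dom j) (f s j)" if "s \<in> S" "j \<in> I" for s j
    unfolding f_def[abs_def] using C1_phi that by simp
  have fd: "f s j differentiable at y" if "s \<in> S" "j \<in> I" "y \<in> dom j" for s j y
    using Ck_on_SucD(1)[OF f1 open_domi] that by blast
  have fc: "continuous_on (dom j) (f s j)" if "s \<in> S" "j \<in> I" for s j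
    using Ck_on_continuous[OF f1] that by blast
  have Zd: "Z j differentiable at y" if "j \<in> I" "y \<in> dom j" for j y
    using Ck_on_SucD(1)[OF Z open_domi] that by blast
  have Zc: "continuous_on (dom j) (Z j)" if "j \<in> I" for j
    using Ck_on_continuous[OF Z] that by blast
  have DfZ: "continuous_on (dom j) (\<lambda>y. D (f s j) y (Z j y))" if "s \<in> S" "j \<in> I" for s j
  proof (rule continuous_on_eq)
    show "continuous_on (dom j) (\<lambda>y. \<Sum>b\<in>Basis. (Z j y \<bullet> b) *\<^sub>R D (f s j) y b)"
      using Ck_on_SucD(2)[OF f1[OF that] open_domi[OF that(2)]] Zc[OF that(2)]
      by (auto intro!: continuous_intros)
    show "(\<Sum>b\<in>Basis. (Z j y \<bullet> b) *\<^sub>R D (f s j) y b) = D (f s j) y (Z j y)" if "y \<in> dom j" for y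
      by (rule linear_euclidean_sum[symmetric]) (rule linear_D(1)[OF fd[OF \<open>s \<in> S\<close> \<open>j \<in> I\<close> that]])
  qed
  have divc: "continuous_on (dom j) (divergence (Z j))" if "j \<in> I" for j
    unfolding divergence_def[abs_def]
    using Ck_on_SucD(2)[OF Z[OF that] open_domi[OF that]] by (auto intro!: continuous_intros)
  have supp_bl: "p (ch s) y \<in> supp s \<longleftrightarrow> y \<in> bl s" if "s \<in> S" "y \<in> dom (ch s)" for s y
    using that by (simp add: supp_iff p_in x_p)
  \<comment> \<open>\<open>Aa\<close> and \<open>Bb\<close> are the two terms of the divergence of
    \<open>phi s\<close> times the field, in the chart of s.\<close>
  define Aa where "Aa s y = (if y \<in> dom (ch s) then f s (ch s) y * divergence (Z (ch s)) y else 0)" for s y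
  define Bb where "Bb s y = (if y \<in> dom (ch s) then D (f s (ch s)) y (Z (ch s) y) else 0)" for s y
  \<comment> \<open>\<open>Bs\<close> and \<open>Cs\<close> represent the same density,
    \<open>phi t\<close> times the derivative of \<open>phi s\<close> along the field, in the charts
    of s and of t respectively.\<close>
  define Bs where "Bs s t y = (if y \<in> dom (ch s) then f t (ch s) y * D (f s (ch s)) y (Z (ch s) y) else 0)" for s t y
  define Cs where "Cs s t y = (if y \<in> dom (ch t) then f t (ch t) y * D (f s (ch t)) y (Z (ch t) y) else 0)" for s t y
  have f0: "f s j y = 0" if "s \<in> S" "p j y \<notin> supp s" for s j y
    unfolding f_def by (rule phi_supp[OF that])
  have Df0: "D (f s j) y v = 0" if "s \<in> S" "j \<in> I" "y \<in> dom j" "p j y \<notin> supp s" for s j y v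
    unfolding f_def[abs_def] by (rule D_phi_far[OF that])
  have ccA: "cc (Aa s)" if s: "s \<in> S" for s
    unfolding Aa_def
    by (rule cc_extend[OF open_domi[OF S_facts(1)[OF s]] _ compact_cball S_facts(3)[OF s]])
      (auto intro!: continuous_on_mult fc[OF s] divc S_facts(1)[OF s] simp: f0[OF s] supp_bl[OF s])
  have ccB: "cc (Bb s)" if s: "s \<in> S" for s
    unfolding Bb_def
    by (rule cc_extend[OF open_domi[OF S_facts(1)[OF s]] DfZ[OF s S_facts(1)[OF s]] compact_cball S_facts(3)[OF s]])
      (simp add: Df0[OF s S_facts(1)[OF s]] supp_bl[OF s])
  have ccBs: "cc (Bs s t)" if s: "s \<in> S" and t: "t \<in> S" for s t
    unfolding Bs_def
    by (rule cc_extend[OF open_domi[OF S_facts(1)[OF s]] _ compact_cball S_facts(3)[OF s]])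
      (auto intro!: continuous_on_mult fc[OF t] DfZ[OF s] S_facts(1)[OF s] simp: Df0[OF s S_facts(1)[OF s]] supp_bl[OF s])
  have ccCs: "cc (Cs s t)" if s: "s \<in> S" and t: "t \<in> S" for s t
    unfolding Cs_def
    by (rule cc_extend[OF open_domi[OF S_facts(1)[OF t]] _ compact_cball S_facts(3)[OF t]])
      (auto intro!: continuous_on_mult fc[OF t] DfZ[OF s] S_facts(1)[OF t] simp: f0[OF t] supp_bl[OF t])
  have AB: "integr (Aa s) + integr (Bb s) = 0" if s: "s \<in> S" for s
  proof -
    note sf = S_facts[OF s]
    define Y where "Y y = (if y \<in> dom (ch s) then f s (ch s) y *\<^sub>R Z (ch s) y else 0)" for y
    have Y0: "Y y = 0" if "y \<notin> bl s" for y
      using that s by (auto simp: Y_def f_def phi_supp supp_bl)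
    have Yo: "Ck_on (Suc 0) (dom (ch s)) Y"
      by (rule Ck_on_cong[OF open_domi[OF sf(1)] _ Ck_on_bilinear[OF bounded_bilinear_scaleR open_domi[OF sf(1)] f1[OF s sf(1)] Z[OF sf(1)]]])
        (simp add: Y_def)
    have Yf: "Ck_on (Suc 0) (- bl s) Y"
      by (rule Ck_on_cong[OF _ _ Ck_on_const[of _ _ 0]]) (auto simp: Y0)
    have YC: "Ck_on (Suc 0) UNIV Y"
    proof (rule Ck_on_local)
      fix y :: "complex^'m"
      show "\<exists>W. open W \<and> y \<in> W \<and> W \<subseteq> UNIV \<and> Ck_on (Suc 0) W Y"
      proof (cases "y \<in> bl s")
        case True
        then show ?thesis using Yo open_domi[OF sf(1)] sf(3) by blast
      next
        case False
        have "open (- bl s)" by (rule open_Compl[OF closed_cball])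
        then show ?thesis using Yf False by blast
      qed
    qed simp
    have "divergence Y y = Aa s y + Bb s y" for y
    proof (cases "y \<in> dom (ch s)")
      case True
      have "D Y y = D (\<lambda>y. f s (ch s) y *\<^sub>R Z (ch s) y) y"
        by (rule D_cong[OF open_domi[OF sf(1)] True]) (simp add: Y_def)
      then have "divergence Y y = divergence (\<lambda>y. f s (ch s) y *\<^sub>R Z (ch s) y) y"
        by (simp add: divergence_def)
      then show ?thesis using True
        by (simp add: divergence_scaleR[OF fd[OF s sf(1) True] Zd[OF sf(1) True]] Aa_def Bb_def)
    next
      case False
      then have "y \<in> - bl s" using sf(3) by blast
      then have "D Y y = D (\<lambda>y. 0) y"
        by (intro D_cong[of "- bl s"]) (auto simp: Y0)
      then show ?thesis using False by (simp add: divergence_def Aa_def Bb_def)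
    qed
    then have "divergence Y = (\<lambda>y. Aa s y + Bb s y)" by (rule ext)
    then have "integr (divergence Y) = integr (\<lambda>y. Aa s y + Bb s y)" by (rule arg_cong)
    also have "\<dots> = integr (Aa s) + integr (Bb s)" by (rule integr_add[OF ccA[OF s] ccB[OF s]])
    finally show ?thesis using integr_divergence[OF YC compact_cball Y0] by simp
  qed
  \<comment> \<open>Insert 1 as the sum of all \<open>phi t\<close>.\<close>
  have BBs: "integr (Bb s) = (\<Sum>t\<in>S. integr (Bs s t))" if s: "s \<in> S" for s
  proof -
    have "Bb s = (\<lambda>y. \<Sum>t\<in>S. Bs s t y)"
    proof
      fix y
      show "Bb s y = (\<Sum>t\<in>S. Bs s t y)"
        using sum_phi[OF p_top[OF S_facts(1)[OF s]], of y]
        by (simp add: Bb_def Bs_def f_def sum_distrib_right[symmetric])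
    qed
    then show ?thesis using integr_sum[of S "Bs s"] ccBs[OF s] by simp
  qed
  \<comment> \<open>In the fixed chart of t the derivatives of the \<open>phi s\<close> add up to
    the derivative of 1.\<close>
  have CCs: "(\<Sum>s\<in>S. integr (Cs s t)) = 0" if t: "t \<in> S" for t
  proof -
    have "(\<lambda>y. \<Sum>s\<in>S. Cs s t y) = (\<lambda>y. 0)"
    proof
      fix y
      show "(\<Sum>s\<in>S. Cs s t y) = 0"
      proof (cases "y \<in> dom (ch t)")
        case True
        have "(\<Sum>s\<in>S. D (f s (ch t)) y (Z (ch t) y)) = 0"
          unfolding f_def[abs_def] by (rule D_phi_sum[OF S_facts(1)[OF t] True])
        then show ?thesis using True by (simp add: Cs_def sum_distrib_left[symmetric])
      qed (simp add: Cs_def)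
    qed
    then have "integr (\<lambda>y. \<Sum>s\<in>S. Cs s t y) = 0" by (simp add: integr_def)
    then show ?thesis using integr_sum[of S "\<lambda>s. Cs s t"] ccCs t by simp
  qed
  \<comment> \<open>The transformation law of a vector density is exactly what the change of
    variables requires. Off the overlap both functions vanish, since one of the two supports is
    missed.\<close>
  have BC: "integr (Bs s t) = integr (Cs s t)" if s: "s \<in> S" and t: "t \<in> S" for s t
  proof -
    note i = S_facts(1)[OF s] and j = S_facts(1)[OF t]
    let ?i = "ch s" and ?j = "ch t"
    have "integr (Cs s t) = integr (Bs s t)"
    proof (rule integr_change_of_variables[OF open_ov[OF i j]])
      show "T ?i ?j differentiable at y" if "y \<in> ov ?i ?j" for y
        by (rule smooth_onD(1)[OF T_smooth[OF i j] open_ov[OF i j] that])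
      show "inj_on (T ?i ?j) (ov ?i ?j)"
        by (rule inj_on_inverseI[of _ "T ?j ?i"]) (rule T_T[OF i j])
      show "cc (Cs s t)" "cc (Bs s t)" by (rule ccCs[OF s t], rule ccBs[OF s t])
      show "Cs s t y = 0" if y: "y \<notin> T ?i ?j ` ov ?i ?j" for y
      proof (cases "y \<in> dom ?j")
        case True
        have "p ?j y \<notin> U ?i"
        proof
          assume "p ?j y \<in> U ?i"
          then have "y \<in> ov ?j ?i" using True by (simp add: ov_iff[OF j])
          then have "T ?j ?i y \<in> ov ?i ?j" "y = T ?i ?j (T ?j ?i y)"
            using T_in[OF j] T_T[OF j i] by auto
          then show False using y by blast
        qed
        then have "p ?j y \<notin> supp s" by (simp add: supp_iff[OF s])
        then show ?thesis using Df0[OF s j True] by (simp add: Cs_def)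
      qed (simp add: Cs_def)
      show "Bs s t y = (if y \<in> ov ?i ?j then \<bar>det (matR (D (T ?i ?j) y))\<bar> * Cs s t (T ?i ?j y) else 0)" for y
      proof (cases "y \<in> ov ?i ?j")
        case True
        have yd: "y \<in> dom ?i" "T ?i ?j y \<in> dom ?j" using True T_in[OF i True] ov_sub by blast+
        have l: "linear (D (f s ?j) (T ?i ?j y))" by (rule linear_D(1)[OF fd[OF s j yd(2)]])
        have "\<bar>det (matR (D (T ?i ?j) y))\<bar> * D (f s ?j) (T ?i ?j y) (Z ?j (T ?i ?j y))
          = D (f s ?j) (T ?i ?j y) (D (T ?i ?j) y (Z ?i y))"
          unfolding tr[OF i j True, symmetric] by (simp add: linear_cmul[OF l])
        also have "\<dots> = D (f s ?i) y (Z ?i y)"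
          unfolding f_def[abs_def] by (rule D_phi_transform[OF s i j True, symmetric])
        finally have "\<bar>det (matR (D (T ?i ?j) y))\<bar> * Cs s t (T ?i ?j y) = f t ?j (T ?i ?j y) * D (f s ?i) y (Z ?i y)"
          using yd by (simp add: Cs_def mult_ac)
        moreover have "f t ?j (T ?i ?j y) = f t ?i y" by (simp add: f_def p_T[OF i j True])
        ultimately show ?thesis using True yd by (simp add: Bs_def)
      next
        case False
        have "f t ?i y = 0" if "y \<in> dom ?i"
        proof -
          have "p ?i y \<notin> U ?j" using False that by (simp add: ov_iff[OF i])
          then show ?thesis unfolding f_def by (intro phi_supp[OF t]) (simp add: supp_iff[OF t])
        qed
        then show ?thesis using False by (simp add: Bs_def)
      qed
    qed
    then show ?thesis by simp
  qed
  have "(\<Sum>s\<in>S. integr (Bb s)) = (\<Sum>s\<in>S. \<Sum>t\<in>S. integr (Cs s t))"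
    by (intro sum.cong refl) (simp add: BBs BC)
  also have "\<dots> = (\<Sum>t\<in>S. \<Sum>s\<in>S. integr (Cs s t))" by (rule sum.swap)
  also have "\<dots> = 0" by (simp add: CCs)
  finally have "(\<Sum>s\<in>S. integr (Aa s)) = 0"
    using sum.distrib[of "\<lambda>s. integr (Aa s)" "\<lambda>s. integr (Bb s)" S] AB by simp
  moreover have Ann: "0 \<le> Aa s y" if "s \<in> S" for s y
    using nonneg[of "ch s" y] S_facts(1)[OF that] phi_nonneg[OF p_top, of "ch s" y s]
    by (simp add: Aa_def f_def)
  then have "0 \<le> integr (Aa s)" if "s \<in> S" for s using that by (intro integr_nonneg)
  ultimately have A0: "integr (Aa s) = 0" if "s \<in> S" for s
    using fin that by (subst (asm) sum_nonneg_eq_0_iff) auto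
  have Az: "Aa s y = 0" if "s \<in> S" for s y
    by (rule integr_eq_0[OF ccA[OF that] Ann[OF that] A0[OF that]])
  \<comment> \<open>The integrals of the non-negative \<open>Aa s\<close> add up to zero, so each
    function vanishes and the divergence is zero where \<open>phi s\<close> is positive. Thus the
    chart in the conclusion is that of some s with positive bump at q.\<close>
  obtain s where s: "s \<in> S" "0 < beta s q" using ex_beta_pos[OF q] by blast
  note i = S_facts(1)[OF s(1)]
  have qU: "q \<in> U (ch s)" using s(2) by (auto simp: beta_def split: if_splits)
  have fq: "f s (ch s) (x (ch s) q) \<noteq> 0"
    using s(2) sigma_pos[OF q] by (simp add: f_def p_x[OF i qU] phi_def)
  define W where "W = {y \<in> dom (ch s). f s (ch s) y \<noteq> 0}"
  have "open W"
  proof -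
    have "open (dom (ch s) \<inter> f s (ch s) -` (- {0}))"
      by (rule continuous_open_preimage[OF fc[OF s(1) i] open_domi[OF i]]) (rule open_Compl[OF closed_singleton])
    moreover have "W = dom (ch s) \<inter> f s (ch s) -` (- {0})" by (auto simp: W_def)
    ultimately show ?thesis by simp
  qed
  moreover have "x (ch s) q \<in> W" using fq x_in[OF qU] by (simp add: W_def)
  moreover have "W \<subseteq> dom (ch s)" by (auto simp: W_def)
  moreover have "divergence (Z (ch s)) y = 0" if "y \<in> W" for y
    using Az[OF s(1), of y] that by (auto simp: W_def Aa_def)
  ultimately show ?thesis using i qU by blast
qed

end


section \<open>The maximum principle\<close>

text \<open>The first derivative is zero at the maximum; were the second positive, the first would
  be positive just after z on the line, and the mean value theorem would give a larger
  value.\<close>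

lemma second_derivative_local_max:
  fixes \<phi> :: "'b::real_normed_vector \<Rightarrow> real"
  assumes sm: "smooth_on S \<phi>" and S: "open S" and z: "z \<in> S" and max: "\<And>y. y \<in> S \<Longrightarrow> \<phi> y \<le> \<phi> z"
  shows "D (\<lambda>y. D \<phi> y v) z v \<le> 0"
proof (rule ccontr)
  assume "\<not> ?thesis"
  then have pos: "0 < D (\<lambda>y. D \<phi> y v) z v" by simp
  note dline = has_real_derivative_line
  have D0: "D \<phi> z v = 0"
  proof -
    have "D \<phi> z = (\<lambda>v. 0)"
      by (rule differential_zero_maxmin[OF z S has_derivative_D[OF smooth_onD(1)[OF sm S z]]]) (use max in auto)
    then show ?thesis by simp
  qed
  obtain e where e: "e > 0" "ball z e \<subseteq> S" using S z open_contains_ball by blast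
  have "((\<lambda>t. D \<phi> (z + t *\<^sub>R v) v) has_real_derivative D (\<lambda>y. D \<phi> y v) (z + 0 *\<^sub>R v) v) (at 0)"
    by (rule dline) (use smooth_onD(1)[OF smooth_onD(2)[OF sm S] S z] in simp)
  from DERIV_pos_inc_right[OF this] pos obtain d where d: "d > 0" "\<And>h. 0 < h \<Longrightarrow> h < d \<Longrightarrow> 0 < D \<phi> (z + h *\<^sub>R v) v"
    by (auto simp: D0)
  define N where "N = norm v + 1"
  have nv: "N > 0" "norm v \<le> N" unfolding N_def using norm_ge_zero[of v] by linarith+
  \<comment> \<open>The first bound stays where the derivative is positive, the second keeps the
    segment inside the ball of radius e.\<close>
  define h where "h = min (d / 2) (e / (2 * N))"
  have h: "0 < h" "h < d" using d(1) e(1) nv by (auto simp: h_def)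
  have "h * norm v < e"
  proof -
    have "h * norm v \<le> h * N" using h(1) nv by simp
    also have "\<dots> \<le> e / (2 * N) * N" using nv by (intro mult_right_mono) (auto simp: h_def)
    also have "\<dots> = e / 2" using nv by simp
    finally show ?thesis using e(1) by simp
  qed
  then have inS: "z + t *\<^sub>R v \<in> S" if "0 \<le> t" "t \<le> h" for t
    using that e(2) mult_right_mono[of t h "norm v"] by (auto simp: dist_norm subset_iff)
  have "\<exists>t::real. t > 0 \<and> t < h \<and> \<phi> (z + h *\<^sub>R v) - \<phi> (z + 0 *\<^sub>R v) = (h - 0) * D \<phi> (z + t *\<^sub>R v) v"
    by (rule MVT2[OF h(1)]) (intro dline smooth_onD(1)[OF sm S] inS)
  then obtain t where t: "0 < t" "t < h" "\<phi> (z + h *\<^sub>R v) - \<phi> z = h * D \<phi> (z + t *\<^sub>R v) v"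
    by auto
  have "0 < h * D \<phi> (z + t *\<^sub>R v) v" using d(2)[of t] t h by simp
  then show False using t(3) max[OF inS[of h]] h(1) by simp
qed

text \<open>The complex Hessian in direction u is a quarter of the Laplacian on the complex line
  through u, a sum of two second derivatives along real directions.\<close>

lemma levi_form_local_max:
  fixes L :: "complex^'m \<Rightarrow> complex"
  assumes sm: "smooth_on S L" and S: "open S" and z: "z \<in> S" and max: "\<And>y. y \<in> S \<Longrightarrow> Re (L y) \<le> Re (L z)"
  shows "Re (Dc (dirz u) (Dc (dirzb u) L) z) \<le> 0"
proof -
  note d1 = smooth_onD(1)[OF smooth_onD(2)[OF sm S] S z]
  have Lb: "Dc (dirzb u) L y = (D L y u + \<i> * D L y (\<i> *s u)) / 2" if "y \<in> S" for y
    by (rule Dc_dirz(2)[OF smooth_onD(1)[OF sm S that]])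
  have smb: "Dc (dirzb u) L differentiable at z"
    by (rule smooth_onD(1)[OF smooth_on_Dc[OF sm S] S z])
  have DD: "D (Dc (dirzb u) L) z w = (D (\<lambda>y. D L y u) z w + \<i> * D (\<lambda>y. D L y (\<i> *s u)) z w) / 2" for w
  proof -
    have "D (Dc (dirzb u) L) z = D (\<lambda>y. (1/2) * (D L y u + \<i> * D L y (\<i> *s u))) z"
      by (rule D_cong[OF S z]) (simp add: Lb)
    then have "D (Dc (dirzb u) L) z w = D (\<lambda>y. (1/2) * (D L y u + \<i> * D L y (\<i> *s u))) z w" by simp
    also have "\<dots> = (1/2) * D (\<lambda>y. D L y u + \<i> * D L y (\<i> *s u)) z w"
      by (rule D_linear_comp[OF bounded_linear_mult_right]) (simp add: d1 differentiable_mult differentiable_add)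
    also have "D (\<lambda>y. D L y u + \<i> * D L y (\<i> *s u)) z w = D (\<lambda>y. D L y u) z w + \<i> * D (\<lambda>y. D L y (\<i> *s u)) z w"
      by (simp add: D_linear_comp[OF bounded_linear_mult_right] D_add d1 differentiable_mult)
    finally show ?thesis by simp
  qed
  have sym: "D (\<lambda>y. D L y u) z (\<i> *s u) = D (\<lambda>y. D L y (\<i> *s u)) z u"
    by (rule D_D_commute[OF sm S z])
  have "Dc (dirz u) (Dc (dirzb u) L) z = (D (\<lambda>y. D L y u) z u + D (\<lambda>y. D L y (\<i> *s u)) z (\<i> *s u)) / 4"
    unfolding Dc_dirz(1)[OF smb] DD sym
    by (simp add: add_divide_distrib diff_divide_distrib algebra_simps)
  then have "Re (Dc (dirz u) (Dc (dirzb u) L) z) = Re ((D (\<lambda>y. D L y u) z u + D (\<lambda>y. D L y (\<i> *s u)) z (\<i> *s u)) / 4)"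
    by (rule arg_cong)
  then have eq: "Re (Dc (dirz u) (Dc (dirzb u) L) z) = (Re (D (\<lambda>y. D L y u) z u) + Re (D (\<lambda>y. D L y (\<i> *s u)) z (\<i> *s u))) / 4"
    by simp
  have neg: "Re (D (\<lambda>y. D L y v) z v) \<le> 0" for v
  proof -
    have "Re (D (\<lambda>y. D L y v) z v) = D (\<lambda>y. Re (D L y v)) z v"
      by (rule D_linear_comp[OF bounded_linear_Re d1, symmetric])
    also have "D (\<lambda>y. Re (D L y v)) z = D (\<lambda>y. D (\<lambda>y. Re (L y)) y v) z"
      by (rule D_cong[OF S z]) (rule D_linear_comp[OF bounded_linear_Re smooth_onD(1)[OF sm S], symmetric])
    also have "D (\<lambda>y. D (\<lambda>y. Re (L y)) y v) z v \<le> 0"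
      by (rule second_derivative_local_max[OF smooth_on_linear_comp[OF bounded_linear_Re S sm] S z max])
    finally show ?thesis .
  qed
  show ?thesis using neg[of u] neg[of "\<i> *s u"] unfolding eq by simp
qed

section \<open>The Levi form of the norm of a holomorphic section\<close>

context target_map
begin

lemma nab_add:
  assumes "smooth_on S s" "smooth_on S t" "z \<in> S"
  shows "nab \<xi> (\<lambda>y. s y + t y) z = nab \<xi> s z + nab \<xi> t z"
proof -
  have "(\<lambda>y. s y $ c) differentiable at z" "(\<lambda>y. t y $ c) differentiable at z" for c
    using smooth_onD(1)[OF smooth_on_nth[OF open_S] open_S] assms by blast+
  then show ?thesis by (simp add: vec_eq_iff nab_nth Dc_add GC_linear)
qed

lemma nab_smult:
  assumes "smooth_on S a" "smooth_on S s" "z \<in> S"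
  shows "nab \<xi> (\<lambda>y. a y *s s y) z = Dc \<xi> a z *s s z + a z *s nab \<xi> s z"
proof -
  have "(\<lambda>y. s y $ c) differentiable at z" "a differentiable at z" for c
    using smooth_onD(1)[OF smooth_on_nth[OF open_S] open_S] smooth_onD(1)[OF _ open_S] assms by blast+
  then show ?thesis by (simp add: vec_eq_iff nab_nth Dc_mult GC_linear algebra_simps)
qed

text \<open>As for holomorphic sections of a Hermitian bundle, the complex Hessian of the squared
  norm is the squared norm of the (1,0)-derivative plus a curvature term. The value
  \<open>s x = FX \<xi> x\<close> makes the latter minus a complex sectional curvature with Z =
  W.\<close>

lemma levi_norm_holomorphic_section:
  assumes s: "smooth_on S s" and x: "x \<in> S" and W: "open W" "x \<in> W" "W \<subseteq> S"
    and hol: "\<And>y. y \<in> W \<Longrightarrow> nab (cdir \<xi>) s y = 0"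
    and sx: "s x = FX \<xi> x"
    and curv: "\<And>P Q. Re (complex_riemann k (F x) P (vec_cnj Q) Q (vec_cnj P)) \<le> 0"
  shows "0 \<le> Re (Dc \<xi> (Dc (cdir \<xi>) (\<lambda>x. kC (F x) (s x) (vec_cnj (s x)))) x)"
proof -
  let ?s = "\<lambda>x. vec_cnj (s x)"
  note sb = smooth_vec_cnj[OF s]
  have hol': "nab \<xi> ?s y = 0" if "y \<in> W" for y
  proof -
    have "nab \<xi> ?s y = vec_cnj (nab (cdir \<xi>) s y)"
      using nab_cnj[OF s, of y "cdir \<xi>"] that W(3) by auto
    then show ?thesis by (simp add: hol[OF that]) (simp add: vec_eq_iff)
  qed
  have k0: "kC y 0 P = 0" "kC y P 0 = 0" for y P by (simp_all add: kC_def cform_def)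
  have "Dc (cdir \<xi>) (\<lambda>x. kC (F x) (s x) (?s x)) y = kC (F y) (s y) (nab (cdir \<xi>) ?s y)" if "y \<in> W" for y
    using Dc_kC[OF s sb, of y "cdir \<xi>"] that W(3) by (auto simp: hol k0)
  then have "Dc \<xi> (Dc (cdir \<xi>) (\<lambda>x. kC (F x) (s x) (?s x))) x = Dc \<xi> (\<lambda>y. kC (F y) (s y) (nab (cdir \<xi>) ?s y)) x"
    by (intro Dc_cong[OF W(1,2)]) auto
  also have "\<dots> = kC (F x) (nab \<xi> s x) (nab (cdir \<xi>) ?s x) + kC (F x) (s x) (nab \<xi> (nab (cdir \<xi>) ?s) x)"
    by (rule Dc_kC[OF s smooth_nab[OF sb] x])
  also have "nab (cdir \<xi>) ?s x = vec_cnj (nab \<xi> s x)"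
    by (rule nab_cnj[OF s x, symmetric])
  also have "nab \<xi> (nab (cdir \<xi>) ?s) x = RC (F x) (FX \<xi> x) (FX (cdir \<xi>) x) (?s x)"
  proof -
    \<comment> \<open>The inner derivative is zero on all of \<open>W\<close>, not just at x, so its
      derivative vanishes and the commutator formula leaves only the curvature.\<close>
    have "nab (cdir \<xi>) (nab \<xi> ?s) x = 0"
    proof -
      have "Dc (cdir \<xi>) (\<lambda>y. nab \<xi> ?s y $ c) x = Dc (cdir \<xi>) (\<lambda>y. 0) x" for c
        by (rule Dc_cong[OF W(1,2)]) (simp add: hol')
      then show ?thesis by (simp add: vec_eq_iff nab_nth hol'[OF W(2)] GC_nth) (simp add: cform_def)
    qed
    then show ?thesis using nab_commutator[OF sb x, of \<xi> "cdir \<xi>"] by simp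
  qed
  also have "kC (F x) (s x) (RC (F x) (FX \<xi> x) (FX (cdir \<xi>) x) (?s x))
     = - complex_riemann k (F x) (FX (cdir \<xi>) x) (FX \<xi> x) (FX (cdir \<xi>) x) (FX \<xi> x)"
  proof -
    have "kC (F x) (s x) (RC (F x) (FX \<xi> x) (FX (cdir \<xi>) x) (?s x)) = kC (F x) (RC (F x) (FX \<xi> x) (FX (cdir \<xi>) x) (?s x)) (s x)"
      by (rule kC_sym[OF F_in[OF x]])
    also have "\<dots> = - kC (F x) (RC (F x) (FX (cdir \<xi>) x) (FX \<xi> x) (?s x)) (s x)"
      by (subst RC_antisym) (simp add: kC_def cform_def sum_negf)
    finally show ?thesis by (simp add: kC_RC[OF F_in[OF x]] sx FX_cnj[OF x])
  qed
  finally have eq: "Dc \<xi> (Dc (cdir \<xi>) (\<lambda>x. kC (F x) (s x) (?s x))) x =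
    kC (F x) (nab \<xi> s x) (vec_cnj (nab \<xi> s x)) + - complex_riemann k (F x) (FX (cdir \<xi>) x) (FX \<xi> x) (FX (cdir \<xi>) x) (FX \<xi> x)" .
  have "Re (complex_riemann k (F x) (FX (cdir \<xi>) x) (FX \<xi> x) (FX (cdir \<xi>) x) (FX \<xi> x)) \<le> 0"
    using curv[of "FX (cdir \<xi>) x" "FX (cdir \<xi>) x"] by (simp add: FX_cnj[OF x])
  then show ?thesis unfolding eq using kC_norm_pos(2)[OF F_in[OF x], of "nab \<xi> s x"] by simp
qed

end

section \<open>Holomorphic sectional curvature through constant vectors\<close>

context kaehler_domain
begin

definition hsc :: "complex^'m \<Rightarrow> complex^'m \<Rightarrow> complex" where
  "hsc z u = (\<Sum>\<alpha>\<in>UNIV. \<Sum>\<beta>\<in>UNIV. \<Sum>\<gamma>\<in>UNIV. \<Sum>\<delta>\<in>UNIV.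
          kaehler_curvature H z \<alpha> \<beta> \<gamma> \<delta> * u $ \<alpha> * cnj (u $ \<beta>) * u $ \<gamma> * cnj (u $ \<delta>))"

abbreviation h :: "complex^'m \<Rightarrow> complex^'m \<Rightarrow> complex^'m \<Rightarrow> complex" where
  "h u v \<equiv> \<lambda>z. herm_form (H z) u v"

lemma Dc_h_expand:
  assumes z: "z \<in> S"
  shows "Dc \<xi> (h u v) z = (\<Sum>\<gamma>\<in>UNIV. \<Sum>\<delta>\<in>UNIV. u $ \<gamma> * cnj (v $ \<delta>) * Dc \<xi> (\<lambda>z. H z $ \<gamma> $ \<delta>) z)"
  unfolding herm_form_def
  by (simp add: Dc_sum Dc_mult H_diff[OF z] differentiable_mult differentiable_sum mult_ac)

lemma Dc_Dc_h_expand: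
  assumes z: "z \<in> S"
  shows "Dc \<eta> (Dc \<xi> (h u v)) z = (\<Sum>\<gamma>\<in>UNIV. \<Sum>\<delta>\<in>UNIV. u $ \<gamma> * cnj (v $ \<delta>) * Dc \<eta> (Dc \<xi> (\<lambda>z. H z $ \<gamma> $ \<delta>)) z)"
proof -
  have d: "Dc \<xi> (\<lambda>z. H z $ \<gamma> $ \<delta>) differentiable at z" for \<gamma> \<delta>
    by (rule smooth_onD(1)[OF smooth_on_Dc[OF H_nth_smooth open_dom] open_dom z])
  have "Dc \<eta> (Dc \<xi> (h u v)) z = Dc \<eta> (\<lambda>z. \<Sum>\<gamma>\<in>UNIV. \<Sum>\<delta>\<in>UNIV. u $ \<gamma> * cnj (v $ \<delta>) * Dc \<xi> (\<lambda>z. H z $ \<gamma> $ \<delta>) z) z"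
    by (rule Dc_cong[OF open_dom z]) (rule Dc_h_expand)
  then show ?thesis by (simp add: Dc_sum Dc_mult d differentiable_mult differentiable_sum)
qed

text \<open>The inverse metric in the curvature formula is resolved by a unitary frame. The first
  order term then is a squared norm, namely that of the covariant derivative of the constant field u
  along u.\<close>

lemma hsc_eq:
  assumes z: "z \<in> S" and E: "frame_at (H z) E"
  shows "hsc z u = - Dc (dirz u) (Dc (dirzb u) (h u u)) z
    + (\<Sum>a\<in>UNIV. Dc (dirz u) (h u (E a)) z * cnj (Dc (dirz u) (h u (E a)) z))"
proof -
  have dH: "Dc \<xi> (\<lambda>w. H w $ \<gamma> $ \<delta>) differentiable at z" for \<xi> \<gamma> \<delta>
    by (rule smooth_onD(1)[OF smooth_on_Dc[OF H_nth_smooth open_dom] open_dom z])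
  have dd: "d_z \<alpha> (d_zbar \<beta> (\<lambda>w. H w $ \<gamma> $ \<delta>)) z = Dc (dirz (axis \<alpha> 1)) (Dc (dirzb (axis \<beta> 1)) (\<lambda>w. H w $ \<gamma> $ \<delta>)) z" for \<alpha> \<beta> \<gamma> \<delta>
  proof -
    have e: "d_zbar \<beta> (\<lambda>w. H w $ \<gamma> $ \<delta>) y = Dc (dirzb (axis \<beta> 1)) (\<lambda>w. H w $ \<gamma> $ \<delta>) y" if "y \<in> S" for y
      by (rule d_zbar_eq[OF H_diff[OF that]])
    have "D (d_zbar \<beta> (\<lambda>w. H w $ \<gamma> $ \<delta>)) z = D (Dc (dirzb (axis \<beta> 1)) (\<lambda>w. H w $ \<gamma> $ \<delta>)) z"
      by (rule D_cong[OF open_dom z]) (rule e)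
    then have "d_z \<alpha> (d_zbar \<beta> (\<lambda>w. H w $ \<gamma> $ \<delta>)) z = d_z \<alpha> (Dc (dirzb (axis \<beta> 1)) (\<lambda>w. H w $ \<gamma> $ \<delta>)) z"
      by (simp add: d_z_def)
    then show ?thesis by (simp add: d_z_eq[OF dH])
  qed
  define R1 where "R1 = (\<Sum>\<alpha>\<in>UNIV. \<Sum>\<beta>\<in>UNIV. \<Sum>\<gamma>\<in>UNIV. \<Sum>\<delta>\<in>UNIV.
     Dc (dirz (axis \<alpha> 1)) (Dc (dirzb (axis \<beta> 1)) (\<lambda>w. H w $ \<gamma> $ \<delta>)) z * (u $ \<alpha> * cnj (u $ \<beta>) * u $ \<gamma> * cnj (u $ \<delta>)))"
  define R2 where "R2 = (\<Sum>\<alpha>\<in>UNIV. \<Sum>\<beta>\<in>UNIV. \<Sum>\<gamma>\<in>UNIV. \<Sum>\<delta>\<in>UNIV. \<Sum>\<mu>\<in>UNIV. \<Sum>\<nu>\<in>UNIV. K z $ \<nu> $ \<mu>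
          * Dc (dirz (axis \<alpha> 1)) (\<lambda>w. H w $ \<gamma> $ \<nu>) z * Dc (dirzb (axis \<beta> 1)) (\<lambda>w. H w $ \<mu> $ \<delta>) z * (u $ \<alpha> * cnj (u $ \<beta>) * u $ \<gamma> * cnj (u $ \<delta>)))"
  have "hsc z u = - R1 + R2"
    unfolding hsc_def kaehler_curvature_def dd d_z_eq[OF H_diff[OF z]] d_zbar_eq[OF H_diff[OF z]] R1_def R2_def
    by (simp add: right_diff_distrib left_diff_distrib distrib_right distrib_left sum.distrib sum_subtractf sum_negf sum_distrib_left sum_distrib_right mult_ac)
  moreover have "R1 = Dc (dirz u) (Dc (dirzb u) (h u u)) z"
  proof -
    have "Dc (dirz u) (Dc (dirzb u) f) z = (\<Sum>\<alpha>\<in>UNIV. \<Sum>\<beta>\<in>UNIV. u $ \<alpha> * (cnj (u $ \<beta>) * Dc (dirz (axis \<alpha> 1)) (Dc (dirzb (axis \<beta> 1)) f) z))"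
      if f: "smooth_on S f" for f
    proof -
      note df = smooth_onD(1)[OF smooth_on_Dc[OF f open_dom] open_dom z]
      have "Dc \<xi> (Dc (dirzb u) f) z = (\<Sum>\<beta>\<in>UNIV. cnj (u $ \<beta>) * Dc \<xi> (Dc (dirzb (axis \<beta> 1)) f) z)" for \<xi>
      proof -
        have "Dc \<xi> (Dc (dirzb u) f) z = Dc \<xi> (\<lambda>z. \<Sum>\<beta>\<in>UNIV. cnj (u $ \<beta>) * Dc (dirzb (axis \<beta> 1)) f z) z"
          by (rule Dc_cong[OF open_dom z]) (rule Dc_dirz_expand(2)[OF smooth_onD(1)[OF f open_dom]])
        then show ?thesis by (simp add: Dc_sum Dc_mult df differentiable_mult)
      qed
      then show ?thesis
        by (subst Dc_dirz_expand(1)[OF df]) (simp add: sum_distrib_left)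
    qed
    note ex = this[OF H_nth_smooth]
    have "Dc (dirz u) (Dc (dirzb u) (h u u)) z = (\<Sum>\<gamma>\<in>UNIV. \<Sum>\<delta>\<in>UNIV. \<Sum>\<alpha>\<in>UNIV. \<Sum>\<beta>\<in>UNIV.
     Dc (dirz (axis \<alpha> 1)) (Dc (dirzb (axis \<beta> 1)) (\<lambda>w. H w $ \<gamma> $ \<delta>)) z * (u $ \<alpha> * cnj (u $ \<beta>) * u $ \<gamma> * cnj (u $ \<delta>)))"
      unfolding Dc_Dc_h_expand[OF z] ex by (simp add: sum_distrib_left mult_ac)
    also have "\<dots> = (\<Sum>\<gamma>\<in>UNIV. \<Sum>\<alpha>\<in>UNIV. \<Sum>\<beta>\<in>UNIV. \<Sum>\<delta>\<in>UNIV.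
     Dc (dirz (axis \<alpha> 1)) (Dc (dirzb (axis \<beta> 1)) (\<lambda>w. H w $ \<gamma> $ \<delta>)) z * (u $ \<alpha> * cnj (u $ \<beta>) * u $ \<gamma> * cnj (u $ \<delta>)))"
      by (intro sum.cong[OF refl] trans[OF sum.swap sum.cong[OF refl sum.swap]])
    also have "\<dots> = R1"
      unfolding R1_def by (rule trans[OF sum.swap sum.cong[OF refl sum.swap]])
    finally show ?thesis by simp
  qed
  moreover have "R2 = (\<Sum>a\<in>UNIV. Dc (dirz u) (h u (E a)) z * cnj (Dc (dirz u) (h u (E a)) z))"
  proof -
    \<comment> \<open>With u in all four slots the first order term factors: \<open>P\<close>
      gathers the unbarred and \<open>Q\<close> the barred derivatives.\<close>
    define P where "P \<nu> = (\<Sum>\<alpha>\<in>UNIV. \<Sum>\<gamma>\<in>UNIV. u $ \<alpha> * u $ \<gamma> * Dc (dirz (axis \<alpha> 1)) (\<lambda>w. H w $ \<gamma> $ \<nu>) z)" for \<nu>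
    define Q where "Q \<mu> = (\<Sum>\<beta>\<in>UNIV. \<Sum>\<delta>\<in>UNIV. cnj (u $ \<beta>) * cnj (u $ \<delta>) * Dc (dirzb (axis \<beta> 1)) (\<lambda>w. H w $ \<mu> $ \<delta>) z)" for \<mu>
    have cH: "cnj (Dc \<xi> (\<lambda>w. H w $ \<gamma> $ \<nu>) z) = Dc (cdir \<xi>) (\<lambda>w. H w $ \<nu> $ \<gamma>) z" for \<xi> \<gamma> \<nu>
    proof -
      have "Dc (cdir \<xi>) (\<lambda>w. H w $ \<nu> $ \<gamma>) z = Dc (cdir \<xi>) (\<lambda>w. cnj (H w $ \<gamma> $ \<nu>)) z"
        by (rule Dc_cong[OF open_dom z]) (rule H_cnj)
      then show ?thesis by (simp add: Dc_cnj[OF H_diff[OF z]])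
    qed
    have PQ: "Q \<mu> = cnj (P \<mu>)" for \<mu>
      unfolding P_def Q_def by (simp add: cH)
    have PE: "Dc (dirz u) (h u v) z = (\<Sum>\<nu>\<in>UNIV. cnj (v $ \<nu>) * P \<nu>)" for v
    proof -
      have "Dc (dirz u) (h u v) z = (\<Sum>\<gamma>\<in>UNIV. \<Sum>\<nu>\<in>UNIV. \<Sum>\<alpha>\<in>UNIV. cnj (v $ \<nu>) * (u $ \<alpha> * u $ \<gamma> * Dc (dirz (axis \<alpha> 1)) (\<lambda>w. H w $ \<gamma> $ \<nu>) z))"
        unfolding Dc_h_expand[OF z] by (subst Dc_dirz_expand(1)[OF H_diff[OF z]]) (simp add: sum_distrib_left mult_ac)
      also have "\<dots> = (\<Sum>\<nu>\<in>UNIV. \<Sum>\<alpha>\<in>UNIV. \<Sum>\<gamma>\<in>UNIV. cnj (v $ \<nu>) * (u $ \<alpha> * u $ \<gamma> * Dc (dirz (axis \<alpha> 1)) (\<lambda>w. H w $ \<gamma> $ \<nu>) z))"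
        by (rule trans[OF sum.swap sum.cong[OF refl sum.swap]])
      finally show ?thesis by (simp add: P_def sum_distrib_left)
    qed
    let ?t = "\<lambda>\<alpha> \<beta> \<gamma> \<delta> \<mu> \<nu>. K z $ \<nu> $ \<mu>
          * Dc (dirz (axis \<alpha> 1)) (\<lambda>w. H w $ \<gamma> $ \<nu>) z * Dc (dirzb (axis \<beta> 1)) (\<lambda>w. H w $ \<mu> $ \<delta>) z * (u $ \<alpha> * cnj (u $ \<beta>) * u $ \<gamma> * cnj (u $ \<delta>))"
    have "R2 = (\<Sum>\<alpha>\<in>UNIV. \<Sum>\<beta>\<in>UNIV. \<Sum>\<gamma>\<in>UNIV. \<Sum>\<mu>\<in>UNIV. \<Sum>\<nu>\<in>UNIV. \<Sum>\<delta>\<in>UNIV. ?t \<alpha> \<beta> \<gamma> \<delta> \<mu> \<nu>)"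
      unfolding R2_def by (intro sum.cong[OF refl] trans[OF sum.swap sum.cong[OF refl sum.swap]])
    also have "\<dots> = (\<Sum>\<alpha>\<in>UNIV. \<Sum>\<beta>\<in>UNIV. \<Sum>\<mu>\<in>UNIV. \<Sum>\<nu>\<in>UNIV. \<Sum>\<gamma>\<in>UNIV. \<Sum>\<delta>\<in>UNIV. ?t \<alpha> \<beta> \<gamma> \<delta> \<mu> \<nu>)"
      by (intro sum.cong[OF refl] trans[OF sum.swap sum.cong[OF refl sum.swap]])
    also have "\<dots> = (\<Sum>\<alpha>\<in>UNIV. \<Sum>\<mu>\<in>UNIV. \<Sum>\<nu>\<in>UNIV. \<Sum>\<beta>\<in>UNIV. \<Sum>\<gamma>\<in>UNIV. \<Sum>\<delta>\<in>UNIV. ?t \<alpha> \<beta> \<gamma> \<delta> \<mu> \<nu>)"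
      by (intro sum.cong[OF refl] trans[OF sum.swap sum.cong[OF refl sum.swap]])
    also have "\<dots> = (\<Sum>\<mu>\<in>UNIV. \<Sum>\<nu>\<in>UNIV. \<Sum>\<alpha>\<in>UNIV. \<Sum>\<beta>\<in>UNIV. \<Sum>\<gamma>\<in>UNIV. \<Sum>\<delta>\<in>UNIV. ?t \<alpha> \<beta> \<gamma> \<delta> \<mu> \<nu>)"
      by (intro trans[OF sum.swap sum.cong[OF refl sum.swap]])
    also have "\<dots> = (\<Sum>\<mu>\<in>UNIV. \<Sum>\<nu>\<in>UNIV. \<Sum>\<alpha>\<in>UNIV. \<Sum>\<gamma>\<in>UNIV. \<Sum>\<beta>\<in>UNIV. \<Sum>\<delta>\<in>UNIV. ?t \<alpha> \<beta> \<gamma> \<delta> \<mu> \<nu>)"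
      by (intro sum.cong[OF refl] sum.swap)
    also have "\<dots> = (\<Sum>\<mu>\<in>UNIV. \<Sum>\<nu>\<in>UNIV. K z $ \<nu> $ \<mu> * P \<nu> * Q \<mu>)"
      unfolding P_def Q_def by (simp add: sum_distrib_left sum_distrib_right mult_ac)
    also have "\<dots> = (\<Sum>\<mu>\<in>UNIV. \<Sum>\<nu>\<in>UNIV. \<Sum>a\<in>UNIV. (cnj (E a $ \<nu>) * P \<nu>) * (E a $ \<mu> * Q \<mu>))"
      by (simp add: frame_K[OF z E] sum_distrib_left sum_distrib_right mult_ac)
    also have "\<dots> = (\<Sum>a\<in>UNIV. \<Sum>\<mu>\<in>UNIV. \<Sum>\<nu>\<in>UNIV. (cnj (E a $ \<nu>) * P \<nu>) * (E a $ \<mu> * Q \<mu>))"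
      by (rule trans[OF sum.cong[OF refl sum.swap] sum.swap])
    also have "\<dots> = (\<Sum>a\<in>UNIV. (\<Sum>\<nu>\<in>UNIV. cnj (E a $ \<nu>) * P \<nu>) * (\<Sum>\<mu>\<in>UNIV. E a $ \<mu> * Q \<mu>))"
      unfolding sum_product by (rule sum.cong[OF refl sum.swap])
    also have "\<dots> = (\<Sum>a\<in>UNIV. Dc (dirz u) (h u (E a)) z * cnj (Dc (dirz u) (h u (E a)) z))"
      by (simp add: PE PQ)
    finally show ?thesis .
  qed
  ultimately show ?thesis by simp
qed

end

section \<open>Exclusion of a positive maximum\<close>

context kaehler_map
begin

text \<open>Test the function \<open>psi(U, U) - l h(U, U)\<close> along the field \<open>U = u + \<tau> w\<close> with \<open>\<tau>\<close> holomorphic,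
  vanishing at \<open>z\<close> and of derivative 1 in the direction \<open>u\<close>, where \<open>w\<close> makes the covariant derivative of \<open>U\<close>
  along \<open>u\<close> vanish at \<open>z\<close>.\<close>
lemma no_positive_maximum:
  assumes z: "z \<in> S" and u: "u \<noteq> 0" and l: "0 < (l :: real)" and Om: "open Om" "z \<in> Om" "Om \<subseteq> S"
    and plh: "\<And>y v w. y \<in> Om \<Longrightarrow> nab (dirzb v) (FX (dirz w)) y = 0"
    and le: "\<And>y v. y \<in> S \<Longrightarrow> Re (psi (dirz v) (dirz v) y) \<le> l * Re (herm_form (H y) v v)"
    and eq: "Re (psi (dirz u) (dirz u) z) = l * Re (herm_form (H z) u u)"
    and curv: "\<And>P Q. Re (complex_riemann k (F z) P (vec_cnj Q) Q (vec_cnj P)) \<le> 0"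
    and pos: "0 < Re (hsc z u)"
  shows False
proof -
  obtain E where E: "frame_at (H z) E" using frame_ex[OF z] by blast
  define P where "P a = Dc (dirz u) (h u (E a)) z" for a
  \<comment> \<open>Minus the covariant derivative at z of the constant field u along itself; its
    characterisation without frames is \<open>hw\<close> below.\<close>
  define w where "w = (\<Sum>a\<in>UNIV. (- P a) *s E a)"
  \<comment> \<open>The linear form \<open>ell\<close> is the Euclidean Hermitian projection onto u,
    normalised so that \<open>ell u = 1\<close>.\<close>
  define nn where "nn = (\<Sum>i\<in>UNIV. cnj (u $ i) * u $ i)"
  define ell where "ell v = (\<Sum>i\<in>UNIV. cnj (u $ i) * v $ i) / nn" for v :: "complex^'m"
  define tau where "tau y = ell y - ell z" for y
  have nn: "nn \<noteq> 0"
  proof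
    assume 0: "nn = 0"
    have "nn = complex_of_real (\<Sum>i\<in>UNIV. (cmod (u $ i))\<^sup>2)"
      unfolding nn_def of_real_sum by (intro sum.cong refl) (metis complex_norm_square mult.commute)
    then have "(\<Sum>i\<in>UNIV. (cmod (u $ i))\<^sup>2) = 0" using 0 by (metis of_real_eq_0_iff)
    then have "\<forall>i. u $ i = 0" by (simp add: sum_nonneg_eq_0_iff)
    then show False using u by (simp add: vec_eq_iff)
  qed
  have ell_lin: "ell (v + v') = ell v + ell v'" "ell (c *s v) = c * ell v" for v v' c
    by (simp_all add: ell_def algebra_simps sum.distrib add_divide_distrib sum_distrib_left)
  have ell_u: "ell u = 1" using nn by (simp add: ell_def nn_def)
  have bl: "bounded_linear ell"
    by (rule linear_conv_bounded_linear[THEN iffD1], rule linearI)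
      (simp_all add: ell_lin scaleR_eq_smult scaleR_conv_of_real)
  have tau_s: "smooth_on S tau"
    unfolding tau_def by (intro smooth_on_diff smooth_on_const smooth_on_linear open_S bl)
  have tau_d: "tau differentiable at y" if "y \<in> S" for y by (rule smooth_onD(1)[OF tau_s open_S that])
  have tauD: "D tau y v = ell v" for y v
  proof -
    have "(tau has_derivative (\<lambda>v. ell v - 0)) (at y)"
      unfolding tau_def by (intro has_derivative_diff bounded_linear_imp_has_derivative bl has_derivative_const)
    then show ?thesis by (simp add: D_eqI)
  qed
  have tau1: "Dc (dirz u) tau y = 1" "Dc (dirzb u) tau y = 0" if "y \<in> S" for y
    using Dc_dirz[OF tau_d[OF that], of u] by (simp_all add: tauD ell_lin ell_u)
  have ctau_s: "smooth_on S (\<lambda>y. cnj (tau y))"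
    by (rule smooth_on_linear_comp[OF bounded_linear_cnj open_S tau_s])
  have ctau_d: "(\<lambda>y. cnj (tau y)) differentiable at y" if "y \<in> S" for y by (rule smooth_onD(1)[OF ctau_s open_S that])
  have ctau1: "Dc (dirz u) (\<lambda>y. cnj (tau y)) y = 0" "Dc (dirzb u) (\<lambda>y. cnj (tau y)) y = 1" if "y \<in> S" for y
    using tau1[OF that] by (simp_all add: Dc_cnj[OF tau_d[OF that]])
  have tau0: "tau z = 0" by (simp add: tau_def)
  define s where "s y = FX (dirz u) y + tau y *s FX (dirz w) y" for y
  have tw: "smooth_on S (\<lambda>y. tau y *s FX (dirz w) y)"
    by (rule smooth_on_vec[OF open_S]) (simp add: smooth_on_mult[OF open_S tau_s smooth_on_nth[OF open_S smooth_FX]])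
  have s_s: "smooth_on S s"
    unfolding s_def by (rule smooth_on_add[OF open_S smooth_FX tw])
  have s_eq: "s y = FX (dirz (u + tau y *s w)) y" if "y \<in> S" for y
    using Dc_dirz_linear[OF smooth_onD(1)[OF smooth_on_F_nth open_S that]]
    by (simp add: s_def vec_eq_iff FX_nth)
  \<comment> \<open>Pluriharmonicity makes both sections holomorphic along u, and \<open>tau\<close>
    has no (0,1)-derivative; this holds on all of \<open>Om\<close>, as required for differentiating
    once more.\<close>
  have hol: "nab (dirzb u) s y = 0" if "y \<in> Om" for y
  proof -
    have y: "y \<in> S" using that Om(3) by blast
    show ?thesis unfolding s_def nab_add[OF smooth_FX tw y] nab_smult[OF tau_s smooth_FX y] plh[OF that] tau1(2)[OF y]
      by simp
  qed
  define G where "G y = kC (F y) (s y) (vec_cnj (s y))" for y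
  have G_s: "smooth_on S G" unfolding G_def by (intro smooth_kC s_s smooth_vec_cnj)
  have G_pos: "0 \<le> Re (Dc (dirz u) (Dc (dirzb u) G) z)"
    unfolding G_def[abs_def]
    by (rule levi_norm_holomorphic_section[OF s_s z Om hol _ curv]) (simp_all add: s_def tau0)
  \<comment> \<open>The norm \<open>h(U, U)\<close> with the powers of \<open>tau\<close> separated,
    so that only derivatives of h between constant vectors occur.\<close>
  define HH where "HH y = h u u y + cnj (tau y) * h u w y + tau y * h w u y + (tau y * cnj (tau y)) * h w w y" for y
  have HH_eq: "HH y = herm_form (H y) (u + tau y *s w) (u + tau y *s w)" for y
    by (simp add: HH_def herm_form_linear algebra_simps)
  have HH_s: "smooth_on S HH"
    unfolding HH_def by (intro smooth_on_add smooth_on_mult h_smooth tau_s ctau_s open_S)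
  note hb_s = smooth_on_Dc[OF h_smooth open_S]
  note hb_d = smooth_onD(1)[OF hb_s open_S]
  define B where "B y = Dc (dirzb u) (h u u) y + (h u w y + cnj (tau y) * Dc (dirzb u) (h u w) y)
    + tau y * Dc (dirzb u) (h w u) y + ((tau y * cnj (tau y)) * Dc (dirzb u) (h w w) y + tau y * h w w y)" for y
  have HHb: "Dc (dirzb u) HH y = B y" if y: "y \<in> S" for y
    unfolding HH_def B_def
    by (simp add: Dc_add Dc_mult h_diff[OF y] tau_d[OF y] ctau_d[OF y] differentiable_add differentiable_mult tau1[OF y] ctau1[OF y])
  have "Dc (dirz u) (Dc (dirzb u) HH) z = Dc (dirz u) B z"
    by (rule Dc_cong[OF open_S z]) (rule HHb)
  also have "\<dots> = Dc (dirz u) (Dc (dirzb u) (h u u)) z + Dc (dirz u) (h u w) z + Dc (dirzb u) (h w u) z + h w w z"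
    unfolding B_def
    by (simp add: Dc_add Dc_mult h_diff[OF z] hb_d[OF z] tau_d[OF z] ctau_d[OF z] differentiable_add differentiable_mult tau1[OF z] ctau1[OF z] tau0)
  finally have HHbb: "Dc (dirz u) (Dc (dirzb u) HH) z =
    Dc (dirz u) (Dc (dirzb u) (h u u)) z + Dc (dirz u) (h u w) z + Dc (dirzb u) (h w u) z + h w w z" .
  have hsum: "Dc (dirz u) (h u (\<Sum>a\<in>UNIV. c a *s E a)) z = (\<Sum>a\<in>UNIV. cnj (c a) * P a)" for c
    unfolding P_def herm_form_sum herm_form_linear
    by (simp add: Dc_sum Dc_mult h_diff[OF z] differentiable_mult)
  have hw: "herm_form (H z) w v = - Dc (dirz u) (h u v) z" for v
  proof -
    have "v = (\<Sum>a\<in>UNIV. herm_form (H z) v (E a) *s E a)" using E by (simp add: frame_at_def)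
    then have "Dc (dirz u) (h u v) z = (\<Sum>a\<in>UNIV. cnj (herm_form (H z) v (E a)) * P a)"
      using hsum[of "\<lambda>a. herm_form (H z) v (E a)"] by simp
    then show ?thesis
      by (simp add: w_def herm_form_sum herm_form_linear h_cnj[OF z] sum_negf mult.commute)
  qed
  define Q where "Q = (\<Sum>a\<in>UNIV. P a * cnj (P a))"
  have d1: "Dc (dirz u) (h u w) z = - Q"
    unfolding w_def hsum by (simp add: Q_def sum_negf mult.commute)
  have d2: "h w w z = Q" using hw[of w] d1 by simp
  have cQ: "cnj Q = Q" by (simp add: Q_def mult.commute)
  have d3: "Dc (dirzb u) (h w u) z = - Q"
  proof -
    have "Dc (dirzb u) (h w u) z = Dc (dirzb u) (\<lambda>y. cnj (h u w y)) z"
      by (rule Dc_cong[OF open_S z]) (simp add: h_cnj)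
    also have "\<dots> = cnj (Dc (dirz u) (h u w) z)" by (simp add: Dc_cnj[OF h_diff[OF z]])
    finally show ?thesis by (simp add: d1 cQ)
  qed
  \<comment> \<open>The two cross terms contribute \<open>- Q\<close> each and
    \<open>h w w z\<close> contributes \<open>Q\<close>; the remaining \<open>- Q\<close> is the
    first order part of the curvature.\<close>
  have "Dc (dirz u) (Dc (dirzb u) HH) z = - hsc z u"
    unfolding HHbb d1 d2 d3 hsc_eq[OF z E] by (simp add: Q_def P_def)
  then have H_neg: "Re (Dc (dirz u) (Dc (dirzb u) HH) z) < 0" using pos by simp
  define L where "L y = G y - complex_of_real l * HH y" for y
  have L_s: "smooth_on S L"
    unfolding L_def by (intro smooth_on_diff smooth_on_mult smooth_on_const G_s HH_s open_S)
  have ReL: "Re (L y) = Re (psi (dirz (u + tau y *s w)) (dirz (u + tau y *s w)) y) - l * Re (herm_form (H y) (u + tau y *s w) (u + tau y *s w))" if "y \<in> S" for y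
    by (simp add: L_def G_def HH_eq s_eq[OF that] psi_def)
  have "Re (L z) = 0" unfolding ReL[OF z] tau0 using eq by simp
  moreover have "Re (L y) \<le> 0" if "y \<in> S" for y unfolding ReL[OF that] using le[OF that] by simp
  ultimately have "Re (Dc (dirz u) (Dc (dirzb u) L) z) \<le> 0"
    by (intro levi_form_local_max[OF L_s open_S z]) auto
  moreover have "Dc (dirz u) (Dc (dirzb u) L) z = Dc (dirz u) (Dc (dirzb u) G) z - l * Dc (dirz u) (Dc (dirzb u) HH) z"
  proof -
    have Lb: "Dc (dirzb u) L y = Dc (dirzb u) G y - l * Dc (dirzb u) HH y" if y: "y \<in> S" for y
      unfolding L_def using smooth_onD(1)[OF G_s open_S y] smooth_onD(1)[OF HH_s open_S y]
      by (simp add: Dc_diff Dc_mult differentiable_mult)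
    have "Dc (dirz u) (Dc (dirzb u) L) z = Dc (dirz u) (\<lambda>y. Dc (dirzb u) G y - l * Dc (dirzb u) HH y) z"
      by (rule Dc_cong[OF open_S z]) (rule Lb)
    then show ?thesis
      using smooth_onD(1)[OF smooth_on_Dc[OF G_s open_S] open_S z] smooth_onD(1)[OF smooth_on_Dc[OF HH_s open_S] open_S z]
      by (simp add: Dc_diff Dc_mult differentiable_mult)
  qed
  ultimately have "Re (Dc (dirz u) (Dc (dirzb u) G) z) \<le> l * Re (Dc (dirz u) (Dc (dirzb u) HH) z)" by simp
  moreover have "l * Re (Dc (dirz u) (Dc (dirzb u) HH) z) < 0" using l H_neg by (rule mult_pos_neg)
  ultimately show False using G_pos by linarith
qed

end


section \<open>Change of charts\<close>

lemma (in target_map) FX_real: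
  assumes "y \<in> S"
  shows "FX \<xi> y = cvec (D F y (fst \<xi>)) + \<i> *s cvec (D F y (snd \<xi>))"
proof -
  have "D (\<lambda>x. complex_of_real (F x $ e)) y v = complex_of_real (D F y v $ e)" for e v
    using D_linear_comp[OF bounded_linear_compose[OF bounded_linear_of_real bounded_linear_vec_nth[of e]] smooth_onD(1)[OF F_smooth open_S assms]] .
  then show ?thesis by (simp add: vec_eq_iff FX_nth Dc_def)
qed

context kaehler_map
begin

lemma FX_dirz_real:
  assumes "z \<in> S"
  shows "FX (dirz u) z = (1/2) *s cvec (D F z u) - (\<i>/2) *s cvec (D F z (\<i> *s u))"
proof -
  have l: "linear (D F z)" by (rule linear_D(1)[OF smooth_onD(1)[OF F_smooth open_S assms]])
  show ?thesis
    unfolding FX_real[OF assms] dirz_def fst_conv snd_conv linear_cmul[OF l]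
    by (simp add: vec_eq_iff)
qed

text \<open>Expresses psi by the real pulled back metric alone. Hence a change of target chart
  leaves psi unchanged without any transformation law for complexified objects of the
  target.\<close>

lemma psi_real:
  assumes z: "z \<in> S"
  defines "e \<equiv> \<lambda>a b. complex_of_real (k (F z) (D F z a) (D F z b))"
  shows "psi (dirz u) (dirz w) z = (e u w + e (\<i> *s u) (\<i> *s w) + \<i> * (e u (\<i> *s w) - e (\<i> *s u) w)) / 4"
proof -
  have "vec_cnj (FX (dirz w) z) = (1/2) *s cvec (D F z w) + (\<i>/2) *s cvec (D F z (\<i> *s w))"
    by (simp add: FX_dirz_real[OF z] vec_eq_iff)
  then show ?thesis
    unfolding psi_def FX_dirz_real[OF z, of u]
    by (simp add: kC_linear kC_cvec[OF F_in[OF z]] e_def algebra_simps add_divide_distrib diff_divide_distrib)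
qed

text \<open>Positivity of the complexified metric kills the (1,0)-part of the differential, whose
  real part is half the real differential.\<close>

lemma psi_zero_imp:
  assumes z: "z \<in> S" and "\<And>u. Re (psi (dirz u) (dirz u) z) \<le> 0"
  shows "D F z v = 0"
proof -
  have "FX (dirz v) z = 0"
    using kC_norm_pos(3)[OF F_in[OF z], of "FX (dirz v) z"] assms(2)[of v] unfolding psi_def by force
  then have "\<forall>c. FX (dirz v) z $ c = 0" by simp
  then have "\<forall>c. D F z v $ c = 0" unfolding FX_dirz_real[OF z] by (simp add: complex_eq_iff)
  then show ?thesis by (simp add: vec_eq_iff)
qed

lemma Dc_psi_expand_fixed:
  assumes z: "z \<in> S"
  shows "Dc \<xi> (psi (dirz u) (dirz w)) z = (\<Sum>i\<in>UNIV. \<Sum>j\<in>UNIV. (u $ i * cnj (w $ j)) *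
     Dc \<xi> (psi (dirz (axis i 1)) (dirz (axis j 1))) z)"
proof -
  have "Dc \<xi> (psi (dirz u) (dirz w)) z = Dc \<xi> (\<lambda>z. \<Sum>i\<in>UNIV. \<Sum>j\<in>UNIV. (u $ i * cnj (w $ j)) * psi (dirz (axis i 1)) (dirz (axis j 1)) z) z"
    by (rule Dc_cong[OF open_dom z]) (rule psi_expand)
  then show ?thesis by (simp add: Dc_sum Dc_mult psi_diff[OF z] differentiable_mult differentiable_sum)
qed

end

text \<open>Two coordinate expressions of one map, with possibly different charts on both sides. The
  change of target chart is recorded only as equality \<open>pull\<close> of the pulled back
  metrics.\<close>

locale kaehler_transition = A: kaehler_map Y k S F H + B: kaehler_map Y' k' S' F' H'
  for Y :: "(real^'n) set" and k and S :: "(complex^'m) set" and F H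
    and Y' :: "(real^'n) set" and k' and S' :: "(complex^'m) set" and F' H' +
  fixes T :: "complex^'m \<Rightarrow> complex^'m" and Om :: "(complex^'m) set"
  assumes open_Om: "open Om" and Om_sub: "Om \<subseteq> S" and T_smooth: "smooth_on Om T"
    and T_in: "z \<in> Om \<Longrightarrow> T z \<in> S'"
    and hol: "z \<in> Om \<Longrightarrow> D T z (c *s v) = c *s D T z v"
    and surj: "z \<in> Om \<Longrightarrow> surj (D T z)"
    and herm: "z \<in> Om \<Longrightarrow> herm_form (H z) u v = herm_form (H' (T z)) (D T z u) (D T z v)"
    and pull: "z \<in> Om \<Longrightarrow> k (F z) (D F z u) (D F z v) =
      k' (F' (T z)) (D F' (T z) (D T z u)) (D F' (T z) (D T z v))"
begin

lemma psi_transform: "z \<in> Om \<Longrightarrow> A.psi (dirz u) (dirz w) z = B.psi (dirz (D T z u)) (dirz (D T z w)) (T z)"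
  using Om_sub by (auto simp: A.psi_real B.psi_real T_in pull hol)

lemma T_diff: "z \<in> Om \<Longrightarrow> T differentiable at z"
  by (rule smooth_onD(1)[OF T_smooth open_Om])

lemma T_lin: "z \<in> Om \<Longrightarrow> linear (D T z)"
  by (rule linear_D(1)[OF T_diff])

lemma DT_nth_smooth: "smooth_on Om (\<lambda>y. D T y u $ i)"
  by (rule smooth_on_nth[OF open_Om smooth_onD(2)[OF T_smooth open_Om]])

lemma DT_nth_diff: "z \<in> Om \<Longrightarrow> (\<lambda>y. D T y u $ i) differentiable at z"
  by (rule smooth_onD(1)[OF DT_nth_smooth open_Om])

lemma DT_diff: "z \<in> Om \<Longrightarrow> (\<lambda>y. D T y u) differentiable at z"
  by (rule smooth_onD(1)[OF smooth_onD(2)[OF T_smooth open_Om] open_Om])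

text \<open>The Jacobian of a holomorphic map has holomorphic entries: commuting the two derivatives
  moves \<open>\<i>\<close> from the direction of the outer derivative into the complex linear inner
  one.\<close>

lemma Dc_DT:
  assumes z: "z \<in> Om"
  shows "Dc (dirzb v) (\<lambda>y. D T y u $ i) z = 0" "Dc (dirz v) (\<lambda>y. D T y u $ i) z = D (\<lambda>y. D T y u) z v $ i"
proof -
  have n: "D (\<lambda>y. D T y u $ i) z w = D (\<lambda>y. D T y u) z w $ i" for u w
    by (rule D_linear_comp[OF bounded_linear_vec_nth DT_diff[OF z]])
  have "D (\<lambda>y. D T y u) z (\<i> *s v) = D (\<lambda>y. D T y (\<i> *s v)) z u"
    by (rule D_D_commute[OF T_smooth open_Om z])
  also have "D (\<lambda>y. D T y (\<i> *s v)) z = D (\<lambda>y. \<i> *s D T y v) z"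
    by (rule D_cong[OF open_Om z]) (rule hol)
  also have "D (\<lambda>y. \<i> *s D T y v) z u $ i = \<i> * (D (\<lambda>y. D T y v) z u $ i)"
  proof -
    have bl: "bounded_linear (\<lambda>w :: complex^'m. \<i> *s w)"
      by (rule linear_conv_bounded_linear[THEN iffD1]) (auto intro!: linearI simp: vec_eq_iff algebra_simps)
    show ?thesis using D_linear_comp[OF bl DT_diff[OF z]] by simp
  qed
  also have "D (\<lambda>y. D T y v) z u = D (\<lambda>y. D T y u) z v"
    by (rule D_D_commute[OF T_smooth open_Om z])
  finally have "D (\<lambda>y. D T y u $ i) z (\<i> *s v) = \<i> * (D (\<lambda>y. D T y u $ i) z v)" by (simp add: n)
  then show "Dc (dirzb v) (\<lambda>y. D T y u $ i) z = 0" "Dc (dirz v) (\<lambda>y. D T y u $ i) z = D (\<lambda>y. D T y u) z v $ i"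
    by (simp_all add: Dc_dirz DT_nth_diff[OF z] n)
qed

lemma Dc_comp_T:
  assumes z: "z \<in> Om" and \<phi>: "\<phi> differentiable at (T z)"
  shows "Dc (dirzb v) (\<lambda>y. \<phi> (T y)) z = Dc (dirzb (D T z v)) \<phi> (T z)"
proof -
  have c: "((\<lambda>y. \<phi> (T y)) has_derivative (\<lambda>w. D \<phi> (T z) (D T z w))) (at z)"
    by (rule has_derivative_compose[OF has_derivative_D[OF T_diff[OF z]] has_derivative_D[OF \<phi>]])
  then have "(\<lambda>y. \<phi> (T y)) differentiable at z" by (rule differentiableI)
  then show ?thesis by (simp add: Dc_dirz \<phi> D_eqI[OF c] hol[OF z])
qed

text \<open>The derivative of psi also produces a term with the second derivative of
  \<open>T\<close> in directions v and w. It is symmetric in v and w and cancels by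
  antisymmetrisation.\<close>

lemma Wf_transform:
  assumes z: "z \<in> Om"
  shows "A.Wf v u w z = B.Wf (D T z v) (D T z u) (D T z w) (T z)"
proof -
  define ps where "ps i j = B.psi (dirz (axis i 1)) (dirz (axis j 1))" for i j
  have ps_d: "ps i j differentiable at (T y)" if "y \<in> Om" for i j y
    unfolding ps_def by (rule B.psi_diff[OF T_in[OF that]])
  have psT_d: "(\<lambda>y. ps i j (T y)) differentiable at z" for i j
    using differentiable_compose[of "ps i j" T z] ps_d[OF z] T_diff[OF z] by simp
  have cd: "(\<lambda>y. cnj (D T y u $ i)) differentiable at z" for u i
    using bounded_linear.has_derivative[OF bounded_linear_cnj has_derivative_D[OF DT_nth_diff[OF z]]] differentiableI by blast
  have A: "Dc (dirzb v) (A.psi (dirz u) (dirz w)) z = (\<Sum>i\<in>UNIV. \<Sum>j\<in>UNIV.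
      D T z u $ i * cnj (D (\<lambda>y. D T y w) z v $ j) * ps i j (T z)
      + (D T z u $ i * cnj (D T z w $ j)) * Dc (dirzb (D T z v)) (ps i j) (T z))" for v w
  proof -
    have "Dc (dirzb v) (A.psi (dirz u) (dirz w)) z = Dc (dirzb v) (\<lambda>y. \<Sum>i\<in>UNIV. \<Sum>j\<in>UNIV. (D T y u $ i * cnj (D T y w $ j)) * ps i j (T y)) z"
      by (rule Dc_cong[OF open_Om z]) (simp add: psi_transform B.psi_expand[OF T_in, of _ "D T _ u" "D T _ w"] ps_def)
    also have "\<dots> = (\<Sum>i\<in>UNIV. \<Sum>j\<in>UNIV. Dc (dirzb v) (\<lambda>y. (D T y u $ i * cnj (D T y w $ j)) * ps i j (T y)) z)"
      by (simp add: Dc_sum DT_nth_diff[OF z] cd psT_d differentiable_mult differentiable_sum)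
    also have "\<dots> = (\<Sum>i\<in>UNIV. \<Sum>j\<in>UNIV.
      D T z u $ i * cnj (D (\<lambda>y. D T y w) z v $ j) * ps i j (T z)
      + (D T z u $ i * cnj (D T z w $ j)) * Dc (dirzb (D T z v)) (ps i j) (T z))"
      by (simp add: Dc_mult DT_nth_diff[OF z] cd psT_d differentiable_mult Dc_DT[OF z] Dc_cnj[OF DT_nth_diff[OF z]]
          Dc_comp_T[OF z ps_d[OF z]] add.commute)
    finally show ?thesis .
  qed
  have sym: "D (\<lambda>y. D T y w) z v = D (\<lambda>y. D T y v) z w"
    by (rule D_D_commute[OF T_smooth open_Om z])
  show ?thesis
    unfolding A.Wf_def A unfolding B.Wf_def
    unfolding B.Dc_psi_expand_fixed[OF T_in[OF z], folded ps_def] sym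
    by (simp add: sum.distrib)
qed

lemma frame_transform:
  assumes z: "z \<in> Om" and E: "frame_at (H z) E"
  shows "frame_at (H' (T z)) (\<lambda>a. D T z (E a))"
  unfolding frame_at_def
proof
  fix u'
  obtain u where u: "u' = D T z u" using surj[OF z] by (metis surjD)
  have "u = (\<Sum>a\<in>UNIV. herm_form (H z) u (E a) *s E a)" using E by (simp add: frame_at_def)
  then have "u' = D T z (\<Sum>a\<in>UNIV. herm_form (H z) u (E a) *s E a)" using u by simp
  also have "\<dots> = (\<Sum>a\<in>UNIV. herm_form (H' (T z)) u' (D T z (E a)) *s D T z (E a))"
    by (simp add: linear_sum[OF T_lin[OF z]] hol[OF z] herm[OF z] u)
  finally show "(\<Sum>a\<in>UNIV. herm_form (H' (T z)) u' (D T z (E a)) *s D T z (E a)) = u'" by simp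
qed

text \<open>A unitary frame at z is carried to one at \<open>T z\<close>, so the two frame
  expressions of the field match term by term.\<close>

lemma V_transform:
  assumes z: "z \<in> Om"
  shows "B.V (T z) = D T z (A.V z)"
proof -
  have zS: "z \<in> S" using z Om_sub by blast
  obtain E where E: "frame_at (H z) E" using A.frame_ex[OF zS] by blast
  show ?thesis
    unfolding A.V_frame[OF zS E] B.V_frame[OF T_in[OF z] frame_transform[OF z E]]
    by (simp add: linear_sum[OF T_lin[OF z]] hol[OF z] Wf_transform[OF z])
qed

text \<open>With \<open>L = D T z\<close>, the metric at z is the adjoint of \<open>L\<close>
  composed with the metric at \<open>T z\<close> and \<open>L\<close>, so its determinant acquires
  the square of \<open>det L\<close>.\<close>

lemma rho_transform:
  assumes z: "z \<in> Om"
  shows "A.rho z = \<bar>det (matR (D T z))\<bar> * B.rho (T z)"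
proof -
  define L where "L = D T z"
  have L: "linear L" unfolding L_def by (rule T_lin[OF z])
  have in_herm: "(transpose M *v u) \<bullet> v = Re (herm_form M u v)" for M and u v :: "complex^'m"
  proof -
    have "herm_form M u v = (\<Sum>b\<in>UNIV. (transpose M *v u) $ b * cnj (v $ b))"
      unfolding herm_form_def by (subst sum.swap) (simp add: matrix_vector_mult_def transpose_def sum_distrib_right del: transpose_matrix_vector)
    then show ?thesis by (simp add: inner_vec_def inner_complex_def del: transpose_matrix_vector)
  qed
  have adj: "adjoint L w \<bullet> v = w \<bullet> L v" for w v
    by (metis adjoint_works[OF L] inner_commute)
  have "(transpose (H z) *v u) \<bullet> v = (adjoint L (transpose (H' (T z)) *v L u)) \<bullet> v" for u v
    by (simp only: adj in_herm herm[OF z] L_def[symmetric])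
  then have "(*v) (transpose (H z)) = adjoint L \<circ> ((*v) (transpose (H' (T z))) \<circ> L)"
    by (intro ext) (metis comp_apply vector_eq_rdot)
  then have "matR ((*v) (transpose (H z))) = matR (adjoint L) ** (matR ((*v) (transpose (H' (T z)))) ** matR L)"
    using matR_compose[OF linear_cmat L] matR_compose[OF adjoint_linear[OF L] linear_compose[OF L linear_cmat]]
    by (simp only:)
  moreover have "matR (adjoint L) = transpose (matR L)"
    by (rule matR_adjoint) (metis adjoint_works[OF L] inner_commute)
  ultimately have "A.detH z = (det (matR L))\<^sup>2 * B.detH (T z)"
    by (simp add: A.detH_def B.detH_def det_mul det_transpose power2_eq_square del: transpose_matrix_vector)
  then have "A.rho z = ((det (matR L))\<^sup>2 * (det (matR L))\<^sup>2 * (B.detH (T z))\<^sup>2) powr (1/4)"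
    by (simp add: A.rho_def power2_eq_square mult_ac)
  also have "\<dots> = ((det (matR L))\<^sup>2 * (det (matR L))\<^sup>2) powr (1/4) * B.rho (T z)"
    by (simp add: B.rho_def powr_mult)
  \<comment> \<open>Because \<open>rho\<close> is a fourth root of a square, a fourth power appears;
    the case of determinant zero is split off since \<open>powr\<close> needs a positive base
    here.\<close>
  also have "((det (matR L))\<^sup>2 * (det (matR L))\<^sup>2) powr (1/4) = \<bar>det (matR L)\<bar>"
  proof -
    have "((det (matR L))\<^sup>2 * (det (matR L))\<^sup>2) = \<bar>det (matR L)\<bar> ^ 4"
      by (simp add: power2_eq_square power4_eq_xxxx abs_mult[symmetric])
    also have "\<dots> powr (1/4) = \<bar>det (matR L)\<bar>"
    proof (cases "det (matR L) = 0")
      case False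
      then have "\<bar>det (matR L)\<bar> ^ 4 = \<bar>det (matR L)\<bar> powr 4"
        using powr_realpow[of "\<bar>det (matR L)\<bar>" 4] by simp
      then have "(\<bar>det (matR L)\<bar> ^ 4) powr (1/4) = \<bar>det (matR L)\<bar> powr (4 * (1/4))"
        by (simp only: powr_powr)
      then show ?thesis by simp
    qed simp
    finally show ?thesis .
  qed
  finally show ?thesis by (simp add: L_def)
qed

lemma density_transform:
  assumes z: "z \<in> Om"
  shows "\<bar>det (matR (D T z))\<bar> *\<^sub>R (B.rho (T z) *\<^sub>R B.V (T z)) = D T z (A.rho z *\<^sub>R A.V z)"
  by (simp add: rho_transform[OF z] V_transform[OF z] linear_cmul[OF T_lin[OF z]])

end


section \<open>Harmonic maps from compact Kaehler manifolds\<close>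

context smooth_manifold
begin

lemma inj_on_coords: "c \<in> A \<Longrightarrow> inj_on (coords c) (chart_dom c)"
  using homeomorphic_imp_injective_map[OF chart_homeo] openin_subset[OF chart_dom_open]
  by (simp add: Int_absorb1)

lemma param_coords: "c \<in> A \<Longrightarrow> q \<in> chart_dom c \<Longrightarrow> param c (coords c q) = q"
  by (rule inv_into_f_f[OF inj_on_coords])

lemma open_chart_image:
  assumes "c \<in> A" "openin X V" "V \<subseteq> chart_dom c" shows "open (coords c ` V)"
proof -
  have "open_map (subtopology X (chart_dom c)) (top_of_set (coords c ` chart_dom c)) (coords c)"
    by (rule homeomorphic_imp_open_map[OF chart_homeo[OF assms(1)]])
  moreover have "openin (subtopology X (chart_dom c)) V"
    using assms by (simp add: openin_open_subtopology chart_dom_open)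
  ultimately have "openin (top_of_set (coords c ` chart_dom c)) (coords c ` V)"
    unfolding open_map_def by blast
  then show ?thesis using chart_image_open[OF assms(1)] openin_open_eq by blast
qed

lemma open_overlap: "c \<in> A \<Longrightarrow> c' \<in> A \<Longrightarrow> open (overlap c c')"
  unfolding overlap_def by (rule open_chart_image) (auto intro: chart_dom_open)

end

locale harmonic_setting =
  M: kaehler_manifold M A h + N: riemannian_manifold N B g
  for M :: "'a topology" and A :: "('a, complex^'m) chart set"
    and h :: "('a, complex^'m) chart \<Rightarrow> complex^'m \<Rightarrow> complex^'m^'m"
    and N :: "'b topology" and B :: "('b, real^'n) chart set"
    and g :: "('b, real^'n) chart \<Rightarrow> (real^'n) local_metric" +
  fixes f :: "'a \<Rightarrow> 'b"
  assumes compact: "compact_space M"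
    and hsc_pos: "positive_holomorphic_sectional_curvature A h"
    and nonpos: "nonpos_complex_sectional_curvature B g"
    and harmonic: "harmonic_map M A (real_metric h) N B g f"
begin

text \<open>The charts of \<open>M\<close> are cut down to preimages of charts of \<open>N\<close>, so they are indexed by pairs.\<close>
definition U :: "('a, complex^'m) chart \<times> ('b, real^'n) chart \<Rightarrow> 'a set" where
  "U i = chart_dom (fst i) \<inter> f -` chart_dom (snd i)"

definition X :: "('a, complex^'m) chart \<times> ('b, real^'n) chart \<Rightarrow> 'a \<Rightarrow> complex^'m" where
  "X i = coords (fst i)"

abbreviation S :: "('a, complex^'m) chart \<times> ('b, real^'n) chart \<Rightarrow> (complex^'m) set" where
  "S i \<equiv> rep_dom (fst i) (snd i) f"

abbreviation F :: "('a, complex^'m) chart \<times> ('b, real^'n) chart \<Rightarrow> complex^'m \<Rightarrow> real^'n" where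
  "F i \<equiv> local_rep (fst i) (snd i) f"

abbreviation Y :: "('a, complex^'m) chart \<times> ('b, real^'n) chart \<Rightarrow> (real^'n) set" where
  "Y i \<equiv> coords (snd i) ` chart_dom (snd i)"

lemma S_eq: "S i = X i ` U i"
  by (simp add: rep_dom_def X_def U_def)

lemma f_cont: "continuous_map M N f"
  using harmonic by (simp add: harmonic_map_def smooth_map_def)

lemma openin_U: "i \<in> A \<times> B \<Longrightarrow> openin M (U i)"
proof -
  assume i: "i \<in> A \<times> B"
  have "openin M {q \<in> topspace M. f q \<in> chart_dom (snd i)}"
    by (rule openin_continuous_map_preimage[OF f_cont N.chart_dom_open]) (use i in auto)
  then have "openin M (chart_dom (fst i) \<inter> {q \<in> topspace M. f q \<in> chart_dom (snd i)})"
    using M.chart_dom_open i by (intro openin_Int) auto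
  moreover have "chart_dom (fst i) \<subseteq> topspace M" using openin_subset[OF M.chart_dom_open[of "fst i"]] i by auto
  then have "chart_dom (fst i) \<inter> {q \<in> topspace M. f q \<in> chart_dom (snd i)} = U i"
    by (auto simp: U_def)
  ultimately show ?thesis by simp
qed

lemma open_S: "i \<in> A \<times> B \<Longrightarrow> open (S i)"
  unfolding S_eq X_def by (rule M.open_chart_image[OF _ openin_U]) (auto simp: U_def)

lemma S_sub: "S i \<subseteq> coords (fst i) ` chart_dom (fst i)"
  by (auto simp: rep_dom_def)

lemma inv_X: "i \<in> A \<times> B \<Longrightarrow> y \<in> S i \<Longrightarrow> inv_into (U i) (X i) y = param (fst i) y"
proof -
  assume i: "i \<in> A \<times> B" and "y \<in> S i"
  then obtain q where q: "q \<in> U i" "y = X i q" unfolding S_eq by blast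
  have "inj_on (X i) (U i)"
    unfolding X_def by (rule inj_on_subset[OF M.inj_on_coords]) (use i in \<open>auto simp: U_def\<close>)
  then have "inv_into (U i) (X i) y = q" using q by (simp add: inv_into_f_f)
  moreover have "param (fst i) y = q" using q i M.param_coords[of "fst i" q] by (auto simp: X_def U_def)
  ultimately show ?thesis by simp
qed

lemma kaehler_map: assumes i: "i \<in> A \<times> B" shows "kaehler_map (Y i) (g (snd i)) (S i) (F i) (h (fst i))"
proof
  have c: "fst i \<in> A" and d: "snd i \<in> B" using i by auto
  show "open (Y i)" by (rule N.chart_image_open[OF d])
  show "bilinear (g (snd i) y)" if "y \<in> Y i" for y by (rule N.metric_bilinear[OF d that])
  show "g (snd i) y u v = g (snd i) y v u" if "y \<in> Y i" for y u v by (rule N.metric_sym[OF d that])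
  show "0 < g (snd i) y u u" if "y \<in> Y i" "u \<noteq> 0" for y u by (rule N.metric_pos[OF d that])
  show "smooth_on (Y i) (\<lambda>y. g (snd i) y u v)" for u v by (rule N.metric_smooth[OF d])
  show oS: "open (S i)" by (rule open_S[OF i])
  show "smooth_on (S i) (F i)"
    using harmonic c d by (auto simp: harmonic_map_def smooth_map_def)
  show "F i x \<in> Y i" if "x \<in> S i" for x
    using that M.param_coords[OF c] by (auto simp: rep_dom_def local_rep_def)
  have sub: "z \<in> coords (fst i) ` chart_dom (fst i)" if "z \<in> S i" for z using that S_sub by blast
  show "h (fst i) z $ b $ a = cnj (h (fst i) z $ a $ b)" if "z \<in> S i" for z a b
    by (rule M.herm_cnj[OF c sub[OF that]])
  show "0 < Re (herm_form (h (fst i) z) u u)" if "z \<in> S i" "u \<noteq> 0" for z u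
    by (rule M.herm_pos[OF c sub[OF that(1)] that(2)])
  show "smooth_on (S i) (h (fst i))"
    by (rule smooth_on_subset[OF M.herm_smooth[OF c] M.chart_image_open[OF c] oS S_sub])
  have "fundamental_form h (fst i) = (\<lambda>z u v. Re (herm_form (h (fst i) z) (\<i> *s u) v))"
    by (simp add: fun_eq_iff fundamental_form_def real_metric_def)
  then show "ext_deriv2 (\<lambda>z u v. Re (herm_form (h (fst i) z) (\<i> *s u) v)) z u v w = 0" if "z \<in> S i" for z u v w
    using M.kaehler_closed[OF c sub[OF that], of u v w] by simp
qed

lemma chart_family: "chart_family M (A \<times> B) U X"
proof
  show "Hausdorff_space M" by (rule M.Hausdorff)
  show "compact_space M" by (rule compact)
  fix i assume i: "i \<in> A \<times> B"
  then have c: "fst i \<in> A" by auto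
  show "openin M (U i)" by (rule openin_U[OF i])
  show "open (X i ` U i)" using open_S[OF i] by (simp add: S_eq)
  have sub: "U i \<subseteq> chart_dom (fst i)" by (auto simp: U_def)
  have "homeomorphic_map (subtopology (subtopology M (chart_dom (fst i))) (U i))
      (subtopology (top_of_set (coords (fst i) ` chart_dom (fst i))) (coords (fst i) ` U i)) (coords (fst i))"
  proof (rule homeomorphic_map_subtopologies[OF M.chart_homeo[OF c]])
    have "topspace (subtopology M (chart_dom (fst i))) = chart_dom (fst i)"
      using openin_subset[OF M.chart_dom_open[OF c]] by auto
    then show "coords (fst i) ` (topspace (subtopology M (chart_dom (fst i))) \<inter> U i)
      = topspace (top_of_set (coords (fst i) ` chart_dom (fst i))) \<inter> coords (fst i) ` U i"
      using sub by (auto simp: Int_absorb1)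
  qed
  then show "homeomorphic_map (subtopology M (U i)) (top_of_set (X i ` U i)) (X i)"
    using sub by (simp add: subtopology_subtopology Int_absorb1 image_mono X_def)
  fix j assume j: "j \<in> A \<times> B"
  then have c': "fst j \<in> A" by auto
  have os: "X i ` (U i \<inter> U j) \<subseteq> overlap (fst i) (fst j)"
    by (auto simp: overlap_def X_def U_def)
  have op: "open (X i ` (U i \<inter> U j))"
    unfolding X_def by (rule M.open_chart_image[OF c]) (use openin_U[OF i] openin_U[OF j] in \<open>auto simp: U_def\<close>)
  show "smooth_on (X i ` (U i \<inter> U j)) (X j \<circ> inv_into (U i) (X i))"
  proof (rule smooth_on_cong[OF op])
    show "smooth_on (X i ` (U i \<inter> U j)) (transition (fst i) (fst j))"
      by (rule smooth_on_subset[OF M.transition_smooth[OF c c'] M.open_overlap[OF c c'] op os])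
    show "transition (fst i) (fst j) y = (X j \<circ> inv_into (U i) (X i)) y" if "y \<in> X i ` (U i \<inter> U j)" for y
    proof -
      have "y \<in> S i" using that by (auto simp: S_eq)
      then show ?thesis by (simp add: inv_X[OF i] transition_def) (simp add: X_def)
    qed
  qed
next
  show "topspace M \<subseteq> (\<Union>i\<in>A \<times> B. U i)"
  proof
    fix q assume q: "q \<in> topspace M"
    obtain c where c: "c \<in> A" "q \<in> chart_dom c" using M.charts_cover q by blast
    have "f q \<in> topspace N" using f_cont q by (simp add: continuous_map_def Pi_iff)
    then obtain d where d: "d \<in> B" "f q \<in> chart_dom d" using N.charts_cover by blast
    show "q \<in> (\<Union>i\<in>A \<times> B. U i)"
      by (rule UN_I[of "(c, d)"]) (use c d in \<open>auto simp: U_def\<close>)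
  qed
qed

sublocale CF: chart_family M "A \<times> B" U X
  by (rule chart_family)

lemma CF_dom: "CF.dom i = S i"
  by (simp add: CF.dom_def S_eq)

lemma good_facts:
  assumes "CF.good s"
  shows "fst s \<in> A \<times> B" "0 < snd (snd s)" "cball (fst (snd s)) (snd (snd s)) \<subseteq> S (fst s)"
  using assms unfolding CF.good_def split_beta CF_dom by blast+

lemma p_param: "i \<in> A \<times> B \<Longrightarrow> y \<in> S i \<Longrightarrow> CF.p i y = param (fst i) y"
  by (simp add: CF.p_def inv_X)

text \<open>Surjectivity of the differential comes from the inverse transition
  \<open>CF.T j i\<close>. The pulled back metrics agree because the two expressions of f differ by
  a target transition, under which g is invariant.\<close>

lemma transition:
  assumes i: "i \<in> A \<times> B" and j: "j \<in> A \<times> B"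
  shows "kaehler_transition (Y i) (g (snd i)) (S i) (F i) (h (fst i))
    (Y j) (g (snd j)) (S j) (F j) (h (fst j)) (CF.T i j) (CF.ov i j)"
proof -
  interpret a: kaehler_map "Y i" "g (snd i)" "S i" "F i" "h (fst i)" by (rule kaehler_map[OF i])
  interpret b: kaehler_map "Y j" "g (snd j)" "S j" "F j" "h (fst j)" by (rule kaehler_map[OF j])
  have c: "fst i \<in> A" "fst j \<in> A" and d: "snd i \<in> B" "snd j \<in> B" using i j by auto
  let ?T = "CF.T i j" and ?O = "CF.ov i j"
  have oO: "open ?O" by (rule CF.open_ov[OF i j])
  have OS: "?O \<subseteq> S i" using CF.ov_sub[of i j] by (simp add: CF_dom)
  have Ts: "smooth_on ?O ?T" by (rule CF.T_smooth[OF i j])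
  have Td: "?T differentiable at z" if "z \<in> ?O" for z by (rule smooth_onD(1)[OF Ts oO that])
  have TS: "?T z \<in> S j" if "z \<in> ?O" for z
    using CF.T_in[OF i that] CF.ov_sub[of j i] by (auto simp: CF_dom)
  have Oov: "?O \<subseteq> overlap (fst i) (fst j)"
    by (auto simp: CF.ov_def overlap_def X_def U_def)
  have Teq: "?T z = transition (fst i) (fst j) z" if "z \<in> ?O" for z
  proof -
    have "z \<in> S i" using that OS by blast
    then show ?thesis by (simp add: CF.T_def p_param[OF i] transition_def X_def)
  qed
  have DT: "D ?T z = D (transition (fst i) (fst j)) z" if "z \<in> ?O" for z
    by (rule D_cong[OF oO that]) (rule Teq)
  show ?thesis
  proof unfold_locales
    show "open ?O" "?O \<subseteq> S i" "smooth_on ?O ?T" by fact+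
    show "?T z \<in> S j" if "z \<in> ?O" for z by (rule TS[OF that])
    fix z assume z: "z \<in> ?O"
    have zov: "z \<in> overlap (fst i) (fst j)" using z Oov by blast
    show "D ?T z (a *s v) = a *s D ?T z v" for a v
      using M.transition_holomorphic[OF c] zov unfolding holomorphic_map_on_def DT[OF z] by blast
    show "herm_form (h (fst i) z) u v = herm_form (h (fst j) (?T z)) (D ?T z u) (D ?T z v)" for u v
      using M.herm_transform[OF c zov] unfolding DT[OF z] Teq[OF z] .
    show "surj (D ?T z)"
    proof -
      have y: "?T z \<in> CF.ov j i" by (rule CF.T_in[OF i z])
      have T'd: "CF.T j i differentiable at (?T z)"
        by (rule smooth_onD(1)[OF CF.T_smooth[OF j i] CF.open_ov[OF j i] y])
      have TTz: "CF.T j i (?T z) = z" by (rule CF.T_T[OF i j z])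
      have "((\<lambda>y. ?T (CF.T j i y)) has_derivative (\<lambda>v. D ?T (CF.T j i (?T z)) (D (CF.T j i) (?T z) v))) (at (?T z))"
        by (rule has_derivative_compose[OF has_derivative_D[OF T'd] has_derivative_D]) (simp add: TTz Td[OF z])
      moreover have "D (\<lambda>y. ?T (CF.T j i y)) (?T z) = D (\<lambda>y. y) (?T z)"
        by (rule D_cong[OF CF.open_ov[OF j i] y]) (rule CF.T_T[OF j i])
      ultimately have "D ?T z (D (CF.T j i) (?T z) v) = v" for v
        by (simp add: D_eqI TTz fun_eq_iff)
      then show ?thesis by (metis surjI)
    qed
    show "g (snd i) (F i z) (D (F i) z u) (D (F i) z v) =
      g (snd j) (F j (?T z)) (D (F j) (?T z) (D ?T z u)) (D (F j) (?T z) (D ?T z v))" for u v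
    proof -
      have q: "param (fst i) y \<in> U i" "param (fst i) y \<in> U j" if "y \<in> ?O" for y
        using that by (auto simp: CF.ov_iff[OF i] CF_dom p_param[OF i] U_def rep_dom_def M.param_coords[OF c(1)])
      have Fov: "F i y \<in> overlap (snd i) (snd j)" if "y \<in> ?O" for y
        using q[OF that] by (auto simp: overlap_def local_rep_def U_def)
      have FT: "F j (?T y) = transition (snd i) (snd j) (F i y)" if "y \<in> ?O" for y
      proof -
        have "param (fst j) (?T y) = param (fst i) y"
          using q[OF that] M.param_coords[OF c(2)] by (simp add: Teq[OF that] transition_def U_def)
        then show ?thesis
          using q[OF that] by (simp add: local_rep_def transition_def U_def N.param_coords[OF d(1)])
      qed
      have zS: "z \<in> S i" using z OS by blast
      have td: "transition (snd i) (snd j) differentiable at (F i z)"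
        by (rule smooth_onD(1)[OF N.transition_smooth[OF d] N.open_overlap[OF d] Fov[OF z]])
      have Fd: "F i differentiable at z" "F j differentiable at (?T z)"
        using smooth_onD(1)[OF a.F_smooth a.open_S zS] smooth_onD(1)[OF b.F_smooth b.open_S TS[OF z]] by auto
      have "D (\<lambda>y. F j (?T y)) z = D (\<lambda>y. transition (snd i) (snd j) (F i y)) z"
        by (rule D_cong[OF oO z]) (rule FT)
      also have "D (\<lambda>y. F j (?T y)) z = (\<lambda>v. D (F j) (?T z) (D ?T z v))"
        by (rule D_eqI) (rule has_derivative_compose[OF has_derivative_D[OF Td[OF z]] has_derivative_D[OF Fd(2)]])
      also have "D (\<lambda>y. transition (snd i) (snd j) (F i y)) z = (\<lambda>v. D (transition (snd i) (snd j)) (F i z) (D (F i) z v))"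
        by (rule D_eqI) (rule has_derivative_compose[OF has_derivative_D[OF Fd(1)] has_derivative_D[OF td]])
      finally have "D (F j) (?T z) (D ?T z v) = D (transition (snd i) (snd j)) (F i z) (D (F i) z v)" for v
        by (simp add: fun_eq_iff)
      then show ?thesis using N.metric_transform[OF d Fov[OF z]] by (simp add: FT[OF z])
    qed
  qed
qed

lemma curv_nonpos: "i \<in> A \<times> B \<Longrightarrow> z \<in> S i \<Longrightarrow> Re (complex_riemann (g (snd i)) (F i z) P (vec_cnj Q) Q (vec_cnj P)) \<le> 0"
proof -
  assume i: "i \<in> A \<times> B" and z: "z \<in> S i"
  interpret a: kaehler_map "Y i" "g (snd i)" "S i" "F i" "h (fst i)" by (rule kaehler_map[OF i])
  show ?thesis using nonpos i a.F_in[OF z] unfolding nonpos_complex_sectional_curvature_def by auto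
qed

lemma harmonic_eq: "i \<in> A \<times> B \<Longrightarrow> z \<in> S i \<Longrightarrow>
    connection_adjoint (\<lambda>z u v. Re (herm_form (h (fst i) z) u v)) (g (snd i)) (F i) (\<lambda>y. D (F i) y) z = 0"
proof -
  assume i: "i \<in> A \<times> B" and z: "z \<in> S i"
  have "real_metric h (fst i) = (\<lambda>z u v. Re (herm_form (h (fst i) z) u v))"
    by (simp add: fun_eq_iff real_metric_def)
  then show ?thesis using harmonic i z unfolding harmonic_map_def by auto
qed

definition plh :: "('a, complex^'m) chart \<times> ('b, real^'n) chart \<Rightarrow> complex^'m \<Rightarrow> bool" where
  "plh i z \<longleftrightarrow> (\<forall>v w. target_map.nab (g (snd i)) (F i) (dirzb v) (target_map.FX (F i) (dirz w)) z = 0)"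

text \<open>The divergence theorem is applied to \<open>rho\<close> times \<open>V\<close>. The
  chart around q cannot be prescribed: it is one in which a partition function is positive at
  q.\<close>

lemma locally_pluriharmonic:
  assumes q: "q \<in> topspace M"
  shows "\<exists>i\<in>A \<times> B. q \<in> U i \<and> (\<exists>W. open W \<and> X i q \<in> W \<and> W \<subseteq> S i \<and> (\<forall>z\<in>W. plh i z))"
proof -
  obtain C where C: "finite C" "\<forall>s\<in>C. CF.good s" "topspace M \<subseteq> (\<Union>(i, c, r)\<in>C. {q \<in> U i. X i q \<in> ball c r})"
    using CF.finite_ball_cover by blast
  interpret CC: chart_cover M "A \<times> B" U X C
    by unfold_locales (use C in auto)
  define Z where "Z i z = kaehler_domain.rho (h (fst i)) z *\<^sub>R kaehler_map.V (g (snd i)) (F i) (h (fst i)) z" for i z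
  have div: "0 \<le> divergence (Z i) z" "divergence (Z i) z = 0 \<Longrightarrow> plh i z" if i: "i \<in> A \<times> B" and z: "z \<in> S i" for i z
  proof -
    interpret a: kaehler_map "Y i" "g (snd i)" "S i" "F i" "h (fst i)" by (rule kaehler_map[OF i])
    obtain E where E: "frame_at (h (fst i) z) E" using a.frame_ex[OF z] by blast
    have d: "divergence (Z i) z = 2 * a.rho z * Re (\<Sum>a\<in>UNIV. \<Sum>b\<in>UNIV. Dc (dirz (E a)) (a.Wf (E a) (E b) (E b)) z)"
      using a.divergence_rho_V[OF z E] by (simp add: Z_def[abs_def])
    note bo = a.bochner_nonneg[OF z E harmonic_eq[OF i z] curv_nonpos[OF i z]]
    show "0 \<le> divergence (Z i) z" unfolding d using bo(1) a.rho_pos[OF z] by simp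
    show "plh i z" if "divergence (Z i) z = 0"
      unfolding plh_def using that d a.rho_pos[OF z] bo(2) by auto
  qed
  have "\<exists>i\<in>A \<times> B. q \<in> U i \<and> (\<exists>W. open W \<and> X i q \<in> W \<and> W \<subseteq> CF.dom i \<and> (\<forall>y\<in>W. divergence (Z i) y = 0))"
  proof (rule CC.divergence_theorem[OF _ _ _ q])
    show "Ck_on (Suc 0) (CF.dom i) (Z i)" if i: "i \<in> A \<times> B" for i
    proof -
      interpret a: kaehler_map "Y i" "g (snd i)" "S i" "F i" "h (fst i)" by (rule kaehler_map[OF i])
      have "smooth_on (S i) (Z i)" unfolding Z_def[abs_def]
        by (rule smooth_on_scaleR[OF a.open_S a.smooth_rho a.V_smooth])
      then show ?thesis by (simp only: CF_dom smooth_on_def)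
    qed
    show "0 \<le> divergence (Z i) y" if "i \<in> A \<times> B" "y \<in> CF.dom i" for i y
      using div(1) that by (simp add: CF_dom)
    show "\<bar>det (matR (D (CF.T i j) y))\<bar> *\<^sub>R Z j (CF.T i j y) = D (CF.T i j) y (Z i y)"
      if "i \<in> A \<times> B" "j \<in> A \<times> B" "y \<in> CF.ov i j" for i j y
      unfolding Z_def by (rule kaehler_transition.density_transform[OF transition[OF that(1,2)] that(3)])
  qed
  then obtain i W where i: "i \<in> A \<times> B" "q \<in> U i"
    and W: "open W" "X i q \<in> W" "W \<subseteq> S i" "\<And>y. y \<in> W \<Longrightarrow> divergence (Z i) y = 0"
    unfolding CF_dom by blast
  have "plh i z" if "z \<in> W" for z
    by (rule div(2)[OF i(1) subsetD[OF W(3) that] W(4)[OF that]])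
  then show ?thesis using i W(1-3) by blast
qed

section \<open>The maximum of the quotient of psi by h\<close>

abbreviation ps :: "('a, complex^'m) chart \<times> ('b, real^'n) chart \<Rightarrow> complex^'m \<Rightarrow> complex^'m \<Rightarrow> real" where
  "ps i z u \<equiv> Re (target_map.psi (g (snd i)) (F i) (dirz u) (dirz u) z)"

abbreviation hs :: "('a, complex^'m) chart \<times> ('b, real^'n) chart \<Rightarrow> complex^'m \<Rightarrow> complex^'m \<Rightarrow> real" where
  "hs i z u \<equiv> Re (herm_form (h (fst i) z) u u)"

definition ratio :: "('a, complex^'m) chart \<times> ('b, real^'n) chart \<Rightarrow> complex^'m \<Rightarrow> complex^'m \<Rightarrow> real" where
  "ratio i z u = ps i z u / hs i z u"

lemma ratio_transform:
  assumes "i \<in> A \<times> B" "j \<in> A \<times> B" "z \<in> CF.ov i j"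
  shows "ratio i z u = ratio j (CF.T i j z) (D (CF.T i j) z u)"
proof -
  interpret t: kaehler_transition "Y i" "g (snd i)" "S i" "F i" "h (fst i)"
    "Y j" "g (snd j)" "S j" "F j" "h (fst j)" "CF.T i j" "CF.ov i j" by (rule transition[OF assms(1,2)])
  show ?thesis unfolding ratio_def t.psi_transform[OF assms(3)] t.herm[OF assms(3)] ..
qed

lemma ratio_scale:
  assumes i: "i \<in> A \<times> B" and z: "z \<in> S i" and r: "r \<noteq> 0"
  shows "ratio i z (r *\<^sub>R u) = ratio i z u"
proof -
  interpret a: kaehler_map "Y i" "g (snd i)" "S i" "F i" "h (fst i)" by (rule kaehler_map[OF i])
  have "a.psi (dirz (r *\<^sub>R u)) (dirz (r *\<^sub>R u)) z = complex_of_real (r\<^sup>2) * a.psi (dirz u) (dirz u) z"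
    unfolding a.psi_expand[OF z, of "r *\<^sub>R u"] a.psi_expand[OF z, of u]
    by (simp add: sum_distrib_left power2_eq_square scaleR_conv_of_real[where 'a=complex] mult_ac)
  moreover have "herm_form (h (fst i) z) (r *\<^sub>R u) (r *\<^sub>R u) = complex_of_real (r\<^sup>2) * herm_form (h (fst i) z) u u"
    by (simp add: herm_form_linear power2_eq_square scaleR_conv_of_real[where 'a=complex])
  ultimately show ?thesis using r by (simp add: ratio_def)
qed

lemma ratio_continuous:
  assumes i: "i \<in> A \<times> B" and C: "C \<subseteq> S i"
  shows "continuous_on (C \<times> sphere 0 1) (\<lambda>(z, u). ratio i z u)"
proof -
  interpret a: kaehler_map "Y i" "g (snd i)" "S i" "F i" "h (fst i)" by (rule kaehler_map[OF i])
  have cc: "continuous_on (C \<times> sphere 0 1) (\<lambda>p. \<phi> (fst p))" if "smooth_on (S i) \<phi>" for \<phi> :: "complex^'m \<Rightarrow> complex"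
    by (rule continuous_on_compose2[OF smooth_onD(3)[OF that a.open_S]]) (use C in \<open>auto intro: continuous_intros\<close>)
  have 1: "continuous_on (C \<times> sphere 0 1) (\<lambda>p. Re (\<Sum>i\<in>UNIV. \<Sum>j\<in>UNIV. (snd p $ i * cnj (snd p $ j)) * a.psi (dirz (axis i 1)) (dirz (axis j 1)) (fst p)))"
    by (intro continuous_intros cc a.smooth_psi)
  have 2: "continuous_on (C \<times> sphere 0 1) (\<lambda>p. Re (herm_form (h (fst i) (fst p)) (snd p) (snd p)))"
    unfolding herm_form_def by (intro continuous_intros cc a.H_nth_smooth)
  have nz: "Re (herm_form (h (fst i) (fst p)) (snd p) (snd p)) \<noteq> 0" if "p \<in> C \<times> sphere 0 1" for p
  proof -
    have "fst p \<in> S i" "snd p \<noteq> 0" using that C by auto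
    then show ?thesis using a.H_pos by fastforce
  qed
  show ?thesis
  proof (rule continuous_on_eq[OF continuous_on_divide[OF 1 2]])
    show "\<forall>p\<in>C \<times> sphere 0 1. Re (herm_form (h (fst i) (fst p)) (snd p) (snd p)) \<noteq> 0" using nz by blast
    show "Re (\<Sum>i\<in>UNIV. \<Sum>j\<in>UNIV. (snd p $ i * cnj (snd p $ j)) * a.psi (dirz (axis i 1)) (dirz (axis j 1)) (fst p))
      / Re (herm_form (h (fst i) (fst p)) (snd p) (snd p)) = (case p of (z, u) \<Rightarrow> ratio i z u)"
      if "p \<in> C \<times> sphere 0 1" for p
    proof -
      have "fst p \<in> S i" using that C by auto
      then show ?thesis by (simp add: split_beta ratio_def a.psi_expand[of "fst p" "snd p" "snd p"])
    qed
  qed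
qed

lemma DT_nonzero:
  assumes "i \<in> A \<times> B" "j \<in> A \<times> B" "z \<in> CF.ov i j" "u \<noteq> 0"
  shows "D (CF.T i j) z u \<noteq> 0"
proof
  interpret t: kaehler_transition "Y i" "g (snd i)" "S i" "F i" "h (fst i)"
    "Y j" "g (snd j)" "S j" "F j" "h (fst j)" "CF.T i j" "CF.ov i j" by (rule transition[OF assms(1,2)])
  assume 0: "D (CF.T i j) z u = 0"
  have "herm_form (h (fst i) z) u u = 0" unfolding t.herm[OF assms(3)] 0 by (simp add: herm_form_def)
  then show False using t.A.H_pos[of z u] assms t.Om_sub by auto
qed

text \<open>The quotient is homogeneous of degree zero and independent of the chart, so finitely
  many compact sets, closed coordinate balls times the unit sphere, carry all its values.\<close>

lemma ratio_max:
  assumes ne: "topspace M \<noteq> {}"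
  shows "\<exists>i\<in>A \<times> B. \<exists>z\<in>S i. \<exists>u. u \<noteq> 0 \<and> (\<forall>j\<in>A \<times> B. \<forall>y\<in>S j. \<forall>v. v \<noteq> 0 \<longrightarrow> ratio j y v \<le> ratio i z u)"
proof -
  obtain C where C: "finite C" "\<forall>s\<in>C. CF.good s" "topspace M \<subseteq> (\<Union>(i, c, r)\<in>C. {q \<in> U i. X i q \<in> ball c r})"
    using CF.finite_ball_cover by blast
  have Cne: "C \<noteq> {}" using C(3) ne by auto
  have ex: "\<exists>p\<in>cball (fst (snd s)) (snd (snd s)) \<times> sphere (0 :: complex^'m) 1.
      \<forall>p'\<in>cball (fst (snd s)) (snd (snd s)) \<times> sphere 0 1. (case p' of (z, u) \<Rightarrow> ratio (fst s) z u) \<le> (case p of (z, u) \<Rightarrow> ratio (fst s) z u)"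
    if "s \<in> C" for s
  proof (rule continuous_attains_sup)
    note s = good_facts[OF bspec[OF C(2) that]]
    show "compact (cball (fst (snd s)) (snd (snd s)) \<times> sphere (0 :: complex^'m) 1)" by (intro compact_Times compact_cball compact_sphere)
    show "cball (fst (snd s)) (snd (snd s)) \<times> sphere (0 :: complex^'m) 1 \<noteq> {}" using s(2) by auto
    show "continuous_on (cball (fst (snd s)) (snd (snd s)) \<times> sphere 0 1) (\<lambda>(z, u). ratio (fst s) z u)"
      by (rule ratio_continuous[OF s(1,3)])
  qed
  define BS where "BS s = cball (fst (snd s)) (snd (snd s)) \<times> sphere (0 :: complex^'m) 1"
    for s :: "(('a, complex^'m) chart \<times> ('b, real^'n) chart) \<times> (complex^'m) \<times> real"
  have "\<forall>s\<in>C. \<exists>p. p \<in> BS s \<and> (\<forall>p'\<in>BS s. (case p' of (z, u) \<Rightarrow> ratio (fst s) z u) \<le> (case p of (z, u) \<Rightarrow> ratio (fst s) z u))"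
    using ex unfolding BS_def by blast
  from bchoice[OF this] obtain P where P0: "\<And>s. s \<in> C \<Longrightarrow> P s \<in> BS s \<and> (\<forall>p'\<in>BS s. (case p' of (z, u) \<Rightarrow> ratio (fst s) z u) \<le> (case P s of (z, u) \<Rightarrow> ratio (fst s) z u))"
    by blast
  have P: "P s \<in> cball (fst (snd s)) (snd (snd s)) \<times> sphere (0 :: complex^'m) 1" if "s \<in> C" for s
    using P0[OF that] by (simp add: BS_def)
  have P2: "ratio (fst s) z u \<le> ratio (fst s) (fst (P s)) (snd (P s))"
    if "s \<in> C" "z \<in> cball (fst (snd s)) (snd (snd s))" "norm u = 1" for s z u
  proof -
    have "(z, u) \<in> BS s" using that by (simp add: BS_def)
    then have "(case (z, u) of (z, u) \<Rightarrow> ratio (fst s) z u) \<le> (case P s of (z, u) \<Rightarrow> ratio (fst s) z u)"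
      using P0[OF that(1)] by blast
    then show ?thesis by (simp add: split_beta)
  qed
  define val where "val s = ratio (fst s) (fst (P s)) (snd (P s))" for s
  have "Max (val ` C) \<in> val ` C" using C(1) Cne by (intro Max_in) auto
  then obtain s where s: "s \<in> C" "val s = Max (val ` C)" by auto
  have smax: "val t \<le> val s" if "t \<in> C" for t using C(1) that by (simp add: s(2))
  have good: "fst t \<in> A \<times> B" "cball (fst (snd t)) (snd (snd t)) \<subseteq> S (fst t)" if "t \<in> C" for t
    by (rule good_facts[OF bspec[OF C(2) that]])+
  have "ratio j y v \<le> val s" if j: "j \<in> A \<times> B" and y: "y \<in> S j" and v: "v \<noteq> 0" for j y v
  proof -
    have yd: "y \<in> CF.dom j" using y by (simp add: CF_dom)
    have "CF.p j y \<in> topspace M" using CF.p_in[OF yd] CF.U_sub[OF j] by blast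
    then obtain t where t: "t \<in> C" "CF.p j y \<in> U (fst t)" "X (fst t) (CF.p j y) \<in> ball (fst (snd t)) (snd (snd t))"
      using C(3) by fastforce
    note i = good(1)[OF t(1)]
    have yov: "y \<in> CF.ov j (fst t)" using t(2) yd by (simp add: CF.ov_iff[OF j])
    define v' where "v' = D (CF.T j (fst t)) y v"
    have v': "v' \<noteq> 0" unfolding v'_def by (rule DT_nonzero[OF j i yov v])
    have Ty: "CF.T j (fst t) y \<in> cball (fst (snd t)) (snd (snd t))"
      using t(3) by (simp add: CF.T_def)
    have "ratio j y v = ratio (fst t) (CF.T j (fst t) y) v'"
      unfolding v'_def by (rule ratio_transform[OF j i yov])
    also have "\<dots> = ratio (fst t) (CF.T j (fst t) y) ((1 / norm v') *\<^sub>R v')"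
      using v' Ty good(2)[OF t(1)] by (intro ratio_scale[OF i, symmetric]) auto
    also have "\<dots> \<le> val t" unfolding val_def by (rule P2[OF t(1) Ty]) (use v' in simp)
    also have "\<dots> \<le> val s" by (rule smax[OF t(1)])
    finally show ?thesis .
  qed
  moreover have "fst (P s) \<in> S (fst s)" using P[OF s(1)] good(2)[OF s(1)] by auto
  moreover have "snd (P s) \<noteq> 0" using P[OF s(1)] by (auto simp: mem_Times_iff)
  ultimately show ?thesis
    unfolding val_def
    by (intro bexI[of _ "fst s"] bexI[of _ "fst (P s)"] exI[of _ "snd (P s)"] conjI ballI allI impI good(1)[OF s(1)])
qed

text \<open>If the maximum were positive, \<open>no_positive_maximum\<close> would be violated; so
  psi is non-positive on the diagonal, and \<open>psi_zero_imp\<close> applies in every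
  chart.\<close>

lemma derivative_zero:
  assumes i: "i \<in> A \<times> B" and z: "z \<in> S i"
  shows "D (F i) z v = 0"
proof -
  have "CF.p i z \<in> topspace M" using CF.p_in[of z i] CF.U_sub[OF i] z by (auto simp: CF_dom)
  then have ne: "topspace M \<noteq> {}" by blast
  obtain i0 z0 u0 where i0: "i0 \<in> A \<times> B" and z0: "z0 \<in> S i0" and u0: "u0 \<noteq> 0"
    and max0: "\<And>j y v. j \<in> A \<times> B \<Longrightarrow> y \<in> S j \<Longrightarrow> v \<noteq> 0 \<Longrightarrow> ratio j y v \<le> ratio i0 z0 u0"
    using ratio_max[OF ne] by blast
  define l where "l = ratio i0 z0 u0"
  have z0d: "z0 \<in> CF.dom i0" using z0 by (simp add: CF_dom)
  have "CF.p i0 z0 \<in> topspace M" using CF.p_in[OF z0d] CF.U_sub[OF i0] by blast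
  \<comment> \<open>The chart in which the maximum was found need not be one in which
    pluriharmonicity is known, so the maximal vector is carried over to the latter.\<close>
  from locally_pluriharmonic[OF this] obtain j W where j: "j \<in> A \<times> B" "CF.p i0 z0 \<in> U j"
    and W: "open W" "X j (CF.p i0 z0) \<in> W" "W \<subseteq> S j" "\<And>y. y \<in> W \<Longrightarrow> plh j y" by blast
  interpret b: kaehler_map "Y j" "g (snd j)" "S j" "F j" "h (fst j)" by (rule kaehler_map[OF j(1)])
  define y where "y = CF.T i0 j z0"
  define w where "w = D (CF.T i0 j) z0 u0"
  have ov: "z0 \<in> CF.ov i0 j" using j(2) z0d by (simp add: CF.ov_iff[OF i0])
  have w: "w \<noteq> 0" unfolding w_def by (rule DT_nonzero[OF i0 j(1) ov u0])
  have yW: "y \<in> W" using W(2) by (simp add: y_def CF.T_def)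
  have yS: "y \<in> S j" using yW W(3) by blast
  have lw: "l = ratio j y w" unfolding l_def y_def w_def by (rule ratio_transform[OF i0 j(1) ov])
  have hp: "0 < hs j y w" by (rule b.H_pos[OF yS w])
  have "\<not> 0 < l"
  proof
    assume l: "0 < l"
    show False
    proof (rule b.no_positive_maximum[OF yS w l W(1) yW W(3)])
      show "b.nab (dirzb v') (b.FX (dirz w')) y' = 0" if "y' \<in> W" for y' v' w'
        using W(4)[OF that] by (simp add: plh_def)
      show "ps j y' v' \<le> l * hs j y' v'" if y': "y' \<in> S j" for y' v'
      proof (cases "v' = 0")
        case True
        have "b.psi (dirz 0) (dirz 0) y' = 0" by (subst b.psi_expand[OF y']) simp
        then show ?thesis using True by (simp add: herm_form_def)
      next
        case False
        have "ratio j y' v' \<le> l" unfolding l_def by (rule max0[OF j(1) y' False])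
        then show ?thesis using b.H_pos[OF y' False] by (simp add: ratio_def divide_le_eq)
      qed
      show "ps j y w = l * hs j y w" using hp by (simp add: lw ratio_def)
      show "Re (complex_riemann (g (snd j)) (F j y) P (vec_cnj Q) Q (vec_cnj P)) \<le> 0" for P Q
        by (rule curv_nonpos[OF j(1) yS])
      have "y \<in> coords (fst j) ` chart_dom (fst j)" using yS S_sub by blast
      then show "0 < Re (b.hsc y w)"
        using hsc_pos j(1) w unfolding positive_holomorphic_sectional_curvature_def b.hsc_def by auto
    qed
  qed
  interpret a: kaehler_map "Y i" "g (snd i)" "S i" "F i" "h (fst i)" by (rule kaehler_map[OF i])
  show ?thesis
  proof (rule a.psi_zero_imp[OF z])
    fix u
    show "ps i z u \<le> 0"
    proof (cases "u = 0")
      case True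
      have "a.psi (dirz 0) (dirz 0) z = 0" by (subst a.psi_expand[OF z]) simp
      then show ?thesis using True by simp
    next
      case False
      have "ratio i z u \<le> 0" using max0[OF i z False] \<open>\<not> 0 < l\<close> by (simp add: l_def)
      then show ?thesis using a.H_pos[OF z False] by (simp add: ratio_def divide_le_0_iff)
    qed
  qed
qed

section \<open>From vanishing differential to constancy\<close>

lemma locally_constant:
  assumes q: "q \<in> topspace M"
  shows "\<exists>V. openin M V \<and> q \<in> V \<and> (\<forall>q'\<in>V. f q' = f q)"
proof -
  obtain i where i: "i \<in> A \<times> B" "q \<in> U i" using CF.cover q by blast
  have c: "fst i \<in> A" and d: "snd i \<in> B" using i by auto
  interpret a: kaehler_map "Y i" "g (snd i)" "S i" "F i" "h (fst i)" by (rule kaehler_map[OF i(1)])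
  have "X i q \<in> S i" using i(2) by (simp add: S_eq)
  then obtain e where e: "e > 0" "ball (X i q) e \<subseteq> S i" using a.open_S open_contains_ball by blast
  define V where "V = {q' \<in> U i. X i q' \<in> ball (X i q) e}"
  have V: "openin M V" unfolding V_def by (rule CF.openin_preimage[OF i(1) open_ball])
  have "\<exists>y. \<forall>x\<in>ball (X i q) e. F i x = y"
  proof (rule has_derivative_zero_constant[OF convex_ball])
    show "(F i has_derivative (\<lambda>h. 0)) (at x within ball (X i q) e)" if "x \<in> ball (X i q) e" for x
    proof -
      have x: "x \<in> S i" using that e(2) by blast
      have "D (F i) x = (\<lambda>h. 0)" using derivative_zero[OF i(1) x] by (simp add: fun_eq_iff)
      then show ?thesis
        using has_derivative_D[OF smooth_onD(1)[OF a.F_smooth a.open_S x]] by (simp add: has_derivative_at_withinI)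
    qed
  qed
  then obtain y where y: "\<And>x. x \<in> ball (X i q) e \<Longrightarrow> F i x = y" by blast
  have const: "f q' = f q" if "q' \<in> V" for q'
  proof -
    have "F i (X i q') = F i (X i q)" using y that e(1) by (simp add: V_def)
    then have "coords (snd i) (f q') = coords (snd i) (f q)"
      using that i(2) M.param_coords[OF c] by (simp add: local_rep_def X_def V_def U_def)
    then show ?thesis
      using N.inj_on_coords[OF d] that i(2) by (simp add: V_def U_def inj_on_def)
  qed
  have "q \<in> V" using i(2) e(1) by (simp add: V_def)
  then show ?thesis by (intro exI[of _ V] conjI ballI V const)
qed

lemma harmonic_constant: "f constant_on topspace M"
proof (cases "topspace M = {}")
  case True
  then show ?thesis by (simp add: constant_on_def)
next
  case False
  then obtain q0 where q0: "q0 \<in> topspace M" by blast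
  define V1 where "V1 = {q \<in> topspace M. f q = f q0}"
  define V2 where "V2 = {q \<in> topspace M. f q \<noteq> f q0}"
  have op: "openin M {q \<in> topspace M. R (f q)}" for R
  proof (subst openin_subopen, intro ballI)
    fix q assume "q \<in> {q \<in> topspace M. R (f q)}"
    then have q: "q \<in> topspace M" "R (f q)" by auto
    from locally_constant[OF q(1)] obtain V where V: "openin M V" "q \<in> V" "\<And>q'. q' \<in> V \<Longrightarrow> f q' = f q" by blast
    have "V \<subseteq> {q \<in> topspace M. R (f q)}" using openin_subset[OF V(1)] V(3) q(2) by auto
    then show "\<exists>V. openin M V \<and> q \<in> V \<and> V \<subseteq> {q \<in> topspace M. R (f q)}" using V(1,2) by blast
  qed
  have "openin M V1" "openin M V2" unfolding V1_def V2_def by (rule op)+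
  moreover have "topspace M \<subseteq> V1 \<union> V2" "V1 \<inter> V2 = {}" "V1 \<noteq> {}"
    using q0 by (auto simp: V1_def V2_def)
  ultimately have "V2 = {}" using M.connected unfolding connected_space_def by blast
  then show ?thesis unfolding constant_on_def V2_def by blast
qed

end

theorem corollary1p4:
  fixes M :: "'a topology"
    and A :: "('a, complex^'m) chart set"
    and h :: "('a, complex^'m) chart \<Rightarrow> complex^'m \<Rightarrow> complex^'m^'m"
    and N :: "'b topology"
    and B :: "('b, real^'n) chart set"
    and g :: "('b, real^'n) chart \<Rightarrow> (real^'n) local_metric"
  assumes "kaehler_manifold M A h"
    and "compact_space M"
    and "positive_holomorphic_sectional_curvature A h"
    and "riemannian_manifold N B g"
    and "nonpos_complex_sectional_curvature B g"
  shows "\<not> (\<exists>f. harmonic_map M A (real_metric h) N B g f \<and> \<not> f constant_on topspace M)"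
proof -
  have "f constant_on topspace M" if "harmonic_map M A (real_metric h) N B g f" for f
  proof -
    interpret harmonic_setting M A h N B g f
      by (intro harmonic_setting.intro harmonic_setting_axioms.intro assms that)
    show ?thesis by (rule harmonic_constant)
  qed
  then show ?thesis by blast
qed

end
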